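(* Let $G : R \to T$ be a morphism of operads. (1) $\mathcal F(G) : \mathcal F(R) \to \mathcal F(T)$ is an exact symmetric monoidal functor. (2) If $\mathcal V$ is symmetric monoidal closed and cocomplete, and $H : \mathcal F(R) \to \mathcal V$ is a symmetric strong monoidal functor, then the left Kan extension $\mathcal F(T) \to \mathcal V$ of $H$ along $\mathcal F(G)$ is a symmetric strong monoidal functor.
   Context: "Operad" means coloured symmetric operad (symmetric multicategory) in sets, with a set of colours; a morphism of operads consists of a function on colours and compatible functions on operations. A symmetric monoidal category $\mathcal W$ determines an operad whose colours are the objects of $\mathcal W$ and whose operations $(A_1,\dots,A_n) \to B$ are the morphisms $A_1\otimes\cdots\otimes A_n \to B$. This gives a forgetful functor from symmetric strict monoidal categories and (symmetric) strict monoidal functors to operads, and $\mathcal F$ denotes its left adjoint (so $\mathcal F(R)$ is the free symmetric strict monoidal category on the operad $R$; strict monoidal functors $\mathcal F(R) \to \mathcal W$ correspond to operad morphisms from $R$ to the operad of $\mathcal W$). $\mathbf S$ is the 2-monad on $\mathbf{Cat}$ for symmetric monoidal categories: objects of $\mathbf S\mathcal V$ are finite sequences of objects of $\mathcal V$, and a morphism $(x_i)_{1\le i\le n} \to (y_i)_{1 \le i\le n}$ is a permutation $\rho \in \Sigma_n$ with morphisms $x_i \to y_{\rho i}$. A symmetric monoidal category is a pseudo $\mathbf S$-algebra via $n$-ary tensor product $\bigotimes : \mathbf S\mathcal V \to \mathcal V$. A lax square of categories $p : P \to A$, $q : P \to B$, $f : A \to C$, $g : B \to C$, $\phi : fp \to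 gq$ is exact if for every $\psi : h \to lf$ exhibiting $l$ as a pointwise left Kan extension of $h$ along $f$, $(l\phi)(\psi p) : hp \to lgq$ exhibits $lg$ as a pointwise left Kan extension of $hp$ along $q$. A symmetric strict monoidal functor $K : \mathcal A \to \mathcal B$ is exact if the square with $P = \mathbf S\mathcal A$, $p = \bigotimes : \mathbf S\mathcal A \to \mathcal A$, $q = \mathbf S(K)$, bottom $K$, right side $\bigotimes : \mathbf S\mathcal B \to \mathcal B$ and 2-cell the identity $K\bigotimes \to \bigotimes\mathbf S(K)$ is exact. *)

theory Defs
  imports
    Main
    "HOL-Library.Infinite_Typeclass"
    "HOL-Combinatorics.Permutations"
begin

section \<open>Categories, functors, natural transformations\<close>

text \<open>
  All structures have explicit carriers, and functors and natural transformations are total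
  functions of which only the values on the carriers matter. Uniqueness statements below are
  therefore always relativised to carriers.
\<close>

record ('o, 'a) cat =
  Obj :: "'o set"
  Arr :: "'a set"
  Dom :: "'a \<Rightarrow> 'o"
  Cod :: "'a \<Rightarrow> 'o"
  Idt :: "'o \<Rightarrow> 'a"
  Comp :: "'a \<Rightarrow> 'a \<Rightarrow> 'a"  (infixr "\<cdot>\<index>" 70)

definition hom :: "('o, 'a, 'z) cat_scheme \<Rightarrow> 'o \<Rightarrow> 'o \<Rightarrow> 'a set" where
  "hom C a b = {f \<in> Arr C. Dom C f = a \<and> Cod C f = b}"

locale category =
  fixes C :: "('o, 'a, 'z) cat_scheme" (structure)
  assumes dom_obj: "f \<in> Arr C \<Longrightarrow> Dom C f \<in> Obj C"
    and cod_obj: "f \<in> Arr C \<Longrightarrow> Cod C f \<in> Obj C"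
    and idt_hom: "a \<in> Obj C \<Longrightarrow> Idt C a \<in> hom C a a"
    and comp_hom: "f \<in> hom C a b \<Longrightarrow> g \<in> hom C b c \<Longrightarrow> g \<cdot> f \<in> hom C a c"
    and comp_idt_right: "f \<in> hom C a b \<Longrightarrow> f \<cdot> Idt C a = f"
    and comp_idt_left: "f \<in> hom C a b \<Longrightarrow> Idt C b \<cdot> f = f"
    and comp_assoc: "f \<in> hom C a b \<Longrightarrow> g \<in> hom C b c \<Longrightarrow> h \<in> hom C c d \<Longrightarrow>
      (h \<cdot> g) \<cdot> f = h \<cdot> (g \<cdot> f)"

definition is_iso :: "('o, 'a, 'z) cat_scheme \<Rightarrow> 'a \<Rightarrow> bool" where
  "is_iso C f \<longleftrightarrow> f \<in> Arr C \<and>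
     (\<exists>g \<in> hom C (Cod C f) (Dom C f).
        g \<cdot>\<^bsub>C\<^esub> f = Idt C (Dom C f) \<and> f \<cdot>\<^bsub>C\<^esub> g = Idt C (Cod C f))"

record ('o, 'a, 'p, 'b) fctr =
  fobj :: "'o \<Rightarrow> 'p"
  farr :: "'a \<Rightarrow> 'b"

definition cat_functor ::
  "('o, 'a, 'z) cat_scheme \<Rightarrow> ('p, 'b, 'y) cat_scheme \<Rightarrow> ('o, 'a, 'p, 'b) fctr \<Rightarrow> bool" where
  "cat_functor A B F \<longleftrightarrow>
     (\<forall>a \<in> Obj A. fobj F a \<in> Obj B) \<and>
     (\<forall>f \<in> Arr A. farr F f \<in> hom B (fobj F (Dom A f)) (fobj F (Cod A f))) \<and>
     (\<forall>a \<in> Obj A. farr F (Idt A a) = Idt B (fobj F a)) \<and>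
     (\<forall>f \<in> Arr A. \<forall>g \<in> Arr A. Cod A f = Dom A g \<longrightarrow>
        farr F (g \<cdot>\<^bsub>A\<^esub> f) = farr F g \<cdot>\<^bsub>B\<^esub> farr F f)"

definition functor_comp ::
  "('p, 'b, 'q, 'c) fctr \<Rightarrow> ('o, 'a, 'p, 'b) fctr \<Rightarrow> ('o, 'a, 'q, 'c) fctr"
  (infixr "\<circ>\<^sub>F" 55) where
  "G \<circ>\<^sub>F F = \<lparr>fobj = fobj G \<circ> fobj F, farr = farr G \<circ> farr F\<rparr>"

definition nat_trans ::
  "('o, 'a, 'z) cat_scheme \<Rightarrow> ('p, 'b, 'y) cat_scheme \<Rightarrow>
   ('o, 'a, 'p, 'b) fctr \<Rightarrow> ('o, 'a, 'p, 'b) fctr \<Rightarrow> ('o \<Rightarrow> 'b) \<Rightarrow> bool" where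
  "nat_trans A B F G \<tau> \<longleftrightarrow>
     cat_functor A B F \<and> cat_functor A B G \<and>
     (\<forall>a \<in> Obj A. \<tau> a \<in> hom B (fobj F a) (fobj G a)) \<and>
     (\<forall>f \<in> Arr A. \<tau> (Cod A f) \<cdot>\<^bsub>B\<^esub> farr F f = farr G f \<cdot>\<^bsub>B\<^esub> \<tau> (Dom A f))"


section \<open>Colimits and left Kan extensions\<close>

definition is_cocone ::
  "('i, 'j, 'z) cat_scheme \<Rightarrow> ('o, 'a, 'y) cat_scheme \<Rightarrow> ('i, 'j, 'o, 'a) fctr \<Rightarrow>
   'o \<Rightarrow> ('i \<Rightarrow> 'a) \<Rightarrow> bool" where
  "is_cocone J X D c \<iota> \<longleftrightarrow>
     c \<in> Obj X \<and> (\<forall>i \<in> Obj J. \<iota> i \<in> hom X (fobj D i) c) \<and>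
     (\<forall>t \<in> Arr J. \<iota> (Cod J t) \<cdot>\<^bsub>X\<^esub> farr D t = \<iota> (Dom J t))"

definition is_colimit ::
  "('i, 'j, 'z) cat_scheme \<Rightarrow> ('o, 'a, 'y) cat_scheme \<Rightarrow> ('i, 'j, 'o, 'a) fctr \<Rightarrow>
   'o \<Rightarrow> ('i \<Rightarrow> 'a) \<Rightarrow> bool" where
  "is_colimit J X D c \<iota> \<longleftrightarrow>
     is_cocone J X D c \<iota> \<and>
     (\<forall>d \<kappa>. is_cocone J X D d \<kappa> \<longrightarrow>
        (\<exists>!u. u \<in> hom X c d \<and> (\<forall>i \<in> Obj J. u \<cdot>\<^bsub>X\<^esub> \<iota> i = \<kappa> i)))"

text \<open>
  The type \<open>'u\<close> plays the role of a universe: small categories (and small operads) are those whose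
  objects and arrows (colours and operations) form subsets of \<open>'u\<close>, i.e. up to isomorphism those of
  cardinality at most that of \<open>'u\<close>.
\<close>

definition cocomplete :: "'u itself \<Rightarrow> ('o, 'a, 'z) cat_scheme \<Rightarrow> bool" where
  "cocomplete U X \<longleftrightarrow>
     (\<forall>(J :: ('u, 'u) cat) D. category J \<and> cat_functor J X D \<longrightarrow> (\<exists>c \<iota>. is_colimit J X D c \<iota>))"

text \<open>
  The comma category \<open>f / c\<close>. An arrow from \<open>(a, m)\<close> to \<open>(a', m')\<close> is given by \<open>t : a \<rightarrow> a'\<close> with
  \<open>m' \<cdot> f t = m\<close>; it is encoded as \<open>(t, m')\<close>, from which \<open>m\<close> is recovered.
\<close>

definition comma ::
  "('o, 'a, 'z) cat_scheme \<Rightarrow> ('p, 'b, 'y) cat_scheme \<Rightarrow> ('o, 'a, 'p, 'b) fctr \<Rightarrow> 'p \<Rightarrow>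
   ('o \<times> 'b, 'a \<times> 'b) cat" where
  "comma A C f c = \<lparr>
     Obj = {(a, m). a \<in> Obj A \<and> m \<in> hom C (fobj f a) c},
     Arr = {(t, m). t \<in> Arr A \<and> m \<in> hom C (fobj f (Cod A t)) c},
     Dom = (\<lambda>(t, m). (Dom A t, m \<cdot>\<^bsub>C\<^esub> farr f t)),
     Cod = (\<lambda>(t, m). (Cod A t, m)),
     Idt = (\<lambda>(a, m). (Idt A a, m)),
     Comp = (\<lambda>(t', m') (t, m). (t' \<cdot>\<^bsub>A\<^esub> t, m'))\<rparr>"

definition comma_proj :: "('o \<times> 'b, 'a \<times> 'b, 'o, 'a) fctr" where
  "comma_proj = \<lparr>fobj = fst, farr = fst\<rparr>"

definition left_kan ::
  "('o, 'a, 'z1) cat_scheme \<Rightarrow> ('p, 'b, 'z2) cat_scheme \<Rightarrow> ('x, 'y, 'z3) cat_scheme \<Rightarrow>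
   ('o, 'a, 'p, 'b) fctr \<Rightarrow> ('o, 'a, 'x, 'y) fctr \<Rightarrow> ('p, 'b, 'x, 'y) fctr \<Rightarrow> ('o \<Rightarrow> 'y) \<Rightarrow> bool" where
  "left_kan A C X f h l \<psi> \<longleftrightarrow>
     cat_functor A C f \<and> cat_functor C X l \<and> nat_trans A X h (l \<circ>\<^sub>F f) \<psi> \<and>
     (\<forall>k \<theta>. cat_functor C X k \<and> nat_trans A X h (k \<circ>\<^sub>F f) \<theta> \<longrightarrow>
        (\<exists>\<tau>. nat_trans C X l k \<tau> \<and> (\<forall>a \<in> Obj A. \<tau> (fobj f a) \<cdot>\<^bsub>X\<^esub> \<psi> a = \<theta> a) \<and>
           (\<forall>\<tau>'. nat_trans C X l k \<tau>' \<and> (\<forall>a \<in> Obj A. \<tau>' (fobj f a) \<cdot>\<^bsub>X\<^esub> \<psi> a = \<theta> a) \<longrightarrow>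
              (\<forall>c \<in> Obj C. \<tau>' c = \<tau> c))))"

definition pointwise_left_kan ::
  "('o, 'a, 'z1) cat_scheme \<Rightarrow> ('p, 'b, 'z2) cat_scheme \<Rightarrow> ('x, 'y, 'z3) cat_scheme \<Rightarrow>
   ('o, 'a, 'p, 'b) fctr \<Rightarrow> ('o, 'a, 'x, 'y) fctr \<Rightarrow> ('p, 'b, 'x, 'y) fctr \<Rightarrow> ('o \<Rightarrow> 'y) \<Rightarrow> bool" where
  "pointwise_left_kan A C X f h l \<psi> \<longleftrightarrow>
     cat_functor A C f \<and> cat_functor C X l \<and> nat_trans A X h (l \<circ>\<^sub>F f) \<psi> \<and>
     (\<forall>c \<in> Obj C. is_colimit (comma A C f c) X (h \<circ>\<^sub>F comma_proj) (fobj l c)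
        (\<lambda>(a, m). farr l m \<cdot>\<^bsub>X\<^esub> \<psi> a))"


section \<open>Exact squares\<close>

definition lax_square ::
  "('o, 'a, 'z1) cat_scheme \<Rightarrow> ('p, 'b, 'z2) cat_scheme \<Rightarrow> ('q, 'c, 'z3) cat_scheme \<Rightarrow>
   ('r, 'd, 'z4) cat_scheme \<Rightarrow> ('o, 'a, 'p, 'b) fctr \<Rightarrow> ('o, 'a, 'q, 'c) fctr \<Rightarrow>
   ('p, 'b, 'r, 'd) fctr \<Rightarrow> ('q, 'c, 'r, 'd) fctr \<Rightarrow> ('o \<Rightarrow> 'd) \<Rightarrow> bool" where
  "lax_square P A B C p q f g \<phi> \<longleftrightarrow>
     category P \<and> category A \<and> category B \<and> category C \<and>
     cat_functor P A p \<and> cat_functor P B q \<and> cat_functor A C f \<and> cat_functor B C g \<and>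
     nat_trans P C (f \<circ>\<^sub>F p) (g \<circ>\<^sub>F q) \<phi>"

text \<open>
  Exactness quantifies over all functors into an arbitrary category \<open>X\<close>. The types of objects and
  arrows of \<open>X\<close> have to be a parameter of the definition, to be left arbitrary where it is used.
\<close>

definition exact_square ::
  "('x \<times> 'y) itself \<Rightarrow>
   ('o, 'a, 'z1) cat_scheme \<Rightarrow> ('p, 'b, 'z2) cat_scheme \<Rightarrow> ('q, 'c, 'z3) cat_scheme \<Rightarrow>
   ('r, 'd, 'z4) cat_scheme \<Rightarrow> ('o, 'a, 'p, 'b) fctr \<Rightarrow> ('o, 'a, 'q, 'c) fctr \<Rightarrow>
   ('p, 'b, 'r, 'd) fctr \<Rightarrow> ('q, 'c, 'r, 'd) fctr \<Rightarrow> ('o \<Rightarrow> 'd) \<Rightarrow> bool" where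
  "exact_square XY P A B C p q f g \<phi> \<longleftrightarrow>
     lax_square P A B C p q f g \<phi> \<and>
     (\<forall>(X :: ('x, 'y) cat) h l \<psi>. category X \<and> pointwise_left_kan A C X f h l \<psi> \<longrightarrow>
        pointwise_left_kan P B X q (h \<circ>\<^sub>F p) (l \<circ>\<^sub>F g)
          (\<lambda>u. farr l (\<phi> u) \<cdot>\<^bsub>X\<^esub> \<psi> (fobj p u)))"


section \<open>Symmetric monoidal categories\<close>

text \<open>
  \<open>Asc x y z : (x \<otimes> y) \<otimes> z \<rightarrow> x \<otimes> (y \<otimes> z)\<close>, \<open>Lun x : I \<otimes> x \<rightarrow> x\<close>, \<open>Run x : x \<otimes> I \<rightarrow> x\<close>,
  \<open>Brd x y : x \<otimes> y \<rightarrow> y \<otimes> x\<close>; \<open>\<odot>\<close> is the tensor product on objects, \<open>\<otimes>\<close> the one on arrows.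
\<close>

record ('o, 'a) smcat = "('o, 'a) cat" +
  TenO :: "'o \<Rightarrow> 'o \<Rightarrow> 'o"  (infixr "\<odot>\<index>" 75)
  TenA :: "'a \<Rightarrow> 'a \<Rightarrow> 'a"  (infixr "\<otimes>\<index>" 75)
  Unt :: 'o
  Asc :: "'o \<Rightarrow> 'o \<Rightarrow> 'o \<Rightarrow> 'a"
  Lun :: "'o \<Rightarrow> 'a"
  Run :: "'o \<Rightarrow> 'a"
  Brd :: "'o \<Rightarrow> 'o \<Rightarrow> 'a"

locale symmetric_monoidal = category M
  for M :: "('o, 'a, 'z) smcat_scheme" (structure) +
  assumes unt_obj: "Unt M \<in> Obj M"
    and tenO_obj: "x \<in> Obj M \<Longrightarrow> y \<in> Obj M \<Longrightarrow> x \<odot> y \<in> Obj M"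
    and tenA_hom: "f \<in> hom M x x' \<Longrightarrow> g \<in> hom M y y' \<Longrightarrow> f \<otimes> g \<in> hom M (x \<odot> y) (x' \<odot> y')"
    and tenA_idt: "x \<in> Obj M \<Longrightarrow> y \<in> Obj M \<Longrightarrow> Idt M x \<otimes> Idt M y = Idt M (x \<odot> y)"
    and tenA_comp: "f \<in> hom M x x' \<Longrightarrow> f' \<in> hom M x' x'' \<Longrightarrow>
      g \<in> hom M y y' \<Longrightarrow> g' \<in> hom M y' y'' \<Longrightarrow>
      (f' \<cdot> f) \<otimes> (g' \<cdot> g) = (f' \<otimes> g') \<cdot> (f \<otimes> g)"
    and asc_hom: "x \<in> Obj M \<Longrightarrow> y \<in> Obj M \<Longrightarrow> z \<in> Obj M \<Longrightarrow>
      Asc M x y z \<in> hom M ((x \<odot> y) \<odot> z) (x \<odot> (y \<odot> z))"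
    and asc_iso: "x \<in> Obj M \<Longrightarrow> y \<in> Obj M \<Longrightarrow> z \<in> Obj M \<Longrightarrow> is_iso M (Asc M x y z)"
    and asc_natural: "f \<in> hom M x x' \<Longrightarrow> g \<in> hom M y y' \<Longrightarrow> h \<in> hom M z z' \<Longrightarrow>
      Asc M x' y' z' \<cdot> ((f \<otimes> g) \<otimes> h) = (f \<otimes> (g \<otimes> h)) \<cdot> Asc M x y z"
    and lun_hom: "x \<in> Obj M \<Longrightarrow> Lun M x \<in> hom M (Unt M \<odot> x) x"
    and lun_iso: "x \<in> Obj M \<Longrightarrow> is_iso M (Lun M x)"
    and lun_natural: "f \<in> hom M x x' \<Longrightarrow> Lun M x' \<cdot> (Idt M (Unt M) \<otimes> f) = f \<cdot> Lun M x"
    and run_hom: "x \<in> Obj M \<Longrightarrow> Run M x \<in> hom M (x \<odot> Unt M) x"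
    and run_iso: "x \<in> Obj M \<Longrightarrow> is_iso M (Run M x)"
    and run_natural: "f \<in> hom M x x' \<Longrightarrow> Run M x' \<cdot> (f \<otimes> Idt M (Unt M)) = f \<cdot> Run M x"
    and brd_hom: "x \<in> Obj M \<Longrightarrow> y \<in> Obj M \<Longrightarrow> Brd M x y \<in> hom M (x \<odot> y) (y \<odot> x)"
    and brd_natural: "f \<in> hom M x x' \<Longrightarrow> g \<in> hom M y y' \<Longrightarrow>
      Brd M x' y' \<cdot> (f \<otimes> g) = (g \<otimes> f) \<cdot> Brd M x y"
    and brd_symmetric: "x \<in> Obj M \<Longrightarrow> y \<in> Obj M \<Longrightarrow> Brd M y x \<cdot> Brd M x y = Idt M (x \<odot> y)"
    and pentagon: "w \<in> Obj M \<Longrightarrow> x \<in> Obj M \<Longrightarrow> y \<in> Obj M \<Longrightarrow> z \<in> Obj M \<Longrightarrow>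
      Asc M w x (y \<odot> z) \<cdot> Asc M (w \<odot> x) y z =
      (Idt M w \<otimes> Asc M x y z) \<cdot> Asc M w (x \<odot> y) z \<cdot> (Asc M w x y \<otimes> Idt M z)"
    and triangle: "x \<in> Obj M \<Longrightarrow> y \<in> Obj M \<Longrightarrow>
      (Idt M x \<otimes> Lun M y) \<cdot> Asc M x (Unt M) y = Run M x \<otimes> Idt M y"
    and hexagon: "x \<in> Obj M \<Longrightarrow> y \<in> Obj M \<Longrightarrow> z \<in> Obj M \<Longrightarrow>
      Asc M y z x \<cdot> Brd M x (y \<odot> z) \<cdot> Asc M x y z =
      (Idt M y \<otimes> Brd M x z) \<cdot> Asc M y x z \<cdot> (Brd M x y \<otimes> Idt M z)"

text \<open>
  Equality of the two bracketings on arrows follows from the conditions below by naturality of the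
  associator and unitors.
\<close>

locale symmetric_strict_monoidal = symmetric_monoidal +
  assumes strict_assoc: "x \<in> Obj M \<Longrightarrow> y \<in> Obj M \<Longrightarrow> z \<in> Obj M \<Longrightarrow> (x \<odot> y) \<odot> z = x \<odot> (y \<odot> z)"
    and strict_unt_left: "x \<in> Obj M \<Longrightarrow> Unt M \<odot> x = x"
    and strict_unt_right: "x \<in> Obj M \<Longrightarrow> x \<odot> Unt M = x"
    and strict_asc: "x \<in> Obj M \<Longrightarrow> y \<in> Obj M \<Longrightarrow> z \<in> Obj M \<Longrightarrow> Asc M x y z = Idt M (x \<odot> (y \<odot> z))"
    and strict_lun: "x \<in> Obj M \<Longrightarrow> Lun M x = Idt M x"
    and strict_run: "x \<in> Obj M \<Longrightarrow> Run M x = Idt M x"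

definition monoidal_closed :: "('o, 'a, 'z) smcat_scheme \<Rightarrow> bool" where
  "monoidal_closed M \<longleftrightarrow>
     (\<forall>y \<in> Obj M. \<forall>z \<in> Obj M. \<exists>e \<in> Obj M. \<exists>ev \<in> hom M (e \<odot>\<^bsub>M\<^esub> y) z.
        \<forall>x \<in> Obj M. \<forall>f \<in> hom M (x \<odot>\<^bsub>M\<^esub> y) z.
          \<exists>!g. g \<in> hom M x e \<and> ev \<cdot>\<^bsub>M\<^esub> (g \<otimes>\<^bsub>M\<^esub> Idt M y) = f)"

text \<open>Symmetric strict monoidal functors, between symmetric strict monoidal categories.\<close>

definition strict_monoidal_functor ::
  "('o, 'a, 'z) smcat_scheme \<Rightarrow> ('p, 'b, 'y) smcat_scheme \<Rightarrow> ('o, 'a, 'p, 'b) fctr \<Rightarrow> bool" where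
  "strict_monoidal_functor M N K \<longleftrightarrow>
     cat_functor M N K \<and>
     fobj K (Unt M) = Unt N \<and>
     (\<forall>x \<in> Obj M. \<forall>y \<in> Obj M. fobj K (x \<odot>\<^bsub>M\<^esub> y) = fobj K x \<odot>\<^bsub>N\<^esub> fobj K y) \<and>
     (\<forall>f \<in> Arr M. \<forall>g \<in> Arr M. farr K (f \<otimes>\<^bsub>M\<^esub> g) = farr K f \<otimes>\<^bsub>N\<^esub> farr K g) \<and>
     (\<forall>x \<in> Obj M. \<forall>y \<in> Obj M. farr K (Brd M x y) = Brd N (fobj K x) (fobj K y))"

text \<open>
  Symmetric strong monoidal functors: \<open>F\<close> together with invertible coherence cells
  \<open>\<mu> x y : F x \<otimes> F y \<rightarrow> F (x \<otimes> y)\<close> and \<open>\<iota> : I \<rightarrow> F I\<close>.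
\<close>

definition strong_monoidal_functor ::
  "('o, 'a, 'z) smcat_scheme \<Rightarrow> ('p, 'b, 'y) smcat_scheme \<Rightarrow> ('o, 'a, 'p, 'b) fctr \<Rightarrow>
   ('o \<Rightarrow> 'o \<Rightarrow> 'b) \<Rightarrow> 'b \<Rightarrow> bool" where
  "strong_monoidal_functor M N F \<mu> \<iota> \<longleftrightarrow>
     cat_functor M N F \<and>
     (\<forall>x \<in> Obj M. \<forall>y \<in> Obj M.
        \<mu> x y \<in> hom N (fobj F x \<odot>\<^bsub>N\<^esub> fobj F y) (fobj F (x \<odot>\<^bsub>M\<^esub> y)) \<and> is_iso N (\<mu> x y)) \<and>
     \<iota> \<in> hom N (Unt N) (fobj F (Unt M)) \<and> is_iso N \<iota> \<and>
     (\<forall>f \<in> Arr M. \<forall>g \<in> Arr M.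
        \<mu> (Cod M f) (Cod M g) \<cdot>\<^bsub>N\<^esub> (farr F f \<otimes>\<^bsub>N\<^esub> farr F g) =
        farr F (f \<otimes>\<^bsub>M\<^esub> g) \<cdot>\<^bsub>N\<^esub> \<mu> (Dom M f) (Dom M g)) \<and>
     (\<forall>x \<in> Obj M. \<forall>y \<in> Obj M. \<forall>z \<in> Obj M.
        farr F (Asc M x y z) \<cdot>\<^bsub>N\<^esub> \<mu> (x \<odot>\<^bsub>M\<^esub> y) z \<cdot>\<^bsub>N\<^esub> (\<mu> x y \<otimes>\<^bsub>N\<^esub> Idt N (fobj F z)) =
        \<mu> x (y \<odot>\<^bsub>M\<^esub> z) \<cdot>\<^bsub>N\<^esub> (Idt N (fobj F x) \<otimes>\<^bsub>N\<^esub> \<mu> y z) \<cdot>\<^bsub>N\<^esub>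
          Asc N (fobj F x) (fobj F y) (fobj F z)) \<and>
     (\<forall>x \<in> Obj M.
        farr F (Lun M x) \<cdot>\<^bsub>N\<^esub> \<mu> (Unt M) x \<cdot>\<^bsub>N\<^esub> (\<iota> \<otimes>\<^bsub>N\<^esub> Idt N (fobj F x)) = Lun N (fobj F x)) \<and>
     (\<forall>x \<in> Obj M.
        farr F (Run M x) \<cdot>\<^bsub>N\<^esub> \<mu> x (Unt M) \<cdot>\<^bsub>N\<^esub> (Idt N (fobj F x) \<otimes>\<^bsub>N\<^esub> \<iota>) = Run N (fobj F x)) \<and>
     (\<forall>x \<in> Obj M. \<forall>y \<in> Obj M.
        farr F (Brd M x y) \<cdot>\<^bsub>N\<^esub> \<mu> x y = \<mu> y x \<cdot>\<^bsub>N\<^esub> Brd N (fobj F x) (fobj F y))"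

definition monoidal_nat_trans ::
  "('o, 'a, 'z) smcat_scheme \<Rightarrow> ('p, 'b, 'y) smcat_scheme \<Rightarrow>
   ('o, 'a, 'p, 'b) fctr \<Rightarrow> ('o \<Rightarrow> 'o \<Rightarrow> 'b) \<Rightarrow> 'b \<Rightarrow>
   ('o, 'a, 'p, 'b) fctr \<Rightarrow> ('o \<Rightarrow> 'o \<Rightarrow> 'b) \<Rightarrow> 'b \<Rightarrow> ('o \<Rightarrow> 'b) \<Rightarrow> bool" where
  "monoidal_nat_trans M N F \<mu> \<iota> G \<mu>' \<iota>' \<tau> \<longleftrightarrow>
     nat_trans M N F G \<tau> \<and>
     (\<forall>x \<in> Obj M. \<forall>y \<in> Obj M. \<tau> (x \<odot>\<^bsub>M\<^esub> y) \<cdot>\<^bsub>N\<^esub> \<mu> x y = \<mu>' x y \<cdot>\<^bsub>N\<^esub> (\<tau> x \<otimes>\<^bsub>N\<^esub> \<tau> y)) \<and>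
     \<tau> (Unt M) \<cdot>\<^bsub>N\<^esub> \<iota> = \<iota>'"


section \<open>The 2-monad for symmetric monoidal categories and \<open>n\<close>-ary tensor products\<close>

text \<open>
  An arrow \<open>(x\<^sub>i)\<^sub>i \<rightarrow> (y\<^sub>i)\<^sub>i\<close> of \<open>sym_cat V\<close>, i.e. a permutation \<open>\<rho>\<close> with arrows
  \<open>f\<^sub>i : x\<^sub>i \<rightarrow> y\<^bsub>\<rho> i\<^esub>\<close>, is encoded as \<open>(\<rho>, [f\<^sub>0, \<dots>, f\<^bsub>n-1\<^esub>])\<close>, from which source and target are
  recovered. Indices start at \<open>0\<close>. Recall that \<open>permute_list \<sigma> xs ! i = xs ! \<sigma> i\<close>.
\<close>

definition sym_cat :: "('o, 'a, 'z) cat_scheme \<Rightarrow> ('o list, (nat \<Rightarrow> nat) \<times> 'a list) cat" where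
  "sym_cat V = \<lparr>
     Obj = {xs. set xs \<subseteq> Obj V},
     Arr = {(\<rho>, fs). \<rho> permutes {..<length fs} \<and> set fs \<subseteq> Arr V},
     Dom = (\<lambda>(\<rho>, fs). map (Dom V) fs),
     Cod = (\<lambda>(\<rho>, fs). permute_list (inv \<rho>) (map (Cod V) fs)),
     Idt = (\<lambda>xs. (id, map (Idt V) xs)),
     Comp = (\<lambda>(\<sigma>, gs) (\<rho>, fs). (\<sigma> \<circ> \<rho>, map2 (\<lambda>g f. g \<cdot>\<^bsub>V\<^esub> f) (permute_list \<rho> gs) fs))\<rparr>"

definition sym_functor ::
  "('o, 'a, 'p, 'b) fctr \<Rightarrow> ('o list, (nat \<Rightarrow> nat) \<times> 'a list, 'p list, (nat \<Rightarrow> nat) \<times> 'b list) fctr"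
  where
  "sym_functor K = \<lparr>fobj = map (fobj K), farr = (\<lambda>(\<rho>, fs). (\<rho>, map (farr K) fs))\<rparr>"

primrec tensor_objs :: "('o, 'a, 'z) smcat_scheme \<Rightarrow> 'o list \<Rightarrow> 'o" where
  "tensor_objs M [] = Unt M"
| "tensor_objs M (x # xs) = x \<odot>\<^bsub>M\<^esub> tensor_objs M xs"

primrec tensor_arrs :: "('o, 'a, 'z) smcat_scheme \<Rightarrow> 'a list \<Rightarrow> 'a" where
  "tensor_arrs M [] = Idt M (Unt M)"
| "tensor_arrs M (f # fs) = f \<otimes>\<^bsub>M\<^esub> tensor_arrs M fs"

text \<open>
  For \<open>\<rho>\<close> a permutation of the positions of \<open>xs\<close> and \<open>M\<close> strict, \<open>perm_arr M \<rho> xs\<close> is the symmetry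
  \<open>x\<^sub>0 \<otimes> \<dots> \<otimes> x\<^bsub>n-1\<^esub> \<rightarrow> y\<^sub>0 \<otimes> \<dots> \<otimes> y\<^bsub>n-1\<^esub>\<close> with \<open>y\<^bsub>\<rho> i\<^esub> = x\<^sub>i\<close>. Recursively, the factors
  \<open>x\<^sub>1, \<dots>, x\<^bsub>n-1\<^esub>\<close> are first brought into their final relative order by the permutation
  \<open>perm_tail \<rho>\<close>, and then \<open>x\<^sub>0\<close> is moved past the first \<open>\<rho> 0\<close> of them. (Strictness makes the
  bracketings agree; by coherence any other decomposition into braidings gives the same arrow.)
\<close>

definition perm_tail :: "(nat \<Rightarrow> nat) \<Rightarrow> nat \<Rightarrow> nat" where
  "perm_tail \<rho> i = (if \<rho> (Suc i) < \<rho> 0 then \<rho> (Suc i) else \<rho> (Suc i) - 1)"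

primrec perm_arr :: "('o, 'a, 'z) smcat_scheme \<Rightarrow> (nat \<Rightarrow> nat) \<Rightarrow> 'o list \<Rightarrow> 'a" where
  "perm_arr M \<rho> [] = Idt M (Unt M)"
| "perm_arr M \<rho> (x # xs) =
     (let ys = permute_list (inv (perm_tail \<rho>)) xs in
      (Brd M x (tensor_objs M (take (\<rho> 0) ys)) \<otimes>\<^bsub>M\<^esub> Idt M (tensor_objs M (drop (\<rho> 0) ys)))
      \<cdot>\<^bsub>M\<^esub> (Idt M x \<otimes>\<^bsub>M\<^esub> perm_arr M (perm_tail \<rho>) xs))"

definition tensor_functor ::
  "('o, 'a, 'z) smcat_scheme \<Rightarrow> ('o list, (nat \<Rightarrow> nat) \<times> 'a list, 'o, 'a) fctr" where
  "tensor_functor M = \<lparr>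
     fobj = tensor_objs M,
     farr = (\<lambda>(\<rho>, fs). perm_arr M \<rho> (map (Cod M) fs) \<cdot>\<^bsub>M\<^esub> tensor_arrs M fs)\<rparr>"

definition exact_monoidal_functor ::
  "('x \<times> 'y) itself \<Rightarrow> ('o, 'a, 'z1) smcat_scheme \<Rightarrow> ('p, 'b, 'z2) smcat_scheme \<Rightarrow>
   ('o, 'a, 'p, 'b) fctr \<Rightarrow> bool" where
  "exact_monoidal_functor XY A B K \<longleftrightarrow>
     strict_monoidal_functor A B K \<and>
     exact_square XY (sym_cat A) A (sym_cat B) B
       (tensor_functor A) (sym_functor K) K (tensor_functor B)
       (\<lambda>xs. Idt B (fobj K (tensor_objs A xs)))"


section \<open>Coloured symmetric operads\<close>

text \<open>
  \<open>Sub x [y\<^sub>0, \<dots>, y\<^bsub>n-1\<^esub>]\<close> is the substitution \<open>x(y\<^sub>0, \<dots>, y\<^bsub>n-1\<^esub>)\<close>, and \<open>Act x \<sigma>\<close> is the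
  operation \<open>x \<sigma> : (c\<^bsub>\<sigma> 0\<^esub>, \<dots>, c\<^bsub>\<sigma> (n-1)\<^esub>) \<rightarrow> d\<close> for \<open>x : (c\<^sub>0, \<dots>, c\<^bsub>n-1\<^esub>) \<rightarrow> d\<close> (a right action).
\<close>

record ('c, 'x) oprd =
  Col :: "'c set"
  Ops :: "'x set"
  Src :: "'x \<Rightarrow> 'c list"
  Tgt :: "'x \<Rightarrow> 'c"
  One :: "'c \<Rightarrow> 'x"
  Sub :: "'x \<Rightarrow> 'x list \<Rightarrow> 'x"
  Act :: "'x \<Rightarrow> (nat \<Rightarrow> nat) \<Rightarrow> 'x"

text \<open>
  \<open>index_blocks [k\<^sub>0, \<dots>, k\<^bsub>n-1\<^esub>]\<close> cuts \<open>0, 1, 2, \<dots>\<close> into consecutive blocks of lengths \<open>k\<^sub>i\<close>.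
  Reading lists of positions as permutations, \<open>block_sum\<close> is the direct sum of permutations
  \<open>\<tau>\<^sub>i\<close> of \<open>k\<^sub>i\<close> elements, and \<open>block_perm \<sigma>\<close> is the block permutation \<open>\<beta>\<close> with
  \<open>permute_list \<beta> (concat xss) = concat (permute_list \<sigma> xss)\<close> for lists \<open>xss ! i\<close> of length \<open>k\<^sub>i\<close>.
\<close>

definition index_blocks :: "nat list \<Rightarrow> nat list list" where
  "index_blocks ks = map (\<lambda>i. [sum_list (take i ks)..<sum_list (take (Suc i) ks)]) [0..<length ks]"

definition perm_of_list :: "nat list \<Rightarrow> nat \<Rightarrow> nat" where
  "perm_of_list js i = (if i < length js then js ! i else i)"

definition block_sum :: "(nat \<Rightarrow> nat) list \<Rightarrow> nat list \<Rightarrow> nat \<Rightarrow> nat" where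
  "block_sum \<tau>s ks = perm_of_list (concat (map2 permute_list \<tau>s (index_blocks ks)))"

definition block_perm :: "(nat \<Rightarrow> nat) \<Rightarrow> nat list \<Rightarrow> nat \<Rightarrow> nat" where
  "block_perm \<sigma> ks = perm_of_list (concat (permute_list \<sigma> (index_blocks ks)))"

locale operad =
  fixes R :: "('c, 'x, 'z) oprd_scheme"
  assumes src_col: "x \<in> Ops R \<Longrightarrow> set (Src R x) \<subseteq> Col R"
    and tgt_col: "x \<in> Ops R \<Longrightarrow> Tgt R x \<in> Col R"
    and one_op: "c \<in> Col R \<Longrightarrow> One R c \<in> Ops R"
    and one_src: "c \<in> Col R \<Longrightarrow> Src R (One R c) = [c]"
    and one_tgt: "c \<in> Col R \<Longrightarrow> Tgt R (One R c) = c"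
    and sub_op: "x \<in> Ops R \<Longrightarrow> set ys \<subseteq> Ops R \<Longrightarrow> map (Tgt R) ys = Src R x \<Longrightarrow> Sub R x ys \<in> Ops R"
    and sub_src: "x \<in> Ops R \<Longrightarrow> set ys \<subseteq> Ops R \<Longrightarrow> map (Tgt R) ys = Src R x \<Longrightarrow>
      Src R (Sub R x ys) = concat (map (Src R) ys)"
    and sub_tgt: "x \<in> Ops R \<Longrightarrow> set ys \<subseteq> Ops R \<Longrightarrow> map (Tgt R) ys = Src R x \<Longrightarrow>
      Tgt R (Sub R x ys) = Tgt R x"
    and act_op: "x \<in> Ops R \<Longrightarrow> \<sigma> permutes {..<length (Src R x)} \<Longrightarrow> Act R x \<sigma> \<in> Ops R"
    and act_src: "x \<in> Ops R \<Longrightarrow> \<sigma> permutes {..<length (Src R x)} \<Longrightarrow>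
      Src R (Act R x \<sigma>) = permute_list \<sigma> (Src R x)"
    and act_tgt: "x \<in> Ops R \<Longrightarrow> \<sigma> permutes {..<length (Src R x)} \<Longrightarrow> Tgt R (Act R x \<sigma>) = Tgt R x"
    and sub_one_left: "x \<in> Ops R \<Longrightarrow> Sub R (One R (Tgt R x)) [x] = x"
    and sub_one_right: "x \<in> Ops R \<Longrightarrow> Sub R x (map (One R) (Src R x)) = x"
    and sub_assoc: "x \<in> Ops R \<Longrightarrow> set ys \<subseteq> Ops R \<Longrightarrow> map (Tgt R) ys = Src R x \<Longrightarrow>
      list_all2 (\<lambda>zs y. set zs \<subseteq> Ops R \<and> map (Tgt R) zs = Src R y) zss ys \<Longrightarrow>
      Sub R (Sub R x ys) (concat zss) = Sub R x (map2 (Sub R) ys zss)"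
    and act_id: "x \<in> Ops R \<Longrightarrow> Act R x id = x"
    and act_comp: "x \<in> Ops R \<Longrightarrow> \<sigma> permutes {..<length (Src R x)} \<Longrightarrow>
      \<tau> permutes {..<length (Src R x)} \<Longrightarrow> Act R (Act R x \<sigma>) \<tau> = Act R x (\<sigma> \<circ> \<tau>)"
    and sub_act_inner: "x \<in> Ops R \<Longrightarrow> set ys \<subseteq> Ops R \<Longrightarrow> map (Tgt R) ys = Src R x \<Longrightarrow>
      list_all2 (\<lambda>y \<tau>. \<tau> permutes {..<length (Src R y)}) ys \<tau>s \<Longrightarrow>
      Sub R x (map2 (Act R) ys \<tau>s) = Act R (Sub R x ys) (block_sum \<tau>s (map (length \<circ> Src R) ys))"
    and sub_act_outer: "x \<in> Ops R \<Longrightarrow> set ys \<subseteq> Ops R \<Longrightarrow> map (Tgt R) ys = Src R x \<Longrightarrow>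
      \<sigma> permutes {..<length (Src R x)} \<Longrightarrow>
      Sub R (Act R x \<sigma>) (permute_list \<sigma> ys) =
      Act R (Sub R x ys) (block_perm \<sigma> (map (length \<circ> Src R) ys))"

record ('c, 'x, 'd, 'y) opmor =
  ocol :: "'c \<Rightarrow> 'd"
  oop :: "'x \<Rightarrow> 'y"

definition operad_morphism ::
  "('c, 'x, 'z1) oprd_scheme \<Rightarrow> ('d, 'y, 'z2) oprd_scheme \<Rightarrow> ('c, 'x, 'd, 'y) opmor \<Rightarrow> bool" where
  "operad_morphism R T G \<longleftrightarrow>
     (\<forall>c \<in> Col R. ocol G c \<in> Col T) \<and>
     (\<forall>x \<in> Ops R. oop G x \<in> Ops T \<and>
        Src T (oop G x) = map (ocol G) (Src R x) \<and> Tgt T (oop G x) = ocol G (Tgt R x)) \<and>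
     (\<forall>c \<in> Col R. oop G (One R c) = One T (ocol G c)) \<and>
     (\<forall>x \<in> Ops R. \<forall>ys. set ys \<subseteq> Ops R \<and> map (Tgt R) ys = Src R x \<longrightarrow>
        oop G (Sub R x ys) = Sub T (oop G x) (map (oop G) ys)) \<and>
     (\<forall>x \<in> Ops R. \<forall>\<sigma>. \<sigma> permutes {..<length (Src R x)} \<longrightarrow>
        oop G (Act R x \<sigma>) = Act T (oop G x) \<sigma>)"

definition opmor_comp ::
  "('d, 'y, 'e, 'w) opmor \<Rightarrow> ('c, 'x, 'd, 'y) opmor \<Rightarrow> ('c, 'x, 'e, 'w) opmor"
  (infixr "\<circ>\<^sub>O" 55) where
  "H \<circ>\<^sub>O G = \<lparr>ocol = ocol H \<circ> ocol G, oop = oop H \<circ> oop G\<rparr>"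

definition opmor_eq ::
  "('c, 'x, 'z) oprd_scheme \<Rightarrow> ('c, 'x, 'd, 'y) opmor \<Rightarrow> ('c, 'x, 'd, 'y) opmor \<Rightarrow> bool" where
  "opmor_eq R G H \<longleftrightarrow> (\<forall>c \<in> Col R. ocol G c = ocol H c) \<and> (\<forall>x \<in> Ops R. oop G x = oop H x)"


section \<open>Free symmetric strict monoidal categories on operads\<close>

text \<open>
  The underlying operad of a symmetric strict monoidal category. An operation
  \<open>(A\<^sub>0, \<dots>, A\<^bsub>n-1\<^esub>) \<rightarrow> B\<close> is an arrow \<open>A\<^sub>0 \<otimes> \<dots> \<otimes> A\<^bsub>n-1\<^esub> \<rightarrow> B\<close>, recorded together with the list of
  its inputs.
\<close>

definition operad_of :: "('o, 'a, 'z) smcat_scheme \<Rightarrow> ('o, 'o list \<times> 'a) oprd" where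
  "operad_of W = \<lparr>
     Col = Obj W,
     Ops = {(xs, f). set xs \<subseteq> Obj W \<and> f \<in> Arr W \<and> Dom W f = tensor_objs W xs},
     Src = fst,
     Tgt = (\<lambda>(xs, f). Cod W f),
     One = (\<lambda>x. ([x], Idt W x)),
     Sub = (\<lambda>(xs, f) ys. (concat (map fst ys), f \<cdot>\<^bsub>W\<^esub> tensor_arrs W (map snd ys))),
     Act = (\<lambda>(xs, f) \<sigma>. (permute_list \<sigma> xs, f \<cdot>\<^bsub>W\<^esub> perm_arr W \<sigma> (permute_list \<sigma> xs)))\<rparr>"

definition opmor_of :: "('o, 'a, 'p, 'b) fctr \<Rightarrow> ('o, 'o list \<times> 'a, 'p, 'p list \<times> 'b) opmor" where
  "opmor_of K = \<lparr>ocol = fobj K, oop = (\<lambda>(xs, f). (map (fobj K) xs, farr K f))\<rparr>"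

text \<open>
  \<open>F\<close> with \<open>\<eta> : R \<rightarrow> operad_of F\<close> is a value at \<open>R\<close> of the left adjoint to the forgetful functor
  from small symmetric strict monoidal categories to small operads: \<open>\<eta>\<close> is a universal arrow.
\<close>

definition free_sym_monoidal ::
  "('u, 'u) oprd \<Rightarrow> ('u, 'u) smcat \<Rightarrow> ('u, 'u, 'u, 'u list \<times> 'u) opmor \<Rightarrow> bool" where
  "free_sym_monoidal R F \<eta> \<longleftrightarrow>
     symmetric_strict_monoidal F \<and> operad_morphism R (operad_of F) \<eta> \<and>
     (\<forall>(W :: ('u, 'u) smcat) \<Phi>.
        symmetric_strict_monoidal W \<and> operad_morphism R (operad_of W) \<Phi> \<longrightarrow>
        (\<exists>K. strict_monoidal_functor F W K \<and> opmor_eq R (opmor_of K \<circ>\<^sub>O \<eta>) \<Phi> \<and>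
           (\<forall>K'. strict_monoidal_functor F W K' \<and> opmor_eq R (opmor_of K' \<circ>\<^sub>O \<eta>) \<Phi> \<longrightarrow>
              (\<forall>x \<in> Obj F. fobj K' x = fobj K x) \<and> (\<forall>f \<in> Arr F. farr K' f = farr K f))))"

text \<open>\<open>K\<close> is the value at \<open>G : R \<rightarrow> T\<close> of that left adjoint: \<open>\<eta>\<close> is natural.\<close>

definition free_sym_monoidal_map ::
  "('u, 'u) oprd \<Rightarrow> ('u, 'u) smcat \<Rightarrow> ('u, 'u, 'u, 'u list \<times> 'u) opmor \<Rightarrow>
   ('u, 'u) smcat \<Rightarrow> ('u, 'u, 'u, 'u list \<times> 'u) opmor \<Rightarrow>
   ('u, 'u, 'u, 'u) opmor \<Rightarrow> ('u, 'u, 'u, 'u) fctr \<Rightarrow> bool" where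
  "free_sym_monoidal_map R FR \<eta>R FT \<eta>T G K \<longleftrightarrow>
     strict_monoidal_functor FR FT K \<and> opmor_eq R (opmor_of K \<circ>\<^sub>O \<eta>R) (\<eta>T \<circ>\<^sub>O G)"

end

theory Submission
  imports Defs
begin

text \<open>
  The objects of the free symmetric strict monoidal category \<open>F\<close> on an operad are tensor products of
  colours, and an arrow from such a product to \<open>y \<otimes> z\<close> is, in a unique way, an unshuffle of the factors
  followed by the tensor product of an arrow to \<open>y\<close> and an arrow to \<open>z\<close>. To obtain this from the
  universal property alone, consider the arrows of \<open>F\<close> equipped with such a splitting for every marking
  of the factors of the target. They form a symmetric strict monoidal category which receives the
  operad, so its forgetful functor to \<open>F\<close> has a section.

  Consequently, among the factorisations of \<open>K a \<rightarrow> y\<^sub>1 \<otimes> \<dots> \<otimes> y\<^sub>n\<close> through lists of arrows \<open>K x\<^sub>i \<rightarrow> y\<^sub>i\<close>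
  there is one that maps to all others. Hence the comma categories of \<open>S K\<close> are final in those of \<open>K\<close>,
  which is exactness. As the tensor product of a closed category preserves colimits in each variable,
  the cases \<open>n = 2\<close> and \<open>n = 0\<close> of this finality make the comparison arrows
  \<open>L y \<otimes> L z \<rightarrow> L (y \<otimes> z)\<close> and \<open>I \<rightarrow> L I\<close> of the Kan extension invertible.
\<close>

section \<open>Categories and symmetric strict monoidal categories\<close>

text \<open>The free category is known only through its universal property, and only against test
  categories whose objects and arrows lie in the universe type \<open>'u\<close>. No normal form for
  its arrows is available, so splittings have to come from a functor. A single splitting is not
  stable under composition: to split a composite, the first arrow must be split along whatever
  marking the second one pulls back. Hence an arrow of the test category answers all markings of its
  target at once and records the marking of its source. The test category is coded into
  \<open>'u\<close>, which is where infiniteness of \<open>'u\<close> enters. Existence of a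
  splitting is read off the section; uniqueness holds because the section, being strict monoidal,
  can be computed on an arrow already given in split form and returns its data. Symmetries are
  handled through labels rather than positions, since the recursion for \<open>perm_arr\<close>
  renumbers positions at every step, which makes composites of permutations awkward to compare along
  it.\<close>

context category
begin

lemmas dom_obj [simp] cod_obj [simp]

lemma idt_simps [simp]:
  "a \<in> Obj C \<Longrightarrow> Idt C a \<in> Arr C" "a \<in> Obj C \<Longrightarrow> Dom C (Idt C a) = a"
  "a \<in> Obj C \<Longrightarrow> Cod C (Idt C a) = a"
  using idt_hom by (auto simp: hom_def)

lemma comp_simps [simp]:
  assumes "f \<in> Arr C" "g \<in> Arr C" "Cod C f = Dom C g"
  shows "g \<cdot> f \<in> Arr C" "Dom C (g \<cdot> f) = Dom C f" "Cod C (g \<cdot> f) = Cod C g"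
  using comp_hom[of f "Dom C f" "Cod C f" g "Cod C g"] assms by (auto simp: hom_def)

lemma comp_idt [simp]:
  "f \<in> Arr C \<Longrightarrow> Dom C f = a \<Longrightarrow> f \<cdot> Idt C a = f"
  "f \<in> Arr C \<Longrightarrow> Cod C f = b \<Longrightarrow> Idt C b \<cdot> f = f"
  using comp_idt_right[of f "Dom C f" "Cod C f"] comp_idt_left[of f "Dom C f" "Cod C f"]
  by (auto simp: hom_def)

text \<open>As a simp rule this nests composites to the right; steps that need another bracketing
  apply it backwards explicitly.\<close>

lemma comp_assoc_arr [simp]:
  "f \<in> Arr C \<Longrightarrow> g \<in> Arr C \<Longrightarrow> h \<in> Arr C \<Longrightarrow> Cod C f = Dom C g \<Longrightarrow> Cod C g = Dom C h \<Longrightarrow>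
    (h \<cdot> g) \<cdot> f = h \<cdot> (g \<cdot> f)"
  using comp_assoc[of f "Dom C f" "Cod C f" g "Cod C g" h "Cod C h"] by (auto simp: hom_def)

lemma is_isoE:
  assumes "is_iso C f"
  obtains g where "g \<in> hom C (Cod C f) (Dom C f)" "g \<cdot> f = Idt C (Dom C f)" "f \<cdot> g = Idt C (Cod C f)"
  using assms by (auto simp: is_iso_def)

end

context symmetric_monoidal
begin

lemmas unt_obj [simp] tenO_obj [simp] tenA_idt [simp]

lemma tenA_simps [simp]:
  assumes "f \<in> Arr M" "g \<in> Arr M"
  shows "f \<otimes> g \<in> Arr M" "Dom M (f \<otimes> g) = Dom M f \<odot> Dom M g" "Cod M (f \<otimes> g) = Cod M f \<odot> Cod M g"
  using tenA_hom[of f "Dom M f" "Cod M f" g "Dom M g" "Cod M g"] assms by (auto simp: hom_def)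

lemma interchange:
  assumes "f \<in> Arr M" "f' \<in> Arr M" "g \<in> Arr M" "g' \<in> Arr M" "Cod M f = Dom M f'" "Cod M g = Dom M g'"
  shows "(f' \<otimes> g') \<cdot> (f \<otimes> g) = (f' \<cdot> f) \<otimes> (g' \<cdot> g)"
  using tenA_comp[of f "Dom M f" "Cod M f" f' "Cod M f'" g "Dom M g" "Cod M g" g' "Cod M g'"] assms
  by (auto simp: hom_def)

text \<open>Composites are normalised to the right, so two adjacent tensor products usually carry a
  further factor and \<open>interchange\<close> does not match; this form keeps that factor
  \<open>h\<close>.\<close>

lemma interchange_assoc:
  assumes "f \<in> Arr M" "f' \<in> Arr M" "g \<in> Arr M" "g' \<in> Arr M" "Cod M f = Dom M f'" "Cod M g = Dom M g'"
    "h \<in> Arr M" "Cod M h = Dom M f \<odot> Dom M g"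
  shows "(f' \<otimes> g') \<cdot> (f \<otimes> g) \<cdot> h = ((f' \<cdot> f) \<otimes> (g' \<cdot> g)) \<cdot> h"
  using assms by (subst interchange [symmetric]) simp_all

lemma brd_simps [simp]:
  assumes "x \<in> Obj M" "y \<in> Obj M"
  shows "Brd M x y \<in> Arr M" "Dom M (Brd M x y) = x \<odot> y" "Cod M (Brd M x y) = y \<odot> x"
  using brd_hom[OF assms] by (auto simp: hom_def)

lemma brd_natural_arr:
  assumes "f \<in> Arr M" "g \<in> Arr M"
  shows "Brd M (Cod M f) (Cod M g) \<cdot> (f \<otimes> g) = (g \<otimes> f) \<cdot> Brd M (Dom M f) (Dom M g)"
  using brd_natural[of f "Dom M f" "Cod M f" g "Dom M g" "Cod M g"] assms by (auto simp: hom_def)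

lemma tensor_objs_obj [simp]: "set xs \<subseteq> Obj M \<Longrightarrow> tensor_objs M xs \<in> Obj M"
  by (induction xs) auto

lemma tensor_arrs_simps:
  assumes "set fs \<subseteq> Arr M"
  shows "tensor_arrs M fs \<in> Arr M" "Dom M (tensor_arrs M fs) = tensor_objs M (map (Dom M) fs)"
    "Cod M (tensor_arrs M fs) = tensor_objs M (map (Cod M) fs)"
  using assms by (induction fs) auto

lemma tensor_arrs_idt: "set xs \<subseteq> Obj M \<Longrightarrow> tensor_arrs M (map (Idt M) xs) = Idt M (tensor_objs M xs)"
  by (induction xs) auto

lemma tensor_arrs_comp:
  assumes "length fs = length gs" "set fs \<subseteq> Arr M" "set gs \<subseteq> Arr M" "map (Cod M) fs = map (Dom M) gs"
  shows "tensor_arrs M (map2 (\<lambda>g f. g \<cdot> f) gs fs) = tensor_arrs M gs \<cdot> tensor_arrs M fs"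
  using assms by (induction fs gs rule: list_induct2) (auto simp: interchange tensor_arrs_simps)

end

context symmetric_strict_monoidal
begin

lemmas strict_assoc [simp] strict_unt_left [simp] strict_unt_right [simp]

text \<open>Naturality of an associator whose components are identities.\<close>

lemma tenA_assoc [simp]:
  assumes "f \<in> Arr M" "g \<in> Arr M" "h \<in> Arr M"
  shows "(f \<otimes> g) \<otimes> h = f \<otimes> (g \<otimes> h)"
  using asc_natural[of f "Dom M f" "Cod M f" g "Dom M g" "Cod M g" h "Dom M h" "Cod M h"] assms
  by (auto simp: hom_def strict_asc)

lemma tenA_unit [simp]:
  assumes "f \<in> Arr M"
  shows "Idt M (Unt M) \<otimes> f = f" "f \<otimes> Idt M (Unt M) = f"
  using lun_natural[of f "Dom M f" "Cod M f"] run_natural[of f "Dom M f" "Cod M f"] assms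
  by (auto simp: hom_def strict_lun strict_run)

text \<open>The hexagon with identity associators.\<close>

lemma brd_tensor_right:
  assumes "x \<in> Obj M" "y \<in> Obj M" "z \<in> Obj M"
  shows "Brd M x (y \<odot> z) = (Idt M y \<otimes> Brd M x z) \<cdot> (Brd M x y \<otimes> Idt M z)"
  using hexagon[OF assms] assms by (simp add: strict_asc)

lemma brd_inverse [simp]:
  assumes "x \<in> Obj M" "y \<in> Obj M"
  shows "Brd M y x \<cdot> Brd M x y = Idt M (x \<odot> y)"
  using brd_symmetric[OF assms] .

text \<open>The second hexagon comes from symmetry: the right-hand side is a right inverse of
  \<open>Brd M z (x \<odot> y)\<close> by \<open>brd_tensor_right\<close>, and
  \<open>Brd M (x \<odot> y) z\<close> is a left inverse of the same arrow.\<close>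

lemma brd_tensor_left:
  assumes [simp]: "x \<in> Obj M" "y \<in> Obj M" "z \<in> Obj M"
  shows "Brd M (x \<odot> y) z = (Brd M x z \<otimes> Idt M y) \<cdot> (Idt M x \<otimes> Brd M y z)"
proof -
  let ?b = "(Brd M x z \<otimes> Idt M y) \<cdot> (Idt M x \<otimes> Brd M y z)"
  have "Brd M z (x \<odot> y) \<cdot> ?b = (Idt M x \<otimes> Brd M z y) \<cdot> (Brd M z x \<otimes> Idt M y) \<cdot> ?b"
    by (simp add: brd_tensor_right)
  also have "\<dots> = Idt M (x \<odot> y \<odot> z)"
    by (simp add: interchange_assoc interchange)
  finally have 1: "Brd M z (x \<odot> y) \<cdot> ?b = Idt M (x \<odot> y \<odot> z)" .
  have "Brd M (x \<odot> y) z = Brd M (x \<odot> y) z \<cdot> Brd M z (x \<odot> y) \<cdot> ?b"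
    by (simp add: 1)
  also have "\<dots> = (Brd M (x \<odot> y) z \<cdot> Brd M z (x \<odot> y)) \<cdot> ?b"
    by (rule comp_assoc_arr[symmetric]) simp_all
  also have "\<dots> = ?b" by simp
  finally show ?thesis .
qed

text \<open>The hexagon at two units makes \<open>Brd M x (Unt M)\<close> idempotent, and an
  idempotent with a left inverse is the identity.\<close>

lemma brd_unit [simp]:
  assumes [simp]: "x \<in> Obj M"
  shows "Brd M x (Unt M) = Idt M x" "Brd M (Unt M) x = Idt M x"
proof -
  let ?b = "Brd M x (Unt M)" and ?c = "Brd M (Unt M) x"
  have s: "?c \<cdot> ?b = Idt M x" by simp
  have "?b = ?b \<cdot> ?b" using brd_tensor_right[of x "Unt M" "Unt M"] by simp
  then have "?c \<cdot> ?b = ?c \<cdot> (?b \<cdot> ?b)" by simp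
  also have "\<dots> = (?c \<cdot> ?b) \<cdot> ?b" by (rule comp_assoc_arr[symmetric]) simp_all
  finally show 1: "?b = Idt M x" by (simp add: s)
  show "?c = Idt M x" using s by (simp add: 1)
qed

lemma tensor_objs_append: "set xs \<subseteq> Obj M \<Longrightarrow> set ys \<subseteq> Obj M \<Longrightarrow>
    tensor_objs M (xs @ ys) = tensor_objs M xs \<odot> tensor_objs M ys"
  by (induction xs) auto

lemma tensor_arrs_append: "set fs \<subseteq> Arr M \<Longrightarrow> set gs \<subseteq> Arr M \<Longrightarrow>
    tensor_arrs M (fs @ gs) = tensor_arrs M fs \<otimes> tensor_arrs M gs"
  by (induction fs) (auto simp: tensor_arrs_simps)

text \<open>Both sides are the symmetry \<open>x \<otimes> y \<otimes> z \<otimes> w \<rightarrow> z \<otimes> x \<otimes> w \<otimes> y\<close>.\<close>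

lemma brd_middle:
  assumes [simp]: "x \<in> Obj M" "y \<in> Obj M" "z \<in> Obj M" "w \<in> Obj M"
  shows "(Idt M z \<otimes> Brd M w x \<otimes> Idt M y) \<cdot> Brd M (x \<odot> y) (z \<odot> w) =
    (Brd M x z \<otimes> Brd M y w) \<cdot> (Idt M x \<otimes> Brd M y z \<otimes> Idt M w)"
proof -
  have 1: "Brd M (x \<odot> y) (z \<odot> w) = (Idt M z \<otimes> Brd M (x \<odot> y) w) \<cdot> (Brd M (x \<odot> y) z \<otimes> Idt M w)"
    by (simp add: brd_tensor_right)
  have 2: "(Idt M z \<otimes> Brd M w x \<otimes> Idt M y) \<cdot> (Idt M z \<otimes> Brd M (x \<odot> y) w) =
     Idt M z \<otimes> Idt M x \<otimes> Brd M y w"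
  proof -
    have "(Brd M w x \<otimes> Idt M y) \<cdot> Brd M (x \<odot> y) w =
        (Brd M w x \<otimes> Idt M y) \<cdot> (Brd M x w \<otimes> Idt M y) \<cdot> (Idt M x \<otimes> Brd M y w)"
      by (simp add: brd_tensor_left)
    also have "\<dots> = Idt M x \<otimes> Brd M y w"
      by (simp add: interchange_assoc)
    finally show ?thesis by (simp add: interchange)
  qed
  have "(Idt M z \<otimes> Brd M w x \<otimes> Idt M y) \<cdot> Brd M (x \<odot> y) (z \<odot> w) =
      ((Idt M z \<otimes> Brd M w x \<otimes> Idt M y) \<cdot> (Idt M z \<otimes> Brd M (x \<odot> y) w)) \<cdot> (Brd M (x \<odot> y) z \<otimes> Idt M w)"
    unfolding 1 by (rule comp_assoc_arr[symmetric]) simp_all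
  also have "\<dots> = (Idt M z \<otimes> Idt M x \<otimes> Brd M y w) \<cdot> (Brd M (x \<odot> y) z \<otimes> Idt M w)"
    by (simp only: 2)
  also have "\<dots> = (Idt M (z \<odot> x) \<otimes> Brd M y w) \<cdot>
      ((Brd M x z \<otimes> Idt M (y \<odot> w)) \<cdot> (Idt M x \<otimes> Brd M y z \<otimes> Idt M w))"
    using interchange[of "Idt M x \<otimes> Brd M y z" "Brd M x z \<otimes> Idt M y" "Idt M w" "Idt M w"]
    by (simp add: brd_tensor_left tenA_idt[symmetric] del: tenA_idt)
  also have "\<dots> = (Brd M x z \<otimes> Brd M y w) \<cdot> (Idt M x \<otimes> Brd M y z \<otimes> Idt M w)"
    by (simp add: interchange_assoc)
  finally show ?thesis .
qed

end

section \<open>Symmetries indexed by permutations\<close>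

text \<open>
  For distinct lists \<open>l\<close> and \<open>l'\<close> of labels with the same elements, \<open>sym_arr M x l l'\<close> is the symmetry
  from the tensor product of the \<open>x e\<close> in the order \<open>l\<close> to the one in the order \<open>l'\<close>. Unlike \<open>perm_arr\<close>
  it involves no renumbering of positions.
\<close>

primrec sym_arr :: "('o, 'a, 'z) smcat_scheme \<Rightarrow> ('e \<Rightarrow> 'o) \<Rightarrow> 'e list \<Rightarrow> 'e list \<Rightarrow> 'a" where
  "sym_arr M x [] l' = Idt M (Unt M)"
| "sym_arr M x (e # l) l' =
     (Brd M (x e) (tensor_objs M (map x (takeWhile (\<lambda>d. d \<noteq> e) l'))) \<otimes>\<^bsub>M\<^esub>
       Idt M (tensor_objs M (map x (tl (dropWhile (\<lambda>d. d \<noteq> e) l')))))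
     \<cdot>\<^bsub>M\<^esub> (Idt M (x e) \<otimes>\<^bsub>M\<^esub> sym_arr M x l (remove1 e l'))"

text \<open>With the target displayed as \<open>p @ e # q\<close> no search for \<open>e\<close>
  takes place. This equation replaces the defining one, which is removed from the simp set
  below.\<close>

lemma sym_arr_Cons:
  assumes "e \<notin> set p"
  shows "sym_arr M x (e # l) (p @ e # q) =
    (Brd M (x e) (tensor_objs M (map x p)) \<otimes>\<^bsub>M\<^esub> Idt M (tensor_objs M (map x q)))
     \<cdot>\<^bsub>M\<^esub> (Idt M (x e) \<otimes>\<^bsub>M\<^esub> sym_arr M x l (p @ q))"
proof -
  have "\<forall>d \<in> set p. d \<noteq> e" using assms by auto
  then show ?thesis using assms by (simp add: takeWhile_append dropWhile_append remove1_append)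
qed

declare sym_arr.simps(2) [simp del]

context symmetric_strict_monoidal
begin

lemma sym_arr_simps:
  assumes "distinct l" "distinct l'" "set l = set l'" "x ` set l \<subseteq> Obj M"
  shows "sym_arr M x l l' \<in> Arr M" "Dom M (sym_arr M x l l') = tensor_objs M (map x l)"
    "Cod M (sym_arr M x l l') = tensor_objs M (map x l')"
proof -
  have "sym_arr M x l l' \<in> Arr M \<and> Dom M (sym_arr M x l l') = tensor_objs M (map x l) \<and>
    Cod M (sym_arr M x l l') = tensor_objs M (map x l')"
    using assms
  proof (induction l arbitrary: l')
    case (Cons e l)
    then obtain p q where l': "l' = p @ e # q" by (metis list.set_intros(1) split_list)
    have d: "e \<notin> set p" "set l = set (p @ q)" "distinct (p @ q)"
      using Cons.prems l' by auto
    have xo: "x ` set p \<subseteq> Obj M" "x ` set q \<subseteq> Obj M" "x e \<in> Obj M"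
      using Cons.prems l' by auto
    have IH: "sym_arr M x l (p @ q) \<in> Arr M" "Dom M (sym_arr M x l (p @ q)) = tensor_objs M (map x l)"
      "Cod M (sym_arr M x l (p @ q)) = tensor_objs M (map x (p @ q))"
      using Cons.IH[of "p @ q"] Cons.prems d by auto
    show ?case
      using xo d IH by (simp add: l' sym_arr_Cons tensor_objs_append)
  qed auto
  then show "sym_arr M x l l' \<in> Arr M" "Dom M (sym_arr M x l l') = tensor_objs M (map x l)"
    "Cod M (sym_arr M x l l') = tensor_objs M (map x l')" by auto
qed

lemma brd_tensor_right_idt:
  assumes [simp]: "x \<in> Obj M" "y \<in> Obj M" "z \<in> Obj M" "w \<in> Obj M"
  shows "Brd M x (y \<odot> z) \<otimes> Idt M w =
    (Idt M y \<otimes> Brd M x z \<otimes> Idt M w) \<cdot> (Brd M x y \<otimes> Idt M (z \<odot> w))"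
  using interchange[of "Brd M x y \<otimes> Idt M z" "Idt M y \<otimes> Brd M x z" "Idt M w" "Idt M w"]
  by (simp add: brd_tensor_right)

text \<open>Moving \<open>x\<close> and then \<open>y\<close> to the right in either order: the symmetry \<open>x y a b \<rightarrow> a x b y\<close>.\<close>

lemma brd_swap:
  assumes [simp]: "x \<in> Obj M" "y \<in> Obj M" "a \<in> Obj M" "b \<in> Obj M"
  shows "Brd M y (a \<odot> x \<odot> b) \<cdot> (Idt M y \<otimes> Brd M x a \<otimes> Idt M b) \<cdot> (Brd M x y \<otimes> Idt M (a \<odot> b)) =
    (Brd M x a \<otimes> Idt M (b \<odot> y)) \<cdot> (Idt M x \<otimes> Brd M y (a \<odot> b))"
proof -
  have 1: "Brd M y (a \<odot> x \<odot> b) \<cdot> (Idt M y \<otimes> Brd M x a \<otimes> Idt M b) =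
      (Brd M x a \<otimes> Idt M (b \<odot> y)) \<cdot> Brd M y (x \<odot> a \<odot> b)"
    using brd_natural_arr[of "Idt M y" "Brd M x a \<otimes> Idt M b"] by simp
  have 2: "Brd M y (x \<odot> a \<odot> b) \<cdot> (Brd M x y \<otimes> Idt M (a \<odot> b)) = Idt M x \<otimes> Brd M y (a \<odot> b)"
    by (simp add: brd_tensor_right[of y x "a \<odot> b"] interchange)
  have "Brd M y (a \<odot> x \<odot> b) \<cdot> (Idt M y \<otimes> Brd M x a \<otimes> Idt M b) \<cdot> (Brd M x y \<otimes> Idt M (a \<odot> b)) =
      (Brd M y (a \<odot> x \<odot> b) \<cdot> (Idt M y \<otimes> Brd M x a \<otimes> Idt M b)) \<cdot> (Brd M x y \<otimes> Idt M (a \<odot> b))"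
    by (rule comp_assoc_arr[symmetric]) simp_all
  also have "\<dots> = (Brd M x a \<otimes> Idt M (b \<odot> y)) \<cdot> Brd M y (x \<odot> a \<odot> b) \<cdot> (Brd M x y \<otimes> Idt M (a \<odot> b))"
    unfolding 1 by (rule comp_assoc_arr) simp_all
  finally show ?thesis unfolding 2 .
qed

text \<open>\<open>brd_swap\<close> tensored with \<open>c\<close> on the right: both sides are the
  symmetry x y a b c \<rightarrow> a x b y c, in which x ends up before y.\<close>

lemma brd_swap_right:
  assumes [simp]: "x \<in> Obj M" "y \<in> Obj M" "a \<in> Obj M" "b \<in> Obj M" "c \<in> Obj M"
  shows "(Brd M y (a \<odot> x \<odot> b) \<otimes> Idt M c) \<cdot> (Idt M y \<otimes> Brd M x a \<otimes> Idt M (b \<odot> c)) \<cdot>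
      (Brd M x y \<otimes> Idt M (a \<odot> b \<odot> c)) =
    (Brd M x a \<otimes> Idt M (b \<odot> y \<odot> c)) \<cdot> (Idt M x \<otimes> Brd M y (a \<odot> b) \<otimes> Idt M c)"
proof -
  have "(Brd M y (a \<odot> x \<odot> b) \<cdot> (Idt M y \<otimes> Brd M x a \<otimes> Idt M b) \<cdot> (Brd M x y \<otimes> Idt M (a \<odot> b))) \<otimes> Idt M c
     = (Brd M y (a \<odot> x \<odot> b) \<otimes> Idt M c) \<cdot> ((Idt M y \<otimes> Brd M x a \<otimes> Idt M b) \<otimes> Idt M c) \<cdot>
       ((Brd M x y \<otimes> Idt M (a \<odot> b)) \<otimes> Idt M c)"
    by (simp add: interchange del: tenA_assoc)
  moreover have "((Brd M x a \<otimes> Idt M (b \<odot> y)) \<cdot> (Idt M x \<otimes> Brd M y (a \<odot> b))) \<otimes> Idt M c =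
     ((Brd M x a \<otimes> Idt M (b \<odot> y)) \<otimes> Idt M c) \<cdot> ((Idt M x \<otimes> Brd M y (a \<odot> b)) \<otimes> Idt M c)"
    by (simp add: interchange del: tenA_assoc)
  ultimately show ?thesis
    using arg_cong[OF brd_swap[OF assms(1-4)], of "\<lambda>f. f \<otimes> Idt M c"] by simp
qed

text \<open>Both sides are x y a b c \<rightarrow> a y b x c. Exchanging x and y in
  \<open>brd_swap_right\<close> gives this up to a braiding of x and y, which cancels against its
  inverse.\<close>

lemma brd_swap_left:
  assumes [simp]: "x \<in> Obj M" "y \<in> Obj M" "a \<in> Obj M" "b \<in> Obj M" "c \<in> Obj M"
  shows "(Brd M y a \<otimes> Idt M (b \<odot> x \<odot> c)) \<cdot> (Idt M y \<otimes> Brd M x (a \<odot> b) \<otimes> Idt M c) \<cdot>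
      (Brd M x y \<otimes> Idt M (a \<odot> b \<odot> c)) =
    (Brd M x (a \<odot> y \<odot> b) \<otimes> Idt M c) \<cdot> (Idt M x \<otimes> Brd M y a \<otimes> Idt M (b \<odot> c))"
proof -
  let ?s = "Brd M x y \<otimes> Idt M (a \<odot> b \<odot> c)" and ?s' = "Brd M y x \<otimes> Idt M (a \<odot> b \<odot> c)"
  let ?f = "Brd M x (a \<odot> y \<odot> b) \<otimes> Idt M c" and ?g = "Idt M x \<otimes> Brd M y a \<otimes> Idt M (b \<odot> c)"
  let ?h = "Brd M y a \<otimes> Idt M (b \<odot> x \<odot> c)" and ?k = "Idt M y \<otimes> Brd M x (a \<odot> b) \<otimes> Idt M c"
  have "?h \<cdot> ?k \<cdot> ?s = (?h \<cdot> ?k) \<cdot> ?s" by simp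
  also have "\<dots> = (?f \<cdot> ?g \<cdot> ?s') \<cdot> ?s"
    using brd_swap_right[of y x a b c] by simp
  also have "\<dots> = ?f \<cdot> ?g \<cdot> (?s' \<cdot> ?s)" by simp
  also have "?s' \<cdot> ?s = Idt M (x \<odot> y \<odot> a \<odot> b \<odot> c)" by (simp add: interchange)
  finally show ?thesis by simp
qed

text \<open>Transitivity of symmetries when the first one moves the single label \<open>i\<close>
  from the front past \<open>p\<close>. By induction on \<open>p\<close>: the braiding past the
  first label \<open>j\<close> is separated, the braiding past the rest is absorbed by the induction
  hypothesis, and the two orders of inserting \<open>i\<close> and \<open>j\<close> among the
  remaining labels are compared by \<open>brd_swap_right\<close> and
  \<open>brd_swap_left\<close>.\<close>

lemma sym_arr_pull:
  assumes "distinct (i # p @ q)" "distinct l" "set l = set (i # p @ q)" "x ` set l \<subseteq> Obj M"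
  shows "sym_arr M x (p @ i # q) l \<cdot> (Brd M (x i) (tensor_objs M (map x p)) \<otimes> Idt M (tensor_objs M (map x q)))
    = sym_arr M x (i # p @ q) l"
  using assms
proof (induction p arbitrary: l)
  case Nil
  then have "x i \<in> Obj M" "x ` set q \<subseteq> Obj M" by auto
  then show ?case using sym_arr_simps[of "i # q" l x] Nil by simp
next
  case (Cons j p)
  let ?T = "\<lambda>l. tensor_objs M (map x l)"
  have [simp]: "x i \<in> Obj M" "x j \<in> Obj M" "x ` set q \<subseteq> Obj M" "x ` set p \<subseteq> Obj M"
    using Cons.prems by auto
  have ij: "i \<noteq> j" "i \<in> set l" "j \<in> set l" using Cons.prems by auto
  \<comment> \<open>The labels other than \<open>i\<close> and \<open>j\<close> in their final
    order; both ways of building \<open>l\<close> start from it.\<close>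
  define m where "m = remove1 i (remove1 j l)"
  have m: "distinct m" "set m = set (p @ q)" "x ` set m \<subseteq> Obj M"
    using Cons.prems by (auto simp: m_def)
  have S[simp]: "sym_arr M x (p @ q) m \<in> Arr M" "Dom M (sym_arr M x (p @ q) m) = ?T p \<odot> ?T q"
    "Cod M (sym_arr M x (p @ q) m) = ?T m"
    using sym_arr_simps[of "p @ q" m x] m Cons.prems by (auto simp: tensor_objs_append)
  define ins where "ins e p q = Brd M (x e) (?T p) \<otimes> Idt M (?T q)" for e p q
  \<comment> \<open>Four positions matter: of \<open>i\<close> and of \<open>j\<close> in
    \<open>l\<close>, of \<open>i\<close> once \<open>j\<close> is removed, and of \<open>j\<close>
    once \<open>i\<close> is removed.\<close>
  obtain a b where ab: "l = a @ i # b" using ij by (metis split_list)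
  obtain a' b' where ab': "l = a' @ j # b'" using ij by (metis split_list)
  obtain c d where cd: "remove1 j l = c @ i # d" using ij by (metis in_set_remove1 split_list)
  obtain c' d' where cd': "remove1 i l = c' @ j # d'" using ij by (metis in_set_remove1 split_list)
  have dl: "distinct l" using Cons.prems by simp
  have "i \<notin> set a" using dl ab by simp
  moreover have "j \<notin> set a'" using dl ab' by simp
  ultimately have r: "remove1 i l = a @ b" "remove1 j l = a' @ b'"
    by (simp add: ab remove1_append, simp add: ab' remove1_append)
  have mm: "c @ d = m" "c' @ d' = m"
  proof -
    have dd: "distinct (remove1 j l)" "distinct (remove1 i l)" using dl by (auto intro: distinct_remove1)
    then have "i \<notin> set c" unfolding cd by simp
    then show "c @ d = m" by (simp add: m_def cd remove1_append)
    have "j \<notin> set c'" using dd unfolding cd' by simp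
    then show "c' @ d' = m" unfolding m_def remove1_commute[of i j] by (simp add: cd' remove1_append)
  qed
  have xs[simp]: "x ` set a \<subseteq> Obj M" "x ` set b \<subseteq> Obj M" "x ` set a' \<subseteq> Obj M" "x ` set b' \<subseteq> Obj M"
      "x ` set c \<subseteq> Obj M" "x ` set d \<subseteq> Obj M" "x ` set c' \<subseteq> Obj M" "x ` set d' \<subseteq> Obj M"
  proof -
    have "set a \<union> set b \<subseteq> set l" unfolding ab by auto
    moreover have "set a' \<union> set b' \<subseteq> set l" unfolding ab' by auto
    moreover have "set m \<subseteq> set l" unfolding m_def using set_remove1_subset[of i "remove1 j l"] set_remove1_subset[of j l] by blast
    then have "set c \<union> set d \<subseteq> set l" "set c' \<union> set d' \<subseteq> set l"
      using arg_cong[OF mm(1), of set] arg_cong[OF mm(2), of set] by auto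
    ultimately show "x ` set a \<subseteq> Obj M" "x ` set b \<subseteq> Obj M" "x ` set a' \<subseteq> Obj M" "x ` set b' \<subseteq> Obj M"
      "x ` set c \<subseteq> Obj M" "x ` set d \<subseteq> Obj M" "x ` set c' \<subseteq> Obj M" "x ` set d' \<subseteq> Obj M"
      using Cons.prems(4) by blast+
  qed
  \<comment> \<open>Inserting \<open>i\<close> and then \<open>j\<close> into \<open>m\<close>, or
    \<open>j\<close> and then \<open>i\<close>, yields the same arrow up to exchanging
    \<open>x i\<close> and \<open>x j\<close> at the start. The cases are whether \<open>j\<close>
    stands after or before \<open>i\<close> in \<open>l\<close>.\<close>
  have swap: "ins j a' b' \<cdot> (Idt M (x j) \<otimes> ins i c d) \<cdot> (Brd M (x i) (x j) \<otimes> Idt M (?T m)) =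
      ins i a b \<cdot> (Idt M (x i) \<otimes> ins j c' d')"
  proof (cases "j \<in> set b")
    case True
    then obtain b1 b2 where b: "b = b1 @ j # b2" by (metis split_list)
    have a': "a' = a @ i # b1" "b' = b2"
      using ab ab' b dl by (auto simp: append_eq_append_conv2 append_eq_Cons_conv Cons_eq_append_conv)
    have c: "c = a" "d = b1 @ b2" "c' = a @ b1" "d' = b2"
      using cd cd' r dl ab b a' by (auto simp: append_eq_append_conv2 append_eq_Cons_conv Cons_eq_append_conv)
    have [simp]: "x ` set b1 \<subseteq> Obj M" "x ` set b2 \<subseteq> Obj M" using b xs by auto
    show ?thesis
      using brd_swap_right[of "x i" "x j" "?T a" "?T b1" "?T b2"]
      by (simp add: ins_def a' c b mm[symmetric] tensor_objs_append del: mm)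
  next
    case False
    then obtain a1 a2 where a: "a = a1 @ j # a2" using ij ab by (metis Un_iff set_append set_ConsD split_list)
    have a': "a' = a1" "b' = a2 @ i # b"
      using ab ab' a dl by (auto simp: append_eq_append_conv2 append_eq_Cons_conv Cons_eq_append_conv)
    have c: "c = a1 @ a2" "d = b" "c' = a1" "d' = a2 @ b"
      using cd cd' r dl ab a a' by (auto simp: append_eq_append_conv2 append_eq_Cons_conv Cons_eq_append_conv)
    have [simp]: "x ` set a1 \<subseteq> Obj M" "x ` set a2 \<subseteq> Obj M" using a xs by auto
    show ?thesis
      using brd_swap_left[of "x i" "x j" "?T a1" "?T a2" "?T b"]
      by (simp add: ins_def a' c a mm[symmetric] tensor_objs_append del: mm)
  qed
  have [simp]: "x ` set m \<subseteq> Obj M" by (rule m)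
  have T: "?T a' \<odot> ?T b' = ?T (a' @ b')" "?T a \<odot> ?T b = ?T (a @ b)" "?T c \<odot> ?T d = ?T m" "?T c' \<odot> ?T d' = ?T m"
    using mm by (simp_all add: tensor_objs_append[symmetric] flip: map_append)
  have rem: "c @ i # d = a' @ b'" "c' @ j # d' = a @ b" using cd cd' r by simp_all
  have ni: "j \<notin> set a'" "i \<notin> set a" "i \<notin> set c" "j \<notin> set c'"
  proof -
    show "j \<notin> set a'" using dl unfolding ab' by simp
    show "i \<notin> set a" using dl unfolding ab by simp
    have "set c \<union> set c' \<subseteq> set (p @ q)"
      using arg_cong[OF mm(1), of set] arg_cong[OF mm(2), of set] m(2) by auto
    then show "i \<notin> set c" "j \<notin> set c'" using Cons.prems(1) by auto
  qed
  have ins_simps[simp]: "ins e p q \<in> Arr M" "Dom M (ins e p q) = x e \<odot> ?T p \<odot> ?T q"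
      "Cod M (ins e p q) = ?T p \<odot> x e \<odot> ?T q"
    if "x e \<in> Obj M" "x ` set p \<subseteq> Obj M" "x ` set q \<subseteq> Obj M" for e p q
    using that by (simp_all add: ins_def)
  let ?S = "sym_arr M x (p @ q) m"
  have dcd: "distinct (c @ i # d)" using distinct_remove1[OF dl, of j] unfolding cd .
  have scd: "set (c @ i # d) = set (i # p @ q)"
    using arg_cong[OF mm(1), of set] m(2) by auto
  have P: "sym_arr M x (p @ i # q) (c @ i # d) \<cdot> (Brd M (x i) (?T p) \<otimes> Idt M (?T q)) = ins i c d \<cdot> (Idt M (x i) \<otimes> ?S)"
  proof -
    have "x ` set (i # p @ q) \<subseteq> Obj M" by (simp add: image_Un)
    then have "sym_arr M x (p @ i # q) (c @ i # d) \<cdot> (Brd M (x i) (?T p) \<otimes> Idt M (?T q)) =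
        sym_arr M x (i # p @ q) (c @ i # d)"
      using Cons.prems(1) dcd scd by (intro Cons.IH) (simp_all del: set_append)
    then show ?thesis using ni mm by (simp add: sym_arr_Cons ins_def)
  qed
  have A[simp]: "sym_arr M x (p @ i # q) (c @ i # d) \<in> Arr M"
    "Dom M (sym_arr M x (p @ i # q) (c @ i # d)) = ?T p \<odot> x i \<odot> ?T q"
    "Cod M (sym_arr M x (p @ i # q) (c @ i # d)) = ?T c \<odot> x i \<odot> ?T d"
    using sym_arr_simps[of "p @ i # q" "c @ i # d" x] Cons.prems(1) dcd scd
    by (auto simp: tensor_objs_append image_Un)
  have "sym_arr M x ((j # p) @ i # q) l \<cdot> (Brd M (x i) (?T (j # p)) \<otimes> Idt M (?T q))
    = (ins j a' b' \<cdot> (Idt M (x j) \<otimes> sym_arr M x (p @ i # q) (c @ i # d))) \<cdot>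
      ((Idt M (x j) \<otimes> Brd M (x i) (?T p) \<otimes> Idt M (?T q)) \<cdot> (Brd M (x i) (x j) \<otimes> Idt M (?T p \<odot> ?T q)))"
    using ni by (simp add: ab' sym_arr_Cons rem ins_def brd_tensor_right_idt)
  also have "\<dots> = ins j a' b' \<cdot> ((Idt M (x j) \<otimes> sym_arr M x (p @ i # q) (c @ i # d)) \<cdot>
      (Idt M (x j) \<otimes> Brd M (x i) (?T p) \<otimes> Idt M (?T q))) \<cdot> (Brd M (x i) (x j) \<otimes> Idt M (?T p \<odot> ?T q))"
    using rem by (simp add: tensor_objs_append T flip: rem)
  also have "(Idt M (x j) \<otimes> sym_arr M x (p @ i # q) (c @ i # d)) \<cdot>
      (Idt M (x j) \<otimes> Brd M (x i) (?T p) \<otimes> Idt M (?T q)) =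
      (Idt M (x j) \<otimes> ins i c d) \<cdot> (Idt M (x j \<odot> x i) \<otimes> ?S)"
    using P by (simp add: interchange T flip: tenA_idt)
  also have "ins j a' b' \<cdot> ((Idt M (x j) \<otimes> ins i c d) \<cdot> (Idt M (x j \<odot> x i) \<otimes> ?S)) \<cdot>
      (Brd M (x i) (x j) \<otimes> Idt M (?T p \<odot> ?T q)) =
      ins j a' b' \<cdot> (Idt M (x j) \<otimes> ins i c d) \<cdot> ((Idt M (x j \<odot> x i) \<otimes> ?S) \<cdot>
      (Brd M (x i) (x j) \<otimes> Idt M (?T p \<odot> ?T q)))"
    by (simp add: T)
  \<comment> \<open>The symmetry of the remaining labels does not touch \<open>i\<close> and
    \<open>j\<close>, so it slides past their braiding.\<close>
  also have "(Idt M (x j \<odot> x i) \<otimes> ?S) \<cdot> (Brd M (x i) (x j) \<otimes> Idt M (?T p \<odot> ?T q)) =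
      (Brd M (x i) (x j) \<otimes> Idt M (?T m)) \<cdot> (Idt M (x i \<odot> x j) \<otimes> ?S)"
    by (simp add: interchange del: tenA_assoc)
  also have "ins j a' b' \<cdot> (Idt M (x j) \<otimes> ins i c d) \<cdot> ((Brd M (x i) (x j) \<otimes> Idt M (?T m)) \<cdot> (Idt M (x i \<odot> x j) \<otimes> ?S))
     = (ins j a' b' \<cdot> (Idt M (x j) \<otimes> ins i c d) \<cdot> (Brd M (x i) (x j) \<otimes> Idt M (?T m))) \<cdot> (Idt M (x i \<odot> x j) \<otimes> ?S)"
    using rem by (simp add: T tensor_objs_append flip: rem)
  also have "\<dots> = (ins i a b \<cdot> (Idt M (x i) \<otimes> ins j c' d')) \<cdot> (Idt M (x i \<odot> x j) \<otimes> ?S)"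
    by (simp only: swap)
  also have "\<dots> = ins i a b \<cdot> (Idt M (x i) \<otimes> (ins j c' d' \<cdot> (Idt M (x j) \<otimes> ?S)))"
  proof -
    have 1: "Idt M (x i \<odot> x j) \<otimes> ?S = Idt M (x i) \<otimes> (Idt M (x j) \<otimes> ?S)"
      by (simp flip: tenA_idt)
    have [simp]: "?T c' \<odot> x j \<odot> ?T d' = ?T a \<odot> ?T b"
      using arg_cong[OF rem(2), of ?T] by (simp add: tensor_objs_append)
    show ?thesis unfolding 1 by (simp add: interchange T)
  qed
  also have "\<dots> = sym_arr M x (i # (j # p) @ q) l"
    using ni mm by (simp add: ab sym_arr_Cons ins_def flip: rem)
  finally show ?case by simp
qed

text \<open>The form of coherence on which functoriality of the n-ary tensor product rests. In the
  induction, \<open>sym_arr_pull\<close> absorbs the braiding that moves the head of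
  \<open>l\<close> into the second symmetry; what remains is a composite of symmetries of the
  tail.\<close>

lemma sym_arr_trans:
  assumes "distinct l" "distinct l'" "distinct l''" "set l = set l'" "set l' = set l''" "x ` set l \<subseteq> Obj M"
  shows "sym_arr M x l' l'' \<cdot> sym_arr M x l l' = sym_arr M x l l''"
  using assms
proof (induction l arbitrary: l' l'')
  case (Cons i l)
  let ?T = "\<lambda>l. tensor_objs M (map x l)"
  obtain p q where l': "l' = p @ i # q" using Cons.prems by (metis list.set_intros(1) split_list)
  obtain a b where l'': "l'' = a @ i # b" using Cons.prems by (metis list.set_intros(1) split_list)
  have d: "i \<notin> set p" "i \<notin> set a" "set l = set (p @ q)" "distinct (p @ q)" "set l = set (a @ b)" "distinct (a @ b)"
      "distinct (i # p @ q)" "set l'' = set (i # p @ q)"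
    using Cons.prems unfolding l' l'' by auto
  have [simp]: "x i \<in> Obj M" "x ` set l \<subseteq> Obj M" using Cons.prems(6) by simp_all
  then have [simp]: "x ` (set p \<union> set q) \<subseteq> Obj M" "x ` (set a \<union> set b) \<subseteq> Obj M" using d by simp_all
  then have [simp]: "x ` set p \<subseteq> Obj M" "x ` set q \<subseteq> Obj M" "x ` set a \<subseteq> Obj M" "x ` set b \<subseteq> Obj M"
    unfolding image_Un by blast+
  have [simp]: "x ` set l'' \<subseteq> Obj M" by (simp add: l'')
  have s1[simp]: "sym_arr M x l (p @ q) \<in> Arr M" "Dom M (sym_arr M x l (p @ q)) = ?T l"
      "Cod M (sym_arr M x l (p @ q)) = ?T p \<odot> ?T q"
    using sym_arr_simps[of l "p @ q" x] d Cons.prems by (auto simp: tensor_objs_append)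
  have s2[simp]: "sym_arr M x (p @ q) (a @ b) \<in> Arr M" "Dom M (sym_arr M x (p @ q) (a @ b)) = ?T p \<odot> ?T q"
      "Cod M (sym_arr M x (p @ q) (a @ b)) = ?T a \<odot> ?T b"
    using sym_arr_simps[of "p @ q" "a @ b" x] d Cons.prems by (auto simp: tensor_objs_append)
  have s3[simp]: "sym_arr M x (p @ i # q) l'' \<in> Arr M" "Dom M (sym_arr M x (p @ i # q) l'') = ?T p \<odot> x i \<odot> ?T q"
    using sym_arr_simps[of "p @ i # q" l'' x] d Cons.prems l' by (auto simp: tensor_objs_append)
  have "sym_arr M x l' l'' \<cdot> sym_arr M x (i # l) l' =
     (sym_arr M x (p @ i # q) l'' \<cdot> (Brd M (x i) (?T p) \<otimes> Idt M (?T q))) \<cdot> (Idt M (x i) \<otimes> sym_arr M x l (p @ q))"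
    by (simp add: l' sym_arr_Cons d)
  also have "\<dots> = sym_arr M x (i # (p @ q)) l'' \<cdot> (Idt M (x i) \<otimes> sym_arr M x l (p @ q))"
    using sym_arr_pull[of i p q l'' x] d Cons.prems by simp
  also have "\<dots> = (Brd M (x i) (?T a) \<otimes> Idt M (?T b)) \<cdot> (Idt M (x i) \<otimes> (sym_arr M x (p @ q) (a @ b) \<cdot> sym_arr M x l (p @ q)))"
    using d by (simp add: l'' sym_arr_Cons interchange)
  also have "sym_arr M x (p @ q) (a @ b) \<cdot> sym_arr M x l (p @ q) = sym_arr M x l (a @ b)"
    using Cons.prems d by (intro Cons.IH) auto
  finally show ?case by (simp add: l'' sym_arr_Cons d)
qed auto

lemma sym_arr_refl: "distinct l \<Longrightarrow> x ` set l \<subseteq> Obj M \<Longrightarrow> sym_arr M x l l = Idt M (tensor_objs M (map x l))"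
proof (induction l)
  case (Cons e l)
  then show ?case using sym_arr_Cons[of e "[]" M x l l] by simp
qed simp

text \<open>Naturality of the braiding, one label at a time.\<close>

lemma sym_arr_natural:
  assumes "distinct l" "distinct l'" "set l = set l'" "f ` set l \<subseteq> Arr M"
  shows "sym_arr M (Cod M \<circ> f) l l' \<cdot> tensor_arrs M (map f l) = tensor_arrs M (map f l') \<cdot> sym_arr M (Dom M \<circ> f) l l'"
  using assms
proof (induction l arbitrary: l')
  case (Cons i l)
  obtain p q where l': "l' = p @ i # q" using Cons.prems by (metis list.set_intros(1) split_list)
  have d: "i \<notin> set p" "set l = set (p @ q)" "distinct (p @ q)" "distinct l"
    using Cons.prems unfolding l' by auto
  have [simp]: "f i \<in> Arr M" "f ` set l \<subseteq> Arr M" using Cons.prems(4) by simp_all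
  then have [simp]: "f ` set p \<subseteq> Arr M" "f ` set q \<subseteq> Arr M" unfolding d by auto
  have im: "(Cod M \<circ> f) ` S \<subseteq> Obj M" "(Dom M \<circ> f) ` S \<subseteq> Obj M" if "f ` S \<subseteq> Arr M" for S
    using that by auto
  let ?C = "\<lambda>l. tensor_objs M (map (Cod M \<circ> f) l)" and ?D = "\<lambda>l. tensor_objs M (map (Dom M \<circ> f) l)"
  let ?A = "\<lambda>l. tensor_arrs M (map f l)"
  have [simp]: "?A u \<in> Arr M" "Dom M (?A u) = ?D u" "Cod M (?A u) = ?C u" "?C u \<in> Obj M" "?D u \<in> Obj M"
    if "f ` set u \<subseteq> Arr M" for u
    using that tensor_arrs_simps[of "map f u"] im[OF that] by (auto simp: o_assoc)
  let ?sC = "sym_arr M (Cod M \<circ> f) l (p @ q)" and ?sD = "sym_arr M (Dom M \<circ> f) l (p @ q)"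
  have [simp]: "?sC \<in> Arr M" "Dom M ?sC = ?C l" "Cod M ?sC = ?C p \<odot> ?C q"
    using sym_arr_simps[of l "p @ q" "Cod M \<circ> f"] d im[of "set l"] im[of "set p"] im[of "set q"] by (auto simp: tensor_objs_append image_Un)
  have [simp]: "?sD \<in> Arr M" "Dom M ?sD = ?D l" "Cod M ?sD = ?D p \<odot> ?D q"
    using sym_arr_simps[of l "p @ q" "Dom M \<circ> f"] d im[of "set l"] im[of "set p"] im[of "set q"] by (auto simp: tensor_objs_append image_Un)
  have IH: "?sC \<cdot> ?A l = (?A p \<otimes> ?A q) \<cdot> ?sD"
    using Cons.IH[of "p @ q"] d \<open>f ` set l \<subseteq> Arr M\<close> by (simp add: tensor_arrs_append del: o_apply)
  have "sym_arr M (Cod M \<circ> f) (i # l) l' \<cdot> ?A (i # l) =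
     (Brd M (Cod M (f i)) (?C p) \<otimes> Idt M (?C q)) \<cdot> (f i \<otimes> (?sC \<cdot> ?A l))"
    by (simp add: l' sym_arr_Cons d(1) interchange)
  also have "\<dots> = (Brd M (Cod M (f i)) (?C p) \<otimes> Idt M (?C q)) \<cdot> ((f i \<otimes> ?A p) \<otimes> ?A q) \<cdot> (Idt M (Dom M (f i)) \<otimes> ?sD)"
    by (simp add: IH interchange)
  also have "\<dots> = ((Brd M (Cod M (f i)) (?C p) \<cdot> (f i \<otimes> ?A p)) \<otimes> ?A q) \<cdot> (Idt M (Dom M (f i)) \<otimes> ?sD)"
    by (simp add: interchange_assoc del: tenA_assoc)
  also have "\<dots> = (((?A p \<otimes> f i) \<cdot> Brd M (Dom M (f i)) (?D p)) \<otimes> ?A q) \<cdot> (Idt M (Dom M (f i)) \<otimes> ?sD)"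
    using brd_natural_arr[of "f i" "?A p"] by simp
  also have "\<dots> = ((?A p \<otimes> f i) \<otimes> ?A q) \<cdot> (Brd M (Dom M (f i)) (?D p) \<otimes> Idt M (?D q)) \<cdot> (Idt M (Dom M (f i)) \<otimes> ?sD)"
    by (simp add: interchange_assoc del: tenA_assoc)
  also have "\<dots> = ?A l' \<cdot> sym_arr M (Dom M \<circ> f) (i # l) l'"
    by (simp add: l' sym_arr_Cons d(1) tensor_arrs_append)
  finally show ?case .
qed auto

end

section \<open>From labels back to permutations of positions\<close>

lemma permute_list_inv_eqI:
  assumes "\<rho> permutes {..<length l}" "length l' = length l" "\<And>i. i < length l \<Longrightarrow> l' ! \<rho> i = l ! i"
  shows "l' = permute_list (inv \<rho>) l"
proof (rule nth_equalityI)
  fix i assume i: "i < length l'"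
  have "inv \<rho> i < length l" using permutes_inv[OF assms(1)] i assms(2)
    by (metis lessThan_iff permutes_in_image)
  then show "l' ! i = permute_list (inv \<rho>) l ! i"
    using assms(3)[of "inv \<rho> i"] i permutes_inverses(1)[OF assms(1)]
    by (simp add: permute_list_nth[OF permutes_inv[OF assms(1)]] assms(2))
qed (simp add: assms(2))

lemma nth_permute_list_inv:
  assumes "\<rho> permutes {..<length l}" "i < length l"
  shows "permute_list (inv \<rho>) l ! \<rho> i = l ! i"
  using assms permutes_in_image[OF assms(1), of i]
  by (simp add: permute_list_nth[OF permutes_inv[OF assms(1)]] permutes_inverses(2))

text \<open>\<open>perm_tail\<close> deletes position 0 of the source and position
  \<open>\<rho> 0\<close> of the target and closes both gaps. It is injective since no other
  position is sent to \<open>\<rho> 0\<close>, and an injective self-map of a finite set is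
  bijective.\<close>

lemma perm_tail_permutes:
  assumes "\<rho> permutes {..<Suc n}"
  shows "perm_tail \<rho> permutes {..<n}"
proof -
  have ne: "\<rho> (Suc i) \<noteq> \<rho> 0" for i
    using permutes_inj[OF assms] by (metis injD nat.distinct(1))
  have "inj_on (perm_tail \<rho>) {..<n}"
  proof (rule inj_onI)
    fix i j assume "perm_tail \<rho> i = perm_tail \<rho> j"
    then have "\<rho> (Suc i) = \<rho> (Suc j)"
      using ne[of i] ne[of j] by (auto simp: perm_tail_def split: if_splits)
    then show "i = j" using permutes_inj[OF assms] by (auto dest: injD)
  qed
  moreover have "perm_tail \<rho> i < n" if "i < n" for i
  proof -
    have "\<rho> (Suc i) < Suc n" "\<rho> 0 < Suc n" using permutes_in_image[OF assms] that by auto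
    then show ?thesis using ne[of i] by (auto simp: perm_tail_def)
  qed
  ultimately have "bij_betw (perm_tail \<rho>) {..<n} {..<n}"
    by (intro bij_betw_imageI endo_inj_surj) auto
  moreover have "perm_tail \<rho> i = i" if "i \<notin> {..<n}" for i
  proof -
    have "\<rho> (Suc i) = Suc i" "\<rho> 0 < Suc n" using that permutes_in_image[OF assms, of 0] permutes_not_in[OF assms] by auto
    then show ?thesis using that by (auto simp: perm_tail_def)
  qed
  ultimately show ?thesis by (rule bij_imp_permutes) 
qed

context symmetric_strict_monoidal
begin

text \<open>Both sides recurse on the head, and deleting \<open>e\<close> from \<open>l'\<close> is
  what \<open>perm_tail\<close> does to positions. Any distinct list of labels may be used, so a
  second permutation can be read on the labels in the order produced by a first.\<close>

lemma perm_arr_eq_sym_arr: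
  assumes "distinct l" "\<rho> permutes {..<length l}" "length l' = length l" "\<And>i. i < length l \<Longrightarrow> l' ! \<rho> i = l ! i"
  shows "perm_arr M \<rho> (map x l) = sym_arr M x l l'"
  using assms
proof (induction l arbitrary: \<rho> l')
  case (Cons e t)
  define p q where "p = take (\<rho> 0) l'" and "q = drop (Suc (\<rho> 0)) l'"
  have r0: "\<rho> 0 < length l'" using Cons.prems permutes_in_image[OF Cons.prems(2), of 0] by simp
  moreover have e: "l' ! \<rho> 0 = e" using Cons.prems(4)[of 0] by simp
  ultimately have l': "l' = p @ e # q" using id_take_nth_drop[of "\<rho> 0" l'] by (simp add: p_def q_def)
  have lp: "length p = \<rho> 0" using r0 by (simp add: p_def)
  have pt: "perm_tail \<rho> permutes {..<length t}" using Cons.prems by (intro perm_tail_permutes) simp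
  have ne: "\<rho> (Suc i) \<noteq> \<rho> 0" for i
    using permutes_inj[OF Cons.prems(2)] by (metis injD nat.distinct(1))
  have len: "length (p @ q) = length t" using Cons.prems(3) by (simp add: l')
  \<comment> \<open>Positions of \<open>l'\<close> after \<open>e\<close> drop by one when
    \<open>e\<close> is removed, matching the subtraction in \<open>perm_tail\<close>;
    \<open>ne\<close> excludes the position of \<open>e\<close> itself.\<close>
  have nth: "(p @ q) ! perm_tail \<rho> i = t ! i" if "i < length t" for i
    using Cons.prems(4)[of "Suc i"] that ne[of i]
    by (auto simp: l' perm_tail_def nth_append lp nth_Cons' )
  have pq: "p @ q = permute_list (inv (perm_tail \<rho>)) t"
    by (rule permute_list_inv_eqI[OF pt len nth])
  have "set l' = set (e # t)"
    using permute_list_inv_eqI[OF Cons.prems(2-4)] set_permute_list[OF permutes_inv[OF Cons.prems(2)]] by simp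
  moreover have "distinct l'"
    using permute_list_inv_eqI[OF Cons.prems(2-4)] Cons.prems distinct_permute_list[OF permutes_inv[OF Cons.prems(2)]] by simp
  ultimately have d: "e \<notin> set p" by (simp add: l')
  have ys: "permute_list (inv (perm_tail \<rho>)) (map x t) = map x p @ map x q"
    using permute_list_map[OF permutes_inv[OF pt], of x] by (simp flip: pq)
  have IH: "perm_arr M (perm_tail \<rho>) (map x t) = sym_arr M x t (p @ q)"
    using Cons.IH[OF _ pt len nth] Cons.prems(1) by simp
  show ?case
    by (simp add: l' sym_arr_Cons d Let_def ys IH flip: lp)
qed simp

lemma perm_arr_sym_arr:
  assumes "\<rho> permutes {..<length xs}"
  shows "perm_arr M \<rho> xs = sym_arr M ((!) xs) [0..<length xs] (permute_list (inv \<rho>) [0..<length xs])"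
  using perm_arr_eq_sym_arr[of "[0..<length xs]" \<rho> "permute_list (inv \<rho>) [0..<length xs]" "(!) xs"] assms
  by (simp add: map_nth nth_permute_list_inv)

lemma perm_arr_simps:
  assumes "\<rho> permutes {..<length xs}" "set xs \<subseteq> Obj M"
  shows "perm_arr M \<rho> xs \<in> Arr M" "Dom M (perm_arr M \<rho> xs) = tensor_objs M xs"
    "Cod M (perm_arr M \<rho> xs) = tensor_objs M (permute_list (inv \<rho>) xs)"
proof -
  let ?l = "[0..<length xs]"
  have p: "inv \<rho> permutes {..<length ?l}" using permutes_inv[OF assms(1)] by simp
  have 1: "distinct (permute_list (inv \<rho>) ?l)" "set ?l = set (permute_list (inv \<rho>) ?l)" "(!) xs ` set ?l \<subseteq> Obj M"
    using assms(2) by (auto simp: distinct_permute_list[OF p] set_permute_list[OF p])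
  have 2: "map ((!) xs) (permute_list (inv \<rho>) ?l) = permute_list (inv \<rho>) xs"
    by (simp add: permute_list_map[OF p, symmetric] map_nth)
  show "perm_arr M \<rho> xs \<in> Arr M" "Dom M (perm_arr M \<rho> xs) = tensor_objs M xs"
    "Cod M (perm_arr M \<rho> xs) = tensor_objs M (permute_list (inv \<rho>) xs)"
    using sym_arr_simps[OF distinct_upt 1] by (simp_all add: perm_arr_sym_arr[OF assms(1)] 2 map_nth)
qed

text \<open>Factors are labelled by their original positions throughout. The second symmetry is read
  on the reordered labels, so the claim is an instance of \<open>sym_arr_trans\<close>.\<close>

lemma perm_arr_comp:
  assumes "\<rho> permutes {..<length xs}" "\<sigma> permutes {..<length xs}" "set xs \<subseteq> Obj M"
  shows "perm_arr M \<sigma> (permute_list (inv \<rho>) xs) \<cdot> perm_arr M \<rho> xs = perm_arr M (\<sigma> \<circ> \<rho>) xs"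
proof -
  let ?l = "[0..<length xs]"
  let ?l' = "permute_list (inv \<rho>) ?l"
  let ?l'' = "permute_list (inv \<sigma>) ?l'"
  have p: "inv \<rho> permutes {..<length ?l}" "inv \<sigma> permutes {..<length ?l'}" using permutes_inv assms by simp_all
  have s: "set ?l' = set ?l" "set ?l'' = set ?l'" by (simp_all only: set_permute_list[OF p(1)] set_permute_list[OF p(2)])
  have d: "distinct ?l'" "distinct ?l''" by (simp_all add: distinct_permute_list[OF p(1)] distinct_permute_list[OF p(2)])
  have 2: "map ((!) xs) ?l' = permute_list (inv \<rho>) xs"
    by (simp add: permute_list_map[OF p(1), symmetric] map_nth)
  have 3: "perm_arr M \<sigma> (map ((!) xs) ?l') = sym_arr M ((!) xs) ?l' ?l''"
    using d assms(2) by (intro perm_arr_eq_sym_arr) (simp_all add: nth_permute_list_inv)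
  have 4: "perm_arr M (\<sigma> \<circ> \<rho>) (map ((!) xs) ?l) = sym_arr M ((!) xs) ?l ?l''"
  proof (rule perm_arr_eq_sym_arr)
    show "\<sigma> \<circ> \<rho> permutes {..<length ?l}" using permutes_compose[OF assms(1,2)] by simp
    fix i assume i: "i < length ?l"
    then have "\<rho> i < length ?l'" using permutes_in_image[OF assms(1), of i] by simp
    then have "?l'' ! \<sigma> (\<rho> i) = ?l' ! \<rho> i" using assms(2) by (intro nth_permute_list_inv) auto
    then show "?l'' ! (\<sigma> \<circ> \<rho>) i = ?l ! i" using nth_permute_list_inv[of \<rho> ?l i] assms(1) i by simp
  qed simp_all
  have "sym_arr M ((!) xs) ?l' ?l'' \<cdot> sym_arr M ((!) xs) ?l ?l' = sym_arr M ((!) xs) ?l ?l''"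
    using d s assms(3) by (intro sym_arr_trans) auto
  then show ?thesis using 3 4 by (simp add: 2 map_nth perm_arr_sym_arr[OF assms(1)])
qed

lemma perm_arr_id: "set xs \<subseteq> Obj M \<Longrightarrow> perm_arr M id xs = Idt M (tensor_objs M xs)"
  using sym_arr_refl[of "[0..<length xs]" "(!) xs"]
  by (simp add: perm_arr_sym_arr permutes_id inv_id map_nth subset_code(1) image_subset_iff)

lemma perm_arr_natural:
  assumes "\<rho> permutes {..<length fs}" "set fs \<subseteq> Arr M"
  shows "perm_arr M \<rho> (map (Cod M) fs) \<cdot> tensor_arrs M fs =
    tensor_arrs M (permute_list (inv \<rho>) fs) \<cdot> perm_arr M \<rho> (map (Dom M) fs)"
proof -
  let ?l = "[0..<length fs]"
  let ?l' = "permute_list (inv \<rho>) ?l"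
  have p: "inv \<rho> permutes {..<length ?l}" using permutes_inv assms by simp
  have e: "perm_arr M \<rho> (map (y \<circ> (!) fs) ?l) = sym_arr M (y \<circ> (!) fs) ?l ?l'" for y :: "'b \<Rightarrow> 'a"
    using assms by (intro perm_arr_eq_sym_arr) (simp_all add: nth_permute_list_inv)
  have m: "map (y \<circ> (!) fs) ?l = map y fs" for y :: "'b \<Rightarrow> 'a"
    by (simp add: map_nth flip: map_map)
  have f: "map ((!) fs) ?l' = permute_list (inv \<rho>) fs" "map ((!) fs) ?l = fs"
    by (simp_all add: permute_list_map[OF p, symmetric] map_nth)
  have "sym_arr M (Cod M \<circ> (!) fs) ?l ?l' \<cdot> tensor_arrs M (map ((!) fs) ?l) =
      tensor_arrs M (map ((!) fs) ?l') \<cdot> sym_arr M (Dom M \<circ> (!) fs) ?l ?l'"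
    using assms(2) by (intro sym_arr_natural) (auto simp: distinct_permute_list[OF p] set_permute_list[OF p])
  then show ?thesis by (simp add: f e[symmetric] m)
qed

end

section \<open>The category \<open>sym_cat\<close> and the tensor product functor\<close>

lemma permute_list_inv_iff:
  assumes "\<rho> permutes {..<length zs}" "length ys = length zs"
  shows "permute_list (inv \<rho>) zs = ys \<longleftrightarrow> permute_list \<rho> ys = zs"
proof -
  have p: "inv \<rho> permutes {..<length zs}" by (rule permutes_inv[OF assms(1)])
  have "permute_list \<rho> (permute_list (inv \<rho>) zs) = zs"
    using permute_list_compose[of \<rho> zs "inv \<rho>"] assms by (simp add: permutes_inv_o)
  moreover have "permute_list (inv \<rho>) (permute_list \<rho> ys) = ys"
    using permute_list_compose[of "inv \<rho>" ys \<rho>] p assms by (simp add: permutes_inv_o)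
  ultimately show ?thesis by auto
qed

text \<open>Stating the codomain condition through \<open>permute_list \<rho> ys\<close> removes the
  inverse permutation that occurs in \<open>Cod\<close>: the i-th arrow ends at the entry of
  \<open>ys\<close> with index \<open>\<rho> i\<close>.\<close>

lemma sym_cat_hom:
  "(\<rho>, fs) \<in> hom (sym_cat V) xs ys \<longleftrightarrow> \<rho> permutes {..<length fs} \<and> set fs \<subseteq> Arr V \<and>
     length xs = length fs \<and> length ys = length fs \<and> map (Dom V) fs = xs \<and> map (Cod V) fs = permute_list \<rho> ys"
  using permute_list_inv_iff[of \<rho> "map (Cod V) fs" ys]
  by (auto simp: hom_def sym_cat_def)

lemma set_permute_list': "\<rho> permutes {..<n} \<Longrightarrow> length xs = n \<Longrightarrow> set (permute_list \<rho> xs) = set xs"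
  by simp

context category
begin

lemma map2_comp_simps:
  assumes "length fs = length gs" "set fs \<subseteq> Arr C" "set gs \<subseteq> Arr C" "map (Cod C) fs = map (Dom C) gs"
  shows "set (map2 (\<lambda>g f. g \<cdot> f) gs fs) \<subseteq> Arr C" "map (Dom C) (map2 (\<lambda>g f. g \<cdot> f) gs fs) = map (Dom C) fs"
    "map (Cod C) (map2 (\<lambda>g f. g \<cdot> f) gs fs) = map (Cod C) gs"
  using assms by (induction fs gs rule: list_induct2) auto

lemma sym_cat_comp_hom:
  assumes "(\<rho>, fs) \<in> hom (sym_cat C) xs ys" "(\<sigma>, gs) \<in> hom (sym_cat C) ys zs"
  shows "(\<sigma> \<circ> \<rho>, map2 (\<lambda>g f. g \<cdot> f) (permute_list \<rho> gs) fs) \<in> hom (sym_cat C) xs zs"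
proof -
  have l: "length gs = length fs" "length zs = length fs" using assms by (auto simp: sym_cat_hom)
  have a: "\<rho> permutes {..<length fs}" "\<sigma> permutes {..<length fs}" "set fs \<subseteq> Arr C" "set gs \<subseteq> Arr C"
    "map (Cod C) fs = permute_list \<rho> (map (Dom C) gs)" "map (Cod C) gs = permute_list \<sigma> zs"
    using assms by (auto simp: sym_cat_hom)
  have 1: "set (permute_list \<rho> gs) \<subseteq> Arr C" using a l by simp
  have 2: "map (Cod C) fs = map (Dom C) (permute_list \<rho> gs)"
    using a(1,5) l by (simp add: permute_list_map)
  have 3: "map (Cod C) (permute_list \<rho> gs) = permute_list (\<sigma> \<circ> \<rho>) zs"
    using a l permute_list_compose[of \<rho> zs \<sigma>] by (simp add: permute_list_map[symmetric])
  show ?thesis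
    using map2_comp_simps[OF _ a(3) 1 2] l 3 assms permutes_compose[OF a(1,2)] by (simp add: sym_cat_hom)
qed

lemma category_sym_cat: "category (sym_cat C)"
proof
  fix f assume f: "f \<in> Arr (sym_cat C)"
  then show "Dom (sym_cat C) f \<in> Obj (sym_cat C)" by (auto simp: sym_cat_def)
  obtain \<rho> fs where [simp]: "f = (\<rho>, fs)" by (cases f)
  from f have "inv \<rho> permutes {..<length fs}" by (auto simp: sym_cat_def intro: permutes_inv)
  with f show "Cod (sym_cat C) f \<in> Obj (sym_cat C)" by (auto simp: sym_cat_def set_permute_list')
next
  fix xs assume "xs \<in> Obj (sym_cat C)"
  then show "Idt (sym_cat C) xs \<in> hom (sym_cat C) xs xs"
    by (auto simp: sym_cat_def hom_def permutes_id inv_id intro!: map_idI)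
next
  fix f g xs ys zs assume "f \<in> hom (sym_cat C) xs ys" "g \<in> hom (sym_cat C) ys zs"
  then show "g \<cdot>\<^bsub>sym_cat C\<^esub> f \<in> hom (sym_cat C) xs zs"
    using sym_cat_comp_hom[of "fst f" "snd f" xs ys "fst g" "snd g" zs]
    by (auto simp: sym_cat_def split: prod.splits)
next
  fix f xs ys assume f: "f \<in> hom (sym_cat C) xs ys"
  obtain \<rho> fs where ff[simp]: "f = (\<rho>, fs)" by (cases f)
  have a: "\<rho> permutes {..<length fs}" "set fs \<subseteq> Arr C" "xs = map (Dom C) fs" "map (Cod C) fs = permute_list \<rho> ys"
      "length ys = length fs"
    using f by (auto simp: sym_cat_hom)
  have n: "fs ! i \<in> Arr C" if "i < length fs" for i using that a(2) by (metis nth_mem subsetD)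
  show "f \<cdot>\<^bsub>sym_cat C\<^esub> Idt (sym_cat C) xs = f"
    using n by (auto simp: sym_cat_def a(3) intro!: nth_equalityI)
  have "permute_list \<rho> (map (Idt C) ys) = map (Idt C) (map (Cod C) fs)"
    using a by (simp add: permute_list_map)
  then show "Idt (sym_cat C) ys \<cdot>\<^bsub>sym_cat C\<^esub> f = f"
    using n by (auto simp: sym_cat_def intro!: nth_equalityI)
next
  fix f g h ws xs ys zs
  assume f: "f \<in> hom (sym_cat C) ws xs" and g: "g \<in> hom (sym_cat C) xs ys" and h: "h \<in> hom (sym_cat C) ys zs"
  obtain \<rho> fs \<sigma> gs \<tau> hs where ff: "f = (\<rho>, fs)" "g = (\<sigma>, gs)" "h = (\<tau>, hs)" by (metis surj_pair)
  have a: "\<rho> permutes {..<length fs}" "\<sigma> permutes {..<length fs}" "length gs = length fs" "length hs = length fs"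
    "set fs \<subseteq> Arr C" "set gs \<subseteq> Arr C" "set hs \<subseteq> Arr C"
    "map (Cod C) fs = permute_list \<rho> (map (Dom C) gs)" "map (Cod C) gs = permute_list \<sigma> (map (Dom C) hs)"
    using f g h by (auto simp: sym_cat_hom ff)
  have cf: "Cod C (fs ! i) = Dom C (gs ! \<rho> i)" if "i < length fs" for i
    using that arg_cong[OF a(8), of "\<lambda>l. l ! i"] a(1-7) permutes_in_image[OF a(1), of i] by (simp add: permute_list_nth)
  have cg: "Cod C (gs ! i) = Dom C (hs ! \<sigma> i)" if "i < length fs" for i
    using that arg_cong[OF a(9), of "\<lambda>l. l ! i"] a(1-7) permutes_in_image[OF a(2), of i] by (simp add: permute_list_nth)
  have r: "\<rho> i < length fs" "\<sigma> i < length fs" if "i < length fs" for i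
    using that permutes_in_image[OF a(1), of i] permutes_in_image[OF a(2), of i] by auto
  have n: "fs ! i \<in> Arr C" "gs ! i \<in> Arr C" "hs ! i \<in> Arr C" if "i < length fs" for i
    using that a(3-7) by (metis nth_mem subsetD)+
  have "map2 (\<cdot>) (permute_list \<rho> (map2 (\<cdot>) (permute_list \<sigma> hs) gs)) fs
     = map2 (\<cdot>) (permute_list (\<sigma> \<circ> \<rho>) hs) (map2 (\<cdot>) (permute_list \<rho> gs) fs)"
    by (rule nth_equalityI) (simp_all add: a r permute_list_nth permutes_compose n cf cg)
  then show "(h \<cdot>\<^bsub>sym_cat C\<^esub> g) \<cdot>\<^bsub>sym_cat C\<^esub> f = h \<cdot>\<^bsub>sym_cat C\<^esub> g \<cdot>\<^bsub>sym_cat C\<^esub> f"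
    by (simp add: ff sym_cat_def o_assoc)
qed

end

lemma cat_functorD:
  assumes "cat_functor A B F"
  shows "a \<in> Obj A \<Longrightarrow> fobj F a \<in> Obj B"
    "f \<in> Arr A \<Longrightarrow> farr F f \<in> Arr B" "f \<in> Arr A \<Longrightarrow> Dom B (farr F f) = fobj F (Dom A f)"
    "f \<in> Arr A \<Longrightarrow> Cod B (farr F f) = fobj F (Cod A f)"
    "a \<in> Obj A \<Longrightarrow> farr F (Idt A a) = Idt B (fobj F a)"
    "f \<in> Arr A \<Longrightarrow> g \<in> Arr A \<Longrightarrow> Cod A f = Dom A g \<Longrightarrow> farr F (g \<cdot>\<^bsub>A\<^esub> f) = farr F g \<cdot>\<^bsub>B\<^esub> farr F f"
  using assms by (auto simp: cat_functor_def hom_def)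

lemma cat_functor_comp:
  assumes "cat_functor A B F" "cat_functor B C G"
  shows "cat_functor A C (G \<circ>\<^sub>F F)"
  unfolding cat_functor_def functor_comp_def
  using assms by (auto simp: cat_functorD[OF assms(1)] cat_functorD[OF assms(2)] hom_def)

lemma cat_functor_sym_functor:
  assumes "cat_functor A B K"
  shows "cat_functor (sym_cat A) (sym_cat B) (sym_functor K)"
proof -
  note K = cat_functorD[OF assms]
  have h: "(\<rho>, map (farr K) fs) \<in> hom (sym_cat B) (map (fobj K) xs) (map (fobj K) ys)"
    if "(\<rho>, fs) \<in> hom (sym_cat A) xs ys" for \<rho> fs xs ys
  proof -
    have "map (Cod B) (map (farr K) fs) = map (fobj K) (map (Cod A) fs)"
    proof -
      have "set fs \<subseteq> Arr A" using that by (simp add: sym_cat_hom)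
      then show ?thesis using K(4) by auto
    qed
    also have "\<dots> = permute_list \<rho> (map (fobj K) ys)"
      using that by (auto simp: sym_cat_hom permute_list_map)
    finally have "map (Cod B) (map (farr K) fs) = permute_list \<rho> (map (fobj K) ys)" .
    moreover have "set fs \<subseteq> Arr A" using that by (simp add: sym_cat_hom)
    then have "map (Dom B) (map (farr K) fs) = map (fobj K) (map (Dom A) fs)" "set (map (farr K) fs) \<subseteq> Arr B"
      using K(2,3) by auto
    ultimately show ?thesis using that by (auto simp: sym_cat_hom)
  qed
  have c: "map (farr K) (map2 (\<lambda>g f. g \<cdot>\<^bsub>A\<^esub> f) (permute_list \<rho> gs) fs) =
      map2 (\<lambda>g f. g \<cdot>\<^bsub>B\<^esub> f) (permute_list \<rho> (map (farr K) gs)) (map (farr K) fs)"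
    if f: "(\<rho>, fs) \<in> hom (sym_cat A) xs ys" and g: "(\<sigma>, gs) \<in> hom (sym_cat A) ys zs" for \<rho> fs xs ys \<sigma> gs zs
  proof -
    have a: "\<rho> permutes {..<length fs}" "length gs = length fs" "set fs \<subseteq> Arr A" "set gs \<subseteq> Arr A"
      "map (Cod A) fs = permute_list \<rho> (map (Dom A) gs)"
      using f g by (auto simp: sym_cat_hom)
    have "Cod A (fs ! i) = Dom A (gs ! \<rho> i)" "fs ! i \<in> Arr A" "gs ! \<rho> i \<in> Arr A" "\<rho> i < length fs" if "i < length fs" for i
      using that arg_cong[OF a(5), of "\<lambda>l. l ! i"] a(1-4) permutes_in_image[OF a(1), of i] by (auto simp: permute_list_nth)
    then show ?thesis
      by (intro nth_equalityI) (simp_all add: a permute_list_nth K)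
  qed
  show ?thesis
    unfolding cat_functor_def
  proof (intro conjI ballI impI)
    fix xs assume "xs \<in> Obj (sym_cat A)"
    then show "fobj (sym_functor K) xs \<in> Obj (sym_cat B)"
      and "farr (sym_functor K) (Idt (sym_cat A) xs) = Idt (sym_cat B) (fobj (sym_functor K) xs)"
      by (auto simp: sym_cat_def sym_functor_def K)
  next
    fix f assume "f \<in> Arr (sym_cat A)"
    then have "(fst f, snd f) \<in> hom (sym_cat A) (Dom (sym_cat A) f) (Cod (sym_cat A) f)" by (simp add: hom_def)
    from h[OF this] show "farr (sym_functor K) f \<in> hom (sym_cat B) (fobj (sym_functor K) (Dom (sym_cat A) f))
           (fobj (sym_functor K) (Cod (sym_cat A) f))"
      by (simp add: sym_functor_def split_def)
    fix g assume "g \<in> Arr (sym_cat A)" "Cod (sym_cat A) f = Dom (sym_cat A) g"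
    then have "(fst g, snd g) \<in> hom (sym_cat A) (Cod (sym_cat A) f) (Cod (sym_cat A) g)" by (simp add: hom_def)
    from c[OF \<open>(fst f, snd f) \<in> _\<close> this]
    show "farr (sym_functor K) (g \<cdot>\<^bsub>sym_cat A\<^esub> f) = farr (sym_functor K) g \<cdot>\<^bsub>sym_cat B\<^esub> farr (sym_functor K) f"
      by (simp add: sym_functor_def split_def sym_cat_def)
  qed
qed

context symmetric_strict_monoidal
begin

lemma tensor_functor_arr:
  assumes "(\<rho>, fs) \<in> hom (sym_cat M) xs ys"
  shows "perm_arr M \<rho> (map (Cod M) fs) \<cdot> tensor_arrs M fs \<in> hom M (tensor_objs M xs) (tensor_objs M ys)"
proof -
  have a: "\<rho> permutes {..<length fs}" "set fs \<subseteq> Arr M" "map (Dom M) fs = xs" "permute_list (inv \<rho>) (map (Cod M) fs) = ys"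
    using assms by (auto simp: hom_def sym_cat_def)
  have "set (map (Cod M) fs) \<subseteq> Obj M" using a by auto
  with a perm_arr_simps[of \<rho> "map (Cod M) fs"] tensor_arrs_simps[of fs]
  show ?thesis by (auto simp: hom_def)
qed

text \<open>Preservation of composites: the arrows of the second factor, reindexed by \<rho>, slide
  past the symmetry of the first by \<open>perm_arr_natural\<close>, and the two symmetries are
  merged by \<open>perm_arr_comp\<close>.\<close>

lemma cat_functor_tensor: "cat_functor (sym_cat M) M (tensor_functor M)"
  unfolding cat_functor_def
proof (intro conjI ballI impI)
  fix xs assume xs: "xs \<in> Obj (sym_cat M)"
  then show "fobj (tensor_functor M) xs \<in> Obj M" by (simp add: sym_cat_def tensor_functor_def)
  have "map (Cod M) (map (Idt M) xs) = xs" using xs by (auto simp: sym_cat_def intro!: map_idI)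
  then show "farr (tensor_functor M) (Idt (sym_cat M) xs) = Idt M (fobj (tensor_functor M) xs)"
    using xs by (simp add: sym_cat_def tensor_functor_def perm_arr_id tensor_arrs_idt del: map_map)
next
  fix f assume f: "f \<in> Arr (sym_cat M)"
  obtain \<rho> fs where ff: "f = (\<rho>, fs)" by (cases f)
  have fh: "(\<rho>, fs) \<in> hom (sym_cat M) (Dom (sym_cat M) f) (Cod (sym_cat M) f)" using f by (simp add: hom_def ff)
  from tensor_functor_arr[OF fh]
  show "farr (tensor_functor M) f
       \<in> hom M (fobj (tensor_functor M) (Dom (sym_cat M) f)) (fobj (tensor_functor M) (Cod (sym_cat M) f))"
    by (simp add: tensor_functor_def ff)
  fix g assume g: "g \<in> Arr (sym_cat M)" "Cod (sym_cat M) f = Dom (sym_cat M) g"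
  obtain \<sigma> gs where gg: "g = (\<sigma>, gs)" by (cases g)
  have gh: "(\<sigma>, gs) \<in> hom (sym_cat M) (Cod (sym_cat M) f) (Cod (sym_cat M) g)" using g by (simp add: hom_def gg)
  have a: "\<rho> permutes {..<length fs}" "\<sigma> permutes {..<length fs}" "set fs \<subseteq> Arr M" "set gs \<subseteq> Arr M" "length gs = length fs"
      "map (Cod M) fs = permute_list \<rho> (map (Dom M) gs)"
    using fh gh by (auto simp: sym_cat_hom)
  \<comment> \<open>Aligned with \<open>fs\<close>: position i of \<open>?gs\<close> holds the arrow
    that starts where \<open>fs ! i\<close> ends.\<close>
  let ?gs = "permute_list \<rho> gs"
  have b: "set ?gs \<subseteq> Arr M" "map (Cod M) fs = map (Dom M) ?gs" "permute_list (inv \<rho>) ?gs = gs"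
    "permute_list (inv \<rho>) (map (Cod M) ?gs) = map (Cod M) gs" "permute_list (inv \<rho>) (map (Dom M) ?gs) = map (Dom M) gs"
    using a permute_list_inv_iff[of \<rho> ?gs gs] permutes_inv[OF a(1)] by (simp_all add: permute_list_map)
  have o: "set (map (Cod M) ?gs) \<subseteq> Obj M" "set (map (Dom M) ?gs) \<subseteq> Obj M" "set (map (Cod M) gs) \<subseteq> Obj M"
      "set (map (Dom M) gs) \<subseteq> Obj M"
    using b(1) a(4) by auto
  have [simp]: "perm_arr M \<rho> (map (Cod M) ?gs) \<in> Arr M" "perm_arr M \<sigma> (map (Cod M) gs) \<in> Arr M"
      "perm_arr M \<rho> (map (Dom M) ?gs) \<in> Arr M"
      "Dom M (perm_arr M \<rho> (map (Cod M) ?gs)) = tensor_objs M (map (Cod M) ?gs)"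
      "Dom M (perm_arr M \<sigma> (map (Cod M) gs)) = tensor_objs M (map (Cod M) gs)"
      "Dom M (perm_arr M \<rho> (map (Dom M) ?gs)) = tensor_objs M (map (Dom M) ?gs)"
      "Cod M (perm_arr M \<rho> (map (Cod M) ?gs)) = tensor_objs M (map (Cod M) gs)"
      "Cod M (perm_arr M \<rho> (map (Dom M) ?gs)) = tensor_objs M (map (Dom M) gs)"
    using perm_arr_simps[of \<rho> "map (Cod M) ?gs"] perm_arr_simps[of \<rho> "map (Dom M) ?gs"]
      perm_arr_simps[of \<sigma> "map (Cod M) gs"] o a b(4,5) by simp_all
  have [simp]: "tensor_arrs M fs \<in> Arr M" "tensor_arrs M gs \<in> Arr M" "tensor_arrs M ?gs \<in> Arr M"
      "Dom M (tensor_arrs M gs) = tensor_objs M (map (Dom M) gs)" "Dom M (tensor_arrs M ?gs) = tensor_objs M (map (Dom M) ?gs)"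
      "Cod M (tensor_arrs M gs) = tensor_objs M (map (Cod M) gs)" "Cod M (tensor_arrs M ?gs) = tensor_objs M (map (Cod M) ?gs)"
      "Cod M (tensor_arrs M fs) = tensor_objs M (map (Dom M) ?gs)"
    using tensor_arrs_simps[of fs] tensor_arrs_simps[of gs] tensor_arrs_simps[of ?gs] a b by simp_all
  have "farr (tensor_functor M) (g \<cdot>\<^bsub>sym_cat M\<^esub> f) =
     perm_arr M (\<sigma> \<circ> \<rho>) (map (Cod M) (map2 (\<cdot>) ?gs fs)) \<cdot> tensor_arrs M (map2 (\<cdot>) ?gs fs)"
    by (simp add: ff gg sym_cat_def tensor_functor_def)
  also have "map (Cod M) (map2 (\<cdot>) ?gs fs) = map (Cod M) ?gs"
    using a b by (intro map2_comp_simps) simp_all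
  also have "tensor_arrs M (map2 (\<cdot>) ?gs fs) = tensor_arrs M ?gs \<cdot> tensor_arrs M fs"
    using a b by (intro tensor_arrs_comp) simp_all
  also have "perm_arr M (\<sigma> \<circ> \<rho>) (map (Cod M) ?gs) = perm_arr M \<sigma> (map (Cod M) gs) \<cdot> perm_arr M \<rho> (map (Cod M) ?gs)"
    using perm_arr_comp[of \<rho> "map (Cod M) ?gs" \<sigma>] a b(4) o by simp
  also have "(perm_arr M \<sigma> (map (Cod M) gs) \<cdot> perm_arr M \<rho> (map (Cod M) ?gs)) \<cdot> tensor_arrs M ?gs \<cdot> tensor_arrs M fs =
     perm_arr M \<sigma> (map (Cod M) gs) \<cdot> (perm_arr M \<rho> (map (Cod M) ?gs) \<cdot> tensor_arrs M ?gs) \<cdot> tensor_arrs M fs"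
    by simp
  also have "perm_arr M \<rho> (map (Cod M) ?gs) \<cdot> tensor_arrs M ?gs = tensor_arrs M gs \<cdot> perm_arr M \<rho> (map (Dom M) ?gs)"
    using perm_arr_natural[of \<rho> ?gs] a b by simp
  also have "perm_arr M \<sigma> (map (Cod M) gs) \<cdot> (tensor_arrs M gs \<cdot> perm_arr M \<rho> (map (Dom M) ?gs)) \<cdot> tensor_arrs M fs =
      farr (tensor_functor M) g \<cdot> farr (tensor_functor M) f"
    by (simp add: ff gg tensor_functor_def b(2))
  finally show "farr (tensor_functor M) (g \<cdot>\<^bsub>sym_cat M\<^esub> f) = farr (tensor_functor M) g \<cdot> farr (tensor_functor M) f" .
qed

end

locale strict_monoidal =
  A: symmetric_strict_monoidal A + B: symmetric_strict_monoidal B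
  for A :: "('o, 'a, 'z1) smcat_scheme" and B :: "('p, 'b, 'z2) smcat_scheme" +
  fixes K :: "('o, 'a, 'p, 'b) fctr"
  assumes strict: "strict_monoidal_functor A B K"
begin

lemma is_functor: "cat_functor A B K"
  using strict by (simp add: strict_monoidal_functor_def)

lemmas functor_simps [simp] = cat_functorD[OF is_functor]

lemma strict_simps [simp]:
  "fobj K (Unt A) = Unt B"
  "x \<in> Obj A \<Longrightarrow> y \<in> Obj A \<Longrightarrow> fobj K (x \<odot>\<^bsub>A\<^esub> y) = fobj K x \<odot>\<^bsub>B\<^esub> fobj K y"
  "f \<in> Arr A \<Longrightarrow> g \<in> Arr A \<Longrightarrow> farr K (f \<otimes>\<^bsub>A\<^esub> g) = farr K f \<otimes>\<^bsub>B\<^esub> farr K g"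
  "x \<in> Obj A \<Longrightarrow> y \<in> Obj A \<Longrightarrow> farr K (Brd A x y) = Brd B (fobj K x) (fobj K y)"
  using strict by (auto simp: strict_monoidal_functor_def)

lemma functor_tensor_objs: "set xs \<subseteq> Obj A \<Longrightarrow> fobj K (tensor_objs A xs) = tensor_objs B (map (fobj K) xs)"
  by (induction xs) auto

lemma functor_tensor_arrs: "set fs \<subseteq> Arr A \<Longrightarrow> farr K (tensor_arrs A fs) = tensor_arrs B (map (farr K) fs)"
  by (induction fs) (auto simp: A.tensor_arrs_simps)

lemma functor_perm_arr:
  assumes "\<rho> permutes {..<length xs}" "set xs \<subseteq> Obj A"
  shows "farr K (perm_arr A \<rho> xs) = perm_arr B \<rho> (map (fobj K) xs)"
  using assms
proof (induction xs arbitrary: \<rho>)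
  case (Cons x xs)
  have pt: "perm_tail \<rho> permutes {..<length xs}" using Cons.prems by (intro perm_tail_permutes) simp
  let ?ys = "permute_list (inv (perm_tail \<rho>)) xs"
  have s: "set ?ys \<subseteq> Obj A" using Cons.prems permutes_inv[OF pt] by simp
  have ys: "permute_list (inv (perm_tail \<rho>)) (map (fobj K) xs) = map (fobj K) ?ys"
    using permute_list_map[OF permutes_inv[OF pt]] .
  have td: "set (take n ?ys) \<subseteq> Obj A" "set (drop n ?ys) \<subseteq> Obj A" for n
    using s by (meson set_take_subset set_drop_subset subset_trans)+
  have [simp]: "tensor_objs A (take n ?ys) \<odot>\<^bsub>A\<^esub> tensor_objs A (drop n ?ys) = tensor_objs A ?ys" for n
    using A.tensor_objs_append[OF td(1)[of n] td(2)[of n]] by simp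
  note P = A.perm_arr_simps[OF pt]
  show ?case
    using Cons td P
    by (simp add: Let_def ys take_map drop_map functor_tensor_objs pt)
qed simp

end

section \<open>Markings and unshuffles\<close>

definition select :: "bool list \<Rightarrow> 'c list \<Rightarrow> 'c list" where
  "select v cs = map snd (filter fst (zip v cs))"

abbreviation "neg v \<equiv> map Not v"
abbreviation "all_true n \<equiv> replicate n True"
abbreviation "all_false n \<equiv> replicate n False"

lemma select_simps [simp]:
  "select [] cs = []" "select (b # v) (c # cs) = (if b then c # select v cs else select v cs)"
  by (auto simp: select_def)

lemma select_append [simp]:
  "length v = length cs \<Longrightarrow> select (v @ v') (cs @ cs') = select v cs @ select v' cs'"
  by (simp add: select_def)

lemma set_select: "set (select v cs) \<subseteq> set cs"
  by (auto simp: select_def dest: set_zip_rightD)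

lemma select_subset [simp]: "set cs \<subseteq> A \<Longrightarrow> set (select v cs) \<subseteq> A"
  using set_select[of v cs] by auto

lemma select_all_true [simp]: "n = length cs \<Longrightarrow> select (all_true n) cs = cs"
  by (induction cs arbitrary: n) auto

lemma select_all_false [simp]: "select (all_false n) cs = []"
  by (auto simp: select_def set_zip filter_empty_conv)

lemma neg_neg [simp]: "map (Not \<circ> Not) v = v"
  by (induction v) auto

lemma select_map: "select v (map f cs) = map f (select v cs)"
  by (induction v cs rule: list_induct2') (auto simp: select_def)

text \<open>The symmetry that brings the marked factors in front of the unmarked ones and keeps the
  order within each group: an unmarked head is braided past the marked factors of the tail.\<close>

fun unshuffle :: "('o, 'a, 'z) smcat_scheme \<Rightarrow> bool list \<Rightarrow> 'o list \<Rightarrow> 'a" where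
  "unshuffle M (b # v) (c # cs) =
     (if b then Idt M c \<otimes>\<^bsub>M\<^esub> unshuffle M v cs
      else (Brd M c (tensor_objs M (select v cs)) \<otimes>\<^bsub>M\<^esub> Idt M (tensor_objs M (select (neg v) cs)))
        \<cdot>\<^bsub>M\<^esub> (Idt M c \<otimes>\<^bsub>M\<^esub> unshuffle M v cs))"
| "unshuffle M _ _ = Idt M (Unt M)"

context symmetric_strict_monoidal
begin

lemma unshuffle_simps [simp]:
  assumes "length v = length cs" "set cs \<subseteq> Obj M"
  shows "unshuffle M v cs \<in> Arr M" "Dom M (unshuffle M v cs) = tensor_objs M cs"
    "Cod M (unshuffle M v cs) = tensor_objs M (select v cs) \<odot> tensor_objs M (select (neg v) cs)"
proof -
  have "unshuffle M v cs \<in> Arr M \<and> Dom M (unshuffle M v cs) = tensor_objs M cs \<and>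
    Cod M (unshuffle M v cs) = tensor_objs M (select v cs) \<odot> tensor_objs M (select (neg v) cs)"
    using assms by (induction v cs rule: list_induct2) auto
  then show "unshuffle M v cs \<in> Arr M" "Dom M (unshuffle M v cs) = tensor_objs M cs"
    "Cod M (unshuffle M v cs) = tensor_objs M (select v cs) \<odot> tensor_objs M (select (neg v) cs)"
    by auto
qed

text \<open>Both sides are the symmetry c a b a' b' \<rightarrow> a a' c b b'. It is the step for an
  unmarked head \<open>c\<close> in \<open>unshuffle_append\<close>.\<close>

lemma brd_unshuffle:
  assumes [simp]: "c \<in> Obj M" "a \<in> Obj M" "b \<in> Obj M" "a' \<in> Obj M" "b' \<in> Obj M"
  shows "(Brd M c (a \<odot> a') \<otimes> Idt M (b \<odot> b')) \<cdot> (Idt M (c \<odot> a) \<otimes> Brd M b a' \<otimes> Idt M b') =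
    (Idt M a \<otimes> Brd M (c \<odot> b) a' \<otimes> Idt M b') \<cdot> (Brd M c a \<otimes> Idt M (b \<odot> a' \<odot> b'))"
proof -
  have "(Brd M c (a \<odot> a') \<otimes> Idt M (b \<odot> b')) \<cdot> (Idt M (c \<odot> a) \<otimes> Brd M b a' \<otimes> Idt M b') =
     (Idt M a \<otimes> Brd M c a' \<otimes> Idt M (b \<odot> b')) \<cdot> (Brd M c a \<otimes> Idt M (a' \<odot> b \<odot> b')) \<cdot>
     (Idt M (c \<odot> a) \<otimes> Brd M b a' \<otimes> Idt M b')"
    by (simp add: brd_tensor_right_idt)
  also have "(Brd M c a \<otimes> Idt M (a' \<odot> b \<odot> b')) \<cdot> (Idt M (c \<odot> a) \<otimes> Brd M b a' \<otimes> Idt M b') =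
     (Idt M (a \<odot> c) \<otimes> Brd M b a' \<otimes> Idt M b') \<cdot> (Brd M c a \<otimes> Idt M (b \<odot> a' \<odot> b'))"
    by (simp add: interchange)
  also have "(Idt M a \<otimes> Brd M c a' \<otimes> Idt M (b \<odot> b')) \<cdot>
      (Idt M (a \<odot> c) \<otimes> Brd M b a' \<otimes> Idt M b') \<cdot> (Brd M c a \<otimes> Idt M (b \<odot> a' \<odot> b')) =
      ((Idt M a \<otimes> Brd M c a' \<otimes> Idt M (b \<odot> b')) \<cdot>
      (Idt M (a \<odot> c) \<otimes> Brd M b a' \<otimes> Idt M b')) \<cdot> (Brd M c a \<otimes> Idt M (b \<odot> a' \<odot> b'))"
    by (rule comp_assoc_arr[symmetric]) simp_all
  also have "(Idt M a \<otimes> Brd M c a' \<otimes> Idt M (b \<odot> b')) \<cdot> (Idt M (a \<odot> c) \<otimes> Brd M b a' \<otimes> Idt M b') =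
      Idt M a \<otimes> Brd M (c \<odot> b) a' \<otimes> Idt M b'"
    using interchange[of "Idt M c \<otimes> Brd M b a'" "Brd M c a' \<otimes> Idt M b" "Idt M b'" "Idt M b'"]
    by (simp add: interchange brd_tensor_left tenA_idt[symmetric] del: tenA_idt)
  finally show ?thesis .
qed

text \<open>Unshuffling the blocks separately leaves four groups, the marked and unmarked factors of
  each block; the braiding exchanges the two inner ones.\<close>

lemma unshuffle_append:
  assumes "length v = length cs" "length v' = length cs'" "set cs \<subseteq> Obj M" "set cs' \<subseteq> Obj M"
  shows "unshuffle M (v @ v') (cs @ cs') =
    (Idt M (tensor_objs M (select v cs)) \<otimes> Brd M (tensor_objs M (select (neg v) cs)) (tensor_objs M (select v' cs'))
      \<otimes> Idt M (tensor_objs M (select (neg v') cs'))) \<cdot> (unshuffle M v cs \<otimes> unshuffle M v' cs')"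
  using assms(1,3)
proof (induction v cs rule: list_induct2)
  case Nil
  then show ?case using assms by simp
next
  case (Cons b v c cs)
  let ?a = "tensor_objs M (select v cs)" and ?b = "tensor_objs M (select (neg v) cs)"
  let ?a' = "tensor_objs M (select v' cs')" and ?b' = "tensor_objs M (select (neg v') cs')"
  let ?U = "unshuffle M v cs" and ?U' = "unshuffle M v' cs'"
  have [simp]: "c \<in> Obj M" "set cs \<subseteq> Obj M" "set cs' \<subseteq> Obj M" "length v = length cs" "length v' = length cs'"
    using Cons assms by auto
  have [simp]: "?a \<in> Obj M" "?b \<in> Obj M" "?a' \<in> Obj M" "?b' \<in> Obj M" by simp_all
  note IH = Cons.IH[OF \<open>set cs \<subseteq> Obj M\<close>]
  show ?case
  proof (cases b)
    case True
    then show ?thesis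
      by (simp add: IH interchange tenA_idt[symmetric] del: tenA_idt)
  next
    case False
    have "unshuffle M ((b # v) @ v') ((c # cs) @ cs') =
       (Brd M c (?a \<odot> ?a') \<otimes> Idt M (?b \<odot> ?b')) \<cdot> (Idt M c \<otimes> ((Idt M ?a \<otimes> Brd M ?b ?a' \<otimes> Idt M ?b') \<cdot> (?U \<otimes> ?U')))"
      using False by (simp add: IH tensor_objs_append)
    also have "\<dots> = ((Brd M c (?a \<odot> ?a') \<otimes> Idt M (?b \<odot> ?b')) \<cdot> (Idt M (c \<odot> ?a) \<otimes> Brd M ?b ?a' \<otimes> Idt M ?b')) \<cdot> (Idt M c \<otimes> (?U \<otimes> ?U'))"
      using interchange[of "Idt M c" "Idt M c" "?U \<otimes> ?U'" "Idt M ?a \<otimes> Brd M ?b ?a' \<otimes> Idt M ?b'"]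
      by (simp add: tenA_idt[symmetric] del: tenA_idt)
    also have "\<dots> = ((Idt M ?a \<otimes> Brd M (c \<odot> ?b) ?a' \<otimes> Idt M ?b') \<cdot> (Brd M c ?a \<otimes> Idt M (?b \<odot> ?a' \<odot> ?b'))) \<cdot> (Idt M c \<otimes> (?U \<otimes> ?U'))"
      by (simp only: brd_unshuffle[OF \<open>c \<in> Obj M\<close> \<open>?a \<in> Obj M\<close> \<open>?b \<in> Obj M\<close> \<open>?a' \<in> Obj M\<close> \<open>?b' \<in> Obj M\<close>])
    also have "\<dots> = (Idt M ?a \<otimes> Brd M (c \<odot> ?b) ?a' \<otimes> Idt M ?b') \<cdot> (((Brd M c ?a \<otimes> Idt M ?b) \<cdot> (Idt M c \<otimes> ?U)) \<otimes> ?U')"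
      using interchange[of "Idt M c \<otimes> ?U" "Brd M c ?a \<otimes> Idt M ?b" ?U' "Idt M (?a' \<odot> ?b')"]
      by simp
    finally show ?thesis using False by simp
  qed
qed

lemma unshuffle_all_true: "set cs \<subseteq> Obj M \<Longrightarrow> n = length cs \<Longrightarrow> unshuffle M (all_true n) cs = Idt M (tensor_objs M cs)"
  by (induction cs arbitrary: n) auto

lemma unshuffle_all_false: "set cs \<subseteq> Obj M \<Longrightarrow> n = length cs \<Longrightarrow> unshuffle M (all_false n) cs = Idt M (tensor_objs M cs)"
  by (induction cs arbitrary: n) auto

text \<open>This is what the braiding of \<open>marked_cat\<close> has to satisfy as a marked arrow.
  Naturality carries the block braiding across the two separate unshuffles, and
  \<open>brd_middle\<close> compares the remaining symmetries of the four groups.\<close>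

lemma unshuffle_brd:
  assumes "length v = length cs" "length v' = length cs'" "set cs \<subseteq> Obj M" "set cs' \<subseteq> Obj M"
  shows "unshuffle M (v' @ v) (cs' @ cs) \<cdot> Brd M (tensor_objs M cs) (tensor_objs M cs') =
    (Brd M (tensor_objs M (select v cs)) (tensor_objs M (select v' cs')) \<otimes>
     Brd M (tensor_objs M (select (neg v) cs)) (tensor_objs M (select (neg v') cs')))
      \<cdot> unshuffle M (v @ v') (cs @ cs')"
proof -
  let ?a = "tensor_objs M (select v cs)" and ?b = "tensor_objs M (select (neg v) cs)"
  let ?a' = "tensor_objs M (select v' cs')" and ?b' = "tensor_objs M (select (neg v') cs')"
  let ?U = "unshuffle M v cs" and ?U' = "unshuffle M v' cs'"
  have [simp]: "set cs \<subseteq> Obj M" "set cs' \<subseteq> Obj M" "length v = length cs" "length v' = length cs'"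
    using assms by auto
  have [simp]: "?a \<in> Obj M" "?b \<in> Obj M" "?a' \<in> Obj M" "?b' \<in> Obj M" by simp_all
  have "unshuffle M (v' @ v) (cs' @ cs) \<cdot> Brd M (tensor_objs M cs) (tensor_objs M cs') =
    (Idt M ?a' \<otimes> Brd M ?b' ?a \<otimes> Idt M ?b) \<cdot> ((?U' \<otimes> ?U) \<cdot> Brd M (tensor_objs M cs) (tensor_objs M cs'))"
    by (simp add: unshuffle_append)
  also have "(?U' \<otimes> ?U) \<cdot> Brd M (tensor_objs M cs) (tensor_objs M cs') = Brd M (?a \<odot> ?b) (?a' \<odot> ?b') \<cdot> (?U \<otimes> ?U')"
    using brd_natural_arr[of ?U ?U'] by simp
  also have "(Idt M ?a' \<otimes> Brd M ?b' ?a \<otimes> Idt M ?b) \<cdot> Brd M (?a \<odot> ?b) (?a' \<odot> ?b') \<cdot> (?U \<otimes> ?U') =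
     ((Idt M ?a' \<otimes> Brd M ?b' ?a \<otimes> Idt M ?b) \<cdot> Brd M (?a \<odot> ?b) (?a' \<odot> ?b')) \<cdot> (?U \<otimes> ?U')"
    by (rule comp_assoc_arr[symmetric]) simp_all
  also have "\<dots> = ((Brd M ?a ?a' \<otimes> Brd M ?b ?b') \<cdot> (Idt M ?a \<otimes> Brd M ?b ?a' \<otimes> Idt M ?b')) \<cdot> (?U \<otimes> ?U')"
    by (simp only: brd_middle[OF \<open>?a \<in> Obj M\<close> \<open>?b \<in> Obj M\<close> \<open>?a' \<in> Obj M\<close> \<open>?b' \<in> Obj M\<close>])
  also have "\<dots> = (Brd M ?a ?a' \<otimes> Brd M ?b ?b') \<cdot> unshuffle M (v @ v') (cs @ cs')"
    by (simp add: unshuffle_append)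
  finally show ?thesis .
qed

end

section \<open>The category of marked arrows\<close>

text \<open>
  An arrow \<open>cs \<rightarrow> ds\<close> assigns to each marking of the positions of \<open>ds\<close> a marking of the positions of \<open>cs\<close>
  and an arrow between the tensor products of the marked factors. Marking everything gives the
  underlying arrow of \<open>M\<close>; the last condition says that each marking splits it as a tensor product of
  the arrows for the marking and for its complement.
\<close>

type_synonym ('o, 'a) marked_arr = "'o list \<times> 'o list \<times> (bool list \<Rightarrow> bool list \<times> 'a)"

definition pre :: "('o, 'a) marked_arr \<Rightarrow> bool list \<Rightarrow> bool list" where
  "pre x v = fst (snd (snd x) v)"

definition part :: "('o, 'a) marked_arr \<Rightarrow> bool list \<Rightarrow> 'a" where
  "part x v = snd (snd (snd x) v)"

text \<open>Markings of the wrong length are sent to \<open>undefined\<close>, so that arrows with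
  the same relevant values are equal as functions; the category axioms are stated with actual
  equality.\<close>

definition mk_arr :: "'o list \<Rightarrow> 'o list \<Rightarrow> (bool list \<Rightarrow> bool list) \<Rightarrow> (bool list \<Rightarrow> 'a) \<Rightarrow> ('o, 'a) marked_arr" where
  "mk_arr cs ds p f = (cs, ds, \<lambda>v. if length v = length ds then (p v, f v) else undefined)"

text \<open>The separate clause for \<open>all_false\<close> makes the empty marking pull back to
  the empty marking with the identity of the unit. It later determines arrows into a singleton by a
  single value, and arrows into the unit completely.\<close>

definition marked_arrs :: "('o, 'a, 'z) smcat_scheme \<Rightarrow> 'o set \<Rightarrow> ('o, 'a) marked_arr set" where
  "marked_arrs M C = {(cs, ds, \<alpha>). set cs \<subseteq> C \<and> set ds \<subseteq> C \<and>
     (\<forall>v. length v \<noteq> length ds \<longrightarrow> \<alpha> v = undefined) \<and>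
     \<alpha> (all_false (length ds)) = (all_false (length cs), Idt M (Unt M)) \<and>
     (\<forall>v. length v = length ds \<longrightarrow>
        length (fst (\<alpha> v)) = length cs \<and> fst (\<alpha> (neg v)) = neg (fst (\<alpha> v)) \<and>
        snd (\<alpha> v) \<in> hom M (tensor_objs M (select (fst (\<alpha> v)) cs)) (tensor_objs M (select v ds)) \<and>
        unshuffle M v ds \<cdot>\<^bsub>M\<^esub> snd (\<alpha> (all_true (length ds))) =
          (snd (\<alpha> v) \<otimes>\<^bsub>M\<^esub> snd (\<alpha> (neg v))) \<cdot>\<^bsub>M\<^esub> unshuffle M (fst (\<alpha> v)) cs)}"

text \<open>Objects are lists over \<open>C\<close> rather than over all objects, so that a section
  of the forgetful functor writes each object as a tensor product of elements of \<open>C\<close>.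
  Markings are pulled back contravariantly, hence \<open>pre x (pre y v)\<close> in the composite.
  Concatenation makes the structure strict.\<close>

definition marked_cat :: "('o, 'a, 'z) smcat_scheme \<Rightarrow> 'o set \<Rightarrow> ('o list, ('o, 'a) marked_arr) smcat" where
  "marked_cat M C = \<lparr>
     Obj = {cs. set cs \<subseteq> C},
     Arr = marked_arrs M C,
     Dom = fst,
     Cod = (\<lambda>x. fst (snd x)),
     Idt = (\<lambda>cs. mk_arr cs cs (\<lambda>v. v) (\<lambda>v. Idt M (tensor_objs M (select v cs)))),
     Comp = (\<lambda>y x. mk_arr (fst x) (fst (snd y)) (\<lambda>v. pre x (pre y v)) (\<lambda>v. part y v \<cdot>\<^bsub>M\<^esub> part x (pre y v))),
     TenO = (@),
     TenA = (\<lambda>x y. let n = length (fst (snd x)) in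
       mk_arr (fst x @ fst y) (fst (snd x) @ fst (snd y)) (\<lambda>v. pre x (take n v) @ pre y (drop n v))
         (\<lambda>v. part x (take n v) \<otimes>\<^bsub>M\<^esub> part y (drop n v))),
     Unt = [],
     Asc = (\<lambda>cs ds es. mk_arr (cs @ ds @ es) (cs @ ds @ es) (\<lambda>v. v) (\<lambda>v. Idt M (tensor_objs M (select v (cs @ ds @ es))))),
     Lun = (\<lambda>cs. mk_arr cs cs (\<lambda>v. v) (\<lambda>v. Idt M (tensor_objs M (select v cs)))),
     Run = (\<lambda>cs. mk_arr cs cs (\<lambda>v. v) (\<lambda>v. Idt M (tensor_objs M (select v cs)))),
     Brd = (\<lambda>cs ds. let n = length ds in
       mk_arr (cs @ ds) (ds @ cs) (\<lambda>v. drop n v @ take n v)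
         (\<lambda>v. Brd M (tensor_objs M (select (drop n v) cs)) (tensor_objs M (select (take n v) ds))))\<rparr>"

lemma mk_arr_simps [simp]:
  "fst (mk_arr cs ds p f) = cs" "fst (snd (mk_arr cs ds p f)) = ds"
  "length v = length ds \<Longrightarrow> pre (mk_arr cs ds p f) v = p v"
  "length v = length ds \<Longrightarrow> part (mk_arr cs ds p f) v = f v"
  by (auto simp: mk_arr_def pre_def part_def)

lemma mk_arr_cong:
  assumes "\<And>v. length v = length ds \<Longrightarrow> p v = p' v" "\<And>v. length v = length ds \<Longrightarrow> f v = f' v"
  shows "mk_arr cs ds p f = mk_arr cs ds p' f'"
  using assms by (auto simp: mk_arr_def)

locale marking = symmetric_strict_monoidal M
  for M :: "('o, 'a, 'z) smcat_scheme" (structure) +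
  fixes C :: "'o set"
  assumes C_obj: "C \<subseteq> Obj M"
begin

abbreviation W where "W \<equiv> marked_cat M C"

abbreviation T where "T v cs \<equiv> tensor_objs M (select v cs)"

lemma C_subset [simp]: "set cs \<subseteq> C \<Longrightarrow> set cs \<subseteq> Obj M"
  using C_obj by auto

lemma mk_arr_marked:
  "mk_arr cs ds p f \<in> marked_arrs M C \<longleftrightarrow> set cs \<subseteq> C \<and> set ds \<subseteq> C \<and>
     p (all_false (length ds)) = all_false (length cs) \<and> f (all_false (length ds)) = Idt M (Unt M) \<and>
     (\<forall>v. length v = length ds \<longrightarrow>
        length (p v) = length cs \<and> p (neg v) = neg (p v) \<and> f v \<in> hom M (T (p v) cs) (T v ds) \<and>
        unshuffle M v ds \<cdot> f (all_true (length ds)) = (f v \<otimes> f (neg v)) \<cdot> unshuffle M (p v) cs)"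
  by (auto simp: marked_arrs_def mk_arr_def)

lemma marked_arr_eta:
  assumes "x \<in> marked_arrs M C"
  shows "x = mk_arr (fst x) (fst (snd x)) (pre x) (part x)"
proof -
  obtain cs ds \<alpha> where x: "x = (cs, ds, \<alpha>)" by (cases x)
  have "\<alpha> v = (if length v = length ds then (fst (\<alpha> v), snd (\<alpha> v)) else undefined)" for v
    using assms unfolding x by (simp add: marked_arrs_def)
  then have e: "\<alpha> = (\<lambda>v. if length v = length ds then (fst (\<alpha> v), snd (\<alpha> v)) else undefined)" by blast
  show ?thesis unfolding x mk_arr_def pre_def part_def fst_conv snd_conv prod.inject
    by (intro conjI refl) (rule e)
qed

lemma marked_arr_simps:
  assumes "x \<in> marked_arrs M C"
  shows "set (fst x) \<subseteq> C" "set (fst (snd x)) \<subseteq> C"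
    "n = length (fst (snd x)) \<Longrightarrow> pre x (all_false n) = all_false (length (fst x))"
    "n = length (fst (snd x)) \<Longrightarrow> part x (all_false n) = Idt M (Unt M)"
    "length v = length (fst (snd x)) \<Longrightarrow> length (pre x v) = length (fst x)"
    "length v = length (fst (snd x)) \<Longrightarrow> pre x (neg v) = neg (pre x v)"
    "length v = length (fst (snd x)) \<Longrightarrow> part x v \<in> Arr M"
    "length v = length (fst (snd x)) \<Longrightarrow> Dom M (part x v) = T (pre x v) (fst x)"
    "length v = length (fst (snd x)) \<Longrightarrow> Cod M (part x v) = T v (fst (snd x))"
    "length v = length (fst (snd x)) \<Longrightarrow> n = length (fst (snd x)) \<Longrightarrow>
       unshuffle M v (fst (snd x)) \<cdot> part x (all_true n) = (part x v \<otimes> part x (neg v)) \<cdot> unshuffle M (pre x v) (fst x)"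
proof -
  obtain cs ds p f where x: "x = mk_arr cs ds p f" using marked_arr_eta[OF assms] by blast
  have m: "mk_arr cs ds p f \<in> marked_arrs M C" using assms unfolding x .
  then show "set (fst x) \<subseteq> C" "set (fst (snd x)) \<subseteq> C"
    "n = length (fst (snd x)) \<Longrightarrow> pre x (all_false n) = all_false (length (fst x))"
    "n = length (fst (snd x)) \<Longrightarrow> part x (all_false n) = Idt M (Unt M)"
    by (simp_all add: mk_arr_marked x)
  assume v: "length v = length (fst (snd x))"
  with m show "length (pre x v) = length (fst x)" "pre x (neg v) = neg (pre x v)"
    "part x v \<in> Arr M" "Dom M (part x v) = T (pre x v) (fst x)" "Cod M (part x v) = T v (fst (snd x))"
    by (simp_all add: mk_arr_marked x hom_def)
  assume "n = length (fst (snd x))"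
  with m v show "unshuffle M v (fst (snd x)) \<cdot> part x (all_true n) = (part x v \<otimes> part x (neg v)) \<cdot> unshuffle M (pre x v) (fst x)"
    by (simp add: mk_arr_marked x)
qed

text \<open>Complements are respected and the preimage of \<open>all_false\<close> is
  prescribed.\<close>

lemma pre_all_true:
  assumes "x \<in> marked_arrs M C" "n = length (fst (snd x))"
  shows "pre x (all_true n) = all_true (length (fst x))"
  using marked_arr_simps(6)[OF assms(1), of "all_false n"] marked_arr_simps(3)[OF assms] assms(2) by simp

lemma marked_arr_eqI:
  assumes "x \<in> marked_arrs M C" "y \<in> marked_arrs M C" "fst x = fst y" "fst (snd x) = fst (snd y)"
    "\<And>v. length v = length (fst (snd y)) \<Longrightarrow> pre x v = pre y v"
    "\<And>v. length v = length (fst (snd y)) \<Longrightarrow> part x v = part y v"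
  shows "x = y"
  using mk_arr_cong[of "fst (snd y)" "pre x" "pre y" "part x" "part y" "fst y"] assms(3-6)
    marked_arr_eta[OF assms(1)] marked_arr_eta[OF assms(2)] by presburger

lemma W_simps [simp]:
  "Obj W = {cs. set cs \<subseteq> C}" "Arr W = marked_arrs M C" "Dom W = fst" "Cod W = (\<lambda>x. fst (snd x))"
  "TenO W = (@)" "Unt W = []"
  by (auto simp: marked_cat_def)

lemma W_idt:
  assumes "set cs \<subseteq> C"
  shows "Idt W cs \<in> marked_arrs M C" "fst (Idt W cs) = cs" "fst (snd (Idt W cs)) = cs"
    "length v = length cs \<Longrightarrow> pre (Idt W cs) v = v" "length v = length cs \<Longrightarrow> part (Idt W cs) v = Idt M (T v cs)"
  using assms by (auto simp: marked_cat_def mk_arr_marked hom_def)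

text \<open>The splitting condition of \<open>y\<close> at \<open>v\<close> is followed by that of
  \<open>x\<close> at \<open>pre y v\<close>, which is why \<open>x\<close> has to be split along
  arbitrary markings.\<close>

lemma W_comp:
  assumes "x \<in> marked_arrs M C" "y \<in> marked_arrs M C" "fst (snd x) = fst y"
  shows "y \<cdot>\<^bsub>W\<^esub> x \<in> marked_arrs M C" "fst (y \<cdot>\<^bsub>W\<^esub> x) = fst x" "fst (snd (y \<cdot>\<^bsub>W\<^esub> x)) = fst (snd y)"
    "length v = length (fst (snd y)) \<Longrightarrow> pre (y \<cdot>\<^bsub>W\<^esub> x) v = pre x (pre y v)"
    "length v = length (fst (snd y)) \<Longrightarrow> part (y \<cdot>\<^bsub>W\<^esub> x) v = part y v \<cdot> part x (pre y v)"
proof -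
  note X = marked_arr_simps[OF assms(1)] and Y = marked_arr_simps[OF assms(2)]
  show "y \<cdot>\<^bsub>W\<^esub> x \<in> marked_arrs M C"
    unfolding marked_cat_def
  proof (simp add: mk_arr_marked, intro conjI allI impI)
    fix v :: "bool list" assume v: "length v = length (fst (snd y))"
    let ?n = "length (fst (snd y))"
    let ?u = "pre y v"
    have u: "length ?u = length (fst (snd x))" "length (pre x ?u) = length (fst x)"
      using v Y X assms(3) by simp_all
    have t: "pre y (all_true ?n) = all_true (length (fst (snd x)))"
      using pre_all_true[OF assms(2)] assms(3) by simp
    note [simp] = X(7-9)[of ?u] X(7-9)[of "neg ?u"] Y(7-9)[of v] Y(7-9)[of "neg v"] Y(6)[OF v] X(6)[OF u(1)]
      Y(7-9)[of "all_true ?n"] X(7-9)[of "all_true (length (fst (snd x)))"] t u v X(1,2) Y(1,2)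
    have "unshuffle M v (fst (snd y)) \<cdot> part y (all_true ?n) \<cdot> part x (pre y (all_true ?n)) =
       (unshuffle M v (fst (snd y)) \<cdot> part y (all_true ?n)) \<cdot> part x (pre y (all_true ?n))"
      by (intro comp_assoc_arr[symmetric]) (simp_all add: assms(3)[symmetric])
    also have "\<dots> = (part y v \<otimes> part y (neg v)) \<cdot> (unshuffle M ?u (fst (snd x)) \<cdot> part x (all_true (length (fst (snd x)))))"
      by (simp add: Y(10) assms(3)[symmetric])
    also have "\<dots> = (part y v \<otimes> part y (neg v)) \<cdot> (part x ?u \<otimes> part x (neg ?u)) \<cdot> unshuffle M (pre x ?u) (fst x)"
      by (simp add: X(10))
    also have "\<dots> = ((part y v \<cdot> part x ?u) \<otimes> (part y (neg v) \<cdot> part x (pre y (neg v)))) \<cdot> unshuffle M (pre x ?u) (fst x)"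
      using assms(3) by (simp add: interchange_assoc)
    finally show "unshuffle M v (fst (snd y)) \<cdot> part y (all_true ?n) \<cdot> part x (pre y (all_true ?n)) =
      ((part y v \<cdot> part x (pre y v)) \<otimes> (part y (neg v) \<cdot> part x (pre y (neg v)))) \<cdot> unshuffle M (pre x (pre y v)) (fst x)" .
  qed (insert X Y assms(3), simp_all add: hom_def)
qed (auto simp: marked_cat_def)

text \<open>The point is the splitting condition: \<open>unshuffle_append\<close> introduces a
  braiding of the unmarked target of \<open>x\<close> with the marked target of \<open>y\<close>,
  and its naturality lets the corresponding parts pass.\<close>

lemma W_tensor:
  assumes "x \<in> marked_arrs M C" "y \<in> marked_arrs M C"
  shows "x \<otimes>\<^bsub>W\<^esub> y \<in> marked_arrs M C" "fst (x \<otimes>\<^bsub>W\<^esub> y) = fst x @ fst y" "fst (snd (x \<otimes>\<^bsub>W\<^esub> y)) = fst (snd x) @ fst (snd y)"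
    "length v = length (fst (snd x)) + length (fst (snd y)) \<Longrightarrow>
       pre (x \<otimes>\<^bsub>W\<^esub> y) v = pre x (take (length (fst (snd x))) v) @ pre y (drop (length (fst (snd x))) v)"
    "length v = length (fst (snd x)) + length (fst (snd y)) \<Longrightarrow>
       part (x \<otimes>\<^bsub>W\<^esub> y) v = part x (take (length (fst (snd x))) v) \<otimes> part y (drop (length (fst (snd x))) v)"
proof -
  note X = marked_arr_simps[OF assms(1)] and Y = marked_arr_simps[OF assms(2)]
  let ?n = "length (fst (snd x))" and ?m = "length (fst (snd y))"
  have "mk_arr (fst x @ fst y) (fst (snd x) @ fst (snd y)) (\<lambda>v. pre x (take ?n v) @ pre y (drop ?n v))
         (\<lambda>v. part x (take ?n v) \<otimes> part y (drop ?n v)) \<in> marked_arrs M C"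
    unfolding mk_arr_marked
  proof (intro conjI allI impI)
    fix v :: "bool list" assume v': "length v = length (fst (snd x) @ fst (snd y))"
    then have v: "length v = ?n + ?m" by simp
    define v1 v2 where "v1 = take ?n v" and "v2 = drop ?n v"
    have vv: "v = v1 @ v2" "length v1 = ?n" "length v2 = ?m" using v by (simp_all add: v1_def v2_def)
    have [simp]: "take ?n (map Not v) = neg v1" "drop ?n (map Not v) = neg v2" "take ?n v = v1" "drop ?n v = v2"
      by (simp_all add: vv)
    have u: "length (pre x v1) = length (fst x)" "length (pre y v2) = length (fst y)"
      using vv X Y by simp_all
    note [simp] = X(7-9)[of v1] X(7-9)[of "neg v1"] Y(7-9)[of v2] Y(7-9)[of "neg v2"] Y(6)[OF vv(3)] X(6)[OF vv(2)]
      Y(7-9)[of "all_true ?m"] X(7-9)[of "all_true ?n"] u vv(2,3) X(1,2) Y(1,2)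
      pre_all_true[OF assms(1)] pre_all_true[OF assms(2)]
    show "length (pre x (take ?n v) @ pre y (drop ?n v)) = length (fst x @ fst y)"
      "pre x (take ?n (map Not v)) @ pre y (drop ?n (map Not v)) = neg (pre x (take ?n v) @ pre y (drop ?n v))"
      by simp_all
    show "part x (take ?n v) \<otimes> part y (drop ?n v)
         \<in> hom M (T (pre x (take ?n v) @ pre y (drop ?n v)) (fst x @ fst y)) (T v (fst (snd x) @ fst (snd y)))"
      unfolding vv(1) by (simp add: hom_def tensor_objs_append)
    let ?I = "\<lambda>v cs v' cs'. Idt M (T v cs) \<otimes> Brd M (T (neg v) cs) (T v' cs') \<otimes> Idt M (T (neg v') cs')"
    let ?x = "part x (all_true ?n)" and ?y = "part y (all_true ?m)"
    have "unshuffle M v (fst (snd x) @ fst (snd y)) \<cdot> (?x \<otimes> ?y)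
       = ?I v1 (fst (snd x)) v2 (fst (snd y)) \<cdot> ((unshuffle M v1 (fst (snd x)) \<cdot> ?x) \<otimes> (unshuffle M v2 (fst (snd y)) \<cdot> ?y))"
      unfolding vv(1) by (simp add: unshuffle_append interchange)
    also have "\<dots> = ?I v1 (fst (snd x)) v2 (fst (snd y)) \<cdot> ((part x v1 \<otimes> part x (neg v1)) \<otimes> (part y v2 \<otimes> part y (neg v2))) \<cdot>
        (unshuffle M (pre x v1) (fst x) \<otimes> unshuffle M (pre y v2) (fst y))"
      by (simp add: X(10) Y(10) interchange del: tenA_assoc)
    also have "\<dots> = (?I v1 (fst (snd x)) v2 (fst (snd y)) \<cdot> ((part x v1 \<otimes> part x (neg v1)) \<otimes> (part y v2 \<otimes> part y (neg v2)))) \<cdot>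
        (unshuffle M (pre x v1) (fst x) \<otimes> unshuffle M (pre y v2) (fst y))"
      by (rule comp_assoc_arr[symmetric]) simp_all
    also have "?I v1 (fst (snd x)) v2 (fst (snd y)) \<cdot> ((part x v1 \<otimes> part x (neg v1)) \<otimes> (part y v2 \<otimes> part y (neg v2))) =
       part x v1 \<otimes> (Brd M (T (neg v1) (fst (snd x))) (T v2 (fst (snd y))) \<cdot> (part x (neg v1) \<otimes> part y v2)) \<otimes> part y (neg v2)"
      using interchange[of "part x v1" "Idt M (T v1 (fst (snd x)))" "part x (neg v1) \<otimes> part y v2 \<otimes> part y (neg v2)"
          "Brd M (T (neg v1) (fst (snd x))) (T v2 (fst (snd y))) \<otimes> Idt M (T (neg v2) (fst (snd y)))"]
        interchange[of "part x (neg v1) \<otimes> part y v2" "Brd M (T (neg v1) (fst (snd x))) (T v2 (fst (snd y)))"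
            "part y (neg v2)" "Idt M (T (neg v2) (fst (snd y)))"] by simp
    also have "Brd M (T (neg v1) (fst (snd x))) (T v2 (fst (snd y))) \<cdot> (part x (neg v1) \<otimes> part y v2) =
        (part y v2 \<otimes> part x (neg v1)) \<cdot> Brd M (T (neg (pre x v1)) (fst x)) (T (pre y v2) (fst y))"
      using brd_natural_arr[of "part x (neg v1)" "part y v2"] by simp
    also have "part x v1 \<otimes> ((part y v2 \<otimes> part x (neg v1)) \<cdot> Brd M (T (neg (pre x v1)) (fst x)) (T (pre y v2) (fst y))) \<otimes> part y (neg v2)
       = ((part x v1 \<otimes> part y v2) \<otimes> (part x (neg v1) \<otimes> part y (neg v2))) \<cdot> ?I (pre x v1) (fst x) (pre y v2) (fst y)"
      using interchange[of "Idt M (T (pre x v1) (fst x))" "part x v1" "Brd M (T (neg (pre x v1)) (fst x)) (T (pre y v2) (fst y)) \<otimes> Idt M (T (neg (pre y v2)) (fst y))"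
          "part y v2 \<otimes> part x (neg v1) \<otimes> part y (neg v2)"]
        interchange[of "Brd M (T (neg (pre x v1)) (fst x)) (T (pre y v2) (fst y))" "part y v2 \<otimes> part x (neg v1)"
            "Idt M (T (neg (pre y v2)) (fst y))" "part y (neg v2)"] by simp
    also have "(((part x v1 \<otimes> part y v2) \<otimes> (part x (neg v1) \<otimes> part y (neg v2))) \<cdot> ?I (pre x v1) (fst x) (pre y v2) (fst y)) \<cdot>
        (unshuffle M (pre x v1) (fst x) \<otimes> unshuffle M (pre y v2) (fst y)) =
        ((part x v1 \<otimes> part y v2) \<otimes> (part x (neg v1) \<otimes> part y (neg v2))) \<cdot> unshuffle M (pre x v1 @ pre y v2) (fst x @ fst y)"
      by (simp add: unshuffle_append)
    finally show "unshuffle M v (fst (snd x) @ fst (snd y)) \<cdot> (part x (take ?n (all_true (length (fst (snd x) @ fst (snd y)))))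
          \<otimes> part y (drop ?n (all_true (length (fst (snd x) @ fst (snd y)))))) =
        ((part x (take ?n v) \<otimes> part y (drop ?n v)) \<otimes> part x (take ?n (map Not v)) \<otimes> part y (drop ?n (map Not v))) \<cdot>
        unshuffle M (pre x (take ?n v) @ pre y (drop ?n v)) (fst x @ fst y)"
      by simp
  qed (insert X(1-4) Y(1-4), simp_all add: replicate_add)
  then show "x \<otimes>\<^bsub>W\<^esub> y \<in> marked_arrs M C" by (simp add: marked_cat_def Let_def)
qed (auto simp: marked_cat_def Let_def)

lemma W_brd:
  assumes "set cs \<subseteq> C" "set ds \<subseteq> C"
  shows "Brd W cs ds \<in> marked_arrs M C" "fst (Brd W cs ds) = cs @ ds" "fst (snd (Brd W cs ds)) = ds @ cs"
    "length v = length cs + length ds \<Longrightarrow> pre (Brd W cs ds) v = drop (length ds) v @ take (length ds) v"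
    "length v = length cs + length ds \<Longrightarrow>
       part (Brd W cs ds) v = Brd M (T (drop (length ds) v) cs) (T (take (length ds) v) ds)"
proof -
  let ?n = "length ds"
  have [simp]: "set cs \<subseteq> C" "set ds \<subseteq> C" by fact+
  have "mk_arr (cs @ ds) (ds @ cs) (\<lambda>v. drop ?n v @ take ?n v)
         (\<lambda>v. Brd M (T (drop ?n v) cs) (T (take ?n v) ds)) \<in> marked_arrs M C"
    unfolding mk_arr_marked
  proof (intro conjI allI impI)
    fix v :: "bool list" assume v': "length v = length (ds @ cs)"
    then have v: "length v = length ds + length cs" by simp
    then show "length (drop ?n v @ take ?n v) = length (cs @ ds)" by simp
    show "drop ?n (map Not v) @ take ?n (map Not v) = map Not (drop ?n v @ take ?n v)"
      by (simp add: take_map drop_map)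
    define v1 v2 where "v1 = take ?n v" and "v2 = drop ?n v"
    have vv: "v = v1 @ v2" "length v1 = length ds" "length v2 = length cs" using v by (simp_all add: v1_def v2_def)
    have [simp]: "take ?n (map Not v) = neg v1" "drop ?n (map Not v) = neg v2" "take ?n v = v1" "drop ?n v = v2"
      by (simp_all add: vv)
    show "Brd M (T (drop ?n v) cs) (T (take ?n v) ds) \<in> hom M (T (drop ?n v @ take ?n v) (cs @ ds)) (T v (ds @ cs))"
      unfolding vv(1) using vv by (simp add: hom_def tensor_objs_append)
    show "unshuffle M v (ds @ cs) \<cdot>
         Brd M (T (drop ?n (all_true (length (ds @ cs)))) cs) (T (take ?n (all_true (length (ds @ cs)))) ds) =
         (Brd M (T (drop ?n v) cs) (T (take ?n v) ds) \<otimes> Brd M (T (drop ?n (map Not v)) cs) (T (take ?n (map Not v)) ds)) \<cdot>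
         unshuffle M (drop ?n v @ take ?n v) (cs @ ds)"
      using unshuffle_brd[of v2 cs v1 ds] vv by simp
  qed (simp_all add: replicate_add)
  then show "Brd W cs ds \<in> marked_arrs M C" by (simp add: marked_cat_def Let_def)
qed (auto simp: marked_cat_def Let_def)

lemma W_strict [simp]:
  "Asc W cs ds es = Idt W (cs @ ds @ es)" "Lun W cs = Idt W cs" "Run W cs = Idt W cs"
  by (auto simp: marked_cat_def)

text \<open>The substantial axioms are checked marking by marking through
  \<open>marked_arr_eqI\<close>, where each becomes an identity in \<open>M\<close> between the
  selected factors.\<close>

lemma symmetric_strict_monoidal_W: "symmetric_strict_monoidal W"
proof -
  note A = marked_arr_simps
  interpret W: category W
  proof
    fix x y z a b c d
    show "x \<in> Arr W \<Longrightarrow> Dom W x \<in> Obj W" "x \<in> Arr W \<Longrightarrow> Cod W x \<in> Obj W"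
      by (auto dest: A(1,2))
    show "a \<in> Obj W \<Longrightarrow> Idt W a \<in> hom W a a" using W_idt[of a] by (auto simp: hom_def)
    show "x \<in> hom W a b \<Longrightarrow> y \<in> hom W b c \<Longrightarrow> y \<cdot>\<^bsub>W\<^esub> x \<in> hom W a c"
      using W_comp[of x y] by (auto simp: hom_def)
    show "x \<in> hom W a b \<Longrightarrow> x \<cdot>\<^bsub>W\<^esub> Idt W a = x"
    proof -
      assume x: "x \<in> hom W a b"
      then have x': "x \<in> marked_arrs M C" "fst x = a" "fst (snd x) = b" by (auto simp: hom_def)
      then have a: "set a \<subseteq> C" using A(1)[OF x'(1)] by simp
      show ?thesis by (rule marked_arr_eqI) (insert x' a, simp_all add: W_comp W_idt A)
    qed
    show "x \<in> hom W a b \<Longrightarrow> Idt W b \<cdot>\<^bsub>W\<^esub> x = x"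
    proof -
      assume x: "x \<in> hom W a b"
      then have x': "x \<in> marked_arrs M C" "fst x = a" "fst (snd x) = b" by (auto simp: hom_def)
      then have a: "set b \<subseteq> C" using A(2)[OF x'(1)] by simp
      show ?thesis by (rule marked_arr_eqI) (insert x' a, simp_all add: W_comp W_idt A)
    qed
    show "x \<in> hom W a b \<Longrightarrow> y \<in> hom W b c \<Longrightarrow> z \<in> hom W c d \<Longrightarrow> (z \<cdot>\<^bsub>W\<^esub> y) \<cdot>\<^bsub>W\<^esub> x = z \<cdot>\<^bsub>W\<^esub> y \<cdot>\<^bsub>W\<^esub> x"
    proof -
      assume x: "x \<in> hom W a b" "y \<in> hom W b c" "z \<in> hom W c d"
      then have x': "x \<in> marked_arrs M C" "fst x = a" "fst (snd x) = b"
        "y \<in> marked_arrs M C" "fst y = b" "fst (snd y) = c" "z \<in> marked_arrs M C" "fst z = c" "fst (snd z) = d"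
        by (auto simp: hom_def)
      show ?thesis by (rule marked_arr_eqI) (insert x', simp_all add: W_comp A)
    qed
  qed
  have tA: "(x \<otimes>\<^bsub>W\<^esub> y) \<otimes>\<^bsub>W\<^esub> z = x \<otimes>\<^bsub>W\<^esub> (y \<otimes>\<^bsub>W\<^esub> z)"
    if x: "x \<in> marked_arrs M C" "y \<in> marked_arrs M C" "z \<in> marked_arrs M C" for x y z
    by (rule marked_arr_eqI) (insert x, simp_all add: W_tensor A drop_take add.commute)
  have tI: "Idt W a \<otimes>\<^bsub>W\<^esub> Idt W b = Idt W (a @ b)" if "set a \<subseteq> C" "set b \<subseteq> C" for a b
  proof (rule marked_arr_eqI)
    fix v :: "bool list" assume "length v = length (fst (snd (Idt W (a @ b))))"
    then have "length v = length a + length b" using that by (simp add: W_idt)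
    then obtain v1 v2 where "v = v1 @ v2" "length v1 = length a" "length v2 = length b"
      by (metis append_take_drop_id length_drop length_take add_diff_cancel_left' le_add1 min.absorb2)
    then show "part (Idt W a \<otimes>\<^bsub>W\<^esub> Idt W b) v = part (Idt W (a @ b)) v"
      using that by (simp add: W_tensor W_idt tensor_objs_append)
  qed (insert that, simp_all add: W_tensor W_idt)
  have tL: "Idt W [] \<otimes>\<^bsub>W\<^esub> x = x" "x \<otimes>\<^bsub>W\<^esub> Idt W [] = x" if x: "x \<in> marked_arrs M C" for x
    by (rule marked_arr_eqI; insert x, simp add: W_tensor W_idt A)+
  have iso: "is_iso W (Idt W a)" if "set a \<subseteq> C" for a
    using that W.idt_hom[of a] unfolding is_iso_def
    by (auto simp: W_idt intro!: bexI[of _ "Idt W a"] W.comp_idt)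
  show ?thesis
  proof (unfold_locales, goal_cases)
    case 1 then show ?case by simp
  next
    case (2 x y) then show ?case by simp
  next
    case (3 f x x' g y y') then show ?case using W_tensor[of f g] by (auto simp: hom_def)
  next
    case (4 x y) then show ?case using tI by simp
  next
    case (5 f x x' f' x'' g y y' g' y'')
    then have x': "f \<in> marked_arrs M C" "fst f = x" "fst (snd f) = x'" "f' \<in> marked_arrs M C" "fst f' = x'" "fst (snd f') = x''"
      "g \<in> marked_arrs M C" "fst g = y" "fst (snd g) = y'" "g' \<in> marked_arrs M C" "fst g' = y'" "fst (snd g') = y''"
      by (auto simp: hom_def)
    show ?case by (rule marked_arr_eqI) (insert x', simp_all add: W_comp W_tensor A interchange)
  next
    case (6 x y z) then show ?case using W.idt_hom[of "x @ y @ z"] by simp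
  next
    case (7 x y z) then show ?case using iso[of "x @ y @ z"] by simp
  next
    case (8 f x x' g y y' h z z')
    then have x': "f \<in> marked_arrs M C" "fst f = x" "fst (snd f) = x'" "g \<in> marked_arrs M C" "fst g = y" "fst (snd g) = y'"
      "h \<in> marked_arrs M C" "fst h = z" "fst (snd h) = z'" by (auto simp: hom_def)
    have "f \<otimes>\<^bsub>W\<^esub> (g \<otimes>\<^bsub>W\<^esub> h) \<in> hom W (x @ y @ z) (x' @ y' @ z')" using x' by (simp add: hom_def W_tensor)
    then show ?case using x' tA[of f g h] W.comp_idt_right W.comp_idt_left by simp
  next
    case (9 x) then show ?case using W.idt_hom[of x] by simp
  next
    case (10 x) then show ?case using iso by simp
  next
    case (11 f x x')
    then show ?case using tL(1)[of f] W.comp_idt_right[OF 11] W.comp_idt_left[OF 11] by (simp add: hom_def)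
  next
    case (12 x) then show ?case using W.idt_hom[of x] by simp
  next
    case (13 x) then show ?case using iso by simp
  next
    case (14 f x x')
    then show ?case using tL(2)[of f] W.comp_idt_right[OF 14] W.comp_idt_left[OF 14] by (simp add: hom_def)
  next
    case (15 x y) then show ?case using W_brd[of x y] by (simp add: hom_def)
  next
    case (16 f x x' g y y')
    then have x': "f \<in> marked_arrs M C" "fst f = x" "fst (snd f) = x'" "g \<in> marked_arrs M C" "fst g = y" "fst (snd g) = y'"
      by (auto simp: hom_def)
    have s: "set x \<subseteq> C" "set y \<subseteq> C" "set x' \<subseteq> C" "set y' \<subseteq> C" using x' A(1,2) by blast+
    show ?case
    proof (rule marked_arr_eqI)
      fix v :: "bool list" assume "length v = length (fst (snd ((g \<otimes>\<^bsub>W\<^esub> f) \<cdot>\<^bsub>W\<^esub> Brd W x y)))"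
      then have v: "length v = length y' + length x'" using x' s by (simp add: W_comp W_tensor W_brd)
      show "pre (Brd W x' y' \<cdot>\<^bsub>W\<^esub> (f \<otimes>\<^bsub>W\<^esub> g)) v = pre ((g \<otimes>\<^bsub>W\<^esub> f) \<cdot>\<^bsub>W\<^esub> Brd W x y) v"
        using x' s v by (simp add: W_comp W_tensor W_brd A)
      show "part (Brd W x' y' \<cdot>\<^bsub>W\<^esub> (f \<otimes>\<^bsub>W\<^esub> g)) v = part ((g \<otimes>\<^bsub>W\<^esub> f) \<cdot>\<^bsub>W\<^esub> Brd W x y) v"
        using x' s v brd_natural_arr[of "part f (drop (length y') v)" "part g (take (length y') v)"]
        by (simp add: W_comp W_tensor W_brd A)
    qed (insert x' s, simp_all add: W_comp W_tensor W_brd)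
  next
    case (17 x y)
    show ?case
    proof (rule marked_arr_eqI)
      fix v :: "bool list" assume "length v = length (fst (snd (Idt W (x \<odot>\<^bsub>W\<^esub> y))))"
      then have v: "length v = length x + length y" using 17 by (simp add: W_idt)
      then obtain v1 v2 where v12: "v = v1 @ v2" "length v1 = length x" "length v2 = length y"
        by (metis append_take_drop_id length_drop length_take add_diff_cancel_left' le_add1 min.absorb2)
      show "pre (Brd W y x \<cdot>\<^bsub>W\<^esub> Brd W x y) v = pre (Idt W (x \<odot>\<^bsub>W\<^esub> y)) v"
        using 17 v12 by (simp add: W_comp W_brd W_idt)
      show "part (Brd W y x \<cdot>\<^bsub>W\<^esub> Brd W x y) v = part (Idt W (x \<odot>\<^bsub>W\<^esub> y)) v"
        using 17 v12 by (simp add: W_comp W_brd W_idt tensor_objs_append)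
    qed (insert 17, simp_all add: W_comp W_brd W_idt)
  next
    case (18 w x y z)
    then have "set (w @ x @ y @ z) \<subseteq> C" by simp
    then show ?case using 18 tI by (simp add: W_idt)
  next
    case (19 x y) then show ?case using tI by (simp add: W_idt)
  next
    case (20 x y z)
    have s: "set x \<subseteq> C" "set y \<subseteq> C" "set z \<subseteq> C" using 20 by auto
    have b: "Brd W x (y @ z) \<in> hom W (x @ y @ z) (y @ z @ x)" "Brd W x y \<otimes>\<^bsub>W\<^esub> Idt W z \<in> hom W (x @ y @ z) (y @ x @ z)"
      using s by (simp_all add: hom_def W_tensor W_brd W_idt)
    have "Brd W x (y @ z) = (Idt W y \<otimes>\<^bsub>W\<^esub> Brd W x z) \<cdot>\<^bsub>W\<^esub> (Brd W x y \<otimes>\<^bsub>W\<^esub> Idt W z)"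
    proof (rule marked_arr_eqI)
      fix v :: "bool list" assume "length v = length (fst (snd ((Idt W y \<otimes>\<^bsub>W\<^esub> Brd W x z) \<cdot>\<^bsub>W\<^esub> (Brd W x y \<otimes>\<^bsub>W\<^esub> Idt W z))))"
      then have v: "length v = length y + (length z + length x)" using s by (simp add: W_comp W_brd W_idt W_tensor)
      define v1 v2 v3 where "v1 = take (length y) v" "v2 = take (length z) (drop (length y) v)" "v3 = drop (length z) (drop (length y) v)"
      then have v12: "v = v1 @ v2 @ v3" "length v1 = length y" "length v2 = length z" "length v3 = length x"
        using v by (simp_all del: drop_drop)
      show "pre (Brd W x (y @ z)) v = pre ((Idt W y \<otimes>\<^bsub>W\<^esub> Brd W x z) \<cdot>\<^bsub>W\<^esub> (Brd W x y \<otimes>\<^bsub>W\<^esub> Idt W z)) v"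
        using s v12 by (simp add: W_comp W_brd W_idt W_tensor)
      show "part (Brd W x (y @ z)) v = part ((Idt W y \<otimes>\<^bsub>W\<^esub> Brd W x z) \<cdot>\<^bsub>W\<^esub> (Brd W x y \<otimes>\<^bsub>W\<^esub> Idt W z)) v"
        using s v12 by (simp add: W_comp W_brd W_idt W_tensor tensor_objs_append brd_tensor_right)
    qed (insert s, simp_all add: W_comp W_brd W_idt W_tensor)
    then show ?case using W.comp_idt_right[OF b(1)] W.comp_idt_left[OF b(1)] W.comp_idt_left[OF b(2)] by simp
  next
    case (21 x y z) then show ?case by simp
  next
    case (22 x) then show ?case by simp
  next
    case (23 x) then show ?case by simp
  next
    case (24 x y z) then show ?case by simp
  next
    case (25 x) then show ?case by simp
  next
    case (26 x) then show ?case by simp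
  qed
qed

end

section \<open>Transport along injections into the universe\<close>

text \<open>Freeness is tested only against categories on the universe type. This is the copy of a
  category on other types along codings of its objects and arrows, with \<open>inv_into\<close> as
  the decoding.\<close>

definition transport_smcat :: "('o \<Rightarrow> 'p) \<Rightarrow> ('a \<Rightarrow> 'b) \<Rightarrow> ('o, 'a) smcat \<Rightarrow> ('p, 'b) smcat" where
  "transport_smcat e e' W = (let d = inv_into (Obj W) e; d' = inv_into (Arr W) e' in \<lparr>
     Obj = e ` Obj W,
     Arr = e' ` Arr W,
     Dom = (\<lambda>f. e (Dom W (d' f))),
     Cod = (\<lambda>f. e (Cod W (d' f))),
     Idt = (\<lambda>x. e' (Idt W (d x))),
     Comp = (\<lambda>g f. e' (d' g \<cdot>\<^bsub>W\<^esub> d' f)),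
     TenO = (\<lambda>x y. e (d x \<odot>\<^bsub>W\<^esub> d y)),
     TenA = (\<lambda>f g. e' (d' f \<otimes>\<^bsub>W\<^esub> d' g)),
     Unt = e (Unt W),
     Asc = (\<lambda>x y z. e' (Asc W (d x) (d y) (d z))),
     Lun = (\<lambda>x. e' (Lun W (d x))),
     Run = (\<lambda>x. e' (Run W (d x))),
     Brd = (\<lambda>x y. e' (Brd W (d x) (d y)))\<rparr>)"

locale smcat_transport = W: symmetric_strict_monoidal W
  for W :: "('o, 'a) smcat" +
  fixes e :: "'o \<Rightarrow> 'p" and e' :: "'a \<Rightarrow> 'b"
  assumes inj_obj: "inj_on e (Obj W)" and inj_arr: "inj_on e' (Arr W)"
begin

abbreviation W' where "W' \<equiv> transport_smcat e e' W"

lemma transport_simps [simp]: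
  "Obj W' = e ` Obj W" "Arr W' = e' ` Arr W"
  "f \<in> Arr W \<Longrightarrow> Dom W' (e' f) = e (Dom W f)"
  "f \<in> Arr W \<Longrightarrow> Cod W' (e' f) = e (Cod W f)"
  "x \<in> Obj W \<Longrightarrow> Idt W' (e x) = e' (Idt W x)"
  "f \<in> Arr W \<Longrightarrow> g \<in> Arr W \<Longrightarrow> e' g \<cdot>\<^bsub>W'\<^esub> e' f = e' (g \<cdot>\<^bsub>W\<^esub> f)"
  "x \<in> Obj W \<Longrightarrow> y \<in> Obj W \<Longrightarrow> e x \<odot>\<^bsub>W'\<^esub> e y = e (x \<odot>\<^bsub>W\<^esub> y)"
  "f \<in> Arr W \<Longrightarrow> g \<in> Arr W \<Longrightarrow> e' f \<otimes>\<^bsub>W'\<^esub> e' g = e' (f \<otimes>\<^bsub>W\<^esub> g)"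
  "Unt W' = e (Unt W)"
  "x \<in> Obj W \<Longrightarrow> y \<in> Obj W \<Longrightarrow> z \<in> Obj W \<Longrightarrow> Asc W' (e x) (e y) (e z) = e' (Asc W x y z)"
  "x \<in> Obj W \<Longrightarrow> Lun W' (e x) = e' (Lun W x)"
  "x \<in> Obj W \<Longrightarrow> Run W' (e x) = e' (Run W x)"
  "x \<in> Obj W \<Longrightarrow> y \<in> Obj W \<Longrightarrow> Brd W' (e x) (e y) = e' (Brd W x y)"
  using inj_obj inj_arr by (auto simp: transport_smcat_def Let_def)

lemma e_eq [simp]: "x \<in> Obj W \<Longrightarrow> y \<in> Obj W \<Longrightarrow> e x = e y \<longleftrightarrow> x = y"
  using inj_obj by (auto dest: inj_onD)

lemma transport_homE:
  assumes "f \<in> hom W' x y"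
  obtains f0 where "f = e' f0" "f0 \<in> Arr W" "x = e (Dom W f0)" "y = e (Cod W f0)"
  using assms by (auto simp: hom_def)

lemma transport_objE:
  assumes "x \<in> Obj W'"
  obtains x0 where "x = e x0" "x0 \<in> Obj W"
  using assms by auto

lemma transport_iso: "f \<in> Arr W \<Longrightarrow> is_iso W f \<Longrightarrow> is_iso W' (e' f)"
  unfolding is_iso_def by (auto simp: hom_def intro!: bexI)

lemma W_str_arr [simp]:
  "x \<in> Obj W \<Longrightarrow> y \<in> Obj W \<Longrightarrow> z \<in> Obj W \<Longrightarrow> Asc W x y z = Idt W (x \<odot>\<^bsub>W\<^esub> y \<odot>\<^bsub>W\<^esub> z)"
  "x \<in> Obj W \<Longrightarrow> Lun W x = Idt W x" "x \<in> Obj W \<Longrightarrow> Run W x = Idt W x"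
  by (simp_all add: W.strict_asc W.strict_lun W.strict_run)

lemma idt_iso [simp]: "x \<in> Obj W \<Longrightarrow> is_iso W (Idt W x)"
  using W.idt_hom[of x] by (auto simp: is_iso_def intro!: bexI[of _ "Idt W x"])

lemma symmetric_strict_monoidal_transport: "symmetric_strict_monoidal W'"
  apply unfold_locales
  apply (auto simp: hom_def W.interchange W.brd_natural_arr W.brd_tensor_right intro!: transport_iso
    elim!: transport_homE transport_objE)
  done

lemma strict_monoidal_functor_transport: "strict_monoidal_functor W W' \<lparr>fobj = e, farr = e'\<rparr>"
  by (auto simp: strict_monoidal_functor_def cat_functor_def hom_def)

lemma strict_monoidal_functor_transport_inv:
  "strict_monoidal_functor W' W \<lparr>fobj = inv_into (Obj W) e, farr = inv_into (Arr W) e'\<rparr>"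
  using inj_obj inj_arr
  by (auto simp: strict_monoidal_functor_def cat_functor_def hom_def)

end

section \<open>The universal property against test categories on other types\<close>

lemma strict_monoidal_functor_comp:
  assumes "strict_monoidal_functor A B F" "strict_monoidal_functor B C G"
  shows "strict_monoidal_functor A C (G \<circ>\<^sub>F F)"
  using assms cat_functor_comp[of A B F C G] unfolding strict_monoidal_functor_def
  by (auto simp: functor_comp_def cat_functorD)

lemma strict_monoidal_functor_id:
  assumes "category A"
  shows "strict_monoidal_functor A A \<lparr>fobj = \<lambda>x. x, farr = \<lambda>f. f\<rparr>"
  by (auto simp: strict_monoidal_functor_def cat_functor_def hom_def)

lemma operad_morphism_operad_ofD:
  assumes "operad_morphism R (operad_of W) \<Phi>"
  shows "c \<in> Col R \<Longrightarrow> ocol \<Phi> c \<in> Obj W"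
    "c \<in> Col R \<Longrightarrow> oop \<Phi> (One R c) = ([ocol \<Phi> c], Idt W (ocol \<Phi> c))"
    "x \<in> Ops R \<Longrightarrow> set (fst (oop \<Phi> x)) \<subseteq> Obj W"
    "x \<in> Ops R \<Longrightarrow> snd (oop \<Phi> x) \<in> Arr W"
    "x \<in> Ops R \<Longrightarrow> Dom W (snd (oop \<Phi> x)) = tensor_objs W (fst (oop \<Phi> x))"
    "x \<in> Ops R \<Longrightarrow> Cod W (snd (oop \<Phi> x)) = ocol \<Phi> (Tgt R x)"
    "x \<in> Ops R \<Longrightarrow> fst (oop \<Phi> x) = map (ocol \<Phi>) (Src R x)"
    "x \<in> Ops R \<Longrightarrow> set ys \<subseteq> Ops R \<Longrightarrow> map (Tgt R) ys = Src R x \<Longrightarrow> oop \<Phi> (Sub R x ys) =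
       (concat (map (fst \<circ> oop \<Phi>) ys), snd (oop \<Phi> x) \<cdot>\<^bsub>W\<^esub> tensor_arrs W (map (snd \<circ> oop \<Phi>) ys))"
    "x \<in> Ops R \<Longrightarrow> \<sigma> permutes {..<length (Src R x)} \<Longrightarrow> oop \<Phi> (Act R x \<sigma>) =
       (permute_list \<sigma> (fst (oop \<Phi> x)), snd (oop \<Phi> x) \<cdot>\<^bsub>W\<^esub> perm_arr W \<sigma> (permute_list \<sigma> (fst (oop \<Phi> x))))"
proof -
  note m = assms[unfolded operad_morphism_def]
  show "c \<in> Col R \<Longrightarrow> ocol \<Phi> c \<in> Obj W"
    "c \<in> Col R \<Longrightarrow> oop \<Phi> (One R c) = ([ocol \<Phi> c], Idt W (ocol \<Phi> c))"
    using m by (simp_all add: operad_of_def)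
  assume x: "x \<in> Ops R"
  then have "oop \<Phi> x \<in> Ops (operad_of W)" "Src (operad_of W) (oop \<Phi> x) = map (ocol \<Phi>) (Src R x)"
    "Tgt (operad_of W) (oop \<Phi> x) = ocol \<Phi> (Tgt R x)"
    using m by blast+
  then show "set (fst (oop \<Phi> x)) \<subseteq> Obj W" "snd (oop \<Phi> x) \<in> Arr W"
    "Dom W (snd (oop \<Phi> x)) = tensor_objs W (fst (oop \<Phi> x))"
    "Cod W (snd (oop \<Phi> x)) = ocol \<Phi> (Tgt R x)" "fst (oop \<Phi> x) = map (ocol \<Phi>) (Src R x)"
    by (auto simp: operad_of_def split_def)
  show "oop \<Phi> (Sub R x ys) = (concat (map (fst \<circ> oop \<Phi>) ys), snd (oop \<Phi> x) \<cdot>\<^bsub>W\<^esub> tensor_arrs W (map (snd \<circ> oop \<Phi>) ys))"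
    if "set ys \<subseteq> Ops R" "map (Tgt R) ys = Src R x"
  proof -
    have "oop \<Phi> (Sub R x ys) = Sub (operad_of W) (oop \<Phi> x) (map (oop \<Phi>) ys)" using m x that by blast
    then show ?thesis by (simp add: operad_of_def split_def)
  qed
  show "oop \<Phi> (Act R x \<sigma>) =
       (permute_list \<sigma> (fst (oop \<Phi> x)), snd (oop \<Phi> x) \<cdot>\<^bsub>W\<^esub> perm_arr W \<sigma> (permute_list \<sigma> (fst (oop \<Phi> x))))"
    if "\<sigma> permutes {..<length (Src R x)}"
  proof -
    have "oop \<Phi> (Act R x \<sigma>) = Act (operad_of W) (oop \<Phi> x) \<sigma>" using m x that by blast
    then show ?thesis by (simp add: operad_of_def split_def)
  qed
qed

lemma permute_list_inv_permute:
  assumes "\<rho> permutes {..<length xs}"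
  shows "permute_list (inv \<rho>) (permute_list \<rho> xs) = xs"
  using permute_list_compose[of "inv \<rho>" xs \<rho>] permutes_inv[OF assms] assms by (simp add: permutes_inv_o)

text \<open>Substitution and action in \<open>operad_of\<close> are built from n-ary tensor products
  and symmetries, both preserved by a strict functor. It serves to carry a morphism of operads along
  the coding of a test category into the universe.\<close>

lemma (in strict_monoidal) operad_morphism_opmor_of:
  assumes "operad_morphism R (operad_of A) \<Phi>"
  shows "operad_morphism R (operad_of B) (opmor_of K \<circ>\<^sub>O \<Phi>)"
proof -
  note \<Phi> = operad_morphism_operad_ofD[OF assms]
  have k: "ocol (opmor_of K \<circ>\<^sub>O \<Phi>) c = fobj K (ocol \<Phi> c)"
    "oop (opmor_of K \<circ>\<^sub>O \<Phi>) x = (map (fobj K) (fst (oop \<Phi> x)), farr K (snd (oop \<Phi> x)))" for c x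
    by (simp_all add: opmor_comp_def opmor_of_def split_def)
  show ?thesis
    unfolding operad_morphism_def k
  proof (intro conjI ballI impI allI)
    fix c assume c: "c \<in> Col R"
    show "fobj K (ocol \<Phi> c) \<in> Col (operad_of B)" using \<Phi>(1)[OF c] by (simp add: operad_of_def)
    show "(map (fobj K) (fst (oop \<Phi> (One R c))), farr K (snd (oop \<Phi> (One R c)))) = One (operad_of B) (fobj K (ocol \<Phi> c))"
      using \<Phi>(1)[OF c] by (simp add: operad_of_def \<Phi>(2)[OF c])
  next
    fix x assume x: "x \<in> Ops R"
    let ?xs = "fst (oop \<Phi> x)" and ?f = "snd (oop \<Phi> x)"
    note a = \<Phi>(3-6)[OF x]
    show "(map (fobj K) ?xs, farr K ?f) \<in> Ops (operad_of B)"
      using a by (auto simp: operad_of_def functor_tensor_objs)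
    show "Src (operad_of B) (map (fobj K) ?xs, farr K ?f) = map (\<lambda>c. fobj K (ocol \<Phi> c)) (Src R x)"
      by (simp add: operad_of_def \<Phi>(7)[OF x])
    show "Tgt (operad_of B) (map (fobj K) ?xs, farr K ?f) = fobj K (ocol \<Phi> (Tgt R x))"
      using a by (simp add: operad_of_def)
    fix \<sigma> assume s: "\<sigma> permutes {..<length (Src R x)}"
    then have p: "\<sigma> permutes {..<length ?xs}" using \<Phi>(7)[OF x] by simp
    let ?ps = "permute_list \<sigma> ?xs"
    have q: "\<sigma> permutes {..<length ?ps}" "set ?ps \<subseteq> Obj A" using p a(1) by simp_all
    have "permute_list (inv \<sigma>) ?ps = ?xs"
      using p by (rule permute_list_inv_permute)
    with A.perm_arr_simps[OF q]
    have "farr K (?f \<cdot>\<^bsub>A\<^esub> perm_arr A \<sigma> ?ps) = farr K ?f \<cdot>\<^bsub>B\<^esub> perm_arr B \<sigma> (map (fobj K) ?ps)"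
      using a(2,3) functor_perm_arr[OF q] by simp
    then show "(map (fobj K) (fst (oop \<Phi> (Act R x \<sigma>))), farr K (snd (oop \<Phi> (Act R x \<sigma>)))) =
        Act (operad_of B) (map (fobj K) ?xs, farr K ?f) \<sigma>"
      using permute_list_map[OF p, of "fobj K"] by (simp add: operad_of_def \<Phi>(9)[OF x s])
  next
    fix x ys assume x: "x \<in> Ops R" and "set ys \<subseteq> Ops R \<and> map (Tgt R) ys = Src R x"
    then have ys: "set ys \<subseteq> Ops R" "map (Tgt R) ys = Src R x" by auto
    let ?f = "snd (oop \<Phi> x)" and ?gs = "map (snd \<circ> oop \<Phi>) ys"
    note a = \<Phi>(3-6)[OF x]
    have y: "snd (oop \<Phi> y) \<in> Arr A" "Cod A (snd (oop \<Phi> y)) = ocol \<Phi> (Tgt R y)" if "y \<in> set ys" for y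
      using \<Phi>(4,6)[of y] that ys(1) by auto
    have b: "set ?gs \<subseteq> Arr A" using y(1) by auto
    have "map (Cod A) ?gs = map (ocol \<Phi>) (map (Tgt R) ys)" using y(2) by simp
    then have c: "map (Cod A) ?gs = fst (oop \<Phi> x)" using \<Phi>(7)[OF x] ys(2) by simp
    have "farr K (?f \<cdot>\<^bsub>A\<^esub> tensor_arrs A ?gs) = farr K ?f \<cdot>\<^bsub>B\<^esub> tensor_arrs B (map (farr K) ?gs)"
      using a(2,3) A.tensor_arrs_simps[OF b] functor_tensor_arrs[OF b] unfolding c by simp
    then show "(map (fobj K) (fst (oop \<Phi> (Sub R x ys))), farr K (snd (oop \<Phi> (Sub R x ys)))) =
        Sub (operad_of B) (map (fobj K) (fst (oop \<Phi> x)), farr K (snd (oop \<Phi> x)))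
          (map (\<lambda>x. (map (fobj K) (fst (oop \<Phi> x)), farr K (snd (oop \<Phi> x)))) ys)"
      by (simp add: operad_of_def \<Phi>(8)[OF x ys] map_concat comp_def)
  qed
qed

text \<open>The existence half of freeness for a test category on arbitrary types: its copy in the
  universe receives a functor, which is then composed with the decoding.\<close>

lemma free_sym_monoidal_functor:
  fixes F :: "('u, 'u) smcat" and W :: "('o, 'a) smcat" and e :: "'o \<Rightarrow> 'u" and e' :: "'a \<Rightarrow> 'u"
  assumes "free_sym_monoidal R F \<eta>" "symmetric_strict_monoidal W" "inj_on e (Obj W)" "inj_on e' (Arr W)"
    "operad_morphism R (operad_of W) \<Phi>"
  obtains K where "strict_monoidal_functor F W K" "opmor_eq R (opmor_of K \<circ>\<^sub>O \<eta>) \<Phi>"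
proof -
  interpret W: symmetric_strict_monoidal W by fact
  interpret smcat_transport W e e'
    using assms(3,4) by unfold_locales
  interpret W': symmetric_strict_monoidal W' by (rule symmetric_strict_monoidal_transport)
  let ?J = "\<lparr>fobj = e, farr = e'\<rparr>" and ?J' = "\<lparr>fobj = inv_into (Obj W) e, farr = inv_into (Arr W) e'\<rparr>"
  have "strict_monoidal W W' ?J"
    by unfold_locales (rule strict_monoidal_functor_transport)
  then have "operad_morphism R (operad_of W') (opmor_of ?J \<circ>\<^sub>O \<Phi>)"
    using assms(5) by (rule strict_monoidal.operad_morphism_opmor_of)
  with assms(1) W'.symmetric_strict_monoidal_axioms
  obtain K where K: "strict_monoidal_functor F W' K" "opmor_eq R (opmor_of K \<circ>\<^sub>O \<eta>) (opmor_of ?J \<circ>\<^sub>O \<Phi>)"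
    unfolding free_sym_monoidal_def by metis
  show ?thesis
  proof
    show "strict_monoidal_functor F W (?J' \<circ>\<^sub>F K)"
      using strict_monoidal_functor_comp[OF K(1) strict_monoidal_functor_transport_inv] .
    have \<eta>: "operad_morphism R (operad_of F) \<eta>" using assms(1) by (simp add: free_sym_monoidal_def)
    have i: "inv_into (Obj W) e (e x) = x" if "x \<in> Obj W" for x using that inj_obj by simp
    have i': "inv_into (Arr W) e' (e' x) = x" if "x \<in> Arr W" for x using that inj_arr by simp
    show "opmor_eq R (opmor_of (?J' \<circ>\<^sub>F K) \<circ>\<^sub>O \<eta>) \<Phi>"
      unfolding opmor_eq_def
    proof (intro conjI ballI)
      fix c assume c: "c \<in> Col R"
      then have "ocol \<Phi> c \<in> Obj W" using operad_morphism_operad_ofD(1)[OF assms(5)] by simp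
      then show "ocol (opmor_of (?J' \<circ>\<^sub>F K) \<circ>\<^sub>O \<eta>) c = ocol \<Phi> c"
        using K(2) c by (simp add: opmor_eq_def opmor_comp_def opmor_of_def functor_comp_def i)
    next
      fix x assume x: "x \<in> Ops R"
      obtain xs f where xf: "oop \<Phi> x = (xs, f)" by fastforce
      have xs: "set xs \<subseteq> Obj W" "f \<in> Arr W"
        using operad_morphism_operad_ofD(3,4)[OF assms(5) x] by (auto simp: xf)
      obtain ys g where yg: "oop \<eta> x = (ys, g)" by fastforce
      have "oop (opmor_of K \<circ>\<^sub>O \<eta>) x = oop (opmor_of ?J \<circ>\<^sub>O \<Phi>) x"
        using K(2) x unfolding opmor_eq_def by blast
      then have "map (fobj K) ys = map e xs" "farr K g = e' f"
        by (simp_all add: opmor_comp_def opmor_of_def xf yg)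
      moreover have "map (inv_into (Obj W) e) (map e xs) = xs" using xs(1) i by (auto intro!: map_idI)
      ultimately have "map (inv_into (Obj W) e) (map (fobj K) ys) = xs" "inv_into (Arr W) e' (farr K g) = f"
        using i'[OF xs(2)] by simp_all
      then show "oop (opmor_of (?J' \<circ>\<^sub>F K) \<circ>\<^sub>O \<eta>) x = oop \<Phi> x"
        by (simp add: opmor_comp_def opmor_of_def functor_comp_def xf yg comp_def)
    qed
  qed
qed

text \<open>An infinite cardinal equals its square.\<close>

lemma inj_prod_infinite: "\<exists>p :: 'u :: infinite \<times> 'u \<Rightarrow> 'u. inj p"
proof -
  have "\<exists>p. bij_betw p (UNIV \<times> UNIV :: ('u \<times> 'u) set) (UNIV :: 'u set)"
    unfolding card_of_ordIso by (rule card_of_Times_same_infinite) (rule infinite_UNIV)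
  then show ?thesis by (auto simp: bij_betw_def)
qed

lemma inj_nat_infinite: "\<exists>i :: nat \<Rightarrow> 'u :: infinite. inj i"
  using infinite_countable_subset[OF infinite_UNIV[where ?'a = 'u]] by auto

text \<open>Folding with an injective pairing is injective on lists of a fixed length; storing the
  length as well separates lists of different lengths.\<close>

lemma inj_list_infinite: "\<exists>e :: 'u :: infinite list \<Rightarrow> 'u. inj e"
proof -
  obtain p :: "'u \<times> 'u \<Rightarrow> 'u" where p: "inj p" using inj_prod_infinite by blast
  obtain i :: "nat \<Rightarrow> 'u" where i: "inj i" using inj_nat_infinite by blast
  define g where "g xs = foldr (\<lambda>x y. p (x, y)) xs (i 0)" for xs
  have g: "length xs = length ys \<Longrightarrow> g xs = g ys \<Longrightarrow> xs = ys" for xs ys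
    by (induction xs ys rule: list_induct2) (auto simp: g_def dest: injD[OF p])
  have "inj (\<lambda>xs. p (i (length xs), g xs))"
    by (rule injI) (auto dest!: injD[OF p] injD[OF i] intro: g)
  then show ?thesis by blast
qed

section \<open>Unique splitting of arrows in a free symmetric strict monoidal category\<close>

context marking
begin

text \<open>The forgetful functor to \<open>M\<close>: the value at the marking of all
  positions.\<close>

definition top_functor :: "('o list, ('o, 'a) marked_arr, 'o, 'a) fctr" where
  "top_functor = \<lparr>fobj = tensor_objs M, farr = (\<lambda>x. part x (all_true (length (fst (snd x)))))\<rparr>"

lemma strict_monoidal_top: "strict_monoidal W M top_functor"
proof -
  interpret W: symmetric_strict_monoidal W by (rule symmetric_strict_monoidal_W)
  show ?thesis
  proof
    note A = marked_arr_simps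
    show "strict_monoidal_functor W M top_functor"
      unfolding strict_monoidal_functor_def cat_functor_def top_functor_def
      by (auto simp: hom_def A pre_all_true W_comp W_tensor W_brd W_idt tensor_objs_append replicate_add)
  qed
qed

text \<open>A singleton target has only the markings \<open>[True]\<close> and
  \<open>[False]\<close>; the value at the first is the image under \<open>top_functor\<close>, the
  value at the second is prescribed.\<close>

lemma singleton_arr_eqI:
  assumes "x \<in> marked_arrs M C" "y \<in> marked_arrs M C" "fst x = fst y" "fst (snd x) = [d]" "fst (snd y) = [d]"
    "farr top_functor x = farr top_functor y"
  shows "x = y"
proof (rule marked_arr_eqI[OF assms(1-3)])
  fix v :: "bool list" assume "length v = length (fst (snd y))"
  then consider "v = [True]" | "v = [False]" using assms(5)
    by (cases v) (auto split: if_splits)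
  moreover have "pre z [True] = all_true (length (fst z))" "part z [True] = farr top_functor z"
      "pre z [False] = all_false (length (fst z))" "part z [False] = Idt M (Unt M)"
    if "z \<in> marked_arrs M C" "fst (snd z) = [d]" for z
  proof -
    have n: "1 = length (fst (snd z))" by (simp add: that(2))
    show "pre z [True] = all_true (length (fst z))" "part z [True] = farr top_functor z"
      "pre z [False] = all_false (length (fst z))" "part z [False] = Idt M (Unt M)"
      using pre_all_true[OF that(1) n] marked_arr_simps(3,4)[OF that(1) n]
      by (simp_all add: top_functor_def that(2))
  qed
  note this[OF assms(1,4)] this[OF assms(2,5)]
  ultimately show "pre x v = pre y v" "part x v = part y v"
    by (metis assms(3,6))+
qed (simp add: assms)

text \<open>An operation has a single output, so a marking of the target pulls back to all inputs or
  to none.\<close>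

definition gen_arr :: "'o list \<Rightarrow> 'a \<Rightarrow> ('o, 'a) marked_arr" where
  "gen_arr cs f = mk_arr cs [Cod M f] (\<lambda>v. replicate (length cs) (hd v)) (\<lambda>v. if hd v then f else Idt M (Unt M))"

lemma gen_arr:
  assumes "set cs \<subseteq> C" "f \<in> Arr M" "Dom M f = tensor_objs M cs" "Cod M f \<in> C"
  shows "gen_arr cs f \<in> marked_arrs M C" "fst (gen_arr cs f) = cs" "fst (snd (gen_arr cs f)) = [Cod M f]"
    "farr top_functor (gen_arr cs f) = f"
proof -
  have [simp]: "Cod M f \<in> Obj M" "set cs \<subseteq> Obj M" using assms by simp_all
  show "gen_arr cs f \<in> marked_arrs M C"
    unfolding gen_arr_def mk_arr_marked
  proof (intro conjI allI impI)
    fix v :: "bool list" assume "length v = length [Cod M f]"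
    then obtain b where v: "v = [b]" by (cases v) auto
    show "(if hd v then f else Idt M (Unt M)) \<in> hom M (T (replicate (length cs) (hd v)) cs) (T v [Cod M f])"
      "unshuffle M v [Cod M f] \<cdot> (if hd (all_true (length [Cod M f])) then f else Idt M (Unt M)) =
         ((if hd v then f else Idt M (Unt M)) \<otimes> (if hd (map Not v) then f else Idt M (Unt M))) \<cdot>
         unshuffle M (replicate (length cs) (hd v)) cs"
      using assms by (auto simp: v hom_def unshuffle_all_true unshuffle_all_false)
    show "replicate (length cs) (hd (map Not v)) = map Not (replicate (length cs) (hd v))"
      "length (replicate (length cs) (hd v)) = length cs"
      by (simp_all add: v)
  qed (insert assms, simp_all)
qed (simp_all add: gen_arr_def top_functor_def)

text \<open>Arrows of \<^term>\<open>W\<close> into a singleton are determined by their image under \<^term>\<open>top_functor\<close>, so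
  the operad axioms for the generators of \<^term>\<open>W\<close> follow from those for \<open>\<eta>\<close>.\<close>

lemma operad_morphism_gen:
  assumes "operad_morphism R (operad_of M) \<eta>" "C = ocol \<eta> ` Col R" "operad R"
  shows "operad_morphism R (operad_of W)
    \<lparr>ocol = \<lambda>c. [ocol \<eta> c], oop = \<lambda>x. (map (\<lambda>c. [c]) (fst (oop \<eta> x)), gen_arr (fst (oop \<eta> x)) (snd (oop \<eta> x)))\<rparr>"
proof -
  interpret W: symmetric_strict_monoidal W by (rule symmetric_strict_monoidal_W)
  interpret top: strict_monoidal W M top_functor by (rule strict_monoidal_top)
  interpret R: operad R by fact
  have R: "\<And>x. x \<in> Ops R \<Longrightarrow> set (Src R x) \<subseteq> Col R \<and> Tgt R x \<in> Col R"
      "\<And>c. c \<in> Col R \<Longrightarrow> One R c \<in> Ops R \<and> Src R (One R c) = [c] \<and> Tgt R (One R c) = c"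
      "\<And>x ys. x \<in> Ops R \<Longrightarrow> set ys \<subseteq> Ops R \<Longrightarrow> map (Tgt R) ys = Src R x \<Longrightarrow> 
         Sub R x ys \<in> Ops R \<and> Src R (Sub R x ys) = concat (map (Src R) ys) \<and> Tgt R (Sub R x ys) = Tgt R x"
      "\<And>x \<sigma>. x \<in> Ops R \<Longrightarrow> \<sigma> permutes {..<length (Src R x)} \<Longrightarrow>
         Act R x \<sigma> \<in> Ops R \<and> Src R (Act R x \<sigma>) = permute_list \<sigma> (Src R x) \<and> Tgt R (Act R x \<sigma>) = Tgt R x"
    by (auto simp: R.src_col R.tgt_col R.one_op R.one_src R.one_tgt R.sub_op R.sub_src R.sub_tgt R.act_op R.act_src R.act_tgt)
  note \<eta> = operad_morphism_operad_ofD[OF assms(1)]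
  have Ccol: "c \<in> Col R \<Longrightarrow> ocol \<eta> c \<in> C" for c using assms(2) by simp
  define xs where "xs x = fst (oop \<eta> x)" for x
  define op where "op = (\<lambda>x. snd (oop \<eta> x))"
  define g where "g x = gen_arr (xs x) (op x)" for x
  have x: "xs x = map (ocol \<eta>) (Src R x)" "op x \<in> Arr M" "Dom M (op x) = tensor_objs M (xs x)"
      "Cod M (op x) = ocol \<eta> (Tgt R x)" "set (xs x) \<subseteq> C" "Cod M (op x) \<in> C" if "x \<in> Ops R" for x
    using \<eta>(3-7)[OF that] Ccol R(1)[OF that] unfolding xs_def op_def by auto
  have g: "g x \<in> marked_arrs M C" "fst (g x) = xs x" "fst (snd (g x)) = [ocol \<eta> (Tgt R x)]"
    "farr top_functor (g x) = op x" if "x \<in> Ops R" for x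
    using gen_arr[of "xs x" "op x"] x[OF that] unfolding g_def by auto
  have tsing: "tensor_objs W (map (\<lambda>c. [c]) cs) = cs" for cs :: "'o list" by (induction cs) auto
  have "operad_morphism R (operad_of W)
     \<lparr>ocol = \<lambda>c. [ocol \<eta> c], oop = \<lambda>x. (map (\<lambda>c. [c]) (xs x), g x)\<rparr>"
    unfolding operad_morphism_def
  proof (intro conjI ballI impI allI)
    fix c assume c: "c \<in> Col R"
    then show "ocol \<lparr>ocol = \<lambda>c. [ocol \<eta> c], oop = \<lambda>x. (map (\<lambda>c. [c]) (xs x), g x)\<rparr> c \<in> Col (operad_of W)"
      using Ccol by (simp add: operad_of_def)
    have o: "One R c \<in> Ops R" "Src R (One R c) = [c]" "Tgt R (One R c) = c" using R(2)[OF c] by auto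
    have "ocol \<eta> c \<in> C" using Ccol c by simp
    moreover have "op (One R c) = Idt M (ocol \<eta> c)" using \<eta>(2)[OF c] by (simp add: op_def)
    ultimately have "g (One R c) = Idt W [ocol \<eta> c]"
      using g[OF o(1)] x[OF o(1)] o C_obj by (intro singleton_arr_eqI) (auto simp: W_idt top_functor_def)
    then show "oop \<lparr>ocol = \<lambda>c. [ocol \<eta> c], oop = \<lambda>x. (map (\<lambda>c. [c]) (xs x), g x)\<rparr> (One R c) =
        One (operad_of W) (ocol \<lparr>ocol = \<lambda>c. [ocol \<eta> c], oop = \<lambda>x. (map (\<lambda>c. [c]) (xs x), g x)\<rparr> c)"
      using x(1)[OF o(1)] o by (simp add: operad_of_def)
  next
    fix y assume y: "y \<in> Ops R"
    show "oop \<lparr>ocol = \<lambda>c. [ocol \<eta> c], oop = \<lambda>x. (map (\<lambda>c. [c]) (xs x), g x)\<rparr> y \<in> Ops (operad_of W)"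
      using x(5)[OF y] g[OF y] by (auto simp: operad_of_def tsing)
    show "Src (operad_of W) (oop \<lparr>ocol = \<lambda>c. [ocol \<eta> c], oop = \<lambda>x. (map (\<lambda>c. [c]) (xs x), g x)\<rparr> y) =
        map (ocol \<lparr>ocol = \<lambda>c. [ocol \<eta> c], oop = \<lambda>x. (map (\<lambda>c. [c]) (xs x), g x)\<rparr>) (Src R y)"
      "Tgt (operad_of W) (oop \<lparr>ocol = \<lambda>c. [ocol \<eta> c], oop = \<lambda>x. (map (\<lambda>c. [c]) (xs x), g x)\<rparr> y) =
        ocol \<lparr>ocol = \<lambda>c. [ocol \<eta> c], oop = \<lambda>x. (map (\<lambda>c. [c]) (xs x), g x)\<rparr> (Tgt R y)"
      using x[OF y] g[OF y] by (auto simp: operad_of_def)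
    fix \<sigma> assume s: "\<sigma> permutes {..<length (Src R y)}"
    note a = R(4)[OF y s]
    have p: "\<sigma> permutes {..<length (xs y)}" using s x[OF y] by simp
    let ?ps = "map (\<lambda>c. [c]) (permute_list \<sigma> (xs y))"
    have pl: "\<sigma> permutes {..<length ?ps}" "set ?ps \<subseteq> Obj W" using p x(5)[OF y] by auto
    have inv: "permute_list (inv \<sigma>) ?ps = map (\<lambda>c. [c]) (xs y)"
      using permute_list_inv_permute[of \<sigma> "map (\<lambda>c. [c]) (xs y)"] p by (simp add: permute_list_map)
    have P: "perm_arr W \<sigma> ?ps \<in> marked_arrs M C" "fst (perm_arr W \<sigma> ?ps) = permute_list \<sigma> (xs y)"
      "fst (snd (perm_arr W \<sigma> ?ps)) = xs y"
      using W.perm_arr_simps[OF pl] unfolding inv by (simp_all add: tsing)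
    have op: "op (Act R y \<sigma>) = op y \<cdot> perm_arr M \<sigma> (permute_list \<sigma> (xs y))"
      using \<eta>(9)[OF y s] by (simp add: op_def xs_def)
    \<comment> \<open>Under \<open>top_functor\<close> a singleton \<open>[c]\<close> becomes
      \<open>c \<odot> Unt M\<close>, which is \<open>c\<close> by strictness.\<close>
    have "map (tensor_objs M) ?ps = permute_list \<sigma> (xs y)"
    proof -
      have "c \<odot> Unt M = c" if "c \<in> set (xs y)" for c
        using that x(5)[OF y] C_obj by (intro strict_unt_right) auto
      then show ?thesis using p by (auto intro!: map_idI)
    qed
    then have "farr top_functor (perm_arr W \<sigma> ?ps) = perm_arr M \<sigma> (permute_list \<sigma> (xs y))"
      using top.functor_perm_arr[OF pl] by (simp add: top_functor_def)
    then have "g (Act R y \<sigma>) = g y \<cdot>\<^bsub>W\<^esub> perm_arr W \<sigma> ?ps"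
      using a g[OF y] g[of "Act R y \<sigma>"] x(1)[OF y] x(1)[of "Act R y \<sigma>"] P op top.functor_simps(6)[of "perm_arr W \<sigma> ?ps" "g y"] s
      by (intro singleton_arr_eqI[of _ _ "ocol \<eta> (Tgt R y)"]) (auto simp: W_comp permute_list_map)
    then show "oop \<lparr>ocol = \<lambda>c. [ocol \<eta> c], oop = \<lambda>x. (map (\<lambda>c. [c]) (xs x), g x)\<rparr> (Act R y \<sigma>) =
        Act (operad_of W) (oop \<lparr>ocol = \<lambda>c. [ocol \<eta> c], oop = \<lambda>x. (map (\<lambda>c. [c]) (xs x), g x)\<rparr> y) \<sigma>"
      using a x(1)[OF y] x(1)[of "Act R y \<sigma>"] s p by (simp add: operad_of_def permute_list_map)
  next
    fix y ys assume y: "y \<in> Ops R" and "set ys \<subseteq> Ops R \<and> map (Tgt R) ys = Src R y"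
    then have ys: "set ys \<subseteq> Ops R" "map (Tgt R) ys = Src R y" by auto
    note a = R(3)[OF y ys]
    have gs: "set (map g ys) \<subseteq> Arr W" using g(1) ys(1) by auto
    have d: "map (Dom W) (map g ys) = map xs ys" "map (Cod W) (map g ys) = map (\<lambda>c. [c]) (xs y)"
      using g ys(1) unfolding x(1)[OF y] ys(2)[symmetric] by auto
    have tc: "tensor_objs W xss = concat xss" for xss :: "'o list list" by (induction xss) auto
    have P: "tensor_arrs W (map g ys) \<in> marked_arrs M C" "fst (tensor_arrs W (map g ys)) = concat (map xs ys)"
      "fst (snd (tensor_arrs W (map g ys))) = xs y"
      using W.tensor_arrs_simps[OF gs] unfolding d by (simp_all add: tc tsing)
    have op: "op (Sub R y ys) = op y \<cdot> tensor_arrs M (map op ys)"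
      using \<eta>(8)[OF y ys] by (simp add: op_def comp_def)
    have "map (farr top_functor) (map g ys) = map op ys" using g(4) ys(1) by auto
    then have "farr top_functor (tensor_arrs W (map g ys)) = tensor_arrs M (map op ys)"
      using top.functor_tensor_arrs[OF gs] by (simp only:)
    moreover have "concat (map xs ys) = xs (Sub R y ys)"
    proof -
      have "map xs ys = map (map (ocol \<eta>)) (map (Src R) ys)" using x(1) ys(1) by auto
      then show ?thesis using a x(1)[of "Sub R y ys"] by (simp only: map_concat)
    qed
    ultimately have "g (Sub R y ys) = g y \<cdot>\<^bsub>W\<^esub> tensor_arrs W (map g ys)"
      using a g[OF y] g[of "Sub R y ys"] P op top.functor_simps(6)[of "tensor_arrs W (map g ys)" "g y"]
      by (intro singleton_arr_eqI[of _ _ "ocol \<eta> (Tgt R y)"]) (auto simp: W_comp)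
    then show "oop \<lparr>ocol = \<lambda>c. [ocol \<eta> c], oop = \<lambda>x. (map (\<lambda>c. [c]) (xs x), g x)\<rparr> (Sub R y ys) =
        Sub (operad_of W) (oop \<lparr>ocol = \<lambda>c. [ocol \<eta> c], oop = \<lambda>x. (map (\<lambda>c. [c]) (xs x), g x)\<rparr> y)
          (map (oop \<lparr>ocol = \<lambda>c. [ocol \<eta> c], oop = \<lambda>x. (map (\<lambda>c. [c]) (xs x), g x)\<rparr>) ys)"
      using \<open>concat (map xs ys) = xs (Sub R y ys)\<close>[symmetric] by (simp add: operad_of_def comp_def map_concat)
  qed
  then show ?thesis by (simp add: xs_def op_def g_def)
qed

end

text \<open>A marked arrow is a function, but only its finitely many values at markings of the
  target's length vary, so it can be coded by its source, its target and a finite list of elements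
  of the universe.\<close>

lemma inj_marked_arrs:
  assumes "marking M C"
  shows "\<exists>e' :: ('u :: infinite, 'u) marked_arr \<Rightarrow> 'u. inj_on e' (marked_arrs M C)"
proof -
  interpret marking M C by fact
  obtain p :: "'u \<times> 'u \<Rightarrow> 'u" where p: "inj p" using inj_prod_infinite by blast
  obtain l :: "'u list \<Rightarrow> 'u" where l: "inj l" using inj_list_infinite by blast
  obtain i :: "nat \<Rightarrow> 'u" where i: "inj i" using inj_nat_infinite by blast
  define bits where "bits v = l (map (\<lambda>b. i (of_bool b)) v)" for v
  have bits: "bits v = bits w \<longleftrightarrow> v = w" for v w
  proof -
    have "inj (\<lambda>b. i (of_bool b))" using i by (auto simp: inj_def)
    then show ?thesis unfolding bits_def by (simp add: inj_eq[OF l] inj_map_eq_map)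
  qed
  \<comment> \<open>A finite enumeration of the markings of the target. It depends only on the
    length of the target, so for equal targets the coded values can be compared entry by
    entry.\<close>
  define vs where "vs x = List.n_lists (length (fst (snd x))) [True, False]" for x :: "('u, 'u) marked_arr"
  define code where "code x = p (l (fst x), p (l (fst (snd x)), l (map (\<lambda>v. p (bits (pre x v), part x v)) (vs x))))" for x
  have "inj_on code (marked_arrs M C)"
  proof (rule inj_onI)
    fix x y assume xy: "x \<in> marked_arrs M C" "y \<in> marked_arrs M C" "code x = code y"
    then have e: "fst x = fst y" "fst (snd x) = fst (snd y)"
      "map (\<lambda>v. p (bits (pre x v), part x v)) (vs x) = map (\<lambda>v. p (bits (pre y v), part y v)) (vs y)"
      by (simp_all add: code_def inj_eq[OF p] inj_eq[OF l])
    have "vs x = vs y" using e(2) by (simp add: vs_def)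
    with e(3) have v: "pre x v = pre y v \<and> part x v = part y v" if "v \<in> set (vs y)" for v
      using that by (auto simp: inj_eq[OF p] bits)
    have "v \<in> set (vs y)" if "length v = length (fst (snd y))" for v
      using that by (auto simp: vs_def set_n_lists)
    with v show "x = y" by (intro marked_arr_eqI[OF xy(1,2) e(1,2)]) auto
  qed
  then show ?thesis by blast
qed

section \<open>Freeness and the section of the forgetful functor\<close>

locale free_monoidal =
  fixes R :: "('u :: infinite, 'u) oprd" and M :: "('u, 'u) smcat" (structure)
    and \<eta> :: "('u, 'u, 'u, 'u list \<times> 'u) opmor"
  assumes operad: "operad R" and free: "free_sym_monoidal R M \<eta>"
begin

definition gens :: "'u set" where "gens = ocol \<eta> ` Col R"

lemma unit_morphism: "operad_morphism R (operad_of M) \<eta>"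
  using free by (simp add: free_sym_monoidal_def)

lemma marking_gens: "marking M gens"
proof -
  have "symmetric_strict_monoidal M" using free by (simp add: free_sym_monoidal_def)
  moreover have "gens \<subseteq> Obj M" using operad_morphism_operad_ofD(1)[OF unit_morphism] by (auto simp: gens_def)
  ultimately show ?thesis by (simp add: marking_def marking_axioms_def)
qed

end

sublocale free_monoidal \<subseteq> marking M gens
  by (rule marking_gens)

context free_monoidal
begin

text \<open>\<open>K\<close> and the identity functor both extend \<eta>, so the uniqueness clause
  of freeness makes each agree with the same functor \<open>K0\<close>.\<close>

lemma functor_eq_id:
  assumes "strict_monoidal_functor M M K" "opmor_eq R (opmor_of K \<circ>\<^sub>O \<eta>) \<eta>"
  shows "x \<in> Obj M \<Longrightarrow> fobj K x = x" "f \<in> Arr M \<Longrightarrow> farr K f = f"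
proof -
  let ?I = "\<lparr>fobj = \<lambda>x. x, farr = \<lambda>f. f\<rparr> :: ('u, 'u, 'u, 'u) fctr"
  have I: "strict_monoidal_functor M M ?I" by (rule strict_monoidal_functor_id) (rule category_axioms)
  have I': "opmor_eq R (opmor_of ?I \<circ>\<^sub>O \<eta>) \<eta>"
    by (auto simp: opmor_eq_def opmor_of_def opmor_comp_def)
  obtain K0 :: "('u, 'u, 'u, 'u) fctr" where "\<forall>K'. strict_monoidal_functor M M K' \<and> opmor_eq R (opmor_of K' \<circ>\<^sub>O \<eta>) \<eta> \<longrightarrow>
              (\<forall>x \<in> Obj M. fobj K' x = fobj K0 x) \<and> (\<forall>f \<in> Arr M. farr K' f = farr K0 f)"
    using free[unfolded free_sym_monoidal_def, THEN conjunct2, THEN conjunct2, rule_format,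
        OF conjI[OF symmetric_strict_monoidal_axioms unit_morphism]]
    by blast
  from this[rule_format, of K] this[rule_format, of ?I]
  show "x \<in> Obj M \<Longrightarrow> fobj K x = x" "f \<in> Arr M \<Longrightarrow> farr K f = f"
    using assms I I' by simp_all
qed

text \<open>\<open>E\<close> is induced by the operad morphism that sends each operation to its
  \<open>gen_arr\<close>. Followed by \<open>top_functor\<close> it restricts to \<eta>, so by
  \<open>functor_eq_id\<close> the composite is the identity.\<close>

lemma section_functor:
  obtains E where "strict_monoidal M W E" "\<And>c. c \<in> gens \<Longrightarrow> fobj E c = [c]"
    "\<And>a. a \<in> Obj M \<Longrightarrow> tensor_objs M (fobj E a) = a" "\<And>f. f \<in> Arr M \<Longrightarrow> farr top_functor (farr E f) = f"
proof -
  let ?\<Phi> = "\<lparr>ocol = \<lambda>c. [ocol \<eta> c], oop = \<lambda>x. (map (\<lambda>c. [c]) (fst (oop \<eta> x)), gen_arr (fst (oop \<eta> x)) (snd (oop \<eta> x)))\<rparr>"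
  obtain l :: "'u list \<Rightarrow> 'u" where l: "inj l" using inj_list_infinite by blast
  obtain e' :: "('u, 'u) marked_arr \<Rightarrow> 'u" where e': "inj_on e' (marked_arrs M gens)"
    using inj_marked_arrs[OF marking_gens] by blast
  have \<Phi>: "operad_morphism R (operad_of W) ?\<Phi>"
    by (rule operad_morphism_gen[OF unit_morphism gens_def operad])
  obtain E where E: "strict_monoidal_functor M W E" "opmor_eq R (opmor_of E \<circ>\<^sub>O \<eta>) ?\<Phi>"
  proof (rule free_sym_monoidal_functor[OF free symmetric_strict_monoidal_W _ _ \<Phi>])
    show "inj_on l (Obj W)" using l by (rule inj_on_subset) simp
    show "inj_on e' (Arr W)" using e' by simp
  qed
  have Ec: "fobj E (ocol \<eta> c) = [ocol \<eta> c]" if "c \<in> Col R" for c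
    using E(2) that by (simp add: opmor_eq_def opmor_comp_def opmor_of_def)
  have Ex: "farr E (snd (oop \<eta> x)) = gen_arr (fst (oop \<eta> x)) (snd (oop \<eta> x))" if "x \<in> Ops R" for x
  proof -
    have "oop (opmor_of E \<circ>\<^sub>O \<eta>) x = oop ?\<Phi> x" using E(2) that unfolding opmor_eq_def by blast
    then show ?thesis by (simp add: opmor_comp_def opmor_of_def split_def)
  qed
  note \<eta> = operad_morphism_operad_ofD[OF unit_morphism]
  interpret R: operad R by (rule operad)
  interpret top: strict_monoidal W M top_functor by (rule strict_monoidal_top)
  have top: "strict_monoidal_functor M M (top_functor \<circ>\<^sub>F E)"
    by (rule strict_monoidal_functor_comp[OF E(1) top.strict])
  \<comment> \<open>Only colours and operations have to be compared: a colour goes to a singleton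
    and back, an operation to its \<open>gen_arr\<close> and back.\<close>
  have eq: "opmor_eq R (opmor_of (top_functor \<circ>\<^sub>F E) \<circ>\<^sub>O \<eta>) \<eta>"
    unfolding opmor_eq_def
  proof (intro conjI ballI)
    fix c assume c: "c \<in> Col R"
    have "ocol \<eta> c \<odot> Unt M = ocol \<eta> c" using \<eta>(1)[OF c] by simp
    then show "ocol (opmor_of (top_functor \<circ>\<^sub>F E) \<circ>\<^sub>O \<eta>) c = ocol \<eta> c"
      using Ec[OF c] by (simp add: opmor_comp_def opmor_of_def functor_comp_def top_functor_def)
  next
    fix x assume x: "x \<in> Ops R"
    have s: "fst (oop \<eta> x) = map (ocol \<eta>) (Src R x)" "set (Src R x) \<subseteq> Col R" "Tgt R x \<in> Col R"
      using \<eta>(7)[OF x] R.src_col[OF x] R.tgt_col[OF x] by auto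
    have sc: "set (fst (oop \<eta> x)) \<subseteq> gens" "Cod M (snd (oop \<eta> x)) \<in> gens"
      using s \<eta>(6)[OF x] by (auto simp: gens_def)
    have "tensor_objs M (fobj E d) = d" if "d \<in> set (fst (oop \<eta> x))" for d
    proof -
      have "d \<in> Obj M" using that sc C_obj by blast
      moreover have "fobj E d = [d]" using that sc Ec unfolding gens_def by auto
      ultimately show ?thesis by simp
    qed
    then have "map (\<lambda>d. tensor_objs M (fobj E d)) (fst (oop \<eta> x)) = fst (oop \<eta> x)" by (auto intro: map_idI)
    moreover have "farr top_functor (farr E (snd (oop \<eta> x))) = snd (oop \<eta> x)"
      unfolding Ex[OF x] by (rule gen_arr(4)[OF sc(1) \<eta>(4)[OF x] \<eta>(5)[OF x] sc(2)])
    moreover have "fobj top_functor = tensor_objs M" by (simp add: top_functor_def)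
    ultimately show "oop (opmor_of (top_functor \<circ>\<^sub>F E) \<circ>\<^sub>O \<eta>) x = oop \<eta> x"
      by (simp add: opmor_comp_def opmor_of_def functor_comp_def split_def comp_def)
  qed
  note id = functor_eq_id[OF top eq]
  show ?thesis
  proof
    show "strict_monoidal M W E"
      using symmetric_strict_monoidal_axioms symmetric_strict_monoidal_W E(1)
      by (simp add: strict_monoidal_def strict_monoidal_axioms_def)
    show "fobj E c = [c]" if "c \<in> gens" for c using that Ec by (auto simp: gens_def)
    show "tensor_objs M (fobj E a) = a" if "a \<in> Obj M" for a
      using id(1)[OF that] by (simp add: functor_comp_def top_functor_def)
    show "farr top_functor (farr E f) = f" if "f \<in> Arr M" for f
      using id(2)[OF that] by (simp add: functor_comp_def)
  qed
qed

end

lemma (in strict_monoidal) functor_unshuffle: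
  assumes "length v = length cs" "set cs \<subseteq> Obj A"
  shows "farr K (unshuffle A v cs) = unshuffle B v (map (fobj K) cs)"
  using assms
proof (induction v cs rule: list_induct2)
  case (Cons b v c cs)
  then show ?case using functor_tensor_objs[of "select v cs"] functor_tensor_objs[of "select (neg v) cs"]
    by (simp add: select_map)
qed simp

context marking
begin

text \<open>Serves the uniqueness of splittings. The section carries unshuffles of \<open>M\<close>
  to unshuffles of \<open>marked_cat\<close>, where marking the front block pulls back to
  \<open>u\<close> and the parts are identities, so that \<open>u\<close> can be recovered from a
  composite arrow.\<close>

lemma unshuffle_W:
  assumes "length u = length cs" "set cs \<subseteq> C"
  shows "unshuffle W u (map (\<lambda>c. [c]) cs) \<in> marked_arrs M C"
    "fst (unshuffle W u (map (\<lambda>c. [c]) cs)) = cs"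
    "fst (snd (unshuffle W u (map (\<lambda>c. [c]) cs))) = select u cs @ select (neg u) cs"
    "n = length (select u cs) \<Longrightarrow> m = length (select (neg u) cs) \<Longrightarrow>
      pre (unshuffle W u (map (\<lambda>c. [c]) cs)) (all_true n @ all_false m) = u"
    "n = length (select u cs) \<Longrightarrow> m = length (select (neg u) cs) \<Longrightarrow>
      part (unshuffle W u (map (\<lambda>c. [c]) cs)) (all_true n @ all_false m) = Idt M (T u cs)"
    "n = length (select u cs) \<Longrightarrow> m = length (select (neg u) cs) \<Longrightarrow>
      part (unshuffle W u (map (\<lambda>c. [c]) cs)) (all_false n @ all_true m) = Idt M (T (neg u) cs)"
proof -
  interpret W: symmetric_strict_monoidal W by (rule symmetric_strict_monoidal_W)
  have tsing: "tensor_objs W (map (\<lambda>c. [c]) cs) = cs" for cs :: "'o list" by (induction cs) auto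
  have s: "unshuffle W u (map (\<lambda>c. [c]) cs) \<in> marked_arrs M C"
    "fst (unshuffle W u (map (\<lambda>c. [c]) cs)) = cs"
    "fst (snd (unshuffle W u (map (\<lambda>c. [c]) cs))) = select u cs @ select (neg u) cs"
    if "length u = length cs" "set cs \<subseteq> C" for u cs
  proof -
    have "set (map (\<lambda>c. [c]) cs) \<subseteq> Obj W" using that by auto
    from W.unshuffle_simps[OF _ this, of u] that
    show "unshuffle W u (map (\<lambda>c. [c]) cs) \<in> marked_arrs M C"
      "fst (unshuffle W u (map (\<lambda>c. [c]) cs)) = cs"
      "fst (snd (unshuffle W u (map (\<lambda>c. [c]) cs))) = select u cs @ select (neg u) cs"
      by (simp_all add: select_map tsing)
  qed
  then show "unshuffle W u (map (\<lambda>c. [c]) cs) \<in> marked_arrs M C"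
    "fst (unshuffle W u (map (\<lambda>c. [c]) cs)) = cs"
    "fst (snd (unshuffle W u (map (\<lambda>c. [c]) cs))) = select u cs @ select (neg u) cs"
    using assms by blast+
  have "pre (unshuffle W u (map (\<lambda>c. [c]) cs)) (all_true (length (select u cs)) @ all_false (length (select (neg u) cs))) = u \<and>
    part (unshuffle W u (map (\<lambda>c. [c]) cs)) (all_true (length (select u cs)) @ all_false (length (select (neg u) cs))) = Idt M (T u cs) \<and>
    pre (unshuffle W u (map (\<lambda>c. [c]) cs)) (all_false (length (select u cs)) @ all_true (length (select (neg u) cs))) = neg u \<and>
    part (unshuffle W u (map (\<lambda>c. [c]) cs)) (all_false (length (select u cs)) @ all_true (length (select (neg u) cs))) = Idt M (T (neg u) cs)"
    using assms
  proof (induction u cs rule: list_induct2)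
    case Nil
    then show ?case using W_idt[of "[]"] by simp
  next
    case (Cons b u c cs)
    have c: "[c] = c # []" "set [c] \<subseteq> C" "set cs \<subseteq> C" "c \<in> Obj M" "c \<odot> Unt M = c" using Cons.prems C_obj by auto
    note s = s[OF Cons.hyps(1) c(3)]
    note IH = Cons.IH[OF c(3)]
    show ?case
    proof (cases b)
      case True
      then show ?thesis using s IH c by (simp add: W_tensor W_idt)
    next
      case False
      have "tensor_objs W (select u (map (\<lambda>c. [c]) cs)) = select u cs"
        "tensor_objs W (select (neg u) (map (\<lambda>c. [c]) cs)) = select (neg u) cs"
        by (simp_all add: select_map tsing)
      then show ?thesis using s IH c False
        by (simp add: W_tensor W_idt W_comp W_brd)
    qed
  qed
  then show "n = length (select u cs) \<Longrightarrow> m = length (select (neg u) cs) \<Longrightarrow>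
      pre (unshuffle W u (map (\<lambda>c. [c]) cs)) (all_true n @ all_false m) = u"
    "n = length (select u cs) \<Longrightarrow> m = length (select (neg u) cs) \<Longrightarrow>
      part (unshuffle W u (map (\<lambda>c. [c]) cs)) (all_true n @ all_false m) = Idt M (T u cs)"
    "n = length (select u cs) \<Longrightarrow> m = length (select (neg u) cs) \<Longrightarrow>
      part (unshuffle W u (map (\<lambda>c. [c]) cs)) (all_false n @ all_true m) = Idt M (T (neg u) cs)"
    by simp_all
qed

end

context free_monoidal
begin

lemma obj_tensor_gens:
  assumes "a \<in> Obj M"
  obtains cs where "set cs \<subseteq> gens" "a = tensor_objs M cs"
proof -
  obtain E where E: "strict_monoidal M W E" "\<And>a. a \<in> Obj M \<Longrightarrow> tensor_objs M (fobj E a) = a"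
    using section_functor by metis
  have "fobj E a \<in> Obj W" using strict_monoidal.functor_simps(1)[OF E(1) assms] .
  then show ?thesis using that[of "fobj E a"] E(2)[OF assms] by simp
qed

text \<open>The section sends such an arrow to one with empty target, whose only marking is both
  \<open>all_true\<close> and \<open>all_false\<close>; the value there is prescribed to be the
  identity.\<close>

lemma arr_into_unit:
  assumes "f \<in> Arr M" "Cod M f = Unt M"
  shows "f = Idt M (Unt M)"
proof -
  obtain E where E: "strict_monoidal M W E" "\<And>f. f \<in> Arr M \<Longrightarrow> farr top_functor (farr E f) = f"
    using section_functor by metis
  interpret E: strict_monoidal M W E by fact
  have "farr E f \<in> marked_arrs M gens" "fst (snd (farr E f)) = []" using assms E.functor_simps(2,4)[of f] by auto
  then have "part (farr E f) [] = Idt M (Unt M)" using marked_arr_simps(4)[of "farr E f" 0] by simp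
  then show ?thesis using E(2)[OF assms(1)] \<open>fst (snd (farr E f)) = []\<close> by (simp add: top_functor_def)
qed

text \<open>The section is applied to \<open>f\<close> and evaluated at the marking of those factors
  of the target that belong to \<open>y\<close>.\<close>

lemma arr_split:
  assumes "set cs \<subseteq> gens" "f \<in> hom M (tensor_objs M cs) (y \<odot> z)" "y \<in> Obj M" "z \<in> Obj M"
  obtains u f1 f2 where "length u = length cs" "f1 \<in> hom M (T u cs) y" "f2 \<in> hom M (T (neg u) cs) z"
    "f = (f1 \<otimes> f2) \<cdot> unshuffle M u cs"
proof -
  obtain E where E: "strict_monoidal M W E" "\<And>c. c \<in> gens \<Longrightarrow> fobj E c = [c]"
    "\<And>a. a \<in> Obj M \<Longrightarrow> tensor_objs M (fobj E a) = a" "\<And>f. f \<in> Arr M \<Longrightarrow> farr top_functor (farr E f) = f"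
    using section_functor by metis
  interpret E: strict_monoidal M W E by fact
  have f: "f \<in> Arr M" "Dom M f = tensor_objs M cs" "Cod M f = y \<odot> z" using assms(2) by (auto simp: hom_def)
  have "map (fobj E) cs = map (\<lambda>c. [c]) cs" using assms(1) E(2) by auto
  moreover have "tensor_objs W (map (\<lambda>c. [c]) cs) = cs" for cs :: "'u list" by (induction cs) auto
  ultimately have Ecs: "fobj E (tensor_objs M cs) = cs"
    using E.functor_tensor_objs[OF C_subset[OF assms(1)]] by (simp only:)
  let ?x = "farr E f" and ?y = "fobj E y" and ?z = "fobj E z"
  have yz: "set ?y \<subseteq> gens" "set ?z \<subseteq> gens" using E.functor_simps(1) assms(3,4) by auto
  have x: "?x \<in> marked_arrs M gens" "fst ?x = cs" "fst (snd ?x) = ?y @ ?z"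
    using E.functor_simps(2-4)[OF f(1)] f Ecs assms(3,4) by auto
  define v where "v = all_true (length ?y) @ all_false (length ?z)"
  have v: "length v = length (fst (snd ?x))" "length (neg v) = length (fst (snd ?x))" by (simp_all add: v_def x)
  have sel: "select v (?y @ ?z) = ?y" "select (neg v) (?y @ ?z) = ?z"
    by (simp_all add: v_def)
  note X = marked_arr_simps[OF x(1)]
  \<comment> \<open>The factors of \<open>y\<close> already stand in front, so this unshuffle is an
    identity and the splitting condition becomes the claimed factorisation of
    \<open>f\<close>.\<close>
  have U: "unshuffle M v (?y @ ?z) = Idt M (y \<odot> z)"
    using yz by (simp add: v_def unshuffle_append unshuffle_all_true unshuffle_all_false E(3) assms(3,4))
  have ft: "part ?x (all_true (length (fst (snd ?x)))) = f"
    using E(4)[OF f(1)] by (simp add: top_functor_def)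
  show ?thesis
  proof
    show "length (pre ?x v) = length cs" using X(5)[OF v(1)] x by simp
    show "part ?x v \<in> hom M (T (pre ?x v) cs) y"
      using X(7-9)[OF v(1)] x(2,3) sel E(3) assms(3) by (simp add: hom_def)
    show "part ?x (neg v) \<in> hom M (T (neg (pre ?x v)) cs) z"
      using X(7-9)[OF v(2)] X(6)[OF v(1)] x(2,3) sel E(3) assms(4) by (simp add: hom_def)
    show "f = (part ?x v \<otimes> part ?x (neg v)) \<cdot> unshuffle M (pre ?x v) cs"
      using X(10)[OF v(1) refl] f U x(2,3) ft by simp
  qed
qed

text \<open>The section, computed on the split form by strictness and \<open>unshuffle_W\<close>,
  returns \<open>u\<close>, \<open>f1\<close> and \<open>f2\<close> at the marking of the factors of
  \<open>y\<close> and at its complement. So all three are determined by the composite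
  arrow.\<close>

lemma arr_split_unique:
  assumes "set cs \<subseteq> gens" "length u = length cs" "f1 \<in> hom M (T u cs) y" "f2 \<in> hom M (T (neg u) cs) z"
    "length u' = length cs" "f1' \<in> hom M (T u' cs) y" "f2' \<in> hom M (T (neg u') cs) z"
    "(f1 \<otimes> f2) \<cdot> unshuffle M u cs = (f1' \<otimes> f2') \<cdot> unshuffle M u' cs"
  shows "u = u' \<and> f1 = f1' \<and> f2 = f2'"
proof -
  obtain E where E: "strict_monoidal M W E" "\<And>c. c \<in> gens \<Longrightarrow> fobj E c = [c]"
    "\<And>a. a \<in> Obj M \<Longrightarrow> tensor_objs M (fobj E a) = a" "\<And>f. f \<in> Arr M \<Longrightarrow> farr top_functor (farr E f) = f"
    using section_functor by metis
  interpret E: strict_monoidal M W E by fact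
  have Es: "map (fobj E) cs = map (\<lambda>c. [c]) cs" if "set cs \<subseteq> gens" for cs using that E(2) by auto
  have "tensor_objs W (map (\<lambda>c. [c]) cs) = cs" for cs :: "'u list" by (induction cs) auto
  then have Ecs: "fobj E (tensor_objs M cs) = cs" if "set cs \<subseteq> gens" for cs
    using E.functor_tensor_objs[OF C_subset[OF that]] Es[OF that] by (simp only:)
  let ?v = "all_true (length (fobj E y)) @ all_false (length (fobj E z))"
  have *: "pre (farr E ((f1 \<otimes> f2) \<cdot> unshuffle M u cs)) ?v = u \<and>
     part (farr E ((f1 \<otimes> f2) \<cdot> unshuffle M u cs)) ?v = f1 \<and>
     part (farr E ((f1 \<otimes> f2) \<cdot> unshuffle M u cs)) (neg ?v) = f2"
    if "length u = length cs" "f1 \<in> hom M (T u cs) y" "f2 \<in> hom M (T (neg u) cs) z" for u f1 f2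
  proof -
    have f: "f1 \<in> Arr M" "Dom M f1 = T u cs" "Cod M f1 = y" "f2 \<in> Arr M" "Dom M f2 = T (neg u) cs" "Cod M f2 = z"
      using that by (auto simp: hom_def)
    let ?U = "unshuffle W u (map (\<lambda>c. [c]) cs)"
    have "farr E (unshuffle M u cs) = ?U"
      using E.functor_unshuffle[OF that(1)] assms(1) Es[OF assms(1)] by simp
    then have e: "farr E ((f1 \<otimes> f2) \<cdot> unshuffle M u cs) = (farr E f1 \<otimes>\<^bsub>W\<^esub> farr E f2) \<cdot>\<^bsub>W\<^esub> ?U"
      using f assms(1) that(1) by simp
    note U = unshuffle_W[OF that(1) assms(1)]
    have x: "farr E f1 \<in> marked_arrs M gens" "fst (farr E f1) = select u cs" "fst (snd (farr E f1)) = fobj E y"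
      "farr E f2 \<in> marked_arrs M gens" "fst (farr E f2) = select (neg u) cs" "fst (snd (farr E f2)) = fobj E z"
      using E.functor_simps(2-4)[of f1] E.functor_simps(2-4)[of f2] f Ecs assms(1) by auto
    have t: "part (farr E f1) (all_true (length (fobj E y))) = f1" "part (farr E f2) (all_true (length (fobj E z))) = f2"
      using E(4)[OF f(1)] E(4)[OF f(4)] x by (simp_all add: top_functor_def)
    have p: "pre (farr E f1) (all_true (length (fobj E y))) = all_true (length (select u cs))"
      "pre (farr E f2) (all_true (length (fobj E z))) = all_true (length (select (neg u) cs))"
      "pre (farr E f1) (all_false (length (fobj E y))) = all_false (length (select u cs))"
      "pre (farr E f2) (all_false (length (fobj E z))) = all_false (length (select (neg u) cs))"
      "part (farr E f1) (all_false (length (fobj E y))) = Idt M (Unt M)"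
      "part (farr E f2) (all_false (length (fobj E z))) = Idt M (Unt M)"
      using pre_all_true[OF x(1)] pre_all_true[OF x(4)] marked_arr_simps(3,4)[OF x(1)] marked_arr_simps(3,4)[OF x(4)] x
      by simp_all
    have o: "T u cs \<in> Obj M" "T (neg u) cs \<in> Obj M" using assms(1) by simp_all
    note TT = W_tensor[OF x(1,4)]
    have "fst (snd ?U) = fst (farr E f1 \<otimes>\<^bsub>W\<^esub> farr E f2)" using TT U x by simp
    note CC = W_comp[OF U(1) TT(1) this]
    show ?thesis unfolding e
      using CC(4,5)[of ?v] CC(4,5)[of "neg ?v"] TT(3) TT(4,5)[of ?v] TT(4,5)[of "neg ?v"] x U(4-6)[OF refl refl] t p f o
      by simp
  qed
  show ?thesis using *[OF assms(2-4), unfolded assms(8)] *[OF assms(5-7)] by metis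
qed

end

section \<open>Exactness\<close>

text \<open>The section sends \<open>tensor_objs M cs\<close> to the list \<open>cs\<close> itself
  and the unit to the empty list.\<close>

lemma (in free_monoidal) tensor_gens_unit:
  assumes "set cs \<subseteq> gens" "tensor_objs M cs = Unt M"
  shows "cs = []"
proof -
  obtain E where E: "strict_monoidal M W E" "\<And>c. c \<in> gens \<Longrightarrow> fobj E c = [c]"
    using section_functor by metis
  interpret E: strict_monoidal M W E by fact
  have "map (fobj E) cs = map (\<lambda>c. [c]) cs" using assms(1) E(2) by auto
  moreover have "tensor_objs W (map (\<lambda>c. [c]) cs) = cs" by (induction cs) auto
  ultimately have "fobj E (tensor_objs M cs) = cs"
    using E.functor_tensor_objs[OF C_subset[OF assms(1)]] by (simp only:)
  then show ?thesis using assms(2) E.strict_simps(1) by simp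
qed

text \<open>
  The arrows \<open>K a \<rightarrow> y \<otimes> z\<close> factor through the tensor product of two arrows \<open>K x \<rightarrow> y\<close> and \<open>K x' \<rightarrow> z\<close>,
  in such a way that every other factorisation is obtained from this one.
\<close>

locale splitting_functor = strict_monoidal A B K
  for A :: "('o, 'a, 'z1) smcat_scheme" and B :: "('p, 'b, 'z2) smcat_scheme" and K +
  assumes split_unit: "a \<in> Obj A \<Longrightarrow> m \<in> hom B (fobj K a) (Unt B) \<Longrightarrow> a = Unt A \<and> m = Idt B (Unt B)"
    and arr_unit: "t \<in> hom A (Unt A) (Unt A) \<Longrightarrow> t = Idt A (Unt A)"
    and split_tensor: "a \<in> Obj A \<Longrightarrow> y \<in> Obj B \<Longrightarrow> z \<in> Obj B \<Longrightarrow> m \<in> hom B (fobj K a) (y \<odot>\<^bsub>B\<^esub> z) \<Longrightarrow>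
      \<exists>x \<in> Obj A. \<exists>x' \<in> Obj A. \<exists>s \<in> hom A a (x \<odot>\<^bsub>A\<^esub> x'). \<exists>g \<in> hom B (fobj K x) y. \<exists>g' \<in> hom B (fobj K x') z.
        (g \<otimes>\<^bsub>B\<^esub> g') \<cdot>\<^bsub>B\<^esub> farr K s = m \<and>
        (\<forall>x1 \<in> Obj A. \<forall>x1' \<in> Obj A. \<forall>t \<in> hom A a (x1 \<odot>\<^bsub>A\<^esub> x1').
          \<forall>h \<in> hom B (fobj K x1) y. \<forall>h' \<in> hom B (fobj K x1') z. (h \<otimes>\<^bsub>B\<^esub> h') \<cdot>\<^bsub>B\<^esub> farr K t = m \<longrightarrow>
            (\<exists>t1 \<in> hom A x x1. \<exists>t2 \<in> hom A x' x1'. t = (t1 \<otimes>\<^bsub>A\<^esub> t2) \<cdot>\<^bsub>A\<^esub> s \<and>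
              h \<cdot>\<^bsub>B\<^esub> farr K t1 = g \<and> h' \<cdot>\<^bsub>B\<^esub> farr K t2 = g'))"

text \<open>As \<open>K\<close> sends generators to generators, the factors of \<open>a\<close>
  correspond one by one to those of its image. The marking that splits \<open>m\<close> in
  \<open>B\<close> therefore also marks the factors of \<open>a\<close>, and the unshuffle of these
  in \<open>A\<close> is the required arrow.\<close>

lemma splitting_functor_free:
  assumes A: "free_monoidal R A \<eta>R" and B: "free_monoidal T B \<eta>T"
    and K: "strict_monoidal_functor A B K" and gens: "\<And>c. c \<in> free_monoidal.gens R \<eta>R \<Longrightarrow> fobj K c \<in> free_monoidal.gens T \<eta>T"
  shows "splitting_functor A B K"
proof -
  interpret A: free_monoidal R A \<eta>R by fact
  interpret B: free_monoidal T B \<eta>T by fact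
  interpret strict_monoidal A B K by unfold_locales fact
  have mg: "set (map (fobj K) cs) \<subseteq> B.gens" if "set cs \<subseteq> A.gens" for cs using that gens by auto
  show ?thesis
  proof
    fix a m assume a: "a \<in> Obj A" and m: "m \<in> hom B (fobj K a) (Unt B)"
    have m': "m = Idt B (Unt B)" using m B.arr_into_unit[of m] by (simp add: hom_def)
    then have "fobj K a = Unt B" using m by (simp add: hom_def)
    moreover obtain cs where cs: "set cs \<subseteq> A.gens" "a = tensor_objs A cs" using A.obj_tensor_gens[OF a] .
    ultimately have "map (fobj K) cs = []"
      using B.tensor_gens_unit[OF mg[OF cs(1)]] functor_tensor_objs[of cs] by simp
    then show "a = Unt A \<and> m = Idt B (Unt B)" using m' cs by simp
  next
    fix t assume "t \<in> hom A (Unt A) (Unt A)"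
    then show "t = Idt A (Unt A)" using A.arr_into_unit by (simp add: hom_def)
  next
    fix a y z m assume a: "a \<in> Obj A" and yz: "y \<in> Obj B" "z \<in> Obj B" and m: "m \<in> hom B (fobj K a) (y \<odot>\<^bsub>B\<^esub> z)"
    obtain cs where cs: "set cs \<subseteq> A.gens" "a = tensor_objs A cs" using A.obj_tensor_gens[OF a] .
    let ?ds = "map (fobj K) cs"
    have Ka: "fobj K a = tensor_objs B ?ds" using cs functor_tensor_objs[of cs] by simp
    obtain u g g' where g: "length u = length ?ds" "g \<in> hom B (tensor_objs B (select u ?ds)) y"
      "g' \<in> hom B (tensor_objs B (select (neg u) ?ds)) z" "m = (g \<otimes>\<^bsub>B\<^esub> g') \<cdot>\<^bsub>B\<^esub> unshuffle B u ?ds"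
      using B.arr_split[OF mg[OF cs(1)] m[unfolded Ka] yz] by metis
    have lu: "length u = length cs" using g(1) by simp
    \<comment> \<open>Selecting by a marking commutes with applying \<open>K\<close> to the factors,
      so the parts of a splitting in \<open>B\<close> start at images of objects of
      \<open>A\<close>.\<close>
    have Ksel: "tensor_objs B (select v ?ds) = fobj K (tensor_objs A (select v cs))" for v
      using functor_tensor_objs[of "select v cs"] cs(1) by (simp add: select_map)
    have Ku: "farr K (unshuffle A v cs) = unshuffle B v ?ds" if "length v = length cs" for v
      using functor_unshuffle[OF that] cs(1) by simp
    have univ: "\<forall>x1 \<in> Obj A. \<forall>x1' \<in> Obj A. \<forall>t \<in> hom A a (x1 \<odot>\<^bsub>A\<^esub> x1').
          \<forall>h \<in> hom B (fobj K x1) y. \<forall>h' \<in> hom B (fobj K x1') z. (h \<otimes>\<^bsub>B\<^esub> h') \<cdot>\<^bsub>B\<^esub> farr K t = m \<longrightarrow>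
            (\<exists>t1 \<in> hom A (tensor_objs A (select u cs)) x1. \<exists>t2 \<in> hom A (tensor_objs A (select (neg u) cs)) x1'.
              t = (t1 \<otimes>\<^bsub>A\<^esub> t2) \<cdot>\<^bsub>A\<^esub> unshuffle A u cs \<and> h \<cdot>\<^bsub>B\<^esub> farr K t1 = g \<and> h' \<cdot>\<^bsub>B\<^esub> farr K t2 = g')"
    proof (intro ballI impI)
      fix x1 x1' t h h'
      assume x: "x1 \<in> Obj A" "x1' \<in> Obj A" and t: "t \<in> hom A a (x1 \<odot>\<^bsub>A\<^esub> x1')" and h: "h \<in> hom B (fobj K x1) y" "h' \<in> hom B (fobj K x1') z"
        and e: "(h \<otimes>\<^bsub>B\<^esub> h') \<cdot>\<^bsub>B\<^esub> farr K t = m"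
      \<comment> \<open>The competing arrow \<open>t\<close> is itself split in \<open>A\<close>.
        Its image under \<open>K\<close>, followed by \<open>h\<close> and \<open>h'\<close>, is a
        second splitting of \<open>m\<close>, to be compared with the first by uniqueness in
        \<open>B\<close>.\<close>
      obtain u1 t1 t2 where t12: "length u1 = length cs" "t1 \<in> hom A (tensor_objs A (select u1 cs)) x1"
        "t2 \<in> hom A (tensor_objs A (select (neg u1) cs)) x1'" "t = (t1 \<otimes>\<^bsub>A\<^esub> t2) \<cdot>\<^bsub>A\<^esub> unshuffle A u1 cs"
        using A.arr_split[OF cs(1) t[unfolded cs(2)] x] .
      have tt: "t1 \<in> Arr A" "Dom A t1 = tensor_objs A (select u1 cs)" "Cod A t1 = x1"
        "t2 \<in> Arr A" "Dom A t2 = tensor_objs A (select (neg u1) cs)" "Cod A t2 = x1'"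
        "h \<in> Arr B" "Dom B h = fobj K x1" "Cod B h = y" "h' \<in> Arr B" "Dom B h' = fobj K x1'" "Cod B h' = z"
        using t12(2,3) h by (auto simp: hom_def)
      have "m = ((h \<cdot>\<^bsub>B\<^esub> farr K t1) \<otimes>\<^bsub>B\<^esub> (h' \<cdot>\<^bsub>B\<^esub> farr K t2)) \<cdot>\<^bsub>B\<^esub> unshuffle B u1 ?ds"
        using e tt t12(1) cs(1) mg[OF cs(1)] by (simp add: t12(4) Ku B.interchange_assoc Ksel del: set_map)
      then have "(g \<otimes>\<^bsub>B\<^esub> g') \<cdot>\<^bsub>B\<^esub> unshuffle B u ?ds = ((h \<cdot>\<^bsub>B\<^esub> farr K t1) \<otimes>\<^bsub>B\<^esub> (h' \<cdot>\<^bsub>B\<^esub> farr K t2)) \<cdot>\<^bsub>B\<^esub> unshuffle B u1 ?ds"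
        using g(4) by simp
      then have "u = u1 \<and> g = h \<cdot>\<^bsub>B\<^esub> farr K t1 \<and> g' = h' \<cdot>\<^bsub>B\<^esub> farr K t2"
        by (intro B.arr_split_unique[OF mg[OF cs(1)] g(1-3)]) (use tt t12(1) in \<open>simp_all add: hom_def Ksel\<close>)
      then show "\<exists>t1 \<in> hom A (tensor_objs A (select u cs)) x1. \<exists>t2 \<in> hom A (tensor_objs A (select (neg u) cs)) x1'.
          t = (t1 \<otimes>\<^bsub>A\<^esub> t2) \<cdot>\<^bsub>A\<^esub> unshuffle A u cs \<and> h \<cdot>\<^bsub>B\<^esub> farr K t1 = g \<and> h' \<cdot>\<^bsub>B\<^esub> farr K t2 = g'"
        using t12 by blast
    qed
    show "\<exists>x \<in> Obj A. \<exists>x' \<in> Obj A. \<exists>s \<in> hom A a (x \<odot>\<^bsub>A\<^esub> x'). \<exists>g \<in> hom B (fobj K x) y. \<exists>g' \<in> hom B (fobj K x') z.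
        (g \<otimes>\<^bsub>B\<^esub> g') \<cdot>\<^bsub>B\<^esub> farr K s = m \<and>
        (\<forall>x1 \<in> Obj A. \<forall>x1' \<in> Obj A. \<forall>t \<in> hom A a (x1 \<odot>\<^bsub>A\<^esub> x1').
          \<forall>h \<in> hom B (fobj K x1) y. \<forall>h' \<in> hom B (fobj K x1') z. (h \<otimes>\<^bsub>B\<^esub> h') \<cdot>\<^bsub>B\<^esub> farr K t = m \<longrightarrow>
            (\<exists>t1 \<in> hom A x x1. \<exists>t2 \<in> hom A x' x1'. t = (t1 \<otimes>\<^bsub>A\<^esub> t2) \<cdot>\<^bsub>A\<^esub> s \<and>
              h \<cdot>\<^bsub>B\<^esub> farr K t1 = g \<and> h' \<cdot>\<^bsub>B\<^esub> farr K t2 = g'))"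
    proof (intro bexI conjI)
      show "(g \<otimes>\<^bsub>B\<^esub> g') \<cdot>\<^bsub>B\<^esub> farr K (unshuffle A u cs) = m" using g(4) Ku[OF lu] by simp
      show "g \<in> hom B (fobj K (tensor_objs A (select u cs))) y" "g' \<in> hom B (fobj K (tensor_objs A (select (neg u) cs))) z"
        using g(2,3) by (simp_all add: Ksel)
      show "unshuffle A u cs \<in> hom A a (tensor_objs A (select u cs) \<odot>\<^bsub>A\<^esub> tensor_objs A (select (neg u) cs))"
        using cs lu by (simp add: hom_def)
      show "tensor_objs A (select u cs) \<in> Obj A" "tensor_objs A (select (neg u) cs) \<in> Obj A"
        using cs(1) by simp_all
    qed (rule univ)
  qed
qed

context splitting_functor
begin

text \<open>The n-ary form, by induction on \<open>ys\<close>: \<open>split_tensor\<close> separates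
  the first factor and the induction hypothesis splits the complementary arrow. Comparison arrows
  are assembled in the same way; the empty list uses \<open>split_unit\<close> and
  \<open>arr_unit\<close>.\<close>

lemma split_tensor_objs:
  assumes "a \<in> Obj A" "set ys \<subseteq> Obj B" "m \<in> hom B (fobj K a) (tensor_objs B ys)"
  shows "\<exists>xs gs s. set xs \<subseteq> Obj A \<and> s \<in> hom A a (tensor_objs A xs) \<and>
     set gs \<subseteq> Arr B \<and> map (Dom B) gs = map (fobj K) xs \<and> map (Cod B) gs = ys \<and> tensor_arrs B gs \<cdot>\<^bsub>B\<^esub> farr K s = m \<and>
     (\<forall>xs1 gs1 t. set xs1 \<subseteq> Obj A \<and> t \<in> hom A a (tensor_objs A xs1) \<and>
        set gs1 \<subseteq> Arr B \<and> map (Dom B) gs1 = map (fobj K) xs1 \<and> map (Cod B) gs1 = ys \<and> tensor_arrs B gs1 \<cdot>\<^bsub>B\<^esub> farr K t = m \<longrightarrow>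
        (\<exists>ts. set ts \<subseteq> Arr A \<and> map (Dom A) ts = xs \<and> map (Cod A) ts = xs1 \<and> t = tensor_arrs A ts \<cdot>\<^bsub>A\<^esub> s \<and>
           map2 (\<lambda>g t. g \<cdot>\<^bsub>B\<^esub> farr K t) gs1 ts = gs))"
  using assms
proof (induction ys arbitrary: a m)
  case Nil
  then have am: "a = Unt A" "m = Idt B (Unt B)" using split_unit[of a m] by auto
  show ?case
  proof (rule exI[of _ "[]"], rule exI[of _ "[]"], rule exI[of _ "Idt A (Unt A)"], intro conjI allI impI)
    fix xs1 gs1 t
    assume "set xs1 \<subseteq> Obj A \<and> t \<in> hom A a (tensor_objs A xs1) \<and> set gs1 \<subseteq> Arr B \<and>
       map (Dom B) gs1 = map (fobj K) xs1 \<and> map (Cod B) gs1 = [] \<and> tensor_arrs B gs1 \<cdot>\<^bsub>B\<^esub> farr K t = m"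
    then have "xs1 = []" "gs1 = []" "t \<in> hom A a (tensor_objs A xs1)" by auto
    moreover from this have "t = Idt A (Unt A)" using arr_unit am by simp
    ultimately show "\<exists>ts. set ts \<subseteq> Arr A \<and> map (Dom A) ts = [] \<and> map (Cod A) ts = xs1 \<and>
        t = tensor_arrs A ts \<cdot>\<^bsub>A\<^esub> Idt A (Unt A) \<and> map2 (\<lambda>g t. g \<cdot>\<^bsub>B\<^esub> farr K t) gs1 ts = []"
      by (intro exI[of _ "[]"]) simp
  qed (use am in \<open>auto simp: hom_def\<close>)
next
  case (Cons y ys)
  have y: "y \<in> Obj B" "set ys \<subseteq> Obj B" "tensor_objs B ys \<in> Obj B" using Cons.prems by auto
  have m: "m \<in> hom B (fobj K a) (y \<odot>\<^bsub>B\<^esub> tensor_objs B ys)" using Cons.prems(3) by simp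
  obtain x x' s0 g g' where x: "x \<in> Obj A" "x' \<in> Obj A" and s0: "s0 \<in> hom A a (x \<odot>\<^bsub>A\<^esub> x')"
    and g: "g \<in> hom B (fobj K x) y" "g' \<in> hom B (fobj K x') (tensor_objs B ys)" "(g \<otimes>\<^bsub>B\<^esub> g') \<cdot>\<^bsub>B\<^esub> farr K s0 = m"
    and univ: "\<forall>x1 \<in> Obj A. \<forall>x1' \<in> Obj A. \<forall>t \<in> hom A a (x1 \<odot>\<^bsub>A\<^esub> x1').
          \<forall>h \<in> hom B (fobj K x1) y. \<forall>h' \<in> hom B (fobj K x1') (tensor_objs B ys). (h \<otimes>\<^bsub>B\<^esub> h') \<cdot>\<^bsub>B\<^esub> farr K t = m \<longrightarrow>
            (\<exists>t1 \<in> hom A x x1. \<exists>t2 \<in> hom A x' x1'. t = (t1 \<otimes>\<^bsub>A\<^esub> t2) \<cdot>\<^bsub>A\<^esub> s0 \<and>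
              h \<cdot>\<^bsub>B\<^esub> farr K t1 = g \<and> h' \<cdot>\<^bsub>B\<^esub> farr K t2 = g')"
    using split_tensor[OF Cons.prems(1) y(1,3) m] by blast
  obtain xs gs s where IH: "set xs \<subseteq> Obj A" "s \<in> hom A x' (tensor_objs A xs)"
     "set gs \<subseteq> Arr B" "map (Dom B) gs = map (fobj K) xs" "map (Cod B) gs = ys" "tensor_arrs B gs \<cdot>\<^bsub>B\<^esub> farr K s = g'"
    and IHu: "\<And>xs1 gs1 t. set xs1 \<subseteq> Obj A \<and> t \<in> hom A x' (tensor_objs A xs1) \<and>
        set gs1 \<subseteq> Arr B \<and> map (Dom B) gs1 = map (fobj K) xs1 \<and> map (Cod B) gs1 = ys \<and> tensor_arrs B gs1 \<cdot>\<^bsub>B\<^esub> farr K t = g' \<Longrightarrow>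
        (\<exists>ts. set ts \<subseteq> Arr A \<and> map (Dom A) ts = xs \<and> map (Cod A) ts = xs1 \<and> t = tensor_arrs A ts \<cdot>\<^bsub>A\<^esub> s \<and>
           map2 (\<lambda>g t. g \<cdot>\<^bsub>B\<^esub> farr K t) gs1 ts = gs)"
    using Cons.IH[OF x(2) y(2) g(2)] by (elim exE conjE) (rule that; blast)
  have a1: "g \<in> Arr B" "Dom B g = fobj K x" "Cod B g = y" "s0 \<in> Arr A" "Dom A s0 = a" "Cod A s0 = x \<odot>\<^bsub>A\<^esub> x'"
    "s \<in> Arr A" "Dom A s = x'" "Cod A s = tensor_objs A xs"
    using g s0 IH by (auto simp: hom_def)
  note TB = B.tensor_arrs_simps[OF IH(3), unfolded IH(4,5)]
  have Kxs: "fobj K (tensor_objs A xs) = tensor_objs B (map (fobj K) xs)" using functor_tensor_objs[OF IH(1)] .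
  show ?case
  \<comment> \<open>\<open>s0\<close> separates the first factor from the rest, and \<open>s\<close>
    splits the rest.\<close>
  proof (rule exI[of _ "x # xs"], rule exI[of _ "g # gs"], rule exI[of _ "(Idt A x \<otimes>\<^bsub>A\<^esub> s) \<cdot>\<^bsub>A\<^esub> s0"],
      intro conjI allI impI)
    show "(Idt A x \<otimes>\<^bsub>A\<^esub> s) \<cdot>\<^bsub>A\<^esub> s0 \<in> hom A a (tensor_objs A (x # xs))"
      using a1 x by (simp add: hom_def)
    have "tensor_arrs B (g # gs) \<cdot>\<^bsub>B\<^esub> farr K ((Idt A x \<otimes>\<^bsub>A\<^esub> s) \<cdot>\<^bsub>A\<^esub> s0) =
       (g \<otimes>\<^bsub>B\<^esub> (tensor_arrs B gs \<cdot>\<^bsub>B\<^esub> farr K s)) \<cdot>\<^bsub>B\<^esub> farr K s0"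
      using a1 x TB by (simp add: B.interchange_assoc Kxs)
    then show "tensor_arrs B (g # gs) \<cdot>\<^bsub>B\<^esub> farr K ((Idt A x \<otimes>\<^bsub>A\<^esub> s) \<cdot>\<^bsub>A\<^esub> s0) = m"
      using IH(6) g(3) by simp
    fix xs1 gs1 t
    assume u: "set xs1 \<subseteq> Obj A \<and> t \<in> hom A a (tensor_objs A xs1) \<and> set gs1 \<subseteq> Arr B \<and>
       map (Dom B) gs1 = map (fobj K) xs1 \<and> map (Cod B) gs1 = y # ys \<and> tensor_arrs B gs1 \<cdot>\<^bsub>B\<^esub> farr K t = m"
    then obtain h hs where gs1: "gs1 = h # hs" by (cases gs1) auto
    with u obtain x1 xs2 where xs1: "xs1 = x1 # xs2" by (cases xs1) auto
    have h: "h \<in> hom B (fobj K x1) y" "set hs \<subseteq> Arr B" "map (Dom B) hs = map (fobj K) xs2" "map (Cod B) hs = ys"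
      "x1 \<in> Obj A" "set xs2 \<subseteq> Obj A" "t \<in> hom A a (x1 \<odot>\<^bsub>A\<^esub> tensor_objs A xs2)" "(h \<otimes>\<^bsub>B\<^esub> tensor_arrs B hs) \<cdot>\<^bsub>B\<^esub> farr K t = m"
      using u by (auto simp: gs1 xs1 hom_def)
    note TH = B.tensor_arrs_simps[OF h(2), unfolded h(3,4)]
    have "tensor_arrs B hs \<in> hom B (fobj K (tensor_objs A xs2)) (tensor_objs B ys)"
      using TH functor_tensor_objs[OF h(6)] by (simp add: hom_def)
    with univ h obtain t1 t2 where t: "t1 \<in> hom A x x1" "t2 \<in> hom A x' (tensor_objs A xs2)" "t = (t1 \<otimes>\<^bsub>A\<^esub> t2) \<cdot>\<^bsub>A\<^esub> s0"
      "h \<cdot>\<^bsub>B\<^esub> farr K t1 = g" "tensor_arrs B hs \<cdot>\<^bsub>B\<^esub> farr K t2 = g'"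
      by (metis A.tensor_objs_obj)
    obtain ts where ts: "set ts \<subseteq> Arr A" "map (Dom A) ts = xs" "map (Cod A) ts = xs2" "t2 = tensor_arrs A ts \<cdot>\<^bsub>A\<^esub> s"
       "map2 (\<lambda>g t. g \<cdot>\<^bsub>B\<^esub> farr K t) hs ts = gs"
      using IHu[of xs2 t2 hs] h t by auto
    note TA = A.tensor_arrs_simps[OF ts(1), unfolded ts(2,3)]
    show "\<exists>ts. set ts \<subseteq> Arr A \<and> map (Dom A) ts = x # xs \<and> map (Cod A) ts = xs1 \<and>
        t = tensor_arrs A ts \<cdot>\<^bsub>A\<^esub> ((Idt A x \<otimes>\<^bsub>A\<^esub> s) \<cdot>\<^bsub>A\<^esub> s0) \<and> map2 (\<lambda>g t. g \<cdot>\<^bsub>B\<^esub> farr K t) gs1 ts = g # gs"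
    proof (intro exI[of _ "t1 # ts"] conjI)
      have t1: "t1 \<in> Arr A" "Dom A t1 = x" "Cod A t1 = x1" using t(1) by (auto simp: hom_def)
      then show "t = tensor_arrs A (t1 # ts) \<cdot>\<^bsub>A\<^esub> ((Idt A x \<otimes>\<^bsub>A\<^esub> s) \<cdot>\<^bsub>A\<^esub> s0)"
        using t(3) ts(4) a1 x TA by (simp add: A.interchange_assoc)
      show "set (t1 # ts) \<subseteq> Arr A" "map (Dom A) (t1 # ts) = x # xs" "map (Cod A) (t1 # ts) = xs1"
        "map2 (\<lambda>g t. g \<cdot>\<^bsub>B\<^esub> farr K t) gs1 (t1 # ts) = g # gs"
        using t1 ts t(4) by (auto simp: xs1 gs1)
    qed
  qed (use a1 x IH in auto)
qed

end

section \<open>Cocones over comma categories and the exact square\<close>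

lemma comma_simps:
  "Obj (comma A C f c) = {(a, m). a \<in> Obj A \<and> m \<in> hom C (fobj f a) c}"
  "Arr (comma A C f c) = {(t, m). t \<in> Arr A \<and> m \<in> hom C (fobj f (Cod A t)) c}"
  "Dom (comma A C f c) (t, m) = (Dom A t, m \<cdot>\<^bsub>C\<^esub> farr f t)"
  "Cod (comma A C f c) (t, m) = (Cod A t, m)"
  by (auto simp: comma_def)

lemma is_cocone_commaD:
  assumes "is_cocone (comma A C f c) X (h \<circ>\<^sub>F comma_proj) d \<kappa>"
  shows "d \<in> Obj X" "a \<in> Obj A \<Longrightarrow> m \<in> hom C (fobj f a) c \<Longrightarrow> \<kappa> (a, m) \<in> hom X (fobj h a) d"
    "t \<in> hom A a a' \<Longrightarrow> m \<in> hom C (fobj f a') c \<Longrightarrow> \<kappa> (a', m) \<cdot>\<^bsub>X\<^esub> farr h t = \<kappa> (a, m \<cdot>\<^bsub>C\<^esub> farr f t)"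
proof -
  show "d \<in> Obj X" using assms by (simp add: is_cocone_def)
  have \<kappa>: "\<And>i. i \<in> Obj (comma A C f c) \<Longrightarrow> \<kappa> i \<in> hom X (fobj h (fst i)) d"
    "\<And>t. t \<in> Arr (comma A C f c) \<Longrightarrow> \<kappa> (Cod (comma A C f c) t) \<cdot>\<^bsub>X\<^esub> farr h (fst t) = \<kappa> (Dom (comma A C f c) t)"
    using assms by (auto simp: is_cocone_def functor_comp_def comma_proj_def)
  show "a \<in> Obj A \<Longrightarrow> m \<in> hom C (fobj f a) c \<Longrightarrow> \<kappa> (a, m) \<in> hom X (fobj h a) d"
    using \<kappa>(1)[of "(a, m)"] by (simp add: comma_simps)
  show "t \<in> hom A a a' \<Longrightarrow> m \<in> hom C (fobj f a') c \<Longrightarrow> \<kappa> (a', m) \<cdot>\<^bsub>X\<^esub> farr h t = \<kappa> (a, m \<cdot>\<^bsub>C\<^esub> farr f t)"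
    using \<kappa>(2)[of "(t, m)"] by (auto simp: comma_simps hom_def)
qed

lemma is_cocone_commaI:
  assumes "d \<in> Obj X" "\<And>a m. a \<in> Obj A \<Longrightarrow> m \<in> hom C (fobj f a) c \<Longrightarrow> \<kappa> (a, m) \<in> hom X (fobj h a) d"
    "\<And>t a a' m. t \<in> hom A a a' \<Longrightarrow> m \<in> hom C (fobj f a') c \<Longrightarrow> \<kappa> (a', m) \<cdot>\<^bsub>X\<^esub> farr h t = \<kappa> (a, m \<cdot>\<^bsub>C\<^esub> farr f t)"
  shows "is_cocone (comma A C f c) X (h \<circ>\<^sub>F comma_proj) d \<kappa>"
  using assms by (auto simp: is_cocone_def functor_comp_def comma_proj_def comma_simps hom_def)

lemma nat_transD:
  assumes "nat_trans A B F G \<tau>"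
  shows "cat_functor A B F" "cat_functor A B G"
    "a \<in> Obj A \<Longrightarrow> \<tau> a \<in> hom B (fobj F a) (fobj G a)"
    "a \<in> Obj A \<Longrightarrow> \<tau> a \<in> Arr B" "a \<in> Obj A \<Longrightarrow> Dom B (\<tau> a) = fobj F a" "a \<in> Obj A \<Longrightarrow> Cod B (\<tau> a) = fobj G a"
    "f \<in> Arr A \<Longrightarrow> \<tau> (Cod A f) \<cdot>\<^bsub>B\<^esub> farr F f = farr G f \<cdot>\<^bsub>B\<^esub> \<tau> (Dom A f)"
  using assms by (auto simp: nat_trans_def hom_def)

lemma functor_comp_simps [simp]:
  "fobj (G \<circ>\<^sub>F F) a = fobj G (fobj F a)" "farr (G \<circ>\<^sub>F F) f = farr G (farr F f)"
  by (simp_all add: functor_comp_def)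

lemma is_cocone_comma_nat_trans:
  assumes "category A" "category X" "category C" "cat_functor A C f" "cat_functor C X l" "nat_trans A X h (l \<circ>\<^sub>F f) \<psi>" "c \<in> Obj C"
  shows "is_cocone (comma A C f c) X (h \<circ>\<^sub>F comma_proj) (fobj l c) (\<lambda>(a, m). farr l m \<cdot>\<^bsub>X\<^esub> \<psi> a)"
proof -
  interpret A: category A by fact
  interpret X: category X by fact
  interpret C: category C by fact
  note l = cat_functorD[OF assms(5)] and f = cat_functorD[OF assms(4)] and \<psi> = nat_transD[OF assms(6)]
  note h = cat_functorD[OF \<psi>(1)]
  show ?thesis
  proof (rule is_cocone_commaI)
    show "fobj l c \<in> Obj X" using l assms by simp
    fix a m assume "a \<in> Obj A" "m \<in> hom C (fobj f a) c"
    then show "(\<lambda>(a, m). farr l m \<cdot>\<^bsub>X\<^esub> \<psi> a) (a, m) \<in> hom X (fobj h a) (fobj l c)"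
      using l \<psi> by (auto simp: hom_def)
  next
    fix t a a' m assume t: "t \<in> hom A a a'" and m: "m \<in> hom C (fobj f a') c"
    then show "(\<lambda>(a, m). farr l m \<cdot>\<^bsub>X\<^esub> \<psi> a) (a', m) \<cdot>\<^bsub>X\<^esub> farr h t = (\<lambda>(a, m). farr l m \<cdot>\<^bsub>X\<^esub> \<psi> a) (a, m \<cdot>\<^bsub>C\<^esub> farr f t)"
      using l f h \<psi>(4-6) \<psi>(7)[of t] by (auto simp: hom_def)
  qed
qed

context splitting_functor
begin

lemma tensor_sym_functor_obj: "xs \<in> Obj (sym_cat A) \<Longrightarrow> fobj K (tensor_objs A xs) = tensor_objs B (map (fobj K) xs)"
  by (rule functor_tensor_objs) (simp add: sym_cat_def)

lemma tensor_sym_functor_arr: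
  assumes "r \<in> Arr (sym_cat A)"
  shows "farr K (farr (tensor_functor A) r) = farr (tensor_functor B) (farr (sym_functor K) r)"
proof -
  obtain \<rho> fs where r: "r = (\<rho>, fs)" by (cases r)
  have a: "\<rho> permutes {..<length (map (Cod A) fs)}" "set fs \<subseteq> Arr A" "set (map (Cod A) fs) \<subseteq> Obj A"
    using assms by (auto simp: r sym_cat_def)
  have "map (Cod B) (map (farr K) fs) = map (fobj K) (map (Cod A) fs)" using a(2) by auto
  then show ?thesis
    using A.perm_arr_simps[OF a(1,3)] A.tensor_arrs_simps[OF a(2)] functor_perm_arr[OF a(1,3)] functor_tensor_arrs[OF a(2)]
    by (simp add: r tensor_functor_def sym_functor_def del: map_map)
qed

text \<open>Strictness of \<open>K\<close> makes the two composites of the square agree on objects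
  and on arrows, so identity components are natural.\<close>

lemma lax_square_tensor:
  "lax_square (sym_cat A) A (sym_cat B) B (tensor_functor A) (sym_functor K) K (tensor_functor B)
     (\<lambda>xs. Idt B (fobj K (tensor_objs A xs)))"
proof -
  interpret SA: category "sym_cat A" by (rule A.category_sym_cat)
  note tA = A.cat_functor_tensor and tB = B.cat_functor_tensor and S = cat_functor_sym_functor[OF is_functor]
  have K: "cat_functor (sym_cat A) B (K \<circ>\<^sub>F tensor_functor A)" "cat_functor (sym_cat A) B (tensor_functor B \<circ>\<^sub>F sym_functor K)"
    by (rule cat_functor_comp[OF tA is_functor], rule cat_functor_comp[OF S tB])
  have o: "fobj (tensor_functor A) = tensor_objs A" "fobj (tensor_functor B) = tensor_objs B" "fobj (sym_functor K) = map (fobj K)"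
    by (simp_all add: tensor_functor_def sym_functor_def)
  have "nat_trans (sym_cat A) B (K \<circ>\<^sub>F tensor_functor A) (tensor_functor B \<circ>\<^sub>F sym_functor K)
     (\<lambda>xs. Idt B (fobj K (tensor_objs A xs)))"
    unfolding nat_trans_def
  proof (intro conjI ballI K)
    fix xs assume xs: "xs \<in> Obj (sym_cat A)"
    then have "fobj K (tensor_objs A xs) \<in> Obj B" by (simp add: sym_cat_def)
    then show "Idt B (fobj K (tensor_objs A xs)) \<in> hom B (fobj (K \<circ>\<^sub>F tensor_functor A) xs) (fobj (tensor_functor B \<circ>\<^sub>F sym_functor K) xs)"
      using tensor_sym_functor_obj[OF xs] by (simp add: hom_def o)
  next
    fix r assume r: "r \<in> Arr (sym_cat A)"
    then show "Idt B (fobj K (tensor_objs A (Cod (sym_cat A) r))) \<cdot>\<^bsub>B\<^esub> farr (K \<circ>\<^sub>F tensor_functor A) r =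
        farr (tensor_functor B \<circ>\<^sub>F sym_functor K) r \<cdot>\<^bsub>B\<^esub> Idt B (fobj K (tensor_objs A (Dom (sym_cat A) r)))"
      using cat_functorD[OF K(1)] cat_functorD(2-4)[OF K(2) r] tensor_sym_functor_arr[OF r]
        tensor_sym_functor_obj[OF SA.dom_obj[OF r]] tensor_sym_functor_obj[OF SA.cod_obj[OF r]] by (simp add: o)
  qed
  then show ?thesis
    unfolding lax_square_def
    using A.category_sym_cat B.category_sym_cat A.category_axioms B.category_axioms tA tB S is_functor by blast
qed

text \<open>A cocone \<kappa> over the comma category of \<open>sym_functor K\<close> at
  \<open>ys\<close> is extended to one over the comma category of \<open>K\<close> at the tensor
  product of \<open>ys\<close>: the value at (a, m) is taken from any factorisation of m through a
  list of arrows. The universal factorisation makes this well defined, and the colimit for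
  \<open>K\<close> then yields the required unique arrow.\<close>

lemma exact_square_tensor:
  "exact_square TYPE('x \<times> 'y) (sym_cat A) A (sym_cat B) B (tensor_functor A) (sym_functor K) K (tensor_functor B)
     (\<lambda>xs. Idt B (fobj K (tensor_objs A xs)))"
  unfolding exact_square_def
proof (intro conjI allI impI lax_square_tensor)
  fix X :: "('x, 'y) cat" and h l \<psi>
  assume "category X \<and> pointwise_left_kan A B X K h l \<psi>"
  then have X: "category X" and kan: "pointwise_left_kan A B X K h l \<psi>" by auto
  interpret X: category X by fact
  interpret SA: category "sym_cat A" by (rule A.category_sym_cat)
  interpret SB: category "sym_cat B" by (rule B.category_sym_cat)
  let ?SA = "sym_cat A" and ?SB = "sym_cat B" and ?SK = "sym_functor K" and ?TA = "tensor_functor A" and ?TB = "tensor_functor B"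
  let ?\<psi> = "\<lambda>u. farr l (Idt B (fobj K (tensor_objs A u))) \<cdot>\<^bsub>X\<^esub> \<psi> (fobj ?TA u)"
  have l: "cat_functor B X l" and \<psi>: "nat_trans A X h (l \<circ>\<^sub>F K) \<psi>"
    and colim: "\<And>c. c \<in> Obj B \<Longrightarrow> is_colimit (comma A B K c) X (h \<circ>\<^sub>F comma_proj) (fobj l c) (\<lambda>(a, m). farr l m \<cdot>\<^bsub>X\<^esub> \<psi> a)"
    using kan by (auto simp: pointwise_left_kan_def)
  note l' = cat_functorD[OF l] and \<psi>' = nat_transD[OF \<psi>]
  note h' = cat_functorD[OF \<psi>'(1)]
  note TA = A.cat_functor_tensor and TB = B.cat_functor_tensor and SK = cat_functor_sym_functor[OF is_functor]
  note TA' = cat_functorD[OF TA] and TB' = cat_functorD[OF TB] and SK' = cat_functorD[OF SK]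
  have hT: "cat_functor ?SA X (h \<circ>\<^sub>F ?TA)" "cat_functor ?SB X (l \<circ>\<^sub>F ?TB)" "cat_functor ?SA X ((l \<circ>\<^sub>F ?TB) \<circ>\<^sub>F ?SK)"
    using cat_functor_comp[OF TA \<psi>'(1)] cat_functor_comp[OF TB l] cat_functor_comp[OF SK cat_functor_comp[OF TB l]] .
  have o: "fobj ?TA = tensor_objs A" "fobj ?TB = tensor_objs B" "fobj ?SK = map (fobj K)"
    by (simp_all add: tensor_functor_def sym_functor_def)
  have \<psi>eq: "?\<psi> u = \<psi> (tensor_objs A u)" if "u \<in> Obj ?SA" for u
  proof -
    have "tensor_objs A u \<in> Obj A" using that by (simp add: sym_cat_def)
    then show ?thesis using l' \<psi>' by (simp add: o)
  qed
  have nat: "nat_trans ?SA X (h \<circ>\<^sub>F ?TA) ((l \<circ>\<^sub>F ?TB) \<circ>\<^sub>F ?SK) ?\<psi>"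
    unfolding nat_trans_def
  proof (intro conjI ballI hT)
    fix u assume u: "u \<in> Obj ?SA"
    then have "tensor_objs A u \<in> Obj A" by (simp add: sym_cat_def)
    then show "?\<psi> u \<in> hom X (fobj (h \<circ>\<^sub>F ?TA) u) (fobj ((l \<circ>\<^sub>F ?TB) \<circ>\<^sub>F ?SK) u)"
      using \<psi>'(3)[of "tensor_objs A u"] tensor_sym_functor_obj[OF u] unfolding \<psi>eq[OF u] by (simp add: o)
  next
    fix r assume r: "r \<in> Arr ?SA"
    show "?\<psi> (Cod ?SA r) \<cdot>\<^bsub>X\<^esub> farr (h \<circ>\<^sub>F ?TA) r = farr ((l \<circ>\<^sub>F ?TB) \<circ>\<^sub>F ?SK) r \<cdot>\<^bsub>X\<^esub> ?\<psi> (Dom ?SA r)"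
      using \<psi>'(7)[of "farr ?TA r"] TA' r unfolding \<psi>eq[OF SA.cod_obj[OF r]] \<psi>eq[OF SA.dom_obj[OF r]]
      by (simp add: o tensor_sym_functor_arr)
  qed
  show "pointwise_left_kan ?SA ?SB X ?SK (h \<circ>\<^sub>F ?TA) (l \<circ>\<^sub>F ?TB) ?\<psi>"
    unfolding pointwise_left_kan_def
  proof (intro conjI ballI SK hT nat)
    fix ys assume ys: "ys \<in> Obj ?SB"
    let ?c = "tensor_objs B ys"
    have ys': "set ys \<subseteq> Obj B" using ys by (simp add: sym_cat_def)
    then have c: "?c \<in> Obj B" by simp
    let ?lam = "\<lambda>(a, m). farr l m \<cdot>\<^bsub>X\<^esub> \<psi> a"
    let ?Lam = "\<lambda>(u, m). farr (l \<circ>\<^sub>F ?TB) m \<cdot>\<^bsub>X\<^esub> ?\<psi> u"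
    have \<Lambda>: "?Lam (u, m) = ?lam (tensor_objs A u, farr ?TB m)" if "u \<in> Obj ?SA" for u m
      using \<psi>eq[OF that] by simp
    note cl = colim[OF c, unfolded is_colimit_def]
    have lam: "is_cocone (comma A B K ?c) X (h \<circ>\<^sub>F comma_proj) (fobj l ?c) ?lam"
      and univ: "\<And>d \<kappa>. is_cocone (comma A B K ?c) X (h \<circ>\<^sub>F comma_proj) d \<kappa> \<Longrightarrow>
         (\<exists>!u. u \<in> hom X (fobj l ?c) d \<and> (\<forall>i \<in> Obj (comma A B K ?c). u \<cdot>\<^bsub>X\<^esub> ?lam i = \<kappa> i))"
      using cl by auto
    note lam' = is_cocone_commaD[OF lam]
    show "is_colimit (comma ?SA ?SB ?SK ys) X ((h \<circ>\<^sub>F ?TA) \<circ>\<^sub>F comma_proj) (fobj (l \<circ>\<^sub>F ?TB) ys) ?Lam"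
      unfolding is_colimit_def
    proof (intro conjI allI impI)
      show "is_cocone (comma ?SA ?SB ?SK ys) X ((h \<circ>\<^sub>F ?TA) \<circ>\<^sub>F comma_proj) (fobj (l \<circ>\<^sub>F ?TB) ys) ?Lam"
        by (rule is_cocone_comma_nat_trans[OF SA.category_axioms X SB.category_axioms SK hT(2) nat ys])
      fix d \<kappa> assume \<kappa>: "is_cocone (comma ?SA ?SB ?SK ys) X ((h \<circ>\<^sub>F ?TA) \<circ>\<^sub>F comma_proj) d \<kappa>"
      have \<kappa>1: "\<kappa> (xs, m) \<in> hom X (fobj h (tensor_objs A xs)) d"
        if "xs \<in> Obj ?SA" "m \<in> hom ?SB (map (fobj K) xs) ys" for xs m
        using is_cocone_commaD(2)[OF \<kappa>] that by (simp add: o)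
      have \<kappa>2: "\<kappa> (xs', m) \<cdot>\<^bsub>X\<^esub> farr h (farr ?TA r) = \<kappa> (xs, m \<cdot>\<^bsub>?SB\<^esub> farr ?SK r)"
        if "r \<in> hom ?SA xs xs'" "m \<in> hom ?SB (map (fobj K) xs') ys" for r xs xs' m
        using is_cocone_commaD(3)[OF \<kappa>] that by (simp add: o)
      have d: "d \<in> Obj X" using is_cocone_commaD(1)[OF \<kappa>] .
      \<comment> \<open>The pair (v, s) is a factorisation of m: v is a list of arrows into
        \<open>ys\<close>, possibly with a permutation, and s leads from a to the tensor product of
        its sources.\<close>
      define P where "P a m v s \<longleftrightarrow> v \<in> Obj (comma ?SA ?SB ?SK ys) \<and> s \<in> hom A a (tensor_objs A (fst v)) \<and>
         farr ?TB (snd v) \<cdot>\<^bsub>B\<^esub> farr K s = m" for a m v s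
      \<comment> \<open>Every factorisation gives the same composite with \<kappa> as one
        distinguished factorisation.\<close>
      have ex: "\<exists>v s. P a m v s \<and> (\<forall>w t. P a m w t \<longrightarrow> \<kappa> w \<cdot>\<^bsub>X\<^esub> farr h t = \<kappa> v \<cdot>\<^bsub>X\<^esub> farr h s)"
        if a: "a \<in> Obj A" and m: "m \<in> hom B (fobj K a) ?c" for a m
      proof -
        obtain xs gs s where xs: "set xs \<subseteq> Obj A" "s \<in> hom A a (tensor_objs A xs)"
          "set gs \<subseteq> Arr B" "map (Dom B) gs = map (fobj K) xs" "map (Cod B) gs = ys" "tensor_arrs B gs \<cdot>\<^bsub>B\<^esub> farr K s = m"
          and u: "\<And>xs1 gs1 t. set xs1 \<subseteq> Obj A \<and> t \<in> hom A a (tensor_objs A xs1) \<and>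
            set gs1 \<subseteq> Arr B \<and> map (Dom B) gs1 = map (fobj K) xs1 \<and> map (Cod B) gs1 = ys \<and> tensor_arrs B gs1 \<cdot>\<^bsub>B\<^esub> farr K t = m \<Longrightarrow>
            (\<exists>ts. set ts \<subseteq> Arr A \<and> map (Dom A) ts = xs \<and> map (Cod A) ts = xs1 \<and> t = tensor_arrs A ts \<cdot>\<^bsub>A\<^esub> s \<and>
             map2 (\<lambda>g t. g \<cdot>\<^bsub>B\<^esub> farr K t) gs1 ts = gs)"
          using split_tensor_objs[OF a ys' m] by (elim exE conjE) (rule that; blast)
        have len: "length gs = length ys" "length xs = length gs"
          using arg_cong[OF xs(5), of length] arg_cong[OF xs(4), of length] by simp_all
        have gsh: "(id, gs) \<in> hom ?SB (map (fobj K) xs) ys"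
          using xs(3-5) len by (simp add: sym_cat_hom permutes_id)
        have id: "farr ?TB (id, gs) = tensor_arrs B gs" if "set gs \<subseteq> Arr B" for gs
        proof -
          have "set (map (Cod B) gs) \<subseteq> Obj B" using that by auto
          then show ?thesis using B.perm_arr_id B.tensor_arrs_simps[OF that] by (simp add: tensor_functor_def)
        qed
        have idA: "farr ?TA (id, ts) = tensor_arrs A ts" if "set ts \<subseteq> Arr A" for ts
        proof -
          have "set (map (Cod A) ts) \<subseteq> Obj A" using that by auto
          then show ?thesis using A.perm_arr_id A.tensor_arrs_simps[OF that] by (simp add: tensor_functor_def)
        qed
        have sh: "s \<in> Arr A" "Dom A s = a" "Cod A s = tensor_objs A xs" using xs(2) by (auto simp: hom_def)
        show ?thesis
        proof (intro exI conjI allI impI)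
          show "P a m (xs, (id, gs)) s"
            using xs gsh by (simp add: P_def comma_simps o id sym_cat_def[of A])
          fix w t assume w: "P a m w t"
          obtain zs \<rho> hs where ww: "w = (zs, (\<rho>, hs))" by (metis surj_pair)
          have zs: "zs \<in> Obj ?SA" "(\<rho>, hs) \<in> hom ?SB (map (fobj K) zs) ys" "t \<in> hom A a (tensor_objs A zs)"
            "farr ?TB (\<rho>, hs) \<cdot>\<^bsub>B\<^esub> farr K t = m"
            using w by (auto simp: P_def ww comma_simps o)
          have t: "t \<in> Arr A" "Dom A t = a" "Cod A t = tensor_objs A zs" using zs(3) by (auto simp: hom_def)
          have zs': "set zs \<subseteq> Obj A" using zs(1) by (simp add: sym_cat_def)
          have hs: "\<rho> permutes {..<length hs}" "set hs \<subseteq> Arr B" "map (Dom B) hs = map (fobj K) zs" "length ys = length hs"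
            "map (Cod B) hs = permute_list \<rho> ys" "length zs = length hs"
            using zs(2) by (auto simp: sym_cat_hom)
          let ?zs = "permute_list (inv \<rho>) zs" and ?hs = "permute_list (inv \<rho>) hs"
          have ip: "inv \<rho> permutes {..<length hs}" using permutes_inv[OF hs(1)] .
          \<comment> \<open>A factorisation with a permutation \<rho> is reduced to one with the
            identity permutation: \<open>r\<close> reorders the sources by \<rho> using identity
            arrows, and \<open>(\<rho>, hs)\<close> is the image of \<open>r\<close> followed by
            \<open>(id, ?hs)\<close>.\<close>
          define r where "r = (\<rho>, map (Idt A) zs)"
          have rr: "permute_list \<rho> ?zs = zs" "permute_list \<rho> ?hs = hs"
            using permute_list_inv_permute[of "inv \<rho>" zs] permute_list_inv_permute[of "inv \<rho>" hs] ip hs(1,6)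
            by (simp_all add: permutes_inv_inv)
          have "map (Cod A) (map (Idt A) zs) = zs" "map (Dom A) (map (Idt A) zs) = zs" using zs' by (auto intro!: map_idI)
          then have r: "r \<in> hom ?SA zs ?zs"
            using hs zs' rr by (auto simp: r_def sym_cat_hom simp del: map_map)
          have hsy: "map (Cod B) ?hs = ys"
            using hs(5) permute_list_inv_permute[of \<rho> ys] hs(1,4) ip by (simp flip: permute_list_map)
          have hsx: "map (Dom B) ?hs = map (fobj K) ?zs"
            using hs(3,6) ip by (simp flip: permute_list_map)
          have hsa: "set ?hs \<subseteq> Arr B" using hs(2) ip by simp
          have hsh: "(id, ?hs) \<in> hom ?SB (map (fobj K) ?zs) ys"
            using hsa hsx hsy hs(4,6) by (simp add: sym_cat_hom permutes_id)
          have "map2 (\<lambda>g f. g \<cdot>\<^bsub>B\<^esub> f) hs (map (farr K) (map (Idt A) zs)) = hs"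
          proof (rule nth_equalityI)
            fix i assume "i < length (map2 (\<lambda>g f. g \<cdot>\<^bsub>B\<^esub> f) hs (map (farr K) (map (Idt A) zs)))"
            then have i: "i < length hs" by simp
            then have "hs ! i \<in> Arr B" "zs ! i \<in> Obj A" "Dom B (hs ! i) = fobj K (zs ! i)"
              using hs(2) zs' hs(6) arg_cong[OF hs(3), of "\<lambda>l. l ! i"] by (auto simp: subset_code(1))
            then show "map2 (\<lambda>g f. g \<cdot>\<^bsub>B\<^esub> f) hs (map (farr K) (map (Idt A) zs)) ! i = hs ! i"
              using i hs(6) by simp
          qed (simp add: hs(6))
          then have comp: "(id, ?hs) \<cdot>\<^bsub>?SB\<^esub> farr ?SK r = (\<rho>, hs)"
            by (simp add: sym_cat_def r_def sym_functor_def rr(2) del: map_map)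
          have 1: "\<kappa> (?zs, (id, ?hs)) \<cdot>\<^bsub>X\<^esub> farr h (farr ?TA r) = \<kappa> w"
            using \<kappa>2[OF r hsh] unfolding comp ww .
          have rA: "r \<in> Arr ?SA" "Dom ?SA r = zs" "Cod ?SA r = ?zs" using r by (auto simp: hom_def)
          have Tr: "farr ?TA r \<in> Arr A" "Dom A (farr ?TA r) = tensor_objs A zs" "Cod A (farr ?TA r) = tensor_objs A ?zs"
            using TA'(2-4)[OF rA(1)] rA by (simp_all add: o)
          have SKr: "farr ?SK r \<in> Arr ?SB" "Cod ?SB (farr ?SK r) = Dom ?SB (id, ?hs)" "(id, ?hs) \<in> Arr ?SB"
            using SK'(2-4)[OF rA(1)] rA hsh by (simp_all add: o hom_def)
          have Th: "tensor_arrs B ?hs \<in> Arr B" "Dom B (tensor_arrs B ?hs) = tensor_objs B (map (fobj K) ?zs)"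
            using B.tensor_arrs_simps[OF hsa] hsx by simp_all
          have Kz: "fobj K (tensor_objs A ?zs) = tensor_objs B (map (fobj K) ?zs)"
            using SA.cod_obj[OF rA(1)] unfolding rA(3) by (rule tensor_sym_functor_obj)
          have "farr ?TB (\<rho>, hs) = tensor_arrs B ?hs \<cdot>\<^bsub>B\<^esub> farr K (farr ?TA r)"
            using TB'(6)[OF SKr(1,3,2)] unfolding comp id[OF hsa] tensor_sym_functor_arr[OF rA(1)] .
          then have "tensor_arrs B ?hs \<cdot>\<^bsub>B\<^esub> farr K (farr ?TA r \<cdot>\<^bsub>A\<^esub> t) = m"
            using zs(4) Tr t Th Kz by simp
          moreover have "set ?zs \<subseteq> Obj A" using SA.cod_obj[OF rA(1)] unfolding rA(3) by (simp add: sym_cat_def)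
          moreover have "farr ?TA r \<cdot>\<^bsub>A\<^esub> t \<in> hom A a (tensor_objs A ?zs)" using Tr t by (simp add: hom_def)
          \<comment> \<open>The reordered factorisation has no permutation, so the universal one
            maps to it; \<open>ts\<close> is the comparison.\<close>
          ultimately obtain ts where ts: "set ts \<subseteq> Arr A" "map (Dom A) ts = xs" "map (Cod A) ts = ?zs"
            "farr ?TA r \<cdot>\<^bsub>A\<^esub> t = tensor_arrs A ts \<cdot>\<^bsub>A\<^esub> s" "map2 (\<lambda>g t. g \<cdot>\<^bsub>B\<^esub> farr K t) ?hs ts = gs"
            using u[of ?zs "farr ?TA r \<cdot>\<^bsub>A\<^esub> t" ?hs] hsa hsx hsy by blast
          have lts: "length ts = length xs" "length hs = length ts"
            using arg_cong[OF ts(2), of length] arg_cong[OF ts(3), of length] hs(6) by simp_all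
          have tsh: "(id, ts) \<in> hom ?SA xs ?zs" using ts lts hs(6) by (simp add: sym_cat_hom permutes_id)
          have "map2 (\<lambda>g f. g \<cdot>\<^bsub>B\<^esub> f) ?hs (map (farr K) ts) = map2 (\<lambda>g t. g \<cdot>\<^bsub>B\<^esub> farr K t) ?hs ts"
            by (simp add: zip_map2 split_def comp_def)
          then have comp2: "(id, ?hs) \<cdot>\<^bsub>?SB\<^esub> farr ?SK (id, ts) = (id, gs)"
            using ts(5) by (simp add: sym_cat_def sym_functor_def)
          have 2: "\<kappa> (?zs, (id, ?hs)) \<cdot>\<^bsub>X\<^esub> farr h (tensor_arrs A ts) = \<kappa> (xs, (id, gs))"
            using \<kappa>2[OF tsh hsh] unfolding comp2 idA[OF ts(1)] .
          note Tt = A.tensor_arrs_simps[OF ts(1), unfolded ts(2,3)]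
          have k: "\<kappa> (?zs, (id, ?hs)) \<in> Arr X" "Dom X (\<kappa> (?zs, (id, ?hs))) = fobj h (tensor_objs A ?zs)"
            using \<kappa>1[OF SA.cod_obj[OF rA(1)], unfolded rA(3), OF hsh] by (auto simp: hom_def)
          have "\<kappa> w \<cdot>\<^bsub>X\<^esub> farr h t = \<kappa> (?zs, (id, ?hs)) \<cdot>\<^bsub>X\<^esub> farr h (farr ?TA r \<cdot>\<^bsub>A\<^esub> t)"
            unfolding 1[symmetric] using k Tr t h' by simp
          also have "\<dots> = \<kappa> (xs, (id, gs)) \<cdot>\<^bsub>X\<^esub> farr h s"
            unfolding 2[symmetric] ts(4) using k Tt sh h' by simp
          finally show "\<kappa> w \<cdot>\<^bsub>X\<^esub> farr h t = \<kappa> (xs, (id, gs)) \<cdot>\<^bsub>X\<^esub> farr h s" .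
        qed
      qed
      \<comment> \<open>A factorisation is chosen at each object; by \<open>ex\<close> the value
        does not depend on the choice.\<close>
      define \<kappa>' where "\<kappa>' = (\<lambda>(a, m). SOME y. \<exists>v s. P a m v s \<and> y = \<kappa> v \<cdot>\<^bsub>X\<^esub> farr h s)"
      have \<kappa>': "\<kappa>' (a, m) = \<kappa> v \<cdot>\<^bsub>X\<^esub> farr h s" if "a \<in> Obj A" "m \<in> hom B (fobj K a) ?c" "P a m v s" for a m v s
      proof -
        note e = ex[OF that(1,2)]
        have "\<exists>v s. P a m v s \<and> \<kappa>' (a, m) = \<kappa> v \<cdot>\<^bsub>X\<^esub> farr h s"
          unfolding \<kappa>'_def prod.case
          by (rule someI[of "\<lambda>y. \<exists>v s. P a m v s \<and> y = \<kappa> v \<cdot>\<^bsub>X\<^esub> farr h s" "\<kappa> v \<cdot>\<^bsub>X\<^esub> farr h s"])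
            (rule exI[of _ v], rule exI[of _ s], simp add: that(3))
        then obtain v1 s1 where 1: "P a m v1 s1" "\<kappa>' (a, m) = \<kappa> v1 \<cdot>\<^bsub>X\<^esub> farr h s1" by blast
        obtain v0 s0 where "\<forall>w t. P a m w t \<longrightarrow> \<kappa> w \<cdot>\<^bsub>X\<^esub> farr h t = \<kappa> v0 \<cdot>\<^bsub>X\<^esub> farr h s0"
          using e by blast
        then show ?thesis using 1 that(3) by metis
      qed
      have \<kappa>'c: "is_cocone (comma A B K ?c) X (h \<circ>\<^sub>F comma_proj) d \<kappa>'"
      proof (rule is_cocone_commaI[OF d])
        fix a m assume am: "a \<in> Obj A" "m \<in> hom B (fobj K a) ?c"
        then obtain v s where P: "P a m v s" using ex by blast
        show "\<kappa>' (a, m) \<in> hom X (fobj h a) d"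
          unfolding \<kappa>'[OF am P] using P \<kappa>1[of "fst v" "snd v"] h' by (auto simp: P_def comma_simps o hom_def)
      next
        fix t a a' m assume t: "t \<in> hom A a a'" and m: "m \<in> hom B (fobj K a') ?c"
        have t': "t \<in> Arr A" "Dom A t = a" "Cod A t = a'" "a \<in> Obj A" "a' \<in> Obj A" using t by (auto simp: hom_def)
        have mt: "m \<cdot>\<^bsub>B\<^esub> farr K t \<in> hom B (fobj K a) ?c" using t' m by (auto simp: hom_def)
        obtain v s where P: "P a' m v s" using ex[OF t'(5) m] by blast
        have s: "s \<in> Arr A" "Dom A s = a'" "Cod A s = tensor_objs A (fst v)"
          "fst v \<in> Obj ?SA" "snd v \<in> hom ?SB (map (fobj K) (fst v)) ys"
        proof -
          have v: "fst v \<in> Obj ?SA \<and> snd v \<in> hom ?SB (map (fobj K) (fst v)) ys"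
            using P unfolding P_def by (cases v) (simp add: comma_simps o)
          then show "fst v \<in> Obj ?SA" "snd v \<in> hom ?SB (map (fobj K) (fst v)) ys" by blast+
          show "s \<in> Arr A" "Dom A s = a'" "Cod A s = tensor_objs A (fst v)"
            using P by (simp_all add: P_def hom_def[of A])
        qed
        have Tv: "farr ?TB (snd v) \<in> Arr B" "Dom B (farr ?TB (snd v)) = fobj K (tensor_objs A (fst v))"
          using TB'(2-4)[of "snd v"] s(5) tensor_sym_functor_obj[OF s(4)] by (auto simp: o hom_def)
        have P': "P a (m \<cdot>\<^bsub>B\<^esub> farr K t) v (s \<cdot>\<^bsub>A\<^esub> t)"
          using P t' s Tv by (auto simp: P_def hom_def[of A])
        have kv: "\<kappa> v \<in> Arr X" "Dom X (\<kappa> v) = fobj h (tensor_objs A (fst v))" using \<kappa>1[OF s(4,5)] by (auto simp: hom_def)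
        show "\<kappa>' (a', m) \<cdot>\<^bsub>X\<^esub> farr h t = \<kappa>' (a, m \<cdot>\<^bsub>B\<^esub> farr K t)"
          unfolding \<kappa>'[OF t'(5) m P] \<kappa>'[OF t'(4) mt P'] using t' s kv h' by simp
      qed
      obtain u where u: "u \<in> hom X (fobj l ?c) d" "\<forall>i \<in> Obj (comma A B K ?c). u \<cdot>\<^bsub>X\<^esub> ?lam i = \<kappa>' i"
        and uu: "\<And>u'. u' \<in> hom X (fobj l ?c) d \<Longrightarrow> (\<forall>i \<in> Obj (comma A B K ?c). u' \<cdot>\<^bsub>X\<^esub> ?lam i = \<kappa>' i) \<Longrightarrow> u' = u"
        using univ[OF \<kappa>'c] by (elim ex1E) blast
      show "\<exists>!u. u \<in> hom X (fobj (l \<circ>\<^sub>F ?TB) ys) d \<and> (\<forall>i \<in> Obj (comma ?SA ?SB ?SK ys). u \<cdot>\<^bsub>X\<^esub> ?Lam i = \<kappa> i)"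
      proof (intro ex1I conjI ballI)
        show "u \<in> hom X (fobj (l \<circ>\<^sub>F ?TB) ys) d" using u(1) by (simp add: o)
        fix i assume i: "i \<in> Obj (comma ?SA ?SB ?SK ys)"
        obtain xs m where im: "i = (xs, m)" by (cases i)
        have xm: "xs \<in> Obj ?SA" "m \<in> hom ?SB (map (fobj K) xs) ys" using i by (auto simp: im comma_simps o)
        have tx: "tensor_objs A xs \<in> Obj A" using xm(1) by (simp add: sym_cat_def)
        have Tm: "farr ?TB m \<in> hom B (fobj K (tensor_objs A xs)) ?c"
          using TB'(2-4)[of m] xm tensor_sym_functor_obj[OF xm(1)] by (auto simp: hom_def o)
        \<comment> \<open>The arrow \<open>farr ?TB m\<close> factors through \<open>i\<close>
          itself with an identity in front, so \<kappa>' restricts to \<kappa>.\<close>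
        have P: "P (tensor_objs A xs) (farr ?TB m) i (Idt A (tensor_objs A xs))"
          using i tx Tm by (simp add: P_def im hom_def)
        have "u \<cdot>\<^bsub>X\<^esub> ?Lam i = \<kappa>' (tensor_objs A xs, farr ?TB m)"
          using u(2)[rule_format, of "(tensor_objs A xs, farr ?TB m)"] tx Tm unfolding im \<Lambda>[OF xm(1)] by (simp add: comma_simps)
        also have "\<dots> = \<kappa> i"
          unfolding \<kappa>'[OF tx Tm P] using \<kappa>1[OF xm] tx h' by (auto simp: im hom_def)
        finally show "u \<cdot>\<^bsub>X\<^esub> ?Lam i = \<kappa> i" .
      next
        fix u' assume u': "u' \<in> hom X (fobj (l \<circ>\<^sub>F ?TB) ys) d \<and> (\<forall>i \<in> Obj (comma ?SA ?SB ?SK ys). u' \<cdot>\<^bsub>X\<^esub> ?Lam i = \<kappa> i)"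
        show "u' = u"
        proof (rule uu)
          show uh: "u' \<in> hom X (fobj l ?c) d" using u' by (simp add: o)
          show "\<forall>i \<in> Obj (comma A B K ?c). u' \<cdot>\<^bsub>X\<^esub> ?lam i = \<kappa>' i"
          proof
            fix i assume i: "i \<in> Obj (comma A B K ?c)"
            obtain a m where im: "i = (a, m)" by (cases i)
            have am: "a \<in> Obj A" "m \<in> hom B (fobj K a) ?c" using i by (auto simp: im comma_simps)
            then obtain v s where P: "P a m v s" using ex by blast
            obtain xs n where v: "v = (xs, n)" by (cases v)
            have s: "s \<in> hom A a (tensor_objs A xs)" "farr ?TB n \<cdot>\<^bsub>B\<^esub> farr K s = m" "xs \<in> Obj ?SA" "n \<in> hom ?SB (map (fobj K) xs) ys"
              "v \<in> Obj (comma ?SA ?SB ?SK ys)"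
              using P by (auto simp: P_def v comma_simps o)
            have tx: "tensor_objs A xs \<in> Obj A" using s(3) by (simp add: sym_cat_def)
            have Tm: "farr ?TB n \<in> hom B (fobj K (tensor_objs A xs)) ?c"
              using TB'(2-4)[of n] s tensor_sym_functor_obj[OF s(3)] by (auto simp: hom_def o)
            \<comment> \<open>The coprojection at (a, m) factors through the one at
              \<open>v\<close>, so an arrow compatible with \<kappa> is compatible with \<kappa>' as
              well.\<close>
            have "?lam (tensor_objs A xs, farr ?TB n) \<cdot>\<^bsub>X\<^esub> farr h s = ?lam (a, m)"
              using lam'(3)[OF s(1) Tm] unfolding s(2) .
            then have "u' \<cdot>\<^bsub>X\<^esub> ?lam i = u' \<cdot>\<^bsub>X\<^esub> ?Lam v \<cdot>\<^bsub>X\<^esub> farr h s"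
              unfolding im v \<Lambda>[OF s(3)] by simp
            also have "\<dots> = (u' \<cdot>\<^bsub>X\<^esub> ?Lam v) \<cdot>\<^bsub>X\<^esub> farr h s"
              unfolding v \<Lambda>[OF s(3)] using uh lam'(2)[OF tx Tm] s(1) h'
              by (intro X.comp_assoc_arr[symmetric]) (auto simp: hom_def)
            also have "\<dots> = \<kappa>' i"
              using u' s(5) unfolding im \<kappa>'[OF am P] by simp
            finally show "u' \<cdot>\<^bsub>X\<^esub> ?lam i = \<kappa>' i" .
          qed
        qed
      qed
    qed
  qed
qed

lemma exact_monoidal: "exact_monoidal_functor TYPE('x \<times> 'y) A B K"
  unfolding exact_monoidal_functor_def using strict exact_square_tensor by blast

end

section \<open>Pointwise left Kan extensions\<close>

text \<open>Comma categories have pairs as objects and arrows, whereas \<open>cocomplete\<close>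
  quantifies over index categories on the universe type; this is the copy of an index category along
  codings \<open>e\<close> and \<open>e'\<close>.\<close>

definition transport_cat :: "('o \<Rightarrow> 'p) \<Rightarrow> ('a \<Rightarrow> 'b) \<Rightarrow> ('o, 'a, 'z) cat_scheme \<Rightarrow> ('p, 'b) cat" where
  "transport_cat e e' J = (let d = inv_into (Obj J) e; d' = inv_into (Arr J) e' in \<lparr>
     Obj = e ` Obj J,
     Arr = e' ` Arr J,
     Dom = (\<lambda>f. e (Dom J (d' f))),
     Cod = (\<lambda>f. e (Cod J (d' f))),
     Idt = (\<lambda>x. e' (Idt J (d x))),
     Comp = (\<lambda>g f. e' (d' g \<cdot>\<^bsub>J\<^esub> d' f))\<rparr>)"

lemma cocomplete_colimit:
  fixes J :: "('i, 'j, 'z) cat_scheme" and e :: "'i \<Rightarrow> 'u" and e' :: "'j \<Rightarrow> 'u"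
  assumes "cocomplete TYPE('u) X" "category J" "inj_on e (Obj J)" "inj_on e' (Arr J)" "cat_functor J X D"
  shows "\<exists>c \<iota>. is_colimit J X D c \<iota>"
proof -
  interpret J: category J by fact
  let ?d = "inv_into (Obj J) e" and ?d' = "inv_into (Arr J) e'"
  let ?J = "transport_cat e e' J"
  let ?D = "\<lparr>fobj = fobj D \<circ> ?d, farr = farr D \<circ> ?d'\<rparr>"
  have J' [simp]:
    "Obj ?J = e ` Obj J" "Arr ?J = e' ` Arr J"
    "f \<in> Arr J \<Longrightarrow> Dom ?J (e' f) = e (Dom J f)" "f \<in> Arr J \<Longrightarrow> Cod ?J (e' f) = e (Cod J f)"
    "x \<in> Obj J \<Longrightarrow> Idt ?J (e x) = e' (Idt J x)"
    "f \<in> Arr J \<Longrightarrow> g \<in> Arr J \<Longrightarrow> e' g \<cdot>\<^bsub>?J\<^esub> e' f = e' (g \<cdot>\<^bsub>J\<^esub> f)" for f g x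
    using assms(3,4) by (auto simp: transport_cat_def Let_def)
  have e_eq [simp]: "x \<in> Obj J \<Longrightarrow> y \<in> Obj J \<Longrightarrow> e x = e y \<longleftrightarrow> x = y" for x y
    using assms(3) by (auto dest: inj_onD)
  have d [simp]: "x \<in> Obj J \<Longrightarrow> ?d (e x) = x" "f \<in> Arr J \<Longrightarrow> ?d' (e' f) = f" for x f
    using assms(3,4) by auto
  note D = cat_functorD[OF assms(5)]
  have "category ?J" by unfold_locales (auto simp: hom_def)
  moreover have "cat_functor ?J X ?D"
    unfolding cat_functor_def using D by (auto simp: hom_def)
  ultimately obtain c \<iota> where c: "is_colimit ?J X ?D c \<iota>"
    using assms(1) unfolding cocomplete_def by blast
  have cocone: "is_cocone ?J X ?D x (\<kappa> \<circ> ?d) \<longleftrightarrow> is_cocone J X D x \<kappa>" for x \<kappa>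
    by (auto simp: is_cocone_def)
  have "is_colimit J X D c (\<iota> \<circ> e)"
    unfolding is_colimit_def
  proof (intro conjI allI impI)
    show "is_cocone J X D c (\<iota> \<circ> e)"
      using c by (auto simp: is_colimit_def is_cocone_def)
    fix x \<kappa> assume "is_cocone J X D x \<kappa>"
    then have "\<exists>!u. u \<in> hom X c x \<and> (\<forall>i \<in> Obj ?J. u \<cdot>\<^bsub>X\<^esub> \<iota> i = (\<kappa> \<circ> ?d) i)"
      using c unfolding is_colimit_def cocone[symmetric] by blast
    then show "\<exists>!u. u \<in> hom X c x \<and> (\<forall>i \<in> Obj J. u \<cdot>\<^bsub>X\<^esub> (\<iota> \<circ> e) i = \<kappa> i)"
      by simp
  qed
  then show ?thesis by blast
qed

lemma category_comma:
  assumes "category A" "category C" "cat_functor A C f"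
  shows "category (comma A C f c)"
proof -
  interpret A: category A by fact
  interpret C: category C by fact
  note f = cat_functorD[OF assms(3)]
  show ?thesis
  proof
    fix x y z p q r t
    show "x \<in> Arr (comma A C f c) \<Longrightarrow> Dom (comma A C f c) x \<in> Obj (comma A C f c)"
      by (auto simp: comma_def hom_def f)
    show "x \<in> Arr (comma A C f c) \<Longrightarrow> Cod (comma A C f c) x \<in> Obj (comma A C f c)"
      by (auto simp: comma_def hom_def f)
    show "p \<in> Obj (comma A C f c) \<Longrightarrow> Idt (comma A C f c) p \<in> hom (comma A C f c) p p"
      by (auto simp: comma_def hom_def f)
    show "y \<cdot>\<^bsub>comma A C f c\<^esub> x \<in> hom (comma A C f c) p r"
      if "x \<in> hom (comma A C f c) p q" "y \<in> hom (comma A C f c) q r"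
    proof -
      obtain x1 x2 y1 y2 where xy: "x = (x1, x2)" "y = (y1, y2)" by (metis surj_pair)
      have a: "x1 \<in> Arr A" "y1 \<in> Arr A" "Cod A x1 = Dom A y1" "x2 = y2 \<cdot>\<^bsub>C\<^esub> farr f y1" "y2 \<in> Arr C"
        "Dom C y2 = fobj f (Cod A y1)" "Cod C y2 = c" "p = (Dom A x1, x2 \<cdot>\<^bsub>C\<^esub> farr f x1)" "r = (Cod A y1, y2)"
        using that unfolding xy by (auto simp: comma_def hom_def)
      show ?thesis unfolding a(8,9) xy using a(1-7) by (simp add: comma_def hom_def f)
    qed
    show "x \<cdot>\<^bsub>comma A C f c\<^esub> Idt (comma A C f c) p = x" if "x \<in> hom (comma A C f c) p q"
      using that by (cases x) (auto simp: comma_def hom_def f)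
    show "Idt (comma A C f c) q \<cdot>\<^bsub>comma A C f c\<^esub> x = x" if "x \<in> hom (comma A C f c) p q"
      using that by (cases x) (auto simp: comma_def hom_def f)
    show "(z \<cdot>\<^bsub>comma A C f c\<^esub> y) \<cdot>\<^bsub>comma A C f c\<^esub> x = z \<cdot>\<^bsub>comma A C f c\<^esub> y \<cdot>\<^bsub>comma A C f c\<^esub> x"
      if "x \<in> hom (comma A C f c) p q" "y \<in> hom (comma A C f c) q r" "z \<in> hom (comma A C f c) r t"
    proof -
      obtain x1 x2 y1 y2 z1 z2 where xyz: "x = (x1, x2)" "y = (y1, y2)" "z = (z1, z2)" by (metis surj_pair)
      have a: "x1 \<in> Arr A" "y1 \<in> Arr A" "z1 \<in> Arr A" "Cod A x1 = Dom A y1" "Cod A y1 = Dom A z1"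
        using that unfolding xyz by (auto simp: comma_def hom_def)
      show ?thesis unfolding xyz using a by (simp add: comma_def)
    qed
  qed
qed

lemma cat_functor_comma_proj: "cat_functor (comma A C f c) A comma_proj" if "category A"
  using category.idt_hom[OF that] by (auto simp: cat_functor_def comma_def comma_proj_def hom_def)

lemma is_colimit_cong:
  assumes "is_colimit J X D c \<iota>" "\<And>i. i \<in> Obj J \<Longrightarrow> \<iota> i = \<iota>' i" "category J"
  shows "is_colimit J X D c \<iota>'"
proof -
  interpret J: category J by fact
  show ?thesis using assms(1,2) by (simp add: is_colimit_def is_cocone_def)
qed

lemma is_colimit_univ:
  assumes "is_colimit J X D c \<iota>" "is_cocone J X D d \<kappa>"
  obtains u where "u \<in> hom X c d" "\<And>i. i \<in> Obj J \<Longrightarrow> u \<cdot>\<^bsub>X\<^esub> \<iota> i = \<kappa> i"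
  using assms unfolding is_colimit_def by blast

text \<open>Composing the coprojections with \<open>u\<close> gives a cocone through which both
  \<open>u\<close> and \<open>v\<close> factor.\<close>

lemma is_colimit_epi:
  assumes "is_colimit J X D c \<iota>" "category X" "category J" "cat_functor J X D" "u \<in> hom X c d" "v \<in> hom X c d"
    "\<And>i. i \<in> Obj J \<Longrightarrow> u \<cdot>\<^bsub>X\<^esub> \<iota> i = v \<cdot>\<^bsub>X\<^esub> \<iota> i"
  shows "u = v"
proof -
  interpret X: category X by fact
  interpret J: category J by fact
  note D = cat_functorD[OF assms(4)]
  have u: "u \<in> Arr X" "Dom X u = c" "Cod X u = d" using assms(5) by (auto simp: hom_def)
  have \<iota>: "i \<in> Obj J \<Longrightarrow> \<iota> i \<in> Arr X" "i \<in> Obj J \<Longrightarrow> Dom X (\<iota> i) = fobj D i" "i \<in> Obj J \<Longrightarrow> Cod X (\<iota> i) = c"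
    "t \<in> Arr J \<Longrightarrow> \<iota> (Cod J t) \<cdot>\<^bsub>X\<^esub> farr D t = \<iota> (Dom J t)" for i t
    using assms(1) by (auto simp: is_colimit_def is_cocone_def hom_def)
  have "is_cocone J X D d (\<lambda>i. u \<cdot>\<^bsub>X\<^esub> \<iota> i)"
    unfolding is_cocone_def using u \<iota> D X.cod_obj[OF u(1)] by (auto simp: hom_def)
  then have "\<exists>!w. w \<in> hom X c d \<and> (\<forall>i \<in> Obj J. w \<cdot>\<^bsub>X\<^esub> \<iota> i = u \<cdot>\<^bsub>X\<^esub> \<iota> i)"
    using assms(1) by (simp add: is_colimit_def)
  then show ?thesis using assms(5-7) by (metis (no_types, lifting))
qed

lemma nat_transI:
  assumes "cat_functor A B F" "cat_functor A B G" "\<And>a. a \<in> Obj A \<Longrightarrow> \<tau> a \<in> hom B (fobj F a) (fobj G a)"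
    "\<And>f. f \<in> Arr A \<Longrightarrow> \<tau> (Cod A f) \<cdot>\<^bsub>B\<^esub> farr F f = farr G f \<cdot>\<^bsub>B\<^esub> \<tau> (Dom A f)"
  shows "nat_trans A B F G \<tau>"
  using assms by (auto simp: nat_trans_def)

locale kan_setting = A: category A + C: category C + X: category X
  for A :: "('o, 'a, 'z1) cat_scheme" and C :: "('p, 'b, 'z2) cat_scheme" and X :: "('x, 'y, 'z3) cat_scheme" +
  fixes f :: "('o, 'a, 'p, 'b) fctr" and h :: "('o, 'a, 'x, 'y) fctr"
  assumes f_functor: "cat_functor A C f" and h_functor: "cat_functor A X h"
begin

lemmas f [simp] = cat_functorD[OF f_functor]
lemmas h [simp] = cat_functorD[OF h_functor]

lemma category_comma': "category (comma A C f c)"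
  by (rule category_comma) (unfold_locales, rule f_functor)

lemma cat_functor_comma: "cat_functor (comma A C f c) X (h \<circ>\<^sub>F comma_proj)"
  by (rule cat_functor_comp[OF cat_functor_comma_proj h_functor]) unfold_locales

text \<open>An arrow n acts on the chosen colimits by composing the indexing arrows with n;
  functoriality follows because the coprojections are jointly epic.\<close>

lemma pointwise_left_kan_exists:
  assumes "\<And>c. c \<in> Obj C \<Longrightarrow> \<exists>d \<iota>. is_colimit (comma A C f c) X (h \<circ>\<^sub>F comma_proj) d \<iota>"
  shows "\<exists>l \<psi>. pointwise_left_kan A C X f h l \<psi>"
proof -
  from assms obtain L \<iota> where colim: "\<And>c. c \<in> Obj C \<Longrightarrow> is_colimit (comma A C f c) X (h \<circ>\<^sub>F comma_proj) (L c) (\<iota> c)"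
    by metis
  have cocone: "is_cocone (comma A C f c) X (h \<circ>\<^sub>F comma_proj) (L c) (\<iota> c)" if "c \<in> Obj C" for c
    using colim[OF that] by (simp add: is_colimit_def)
  have L: "L c \<in> Obj X" if "c \<in> Obj C" for c using is_cocone_commaD(1)[OF cocone[OF that]] .
  have \<iota>: "\<iota> c (a, m) \<in> hom X (fobj h a) (L c)" if "c \<in> Obj C" "a \<in> Obj A" "m \<in> hom C (fobj f a) c" for c a m
    using is_cocone_commaD(2)[OF cocone] that by blast
  have \<iota>nat: "\<iota> c (a', m) \<cdot>\<^bsub>X\<^esub> farr h t = \<iota> c (a, m \<cdot>\<^bsub>C\<^esub> farr f t)"
    if "c \<in> Obj C" "t \<in> hom A a a'" "m \<in> hom C (fobj f a') c" for c a a' t m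
    using is_cocone_commaD(3)[OF cocone] that by blast
  have epi: "u = v" if "c \<in> Obj C" "u \<in> hom X (L c) d" "v \<in> hom X (L c) d"
    "\<And>a m. a \<in> Obj A \<Longrightarrow> m \<in> hom C (fobj f a) c \<Longrightarrow> u \<cdot>\<^bsub>X\<^esub> \<iota> c (a, m) = v \<cdot>\<^bsub>X\<^esub> \<iota> c (a, m)" for c d u v
    by (rule is_colimit_epi[OF colim[OF that(1)] X.category_axioms category_comma' cat_functor_comma that(2,3)])
      (use that(4) in \<open>auto simp: comma_simps\<close>)
  have ex: "\<exists>u. u \<in> hom X (L (Dom C n)) (L (Cod C n)) \<and>
      (\<forall>a m. a \<in> Obj A \<longrightarrow> m \<in> hom C (fobj f a) (Dom C n) \<longrightarrow> u \<cdot>\<^bsub>X\<^esub> \<iota> (Dom C n) (a, m) = \<iota> (Cod C n) (a, n \<cdot>\<^bsub>C\<^esub> m))"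
    if n: "n \<in> Arr C" for n
  proof -
    have "is_cocone (comma A C f (Dom C n)) X (h \<circ>\<^sub>F comma_proj) (L (Cod C n)) (\<lambda>(a, m). \<iota> (Cod C n) (a, n \<cdot>\<^bsub>C\<^esub> m))"
    proof (rule is_cocone_commaI)
      show "L (Cod C n) \<in> Obj X" using L n by simp
      fix a m assume "a \<in> Obj A" "m \<in> hom C (fobj f a) (Dom C n)"
      then show "(\<lambda>(a, m). \<iota> (Cod C n) (a, n \<cdot>\<^bsub>C\<^esub> m)) (a, m) \<in> hom X (fobj h a) (L (Cod C n))"
        using \<iota>[of "Cod C n" a "n \<cdot>\<^bsub>C\<^esub> m"] n by (simp add: hom_def[of C])
    next
      fix t a a' m assume t: "t \<in> hom A a a'" and m: "m \<in> hom C (fobj f a') (Dom C n)"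
      then have "n \<cdot>\<^bsub>C\<^esub> m \<in> hom C (fobj f a') (Cod C n)" using n by (simp add: hom_def)
      from \<iota>nat[OF _ t this] n t m
      show "(\<lambda>(a, m). \<iota> (Cod C n) (a, n \<cdot>\<^bsub>C\<^esub> m)) (a', m) \<cdot>\<^bsub>X\<^esub> farr h t =
          (\<lambda>(a, m). \<iota> (Cod C n) (a, n \<cdot>\<^bsub>C\<^esub> m)) (a, m \<cdot>\<^bsub>C\<^esub> farr f t)"
        by (auto simp: hom_def)
    qed
    from is_colimit_univ[OF colim[OF C.dom_obj[OF n]] this] show ?thesis
      by (auto simp: comma_simps) (metis)
  qed
  then obtain l0 where l0: "\<And>n. n \<in> Arr C \<Longrightarrow> l0 n \<in> hom X (L (Dom C n)) (L (Cod C n))"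
    "\<And>n a m. n \<in> Arr C \<Longrightarrow> a \<in> Obj A \<Longrightarrow> m \<in> hom C (fobj f a) (Dom C n) \<Longrightarrow>
        l0 n \<cdot>\<^bsub>X\<^esub> \<iota> (Dom C n) (a, m) = \<iota> (Cod C n) (a, n \<cdot>\<^bsub>C\<^esub> m)"
    by metis
  define l where "l = \<lparr>fobj = L, farr = l0\<rparr>"
  \<comment> \<open>The unit of a pointwise extension is the coprojection indexed by an
    identity.\<close>
  define \<psi> where "\<psi> a = \<iota> (fobj f a) (a, Idt C (fobj f a))" for a
  have l0': "n \<in> Arr C \<Longrightarrow> l0 n \<in> Arr X" "n \<in> Arr C \<Longrightarrow> Dom X (l0 n) = L (Dom C n)" "n \<in> Arr C \<Longrightarrow> Cod X (l0 n) = L (Cod C n)" for n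
    using l0(1)[of n] by (auto simp: hom_def)
  have \<iota>': "\<iota> c (a, m) \<in> Arr X" "Dom X (\<iota> c (a, m)) = fobj h a" "Cod X (\<iota> c (a, m)) = L c"
    if "c \<in> Obj C" "a \<in> Obj A" "m \<in> hom C (fobj f a) c" for c a m
    using \<iota>[OF that] by (auto simp: hom_def)
  have lf: "cat_functor C X l"
    unfolding cat_functor_def
  proof (intro conjI ballI impI)
    fix c assume c: "c \<in> Obj C"
    show "fobj l c \<in> Obj X" using L c by (simp add: l_def)
    have "l0 (Idt C c) = Idt X (L c)"
    proof (rule epi[OF c])
      show "l0 (Idt C c) \<in> hom X (L c) (L c)" using l0(1)[of "Idt C c"] c by simp
      show "Idt X (L c) \<in> hom X (L c) (L c)" using L[OF c] by (rule X.idt_hom)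
      fix a m assume am: "a \<in> Obj A" "m \<in> hom C (fobj f a) c"
      then show "l0 (Idt C c) \<cdot>\<^bsub>X\<^esub> \<iota> c (a, m) = Idt X (L c) \<cdot>\<^bsub>X\<^esub> \<iota> c (a, m)"
        using l0(2)[of "Idt C c" a m] c \<iota>'[OF c am] C.comp_idt_left[OF am(2)] by simp
    qed
    then show "farr l (Idt C c) = Idt X (fobj l c)" by (simp add: l_def)
  next
    fix n assume n: "n \<in> Arr C"
    show "farr l n \<in> hom X (fobj l (Dom C n)) (fobj l (Cod C n))" using l0(1)[OF n] by (simp add: l_def)
    fix n' assume n': "n' \<in> Arr C" "Cod C n = Dom C n'"
    have "l0 (n' \<cdot>\<^bsub>C\<^esub> n) = l0 n' \<cdot>\<^bsub>X\<^esub> l0 n"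
    proof (rule epi[OF C.dom_obj[OF n]])
      show "l0 (n' \<cdot>\<^bsub>C\<^esub> n) \<in> hom X (L (Dom C n)) (L (Cod C n'))" using l0(1)[of "n' \<cdot>\<^bsub>C\<^esub> n"] n n' by simp
      show "l0 n' \<cdot>\<^bsub>X\<^esub> l0 n \<in> hom X (L (Dom C n)) (L (Cod C n'))" using n n' l0' by (simp add: hom_def)
      fix a m assume am: "a \<in> Obj A" "m \<in> hom C (fobj f a) (Dom C n)"
      have m: "m \<in> Arr C" "Dom C m = fobj f a" "Cod C m = Dom C n" using am by (auto simp: hom_def)
      have nm: "n \<cdot>\<^bsub>C\<^esub> m \<in> hom C (fobj f a) (Dom C n')" using m n n' by (simp add: hom_def)
      have "(l0 n' \<cdot>\<^bsub>X\<^esub> l0 n) \<cdot>\<^bsub>X\<^esub> \<iota> (Dom C n) (a, m) = l0 n' \<cdot>\<^bsub>X\<^esub> (l0 n \<cdot>\<^bsub>X\<^esub> \<iota> (Dom C n) (a, m))"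
        using n n' am \<iota>'[OF C.dom_obj[OF n] am] l0' by simp
      also have "\<dots> = \<iota> (Cod C n') (a, n' \<cdot>\<^bsub>C\<^esub> n \<cdot>\<^bsub>C\<^esub> m)"
        using l0(2)[OF n am] l0(2)[OF n'(1) am(1) nm] n' by simp
      finally show "l0 (n' \<cdot>\<^bsub>C\<^esub> n) \<cdot>\<^bsub>X\<^esub> \<iota> (Dom C n) (a, m) = (l0 n' \<cdot>\<^bsub>X\<^esub> l0 n) \<cdot>\<^bsub>X\<^esub> \<iota> (Dom C n) (a, m)"
        using l0(2)[of "n' \<cdot>\<^bsub>C\<^esub> n" a m] n n' am m by simp
    qed
    then show "farr l (n' \<cdot>\<^bsub>C\<^esub> n) = farr l n' \<cdot>\<^bsub>X\<^esub> farr l n" by (simp add: l_def)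
  qed
  have lam: "farr l m \<cdot>\<^bsub>X\<^esub> \<psi> a = \<iota> c (a, m)" if am: "a \<in> Obj A" "m \<in> hom C (fobj f a) c" for a m c
    using l0(2)[of m a "Idt C (fobj f a)"] am C.idt_hom[of "fobj f a"] by (auto simp: l_def \<psi>_def hom_def)
  have \<psi>: "nat_trans A X h (l \<circ>\<^sub>F f) \<psi>"
  proof (rule nat_transI[OF h_functor cat_functor_comp[OF f_functor lf]])
    fix a assume a: "a \<in> Obj A"
    show "\<psi> a \<in> hom X (fobj h a) (fobj (l \<circ>\<^sub>F f) a)"
      using \<iota>[of "fobj f a" a "Idt C (fobj f a)"] a C.idt_hom by (simp add: \<psi>_def l_def)
  next
    fix t assume t: "t \<in> Arr A"
    have "\<psi> (Cod A t) \<cdot>\<^bsub>X\<^esub> farr h t = \<iota> (fobj f (Cod A t)) (Dom A t, Idt C (fobj f (Cod A t)) \<cdot>\<^bsub>C\<^esub> farr f t)"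
      unfolding \<psi>_def using t by (intro \<iota>nat) (auto simp: hom_def)
    also have "\<dots> = farr l (farr f t) \<cdot>\<^bsub>X\<^esub> \<psi> (Dom A t)"
      using lam[of "Dom A t" "farr f t" "fobj f (Cod A t)"] t by (simp add: hom_def)
    finally show "\<psi> (Cod A t) \<cdot>\<^bsub>X\<^esub> farr h t = farr (l \<circ>\<^sub>F f) t \<cdot>\<^bsub>X\<^esub> \<psi> (Dom A t)" by simp
  qed
  have "pointwise_left_kan A C X f h l \<psi>"
    unfolding pointwise_left_kan_def
  proof (intro conjI ballI f_functor lf \<psi>)
    fix c assume c: "c \<in> Obj C"
    show "is_colimit (comma A C f c) X (h \<circ>\<^sub>F comma_proj) (fobj l c) (\<lambda>(a, m). farr l m \<cdot>\<^bsub>X\<^esub> \<psi> a)"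
      unfolding l_def fctr.simps
      by (rule is_colimit_cong[OF colim[OF c] _ category_comma']) (auto simp: comma_simps lam[unfolded l_def fctr.simps])
  qed
  then show ?thesis by blast
qed

end

locale pointwise_kan = kan_setting A C X f h
  for A :: "('o, 'a, 'z1) cat_scheme" and C :: "('p, 'b, 'z2) cat_scheme" and X :: "('x, 'y, 'z3) cat_scheme"
    and f h +
  fixes l :: "('p, 'b, 'x, 'y) fctr" and \<psi> :: "'o \<Rightarrow> 'y"
  assumes pointwise: "pointwise_left_kan A C X f h l \<psi>"
begin

lemma l_functor: "cat_functor C X l" and \<psi>_nat: "nat_trans A X h (l \<circ>\<^sub>F f) \<psi>"
  using pointwise by (auto simp: pointwise_left_kan_def)

lemmas l [simp] = cat_functorD[OF l_functor]

text \<open>The coprojection at (a, m) of the colimit that computes \<open>l\<close> at the codomain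
  of m.\<close>

definition lam :: "'o \<Rightarrow> 'b \<Rightarrow> 'y" where
  "lam a m = farr l m \<cdot>\<^bsub>X\<^esub> \<psi> a"

lemma colimit: "c \<in> Obj C \<Longrightarrow> is_colimit (comma A C f c) X (h \<circ>\<^sub>F comma_proj) (fobj l c) (\<lambda>(a, m). lam a m)"
  using pointwise by (simp add: pointwise_left_kan_def lam_def)

lemma \<psi>_simps [simp]:
  "a \<in> Obj A \<Longrightarrow> \<psi> a \<in> Arr X" "a \<in> Obj A \<Longrightarrow> Dom X (\<psi> a) = fobj h a" "a \<in> Obj A \<Longrightarrow> Cod X (\<psi> a) = fobj l (fobj f a)"
  using nat_transD(4-6)[OF \<psi>_nat] by auto

lemma lam_simps [simp]:
  assumes "a \<in> Obj A" "m \<in> Arr C" "Dom C m = fobj f a"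
  shows "lam a m \<in> Arr X" "Dom X (lam a m) = fobj h a" "Cod X (lam a m) = fobj l (Cod C m)"
  using assms by (auto simp: lam_def)

lemma lam_id: "a \<in> Obj A \<Longrightarrow> lam a (Idt C (fobj f a)) = \<psi> a"
  by (simp add: lam_def)

lemma lam_pre:
  assumes "t \<in> Arr A" "m \<in> Arr C" "Dom C m = fobj f (Cod A t)"
  shows "lam (Cod A t) m \<cdot>\<^bsub>X\<^esub> farr h t = lam (Dom A t) (m \<cdot>\<^bsub>C\<^esub> farr f t)"
  using assms nat_transD(7)[OF \<psi>_nat assms(1)] by (simp add: lam_def)

lemma lam_post:
  assumes "a \<in> Obj A" "m \<in> Arr C" "Dom C m = fobj f a" "n \<in> Arr C" "Dom C n = Cod C m"
  shows "farr l n \<cdot>\<^bsub>X\<^esub> lam a m = lam a (n \<cdot>\<^bsub>C\<^esub> m)"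
  using assms by (simp add: lam_def)

lemma lam_univ:
  assumes c: "c \<in> Obj C" and d: "d \<in> Obj X"
    and \<kappa>: "\<And>a m. a \<in> Obj A \<Longrightarrow> m \<in> hom C (fobj f a) c \<Longrightarrow> \<kappa> a m \<in> hom X (fobj h a) d"
    and nat: "\<And>t a a' m. t \<in> hom A a a' \<Longrightarrow> m \<in> hom C (fobj f a') c \<Longrightarrow> \<kappa> a' m \<cdot>\<^bsub>X\<^esub> farr h t = \<kappa> a (m \<cdot>\<^bsub>C\<^esub> farr f t)"
  obtains u where "u \<in> hom X (fobj l c) d" "\<And>a m. a \<in> Obj A \<Longrightarrow> m \<in> hom C (fobj f a) c \<Longrightarrow> u \<cdot>\<^bsub>X\<^esub> lam a m = \<kappa> a m"
proof -
  have "is_cocone (comma A C f c) X (h \<circ>\<^sub>F comma_proj) d (\<lambda>(a, m). \<kappa> a m)"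
    by (rule is_cocone_commaI[OF d]) (use \<kappa> nat in auto)
  from is_colimit_univ[OF colimit[OF c] this] obtain u where "u \<in> hom X (fobj l c) d"
    "\<And>i. i \<in> Obj (comma A C f c) \<Longrightarrow> u \<cdot>\<^bsub>X\<^esub> (\<lambda>(a, m). lam a m) i = (\<lambda>(a, m). \<kappa> a m) i" by metis
  then show ?thesis using that[of u] by (auto simp: comma_simps)
qed

lemma lam_epi:
  assumes "c \<in> Obj C" "u \<in> hom X (fobj l c) d" "v \<in> hom X (fobj l c) d"
    "\<And>a m. a \<in> Obj A \<Longrightarrow> m \<in> hom C (fobj f a) c \<Longrightarrow> u \<cdot>\<^bsub>X\<^esub> lam a m = v \<cdot>\<^bsub>X\<^esub> lam a m"
  shows "u = v"
  by (rule is_colimit_epi[OF colimit[OF assms(1)] X.category_axioms category_comma' cat_functor_comma assms(2,3)])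
    (use assms(4) in \<open>auto simp: comma_simps\<close>)

text \<open>For a competing pair of \<open>k\<close> and \<theta> the arrows
  \<open>farr k m \<cdot> \<theta> a\<close> form a cocone over each comma category. The induced
  arrows are natural and unique because the coprojections are jointly epic.\<close>

lemma left_kan: "left_kan A C X f h l \<psi>"
  unfolding left_kan_def
proof (intro conjI allI impI f_functor l_functor \<psi>_nat)
  fix k \<theta> assume "cat_functor C X k \<and> nat_trans A X h (k \<circ>\<^sub>F f) \<theta>"
  then have k: "cat_functor C X k" and \<theta>: "nat_trans A X h (k \<circ>\<^sub>F f) \<theta>" by auto
  note k' = cat_functorD[OF k] and \<theta>' = nat_transD[OF \<theta>]
  have "\<exists>u. u \<in> hom X (fobj l c) (fobj k c) \<and>
      (\<forall>a m. a \<in> Obj A \<longrightarrow> m \<in> hom C (fobj f a) c \<longrightarrow> u \<cdot>\<^bsub>X\<^esub> lam a m = farr k m \<cdot>\<^bsub>X\<^esub> \<theta> a)" if c: "c \<in> Obj C" for c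
  proof (rule lam_univ[OF c, of "fobj k c" "\<lambda>a m. farr k m \<cdot>\<^bsub>X\<^esub> \<theta> a"])
    show "fobj k c \<in> Obj X" using k' c by simp
    fix a m assume "a \<in> Obj A" "m \<in> hom C (fobj f a) c"
    then show "farr k m \<cdot>\<^bsub>X\<^esub> \<theta> a \<in> hom X (fobj h a) (fobj k c)" using k' \<theta>' by (auto simp: hom_def)
  next
    fix t a a' m assume "t \<in> hom A a a'" "m \<in> hom C (fobj f a') c"
    then show "(farr k m \<cdot>\<^bsub>X\<^esub> \<theta> a') \<cdot>\<^bsub>X\<^esub> farr h t = farr k (m \<cdot>\<^bsub>C\<^esub> farr f t) \<cdot>\<^bsub>X\<^esub> \<theta> a"
      using k' \<theta>'(4-6) \<theta>'(7)[of t] by (auto simp: hom_def)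
  qed blast
  then obtain \<tau> where \<tau>: "\<And>c. c \<in> Obj C \<Longrightarrow> \<tau> c \<in> hom X (fobj l c) (fobj k c)"
    "\<And>c a m. c \<in> Obj C \<Longrightarrow> a \<in> Obj A \<Longrightarrow> m \<in> hom C (fobj f a) c \<Longrightarrow> \<tau> c \<cdot>\<^bsub>X\<^esub> lam a m = farr k m \<cdot>\<^bsub>X\<^esub> \<theta> a"
    by metis
  have \<tau>': "c \<in> Obj C \<Longrightarrow> \<tau> c \<in> Arr X" "c \<in> Obj C \<Longrightarrow> Dom X (\<tau> c) = fobj l c" "c \<in> Obj C \<Longrightarrow> Cod X (\<tau> c) = fobj k c" for c
    using \<tau>(1)[of c] by (auto simp: hom_def)
  show "\<exists>\<tau>. nat_trans C X l k \<tau> \<and> (\<forall>a \<in> Obj A. \<tau> (fobj f a) \<cdot>\<^bsub>X\<^esub> \<psi> a = \<theta> a) \<and>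
      (\<forall>\<tau>'. nat_trans C X l k \<tau>' \<and> (\<forall>a \<in> Obj A. \<tau>' (fobj f a) \<cdot>\<^bsub>X\<^esub> \<psi> a = \<theta> a) \<longrightarrow> (\<forall>c \<in> Obj C. \<tau>' c = \<tau> c))"
  proof (rule exI[of _ \<tau>], intro conjI allI impI ballI)
    show "nat_trans C X l k \<tau>"
    proof (rule nat_transI[OF l_functor k \<tau>(1)])
      fix n assume n: "n \<in> Arr C"
      show "\<tau> (Cod C n) \<cdot>\<^bsub>X\<^esub> farr l n = farr k n \<cdot>\<^bsub>X\<^esub> \<tau> (Dom C n)"
      proof (rule lam_epi[OF C.dom_obj[OF n]])
        show "\<tau> (Cod C n) \<cdot>\<^bsub>X\<^esub> farr l n \<in> hom X (fobj l (Dom C n)) (fobj k (Cod C n))"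
          "farr k n \<cdot>\<^bsub>X\<^esub> \<tau> (Dom C n) \<in> hom X (fobj l (Dom C n)) (fobj k (Cod C n))"
          using n k' \<tau>' by (auto simp: hom_def)
        fix a m assume a: "a \<in> Obj A" and "m \<in> hom C (fobj f a) (Dom C n)"
        then have m: "m \<in> Arr C" "Dom C m = fobj f a" "Cod C m = Dom C n" by (auto simp: hom_def)
        then show "(\<tau> (Cod C n) \<cdot>\<^bsub>X\<^esub> farr l n) \<cdot>\<^bsub>X\<^esub> lam a m = (farr k n \<cdot>\<^bsub>X\<^esub> \<tau> (Dom C n)) \<cdot>\<^bsub>X\<^esub> lam a m"
          using n a k' \<tau>' \<theta>' \<tau>(2)[of "Dom C n" a m] \<tau>(2)[of "Cod C n" a "n \<cdot>\<^bsub>C\<^esub> m"]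
          by (simp add: lam_post hom_def)
      qed
    qed
  next
    fix a assume "a \<in> Obj A"
    then show "\<tau> (fobj f a) \<cdot>\<^bsub>X\<^esub> \<psi> a = \<theta> a"
      using \<tau>(2)[of "fobj f a" a "Idt C (fobj f a)"] C.idt_hom[of "fobj f a"] k' \<theta>' by (simp add: lam_id)
  next
    fix \<tau>2 c assume "nat_trans C X l k \<tau>2 \<and> (\<forall>a \<in> Obj A. \<tau>2 (fobj f a) \<cdot>\<^bsub>X\<^esub> \<psi> a = \<theta> a)" and c: "c \<in> Obj C"
    then have \<tau>2: "nat_trans C X l k \<tau>2" "\<And>a. a \<in> Obj A \<Longrightarrow> \<tau>2 (fobj f a) \<cdot>\<^bsub>X\<^esub> \<psi> a = \<theta> a" by auto
    note \<tau>2' = nat_transD[OF \<tau>2(1)]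
    show "\<tau>2 c = \<tau> c"
    proof (rule lam_epi[OF c \<tau>2'(3)[OF c] \<tau>(1)[OF c]])
      fix a m assume a: "a \<in> Obj A" and m: "m \<in> hom C (fobj f a) c"
      have m': "m \<in> Arr C" "Dom C m = fobj f a" "Cod C m = c" using m by (auto simp: hom_def)
      have "\<tau>2 c \<cdot>\<^bsub>X\<^esub> lam a m = (\<tau>2 c \<cdot>\<^bsub>X\<^esub> farr l m) \<cdot>\<^bsub>X\<^esub> \<psi> a"
        using a m' c \<tau>2'(4-6) by (simp add: lam_def)
      also have "\<dots> = farr k m \<cdot>\<^bsub>X\<^esub> \<theta> a"
        using \<tau>2'(7)[OF m'(1)] a m' c \<tau>2'(4-6) k' \<tau>2(2)[OF a] by simp
      finally show "\<tau>2 c \<cdot>\<^bsub>X\<^esub> lam a m = \<tau> c \<cdot>\<^bsub>X\<^esub> lam a m" using \<tau>(2)[OF c a m] by simp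
    qed
  qed
qed

end

lemma left_kan_univ:
  assumes "left_kan A C X f h l \<psi>" "cat_functor C X k" "nat_trans A X h (k \<circ>\<^sub>F f) \<theta>"
  obtains \<tau> where "nat_trans C X l k \<tau>" "\<And>a. a \<in> Obj A \<Longrightarrow> \<tau> (fobj f a) \<cdot>\<^bsub>X\<^esub> \<psi> a = \<theta> a"
    "\<And>\<tau>' c. nat_trans C X l k \<tau>' \<Longrightarrow> (\<And>a. a \<in> Obj A \<Longrightarrow> \<tau>' (fobj f a) \<cdot>\<^bsub>X\<^esub> \<psi> a = \<theta> a) \<Longrightarrow> c \<in> Obj C \<Longrightarrow> \<tau>' c = \<tau> c"
proof -
  have "\<exists>\<tau>. nat_trans C X l k \<tau> \<and> (\<forall>a \<in> Obj A. \<tau> (fobj f a) \<cdot>\<^bsub>X\<^esub> \<psi> a = \<theta> a) \<and>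
      (\<forall>\<tau>'. nat_trans C X l k \<tau>' \<and> (\<forall>a \<in> Obj A. \<tau>' (fobj f a) \<cdot>\<^bsub>X\<^esub> \<psi> a = \<theta> a) \<longrightarrow> (\<forall>c \<in> Obj C. \<tau>' c = \<tau> c))"
    using assms unfolding left_kan_def by blast
  then show ?thesis using that by (elim exE conjE) blast
qed

lemma nat_trans_comp:
  assumes "category A" "category B" "nat_trans A B F G \<sigma>" "nat_trans A B G H \<tau>"
  shows "nat_trans A B F H (\<lambda>a. \<tau> a \<cdot>\<^bsub>B\<^esub> \<sigma> a)"
proof -
  interpret A: category A by fact
  interpret B: category B by fact
  note s = nat_transD[OF assms(3)] and t = nat_transD[OF assms(4)]
  note F = cat_functorD[OF s(1)] and G = cat_functorD[OF s(2)] and H = cat_functorD[OF t(2)]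
  show ?thesis
  proof (rule nat_transI[OF s(1) t(2)])
    fix a assume "a \<in> Obj A"
    then show "\<tau> a \<cdot>\<^bsub>B\<^esub> \<sigma> a \<in> hom B (fobj F a) (fobj H a)" using s t by (simp add: hom_def)
  next
    fix f assume f: "f \<in> Arr A"
    have "(\<tau> (Cod A f) \<cdot>\<^bsub>B\<^esub> \<sigma> (Cod A f)) \<cdot>\<^bsub>B\<^esub> farr F f = \<tau> (Cod A f) \<cdot>\<^bsub>B\<^esub> (\<sigma> (Cod A f) \<cdot>\<^bsub>B\<^esub> farr F f)"
      using f s(4-6) t(4-6) F by simp
    also have "\<dots> = (\<tau> (Cod A f) \<cdot>\<^bsub>B\<^esub> farr G f) \<cdot>\<^bsub>B\<^esub> \<sigma> (Dom A f)"
      using f s(4-7) t(4-6) G by simp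
    also have "\<dots> = farr H f \<cdot>\<^bsub>B\<^esub> \<tau> (Dom A f) \<cdot>\<^bsub>B\<^esub> \<sigma> (Dom A f)"
      using f s(4-6) t(4-7) H by simp
    finally show "(\<tau> (Cod A f) \<cdot>\<^bsub>B\<^esub> \<sigma> (Cod A f)) \<cdot>\<^bsub>B\<^esub> farr F f = farr H f \<cdot>\<^bsub>B\<^esub> \<tau> (Dom A f) \<cdot>\<^bsub>B\<^esub> \<sigma> (Dom A f)" .
  qed
qed

lemma nat_trans_id:
  assumes "category B" "cat_functor A B F" "category A"
  shows "nat_trans A B F F (\<lambda>a. Idt B (fobj F a))"
proof -
  interpret B: category B by fact
  interpret A: category A by fact
  show ?thesis
    by (rule nat_transI[OF assms(2,2)]) (use cat_functorD[OF assms(2)] in \<open>auto simp: hom_def\<close>)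
qed

text \<open>Left Kan extensions are unique up to isomorphism, so all are pointwise as soon as one is.\<close>

lemma (in pointwise_kan) left_kan_pointwise:
  assumes lk: "left_kan A C X f h l' \<psi>'"
  shows "pointwise_left_kan A C X f h l' \<psi>'"
proof -
  have l': "cat_functor C X l'" and \<psi>': "nat_trans A X h (l' \<circ>\<^sub>F f) \<psi>'"
    using lk by (auto simp: left_kan_def)
  note L' = cat_functorD[OF l'] and P' = nat_transD[OF \<psi>']
  obtain \<tau> where \<tau>: "nat_trans C X l l' \<tau>" "\<And>a. a \<in> Obj A \<Longrightarrow> \<tau> (fobj f a) \<cdot>\<^bsub>X\<^esub> \<psi> a = \<psi>' a"
    using left_kan_univ[OF left_kan l' \<psi>'] by metis
  obtain \<sigma> where \<sigma>: "nat_trans C X l' l \<sigma>" "\<And>a. a \<in> Obj A \<Longrightarrow> \<sigma> (fobj f a) \<cdot>\<^bsub>X\<^esub> \<psi>' a = \<psi> a"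
    using left_kan_univ[OF lk l_functor \<psi>_nat] by metis
  note \<tau>' = nat_transD[OF \<tau>(1)] and \<sigma>' = nat_transD[OF \<sigma>(1)]
  \<comment> \<open>Uniqueness in the universal property of \<open>l'\<close> identifies \<tau>
    after \<sigma> with the identity; this enters in the uniqueness of factorisations below.\<close>
  have ts: "\<tau> c \<cdot>\<^bsub>X\<^esub> \<sigma> c = Idt X (fobj l' c)" if c: "c \<in> Obj C" for c
  proof -
    obtain \<rho> where \<rho>: "\<And>\<tau>' c. nat_trans C X l' l' \<tau>' \<Longrightarrow> (\<And>a. a \<in> Obj A \<Longrightarrow> \<tau>' (fobj f a) \<cdot>\<^bsub>X\<^esub> \<psi>' a = \<psi>' a) \<Longrightarrow> c \<in> Obj C \<Longrightarrow> \<tau>' c = \<rho> c"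
      using left_kan_univ[OF lk l' \<psi>'] by metis
    have "\<tau> c \<cdot>\<^bsub>X\<^esub> \<sigma> c = \<rho> c"
    proof (rule \<rho>[OF nat_trans_comp[OF C.category_axioms X.category_axioms \<sigma>(1) \<tau>(1)] _ c])
      fix a assume "a \<in> Obj A"
      then show "(\<tau> (fobj f a) \<cdot>\<^bsub>X\<^esub> \<sigma> (fobj f a)) \<cdot>\<^bsub>X\<^esub> \<psi>' a = \<psi>' a"
        using \<tau>'(4-6) \<sigma>'(4-6) P'(4-6) \<sigma>(2) \<tau>(2) by simp
    qed
    moreover have "Idt X (fobj l' c) = \<rho> c"
      using \<rho>[OF nat_trans_id[OF X.category_axioms l' C.category_axioms] _ c] P'(4-6) by simp
    ultimately show ?thesis by simp
  qed
  show ?thesis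
    unfolding pointwise_left_kan_def
  proof (intro conjI ballI f_functor l' \<psi>')
    fix c assume c: "c \<in> Obj C"
    show "is_colimit (comma A C f c) X (h \<circ>\<^sub>F comma_proj) (fobj l' c) (\<lambda>(a, m). farr l' m \<cdot>\<^bsub>X\<^esub> \<psi>' a)"
      unfolding is_colimit_def
    proof (intro conjI allI impI)
      show "is_cocone (comma A C f c) X (h \<circ>\<^sub>F comma_proj) (fobj l' c) (\<lambda>(a, m). farr l' m \<cdot>\<^bsub>X\<^esub> \<psi>' a)"
        by (rule is_cocone_comma_nat_trans[OF A.category_axioms X.category_axioms C.category_axioms f_functor l' \<psi>' c])
      fix d \<kappa> assume \<kappa>: "is_cocone (comma A C f c) X (h \<circ>\<^sub>F comma_proj) d \<kappa>"
      from is_colimit_univ[OF colimit[OF c] \<kappa>]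
      obtain u where u: "u \<in> hom X (fobj l c) d" "\<And>i. i \<in> Obj (comma A C f c) \<Longrightarrow> u \<cdot>\<^bsub>X\<^esub> (\<lambda>(a, m). lam a m) i = \<kappa> i"
        by metis
      have u': "u \<in> Arr X" "Dom X u = fobj l c" "Cod X u = d" using u(1) by (auto simp: hom_def)
      have l1: "\<sigma> c \<cdot>\<^bsub>X\<^esub> farr l' m \<cdot>\<^bsub>X\<^esub> \<psi>' a = lam a m" if "a \<in> Obj A" "m \<in> Arr C" "Dom C m = fobj f a" "Cod C m = c" for a m
      proof -
        have "\<sigma> c \<cdot>\<^bsub>X\<^esub> farr l' m \<cdot>\<^bsub>X\<^esub> \<psi>' a = (\<sigma> c \<cdot>\<^bsub>X\<^esub> farr l' m) \<cdot>\<^bsub>X\<^esub> \<psi>' a"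
          using that c L' P'(4-6) \<sigma>'(4-6) by simp
        also have "\<dots> = farr l m \<cdot>\<^bsub>X\<^esub> \<sigma> (fobj f a) \<cdot>\<^bsub>X\<^esub> \<psi>' a"
          using that c \<sigma>'(7)[OF that(2)] P'(4-6) \<sigma>'(4-6) by simp
        finally show ?thesis using \<sigma>(2)[OF that(1)] by (simp add: lam_def)
      qed
      have l2: "\<tau> c \<cdot>\<^bsub>X\<^esub> lam a m = farr l' m \<cdot>\<^bsub>X\<^esub> \<psi>' a" if "a \<in> Obj A" "m \<in> Arr C" "Dom C m = fobj f a" "Cod C m = c" for a m
      proof -
        have "\<tau> c \<cdot>\<^bsub>X\<^esub> lam a m = (\<tau> c \<cdot>\<^bsub>X\<^esub> farr l m) \<cdot>\<^bsub>X\<^esub> \<psi> a"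
          using that c \<tau>'(4-6) by (simp add: lam_def)
        also have "\<dots> = farr l' m \<cdot>\<^bsub>X\<^esub> \<tau> (fobj f a) \<cdot>\<^bsub>X\<^esub> \<psi> a"
          using that c \<tau>'(7)[OF that(2)] L' \<tau>'(4-6) by simp
        finally show ?thesis using \<tau>(2)[OF that(1)] by simp
      qed
      show "\<exists>!u. u \<in> hom X (fobj l' c) d \<and> (\<forall>i \<in> Obj (comma A C f c). u \<cdot>\<^bsub>X\<^esub> (\<lambda>(a, m). farr l' m \<cdot>\<^bsub>X\<^esub> \<psi>' a) i = \<kappa> i)"
      proof (intro ex1I conjI ballI)
        \<comment> \<open>The factorisation through \<open>l'\<close> is the one through
          \<open>l\<close> transported along \<sigma>.\<close>
        show "u \<cdot>\<^bsub>X\<^esub> \<sigma> c \<in> hom X (fobj l' c) d" using u' \<sigma>'(4-6) c by (simp add: hom_def)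
        fix i assume i: "i \<in> Obj (comma A C f c)"
        obtain a m where im: "i = (a, m)" by (cases i)
        have am: "a \<in> Obj A" "m \<in> Arr C" "Dom C m = fobj f a" "Cod C m = c" using i by (auto simp: im comma_simps hom_def)
        show "(u \<cdot>\<^bsub>X\<^esub> \<sigma> c) \<cdot>\<^bsub>X\<^esub> (\<lambda>(a, m). farr l' m \<cdot>\<^bsub>X\<^esub> \<psi>' a) i = \<kappa> i"
          using u(2)[OF i] l1[OF am] am u' \<sigma>'(4-6) c L' P'(4-6) by (simp add: im)
      next
        fix v assume v: "v \<in> hom X (fobj l' c) d \<and> (\<forall>i \<in> Obj (comma A C f c). v \<cdot>\<^bsub>X\<^esub> (\<lambda>(a, m). farr l' m \<cdot>\<^bsub>X\<^esub> \<psi>' a) i = \<kappa> i)"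
        then have v': "v \<in> Arr X" "Dom X v = fobj l' c" "Cod X v = d" by (auto simp: hom_def)
        have "v \<cdot>\<^bsub>X\<^esub> \<tau> c = u"
        proof (rule lam_epi[OF c _ u(1)])
          show "v \<cdot>\<^bsub>X\<^esub> \<tau> c \<in> hom X (fobj l c) d" using v' \<tau>'(4-6) c by (simp add: hom_def)
          fix a m assume a: "a \<in> Obj A" and m: "m \<in> hom C (fobj f a) c"
          then have i: "(a, m) \<in> Obj (comma A C f c)" and m': "m \<in> Arr C" "Dom C m = fobj f a" "Cod C m = c"
            by (auto simp: comma_simps hom_def)
          have "(v \<cdot>\<^bsub>X\<^esub> \<tau> c) \<cdot>\<^bsub>X\<^esub> lam a m = v \<cdot>\<^bsub>X\<^esub> farr l' m \<cdot>\<^bsub>X\<^esub> \<psi>' a"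
            using l2[OF a m'] v' \<tau>'(4-6) c a m' by simp
          also have "\<dots> = \<kappa> (a, m)" using v i by auto
          finally show "(v \<cdot>\<^bsub>X\<^esub> \<tau> c) \<cdot>\<^bsub>X\<^esub> lam a m = u \<cdot>\<^bsub>X\<^esub> lam a m" using u(2)[OF i] by simp
        qed
        then have "u \<cdot>\<^bsub>X\<^esub> \<sigma> c = v \<cdot>\<^bsub>X\<^esub> \<tau> c \<cdot>\<^bsub>X\<^esub> \<sigma> c" using v' \<tau>'(4-6) \<sigma>'(4-6) c by force
        then show "v = u \<cdot>\<^bsub>X\<^esub> \<sigma> c" using ts[OF c] v' by simp
      qed
    qed
  qed
qed

section \<open>Kan extensions of strong monoidal functors\<close>

text \<open>The uniqueness half of a colimit, isolated because it passes to tensor products in a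
  closed category. Equations between arrows out of tensor products of values of the Kan extension
  are checked on coprojections in this way.\<close>

definition jointly_epi :: "('o, 'a, 'z) cat_scheme \<Rightarrow> 'o \<Rightarrow> 'a set \<Rightarrow> bool" where
  "jointly_epi X c F \<longleftrightarrow> c \<in> Obj X \<and> (\<forall>f \<in> F. f \<in> Arr X \<and> Cod X f = c) \<and>
     (\<forall>d u v. u \<in> hom X c d \<and> v \<in> hom X c d \<and> (\<forall>f \<in> F. u \<cdot>\<^bsub>X\<^esub> f = v \<cdot>\<^bsub>X\<^esub> f) \<longrightarrow> u = v)"

lemma jointly_epiD:
  assumes "jointly_epi X c F" "u \<in> hom X c d" "v \<in> hom X c d" "\<And>f. f \<in> F \<Longrightarrow> u \<cdot>\<^bsub>X\<^esub> f = v \<cdot>\<^bsub>X\<^esub> f"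
  shows "u = v"
  using assms by (auto simp: jointly_epi_def)

lemma jointly_epi_simps:
  assumes "jointly_epi X c F"
  shows "c \<in> Obj X" "f \<in> F \<Longrightarrow> f \<in> Arr X" "f \<in> F \<Longrightarrow> Cod X f = c"
  using assms by (simp_all add: jointly_epi_def)

section \<open>Closed categories: the tensor product preserves colimits in each variable\<close>

locale closed_monoidal = symmetric_monoidal M for M :: "('o, 'a, 'z) smcat_scheme" (structure) +
  assumes closed: "monoidal_closed M"
begin

lemma curry:
  assumes "y \<in> Obj M" "z \<in> Obj M"
  obtains e ev where "e \<in> Obj M" "ev \<in> Arr M" "Dom M ev = e \<odot> y" "Cod M ev = z"
    "\<And>x f. x \<in> Obj M \<Longrightarrow> f \<in> hom M (x \<odot> y) z \<Longrightarrow> \<exists>g \<in> hom M x e. ev \<cdot> (g \<otimes> Idt M y) = f"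
    "\<And>x g g'. x \<in> Obj M \<Longrightarrow> g \<in> hom M x e \<Longrightarrow> g' \<in> hom M x e \<Longrightarrow> ev \<cdot> (g \<otimes> Idt M y) = ev \<cdot> (g' \<otimes> Idt M y) \<Longrightarrow> g = g'"
proof -
  have "\<exists>e \<in> Obj M. \<exists>ev \<in> hom M (e \<odot> y) z. \<forall>x \<in> Obj M. \<forall>f \<in> hom M (x \<odot> y) z.
      \<exists>!g. g \<in> hom M x e \<and> ev \<cdot> (g \<otimes> Idt M y) = f"
    using closed assms unfolding monoidal_closed_def by blast
  then obtain e ev where e: "e \<in> Obj M" "ev \<in> hom M (e \<odot> y) z"
    and u': "\<forall>x \<in> Obj M. \<forall>f \<in> hom M (x \<odot> y) z. \<exists>!g. g \<in> hom M x e \<and> ev \<cdot> (g \<otimes> Idt M y) = f"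
    by (elim bexE)
  have u: "\<exists>!g. g \<in> hom M x e \<and> ev \<cdot> (g \<otimes> Idt M y) = f" if "x \<in> Obj M" "f \<in> hom M (x \<odot> y) z" for x f
    using u' that by simp
  have ev: "ev \<in> Arr M" "Dom M ev = e \<odot> y" "Cod M ev = z" using e(2) by (auto simp: hom_def)
  show ?thesis
  proof (rule that[OF e(1) ev])
    show "\<exists>g \<in> hom M x e. ev \<cdot> (g \<otimes> Idt M y) = f" if "x \<in> Obj M" "f \<in> hom M (x \<odot> y) z" for x f
      using u[OF that] by blast
    show "g = g'" if "x \<in> Obj M" and g: "g \<in> hom M x e" "g' \<in> hom M x e" "ev \<cdot> (g \<otimes> Idt M y) = ev \<cdot> (g' \<otimes> Idt M y)" for x g g'
    proof -
      have "ev \<cdot> (g \<otimes> Idt M y) \<in> hom M (x \<odot> y) z" using g(1) ev assms by (simp add: hom_def)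
      from u[OF that(1) this] g show ?thesis by auto
    qed
  qed
qed

text \<open>An arrow out of \<open>c \<odot> y\<close> is determined by its transpose, an arrow out
  of \<open>c\<close>, and transposition is natural in \<open>c\<close>.\<close>

lemma jointly_epi_tensor_right:
  assumes F: "jointly_epi M c F" and y: "y \<in> Obj M"
  shows "jointly_epi M (c \<odot> y) ((\<lambda>f. f \<otimes> Idt M y) ` F)"
  unfolding jointly_epi_def
proof (intro conjI allI impI ballI)
  note c = jointly_epi_simps(1)[OF F] and F' = jointly_epi_simps(2,3)[OF F]
  show "c \<odot> y \<in> Obj M" using c y by simp
  show "g \<in> Arr M" "Cod M g = c \<odot> y" if "g \<in> (\<lambda>f. f \<otimes> Idt M y) ` F" for g
    using that F' y by auto
  fix d u v
  assume a: "u \<in> hom M (c \<odot> y) d \<and> v \<in> hom M (c \<odot> y) d \<and> (\<forall>f \<in> (\<lambda>f. f \<otimes> Idt M y) ` F. u \<cdot> f = v \<cdot> f)"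
  then have uv: "u \<in> hom M (c \<odot> y) d" "v \<in> hom M (c \<odot> y) d" "\<And>f. f \<in> F \<Longrightarrow> u \<cdot> (f \<otimes> Idt M y) = v \<cdot> (f \<otimes> Idt M y)"
    by auto
  have d: "d \<in> Obj M" using uv(1) by (auto simp: hom_def)
  obtain e ev where e: "e \<in> Obj M" "ev \<in> Arr M" "Dom M ev = e \<odot> y" "Cod M ev = d"
    and ex: "\<And>x f. x \<in> Obj M \<Longrightarrow> f \<in> hom M (x \<odot> y) d \<Longrightarrow> \<exists>g \<in> hom M x e. ev \<cdot> (g \<otimes> Idt M y) = f"
    and un: "\<And>x g g'. x \<in> Obj M \<Longrightarrow> g \<in> hom M x e \<Longrightarrow> g' \<in> hom M x e \<Longrightarrow> ev \<cdot> (g \<otimes> Idt M y) = ev \<cdot> (g' \<otimes> Idt M y) \<Longrightarrow> g = g'"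
    using curry[OF y d] by metis
  obtain u' v' where u': "u' \<in> hom M c e" "ev \<cdot> (u' \<otimes> Idt M y) = u" and v': "v' \<in> hom M c e" "ev \<cdot> (v' \<otimes> Idt M y) = v"
    using ex[OF c uv(1)] ex[OF c uv(2)] by blast
  have arr: "u' \<in> Arr M" "Dom M u' = c" "Cod M u' = e" "v' \<in> Arr M" "Dom M v' = c" "Cod M v' = e"
    using u' v' by (auto simp: hom_def)
  have "u' = v'"
  proof (rule jointly_epiD[OF F u'(1) v'(1)])
    fix f assume f: "f \<in> F"
    note f' = F'[OF f]
    have "ev \<cdot> ((u' \<cdot> f) \<otimes> Idt M y) = u \<cdot> (f \<otimes> Idt M y)" "ev \<cdot> ((v' \<cdot> f) \<otimes> Idt M y) = v \<cdot> (f \<otimes> Idt M y)"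
      using interchange[of f u' "Idt M y" "Idt M y"] interchange[of f v' "Idt M y" "Idt M y"] f' arr e y
      unfolding u'(2)[symmetric] v'(2)[symmetric] by simp_all
    then have eq: "ev \<cdot> ((u' \<cdot> f) \<otimes> Idt M y) = ev \<cdot> ((v' \<cdot> f) \<otimes> Idt M y)"
      using uv(3)[OF f] by simp
    have "u' \<cdot> f \<in> hom M (Dom M f) e" "v' \<cdot> f \<in> hom M (Dom M f) e"
      using f' arr by (simp_all add: hom_def)
    from un[OF dom_obj[OF f'(1)] this eq] show "u' \<cdot> f = v' \<cdot> f" .
  qed
  then show "u = v" using u' v' by simp
qed

text \<open>Closedness concerns tensoring on the right; the braiding carries the result to the
  left.\<close>

lemma jointly_epi_tensor_left:
  assumes F: "jointly_epi M c F" and y: "y \<in> Obj M"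
  shows "jointly_epi M (y \<odot> c) ((\<lambda>f. Idt M y \<otimes> f) ` F)"
  unfolding jointly_epi_def
proof (intro conjI allI impI ballI)
  note c = jointly_epi_simps(1)[OF F] and F' = jointly_epi_simps(2,3)[OF F]
  show "y \<odot> c \<in> Obj M" using c y by simp
  show "g \<in> Arr M" "Cod M g = y \<odot> c" if "g \<in> (\<lambda>f. Idt M y \<otimes> f) ` F" for g
    using that F' y by auto
  fix d u v
  assume "u \<in> hom M (y \<odot> c) d \<and> v \<in> hom M (y \<odot> c) d \<and> (\<forall>f \<in> (\<lambda>f. Idt M y \<otimes> f) ` F. u \<cdot> f = v \<cdot> f)"
  then have uv: "u \<in> Arr M" "Dom M u = y \<odot> c" "Cod M u = d" "v \<in> Arr M" "Dom M v = y \<odot> c" "Cod M v = d"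
    "\<And>f. f \<in> F \<Longrightarrow> u \<cdot> (Idt M y \<otimes> f) = v \<cdot> (Idt M y \<otimes> f)"
    by (auto simp: hom_def)
  have "u \<cdot> Brd M c y = v \<cdot> Brd M c y"
  proof (rule jointly_epiD[OF jointly_epi_tensor_right[OF F y]])
    show "u \<cdot> Brd M c y \<in> hom M (c \<odot> y) d" "v \<cdot> Brd M c y \<in> hom M (c \<odot> y) d"
      using uv c y by (simp_all add: hom_def)
    fix g assume "g \<in> (\<lambda>f. f \<otimes> Idt M y) ` F"
    then obtain f where f: "g = f \<otimes> Idt M y" "f \<in> F" by auto
    note f' = F'[OF f(2)]
    have b: "Brd M c y \<cdot> (f \<otimes> Idt M y) = (Idt M y \<otimes> f) \<cdot> Brd M (Dom M f) y"
      using brd_natural_arr[of f "Idt M y"] f' y by simp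
    have "(w \<cdot> Brd M c y) \<cdot> g = (w \<cdot> (Idt M y \<otimes> f)) \<cdot> Brd M (Dom M f) y"
      if "w \<in> Arr M" "Dom M w = y \<odot> c" for w
      using that f' c y b by (simp add: f(1))
    then show "(u \<cdot> Brd M c y) \<cdot> g = (v \<cdot> Brd M c y) \<cdot> g" using uv(1,2,4,5) uv(7)[OF f(2)] by simp
  qed
  then have "(u \<cdot> Brd M c y) \<cdot> Brd M y c = (v \<cdot> Brd M c y) \<cdot> Brd M y c" by simp
  then show "u = v" using uv c y by (simp add: brd_symmetric)
qed

text \<open>One variable at a time, since \<open>f \<otimes> f'\<close> is
  \<open>f \<otimes> Idt M c'\<close> after \<open>Idt M (Dom M f) \<otimes> f'\<close>.\<close>

lemma jointly_epi_tensor: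
  assumes F: "jointly_epi M c F" and F': "jointly_epi M c' F'"
  shows "jointly_epi M (c \<odot> c') {f \<otimes> f' | f f'. f \<in> F \<and> f' \<in> F'}"
  unfolding jointly_epi_def
proof (intro conjI allI impI ballI)
  note c = jointly_epi_simps[OF F] and c' = jointly_epi_simps[OF F']
  show "c \<odot> c' \<in> Obj M" using c(1) c'(1) by simp
  show "g \<in> Arr M" "Cod M g = c \<odot> c'" if "g \<in> {f \<otimes> f' | f f'. f \<in> F \<and> f' \<in> F'}" for g
    using that c c' by auto
  fix d u v
  assume "u \<in> hom M (c \<odot> c') d \<and> v \<in> hom M (c \<odot> c') d \<and> (\<forall>f \<in> {f \<otimes> f' | f f'. f \<in> F \<and> f' \<in> F'}. u \<cdot> f = v \<cdot> f)"
  then have uv: "u \<in> hom M (c \<odot> c') d" "v \<in> hom M (c \<odot> c') d" "u \<in> Arr M" "Dom M u = c \<odot> c'" "Cod M u = d" "v \<in> Arr M" "Dom M v = c \<odot> c'" "Cod M v = d"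
    "\<And>f f'. f \<in> F \<Longrightarrow> f' \<in> F' \<Longrightarrow> u \<cdot> (f \<otimes> f') = v \<cdot> (f \<otimes> f')"
    by (auto simp: hom_def)
  show "u = v"
  proof (rule jointly_epiD[OF jointly_epi_tensor_right[OF F c'(1)] uv(1,2)])
    fix g assume "g \<in> (\<lambda>f. f \<otimes> Idt M c') ` F"
    then obtain f where f: "g = f \<otimes> Idt M c'" "f \<in> F" by auto
    note a = c(2,3)[OF f(2)]
    show "u \<cdot> g = v \<cdot> g"
    proof (rule jointly_epiD[OF jointly_epi_tensor_left[OF F', of "Dom M f"]])
      show "Dom M f \<in> Obj M" using a by simp
      show "u \<cdot> g \<in> hom M (Dom M f \<odot> c') d" "v \<cdot> g \<in> hom M (Dom M f \<odot> c') d"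
        using a uv(3-8) c'(1) by (simp_all add: hom_def f(1))
      fix k assume "k \<in> (\<lambda>f'. Idt M (Dom M f) \<otimes> f') ` F'"
      then obtain f' where f': "k = Idt M (Dom M f) \<otimes> f'" "f' \<in> F'" by auto
      note a' = c'(2,3)[OF f'(2)]
      have "(w \<cdot> g) \<cdot> k = w \<cdot> (f \<otimes> f')" if "w \<in> Arr M" "Dom M w = c \<odot> c'" for w
        using that a a' c(1) c'(1) by (simp add: f(1) f'(1) interchange)
      then show "(u \<cdot> g) \<cdot> k = (v \<cdot> g) \<cdot> k" using uv(3,4,6,7) uv(9)[OF f(2) f'(2)] by simp
    qed
  qed
qed

end

locale closed_kan = X: closed_monoidal X + pointwise_kan A C X f h l \<psi>
  for A :: "('o, 'a, 'z1) cat_scheme" and C :: "('p, 'b, 'z2) cat_scheme" and X :: "('x, 'y, 'z3) smcat_scheme"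
    and f h l \<psi>
begin

lemma jointly_epi_lam:
  assumes "c \<in> Obj C"
  shows "jointly_epi X (fobj l c) {lam a m | a m. a \<in> Obj A \<and> m \<in> hom C (fobj f a) c}"
  unfolding jointly_epi_def
proof (intro conjI allI impI ballI)
  show "fobj l c \<in> Obj X" using assms by simp
  show "g \<in> Arr X" "Cod X g = fobj l c" if "g \<in> {lam a m | a m. a \<in> Obj A \<and> m \<in> hom C (fobj f a) c}" for g
    using that by (auto simp: hom_def)
  fix d u v
  assume uv: "u \<in> hom X (fobj l c) d \<and> v \<in> hom X (fobj l c) d \<and>
    (\<forall>g \<in> {lam a m | a m. a \<in> Obj A \<and> m \<in> hom C (fobj f a) c}. u \<cdot>\<^bsub>X\<^esub> g = v \<cdot>\<^bsub>X\<^esub> g)"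
  show "u = v"
  proof (rule lam_epi[OF assms])
    show "u \<in> hom X (fobj l c) d" "v \<in> hom X (fobj l c) d" using uv by blast+
    show "u \<cdot>\<^bsub>X\<^esub> lam a m = v \<cdot>\<^bsub>X\<^esub> lam a m" if "a \<in> Obj A" "m \<in> hom C (fobj f a) c" for a m
      using uv that by blast
  qed
qed

text \<open>Tensoring with \<open>y\<close> is a left adjoint, so it preserves the colimit
  \<open>fobj l c\<close>. Here the existence half: a cocone out of the tensor products is
  transposed, factored through the colimit and transposed back.\<close>

lemma lam_tensor_univ_right:
  assumes c: "c \<in> Obj C" and y: "y \<in> Obj X" and d: "d \<in> Obj X"
    and \<kappa>: "\<And>a m. a \<in> Obj A \<Longrightarrow> m \<in> hom C (fobj f a) c \<Longrightarrow> \<kappa> a m \<in> hom X (fobj h a \<odot>\<^bsub>X\<^esub> y) d"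
    and nat: "\<And>t a a' m. t \<in> hom A a a' \<Longrightarrow> m \<in> hom C (fobj f a') c \<Longrightarrow>
      \<kappa> a' m \<cdot>\<^bsub>X\<^esub> (farr h t \<otimes>\<^bsub>X\<^esub> Idt X y) = \<kappa> a (m \<cdot>\<^bsub>C\<^esub> farr f t)"
  obtains u where "u \<in> hom X (fobj l c \<odot>\<^bsub>X\<^esub> y) d"
    "\<And>a m. a \<in> Obj A \<Longrightarrow> m \<in> hom C (fobj f a) c \<Longrightarrow> u \<cdot>\<^bsub>X\<^esub> (lam a m \<otimes>\<^bsub>X\<^esub> Idt X y) = \<kappa> a m"
proof -
  obtain e ev where e: "e \<in> Obj X" "ev \<in> Arr X" "Dom X ev = e \<odot>\<^bsub>X\<^esub> y" "Cod X ev = d"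
    and ex: "\<And>x f. x \<in> Obj X \<Longrightarrow> f \<in> hom X (x \<odot>\<^bsub>X\<^esub> y) d \<Longrightarrow> \<exists>g \<in> hom X x e. ev \<cdot>\<^bsub>X\<^esub> (g \<otimes>\<^bsub>X\<^esub> Idt X y) = f"
    and un: "\<And>x g g'. x \<in> Obj X \<Longrightarrow> g \<in> hom X x e \<Longrightarrow> g' \<in> hom X x e \<Longrightarrow>
      ev \<cdot>\<^bsub>X\<^esub> (g \<otimes>\<^bsub>X\<^esub> Idt X y) = ev \<cdot>\<^bsub>X\<^esub> (g' \<otimes>\<^bsub>X\<^esub> Idt X y) \<Longrightarrow> g = g'"
    using X.curry[OF y d] by metis
  have "\<exists>g. \<forall>a m. a \<in> Obj A \<longrightarrow> m \<in> hom C (fobj f a) c \<longrightarrow>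
      g a m \<in> hom X (fobj h a) e \<and> ev \<cdot>\<^bsub>X\<^esub> (g a m \<otimes>\<^bsub>X\<^esub> Idt X y) = \<kappa> a m"
    using ex[OF _ \<kappa>] by (intro choice allI) (metis h(1))
  then obtain g where g: "\<And>a m. a \<in> Obj A \<Longrightarrow> m \<in> hom C (fobj f a) c \<Longrightarrow> g a m \<in> hom X (fobj h a) e"
    "\<And>a m. a \<in> Obj A \<Longrightarrow> m \<in> hom C (fobj f a) c \<Longrightarrow> ev \<cdot>\<^bsub>X\<^esub> (g a m \<otimes>\<^bsub>X\<^esub> Idt X y) = \<kappa> a m"
    by metis
  obtain v where v: "v \<in> hom X (fobj l c) e" "\<And>a m. a \<in> Obj A \<Longrightarrow> m \<in> hom C (fobj f a) c \<Longrightarrow> v \<cdot>\<^bsub>X\<^esub> lam a m = g a m"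
  proof (rule lam_univ[OF c e(1) g(1)])
    fix t a a' m assume t: "t \<in> hom A a a'" and m: "m \<in> hom C (fobj f a') c"
    have t': "t \<in> Arr A" "Dom A t = a" "Cod A t = a'" "a \<in> Obj A" "a' \<in> Obj A" using t by (auto simp: hom_def)
    have mt: "m \<cdot>\<^bsub>C\<^esub> farr f t \<in> hom C (fobj f a) c" using m t' by (auto simp: hom_def)
    note gm = g(1)[OF t'(5) m, unfolded hom_def] 
    \<comment> \<open>Naturality of the transposed family follows from that of \<kappa> by
      uniqueness of transposes.\<close>
    show "g a' m \<cdot>\<^bsub>X\<^esub> farr h t = g a (m \<cdot>\<^bsub>C\<^esub> farr f t)"
    proof (rule un[of "fobj h a"])
      show "fobj h a \<in> Obj X" using t' by simp
      show "g a' m \<cdot>\<^bsub>X\<^esub> farr h t \<in> hom X (fobj h a) e" using gm t' by (simp add: hom_def)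
      show "g a (m \<cdot>\<^bsub>C\<^esub> farr f t) \<in> hom X (fobj h a) e" by (rule g(1)[OF t'(4) mt])
      have "ev \<cdot>\<^bsub>X\<^esub> ((g a' m \<cdot>\<^bsub>X\<^esub> farr h t) \<otimes>\<^bsub>X\<^esub> Idt X y) = (ev \<cdot>\<^bsub>X\<^esub> (g a' m \<otimes>\<^bsub>X\<^esub> Idt X y)) \<cdot>\<^bsub>X\<^esub> (farr h t \<otimes>\<^bsub>X\<^esub> Idt X y)"
        using X.interchange[of "farr h t" "g a' m" "Idt X y" "Idt X y"] gm t' e y by simp
      then show "ev \<cdot>\<^bsub>X\<^esub> ((g a' m \<cdot>\<^bsub>X\<^esub> farr h t) \<otimes>\<^bsub>X\<^esub> Idt X y) = ev \<cdot>\<^bsub>X\<^esub> (g a (m \<cdot>\<^bsub>C\<^esub> farr f t) \<otimes>\<^bsub>X\<^esub> Idt X y)"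
        using g(2)[OF t'(5) m] g(2)[OF t'(4) mt] nat[OF t m] by simp
    qed
  qed (assumption+, (rule that; blast))
  have v': "v \<in> Arr X" "Dom X v = fobj l c" "Cod X v = e" using v(1) by (auto simp: hom_def)
  show ?thesis
  proof (rule that[of "ev \<cdot>\<^bsub>X\<^esub> (v \<otimes>\<^bsub>X\<^esub> Idt X y)"])
    show "ev \<cdot>\<^bsub>X\<^esub> (v \<otimes>\<^bsub>X\<^esub> Idt X y) \<in> hom X (fobj l c \<odot>\<^bsub>X\<^esub> y) d" using v' e y by (simp add: hom_def)
    fix a m assume am: "a \<in> Obj A" "m \<in> hom C (fobj f a) c"
    then have m: "m \<in> Arr C" "Dom C m = fobj f a" "Cod C m = c" by (auto simp: hom_def)
    show "(ev \<cdot>\<^bsub>X\<^esub> (v \<otimes>\<^bsub>X\<^esub> Idt X y)) \<cdot>\<^bsub>X\<^esub> (lam a m \<otimes>\<^bsub>X\<^esub> Idt X y) = \<kappa> a m"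
      using g(2)[OF am] v(2)[OF am] v' e y m am(1) by (simp add: X.interchange)
  qed
qed

text \<open>Precomposition with the braiding reduces this to
  \<open>lam_tensor_univ_right\<close>.\<close>

lemma lam_tensor_univ_left:
  assumes c: "c \<in> Obj C" and y: "y \<in> Obj X" and d: "d \<in> Obj X"
    and \<kappa>: "\<And>a m. a \<in> Obj A \<Longrightarrow> m \<in> hom C (fobj f a) c \<Longrightarrow> \<kappa> a m \<in> hom X (y \<odot>\<^bsub>X\<^esub> fobj h a) d"
    and nat: "\<And>t a a' m. t \<in> hom A a a' \<Longrightarrow> m \<in> hom C (fobj f a') c \<Longrightarrow>
      \<kappa> a' m \<cdot>\<^bsub>X\<^esub> (Idt X y \<otimes>\<^bsub>X\<^esub> farr h t) = \<kappa> a (m \<cdot>\<^bsub>C\<^esub> farr f t)"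
  obtains u where "u \<in> hom X (y \<odot>\<^bsub>X\<^esub> fobj l c) d"
    "\<And>a m. a \<in> Obj A \<Longrightarrow> m \<in> hom C (fobj f a) c \<Longrightarrow> u \<cdot>\<^bsub>X\<^esub> (Idt X y \<otimes>\<^bsub>X\<^esub> lam a m) = \<kappa> a m"
proof -
  have \<kappa>': "\<kappa> a m \<in> Arr X" "Dom X (\<kappa> a m) = y \<odot>\<^bsub>X\<^esub> fobj h a" "Cod X (\<kappa> a m) = d"
    if "a \<in> Obj A" "m \<in> hom C (fobj f a) c" for a m
    using \<kappa>[OF that] by (auto simp: hom_def)
  obtain u where u: "u \<in> hom X (fobj l c \<odot>\<^bsub>X\<^esub> y) d"
    "\<And>a m. a \<in> Obj A \<Longrightarrow> m \<in> hom C (fobj f a) c \<Longrightarrow> u \<cdot>\<^bsub>X\<^esub> (lam a m \<otimes>\<^bsub>X\<^esub> Idt X y) = \<kappa> a m \<cdot>\<^bsub>X\<^esub> Brd X (fobj h a) y"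
  proof (rule lam_tensor_univ_right[OF c y d, of "\<lambda>a m. \<kappa> a m \<cdot>\<^bsub>X\<^esub> Brd X (fobj h a) y"])
    fix a m assume am: "a \<in> Obj A" "m \<in> hom C (fobj f a) c"
    then show "\<kappa> a m \<cdot>\<^bsub>X\<^esub> Brd X (fobj h a) y \<in> hom X (fobj h a \<odot>\<^bsub>X\<^esub> y) d" using \<kappa>'[OF am] y by (simp add: hom_def[of X])
  next
    fix t a a' m assume t: "t \<in> hom A a a'" and m: "m \<in> hom C (fobj f a') c"
    have t': "t \<in> Arr A" "Dom A t = a" "Cod A t = a'" "a \<in> Obj A" "a' \<in> Obj A" using t by (auto simp: hom_def)
    have b: "Brd X (fobj h a') y \<cdot>\<^bsub>X\<^esub> (farr h t \<otimes>\<^bsub>X\<^esub> Idt X y) = (Idt X y \<otimes>\<^bsub>X\<^esub> farr h t) \<cdot>\<^bsub>X\<^esub> Brd X (fobj h a) y"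
      using X.brd_natural_arr[of "farr h t" "Idt X y"] t' y by simp
    have "(\<kappa> a' m \<cdot>\<^bsub>X\<^esub> Brd X (fobj h a') y) \<cdot>\<^bsub>X\<^esub> (farr h t \<otimes>\<^bsub>X\<^esub> Idt X y) =
       (\<kappa> a' m \<cdot>\<^bsub>X\<^esub> (Idt X y \<otimes>\<^bsub>X\<^esub> farr h t)) \<cdot>\<^bsub>X\<^esub> Brd X (fobj h a) y"
      using \<kappa>'[OF t'(5) m] t' y b by simp
    then show "(\<kappa> a' m \<cdot>\<^bsub>X\<^esub> Brd X (fobj h a') y) \<cdot>\<^bsub>X\<^esub> (farr h t \<otimes>\<^bsub>X\<^esub> Idt X y) = \<kappa> a (m \<cdot>\<^bsub>C\<^esub> farr f t) \<cdot>\<^bsub>X\<^esub> Brd X (fobj h a) y"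
      using nat[OF t m] by simp
  qed blast
  have u': "u \<in> Arr X" "Dom X u = fobj l c \<odot>\<^bsub>X\<^esub> y" "Cod X u = d" using u(1) by (auto simp: hom_def)
  show ?thesis
  proof (rule that[of "u \<cdot>\<^bsub>X\<^esub> Brd X y (fobj l c)"])
    show "u \<cdot>\<^bsub>X\<^esub> Brd X y (fobj l c) \<in> hom X (y \<odot>\<^bsub>X\<^esub> fobj l c) d" using u' c y by (simp add: hom_def)
    fix a m assume am: "a \<in> Obj A" "m \<in> hom C (fobj f a) c"
    then have m: "m \<in> Arr C" "Dom C m = fobj f a" "Cod C m = c" by (auto simp: hom_def)
    have b: "Brd X y (fobj l c) \<cdot>\<^bsub>X\<^esub> (Idt X y \<otimes>\<^bsub>X\<^esub> lam a m) = (lam a m \<otimes>\<^bsub>X\<^esub> Idt X y) \<cdot>\<^bsub>X\<^esub> Brd X y (fobj h a)"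
      using X.brd_natural_arr[of "Idt X y" "lam a m"] m am y by simp
    have "(u \<cdot>\<^bsub>X\<^esub> Brd X y (fobj l c)) \<cdot>\<^bsub>X\<^esub> (Idt X y \<otimes>\<^bsub>X\<^esub> lam a m) = (u \<cdot>\<^bsub>X\<^esub> (lam a m \<otimes>\<^bsub>X\<^esub> Idt X y)) \<cdot>\<^bsub>X\<^esub> Brd X y (fobj h a)"
      using u' b m am c y by simp
    also have "\<dots> = \<kappa> a m"
      using u(2)[OF am] \<kappa>'[OF am] am(1) y by (simp add: X.brd_symmetric)
    finally show "(u \<cdot>\<^bsub>X\<^esub> Brd X y (fobj l c)) \<cdot>\<^bsub>X\<^esub> (Idt X y \<otimes>\<^bsub>X\<^esub> lam a m) = \<kappa> a m" .
  qed
qed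

end

section \<open>The monoidal structure of the Kan extension\<close>

locale kan_monoidal = splitting_functor A B K + V: closed_monoidal V + closed_kan A B V K H L \<psi>
  for A :: "('o, 'a, 'z1) smcat_scheme" and B :: "('p, 'b, 'z2) smcat_scheme" and K
    and V :: "('x, 'y, 'z3) smcat_scheme" and H L \<psi> +
  fixes \<mu>H :: "'o \<Rightarrow> 'o \<Rightarrow> 'y" and \<iota>H :: 'y
  assumes strong: "strong_monoidal_functor A V H \<mu>H \<iota>H"
begin

lemma \<mu>H_simps [simp]:
  assumes "x \<in> Obj A" "y \<in> Obj A"
  shows "\<mu>H x y \<in> Arr V" "Dom V (\<mu>H x y) = fobj H x \<odot>\<^bsub>V\<^esub> fobj H y" "Cod V (\<mu>H x y) = fobj H (x \<odot>\<^bsub>A\<^esub> y)"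
    "is_iso V (\<mu>H x y)"
  using strong assms by (auto simp: strong_monoidal_functor_def hom_def)

lemma \<iota>H_simps [simp]:
  "\<iota>H \<in> Arr V" "Dom V \<iota>H = Unt V" "Cod V \<iota>H = fobj H (Unt A)" "is_iso V \<iota>H"
  using strong by (auto simp: strong_monoidal_functor_def hom_def)

lemma \<mu>H_natural:
  "s \<in> Arr A \<Longrightarrow> t \<in> Arr A \<Longrightarrow> \<mu>H (Cod A s) (Cod A t) \<cdot>\<^bsub>V\<^esub> (farr H s \<otimes>\<^bsub>V\<^esub> farr H t) =
    farr H (s \<otimes>\<^bsub>A\<^esub> t) \<cdot>\<^bsub>V\<^esub> \<mu>H (Dom A s) (Dom A t)"
  using strong by (auto simp: strong_monoidal_functor_def)

lemma \<mu>H_coherence: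
  "x \<in> Obj A \<Longrightarrow> y \<in> Obj A \<Longrightarrow> z \<in> Obj A \<Longrightarrow>
    \<mu>H (x \<odot>\<^bsub>A\<^esub> y) z \<cdot>\<^bsub>V\<^esub> (\<mu>H x y \<otimes>\<^bsub>V\<^esub> Idt V (fobj H z)) =
    \<mu>H x (y \<odot>\<^bsub>A\<^esub> z) \<cdot>\<^bsub>V\<^esub> (Idt V (fobj H x) \<otimes>\<^bsub>V\<^esub> \<mu>H y z) \<cdot>\<^bsub>V\<^esub> Asc V (fobj H x) (fobj H y) (fobj H z)"
  "x \<in> Obj A \<Longrightarrow> \<mu>H (Unt A) x \<cdot>\<^bsub>V\<^esub> (\<iota>H \<otimes>\<^bsub>V\<^esub> Idt V (fobj H x)) = Lun V (fobj H x)"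
  "x \<in> Obj A \<Longrightarrow> \<mu>H x (Unt A) \<cdot>\<^bsub>V\<^esub> (Idt V (fobj H x) \<otimes>\<^bsub>V\<^esub> \<iota>H) = Run V (fobj H x)"
  "x \<in> Obj A \<Longrightarrow> y \<in> Obj A \<Longrightarrow> farr H (Brd A x y) \<cdot>\<^bsub>V\<^esub> \<mu>H x y = \<mu>H y x \<cdot>\<^bsub>V\<^esub> Brd V (fobj H x) (fobj H y)"
proof -
  note s = strong[unfolded strong_monoidal_functor_def]
  show "farr H (Brd A x y) \<cdot>\<^bsub>V\<^esub> \<mu>H x y = \<mu>H y x \<cdot>\<^bsub>V\<^esub> Brd V (fobj H x) (fobj H y)" if "x \<in> Obj A" "y \<in> Obj A"
    using s that by blast
  show "\<mu>H (Unt A) x \<cdot>\<^bsub>V\<^esub> (\<iota>H \<otimes>\<^bsub>V\<^esub> Idt V (fobj H x)) = Lun V (fobj H x)" if x: "x \<in> Obj A"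
  proof -
    have "farr H (Lun A x) \<cdot>\<^bsub>V\<^esub> \<mu>H (Unt A) x \<cdot>\<^bsub>V\<^esub> (\<iota>H \<otimes>\<^bsub>V\<^esub> Idt V (fobj H x)) = Lun V (fobj H x)"
      using s x by blast
    then show ?thesis using x by (simp add: A.strict_lun)
  qed
  show "\<mu>H x (Unt A) \<cdot>\<^bsub>V\<^esub> (Idt V (fobj H x) \<otimes>\<^bsub>V\<^esub> \<iota>H) = Run V (fobj H x)" if x: "x \<in> Obj A"
  proof -
    have "farr H (Run A x) \<cdot>\<^bsub>V\<^esub> \<mu>H x (Unt A) \<cdot>\<^bsub>V\<^esub> (Idt V (fobj H x) \<otimes>\<^bsub>V\<^esub> \<iota>H) = Run V (fobj H x)"
      using s x by blast
    then show ?thesis using x by (simp add: A.strict_run)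
  qed
  show "\<mu>H (x \<odot>\<^bsub>A\<^esub> y) z \<cdot>\<^bsub>V\<^esub> (\<mu>H x y \<otimes>\<^bsub>V\<^esub> Idt V (fobj H z)) =
    \<mu>H x (y \<odot>\<^bsub>A\<^esub> z) \<cdot>\<^bsub>V\<^esub> (Idt V (fobj H x) \<otimes>\<^bsub>V\<^esub> \<mu>H y z) \<cdot>\<^bsub>V\<^esub> Asc V (fobj H x) (fobj H y) (fobj H z)"
    if x: "x \<in> Obj A" "y \<in> Obj A" "z \<in> Obj A"
  proof -
    have "farr H (Asc A x y z) \<cdot>\<^bsub>V\<^esub> \<mu>H (x \<odot>\<^bsub>A\<^esub> y) z \<cdot>\<^bsub>V\<^esub> (\<mu>H x y \<otimes>\<^bsub>V\<^esub> Idt V (fobj H z)) =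
      \<mu>H x (y \<odot>\<^bsub>A\<^esub> z) \<cdot>\<^bsub>V\<^esub> (Idt V (fobj H x) \<otimes>\<^bsub>V\<^esub> \<mu>H y z) \<cdot>\<^bsub>V\<^esub> Asc V (fobj H x) (fobj H y) (fobj H z)"
      using s x by blast
    then show ?thesis using x by (simp add: A.strict_asc)
  qed
qed

text \<open>The inverse of \<open>\<mu>H x y\<close>. Strength of \<open>H\<close> enters through it
  in the construction of an inverse of \<open>mu\<close>.\<close>

definition \<nu>H :: "'o \<Rightarrow> 'o \<Rightarrow> 'y" where
  "\<nu>H x y = (SOME g. g \<in> hom V (Cod V (\<mu>H x y)) (Dom V (\<mu>H x y)) \<and>
     g \<cdot>\<^bsub>V\<^esub> \<mu>H x y = Idt V (Dom V (\<mu>H x y)) \<and> \<mu>H x y \<cdot>\<^bsub>V\<^esub> g = Idt V (Cod V (\<mu>H x y)))"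

lemma \<nu>H_simps [simp]:
  assumes "x \<in> Obj A" "y \<in> Obj A"
  shows "\<nu>H x y \<in> Arr V" "Dom V (\<nu>H x y) = fobj H (x \<odot>\<^bsub>A\<^esub> y)" "Cod V (\<nu>H x y) = fobj H x \<odot>\<^bsub>V\<^esub> fobj H y"
    "\<nu>H x y \<cdot>\<^bsub>V\<^esub> \<mu>H x y = Idt V (fobj H x \<odot>\<^bsub>V\<^esub> fobj H y)" "\<mu>H x y \<cdot>\<^bsub>V\<^esub> \<nu>H x y = Idt V (fobj H (x \<odot>\<^bsub>A\<^esub> y))"
proof -
  have "\<exists>g. g \<in> hom V (Cod V (\<mu>H x y)) (Dom V (\<mu>H x y)) \<and>
     g \<cdot>\<^bsub>V\<^esub> \<mu>H x y = Idt V (Dom V (\<mu>H x y)) \<and> \<mu>H x y \<cdot>\<^bsub>V\<^esub> g = Idt V (Cod V (\<mu>H x y))"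
    using \<mu>H_simps(4)[OF assms] unfolding is_iso_def by blast
  from someI_ex[OF this, folded \<nu>H_def] assms
  show "\<nu>H x y \<in> Arr V" "Dom V (\<nu>H x y) = fobj H (x \<odot>\<^bsub>A\<^esub> y)" "Cod V (\<nu>H x y) = fobj H x \<odot>\<^bsub>V\<^esub> fobj H y"
    "\<nu>H x y \<cdot>\<^bsub>V\<^esub> \<mu>H x y = Idt V (fobj H x \<odot>\<^bsub>V\<^esub> fobj H y)" "\<mu>H x y \<cdot>\<^bsub>V\<^esub> \<nu>H x y = Idt V (fobj H (x \<odot>\<^bsub>A\<^esub> y))"
    by (simp_all add: hom_def)
qed

lemma \<nu>H_natural:
  assumes "s \<in> Arr A" "t \<in> Arr A"
  shows "\<nu>H (Cod A s) (Cod A t) \<cdot>\<^bsub>V\<^esub> farr H (s \<otimes>\<^bsub>A\<^esub> t) = (farr H s \<otimes>\<^bsub>V\<^esub> farr H t) \<cdot>\<^bsub>V\<^esub> \<nu>H (Dom A s) (Dom A t)"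
proof -
  let ?d = "\<nu>H (Dom A s) (Dom A t)" and ?c = "\<nu>H (Cod A s) (Cod A t)"
  have "?c \<cdot>\<^bsub>V\<^esub> farr H (s \<otimes>\<^bsub>A\<^esub> t) = ?c \<cdot>\<^bsub>V\<^esub> (farr H (s \<otimes>\<^bsub>A\<^esub> t) \<cdot>\<^bsub>V\<^esub> \<mu>H (Dom A s) (Dom A t)) \<cdot>\<^bsub>V\<^esub> ?d"
    using assms by simp
  also have "\<dots> = ?c \<cdot>\<^bsub>V\<^esub> (\<mu>H (Cod A s) (Cod A t) \<cdot>\<^bsub>V\<^esub> (farr H s \<otimes>\<^bsub>V\<^esub> farr H t)) \<cdot>\<^bsub>V\<^esub> ?d"
    using \<mu>H_natural[OF assms] by simp
  also have "\<dots> = (?c \<cdot>\<^bsub>V\<^esub> \<mu>H (Cod A s) (Cod A t)) \<cdot>\<^bsub>V\<^esub> (farr H s \<otimes>\<^bsub>V\<^esub> farr H t) \<cdot>\<^bsub>V\<^esub> ?d"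
    using assms by (simp del: \<nu>H_simps(4))
  finally show ?thesis using assms by simp
qed

text \<open>The comparison arrow \<open>L y \<otimes> L z \<rightarrow> L (y \<otimes> z)\<close> is obtained from the two colimits \<open>L y\<close> and \<open>L z\<close>,
  which are preserved by the tensor product of the closed category \<^term>\<open>V\<close>.\<close>

lemma mu_exists:
  assumes y: "y \<in> Obj B" and z: "z \<in> Obj B"
  shows "\<exists>u. u \<in> hom V (fobj L y \<odot>\<^bsub>V\<^esub> fobj L z) (fobj L (y \<odot>\<^bsub>B\<^esub> z)) \<and>
    (\<forall>x x' g g'. x \<in> Obj A \<longrightarrow> x' \<in> Obj A \<longrightarrow> g \<in> hom B (fobj K x) y \<longrightarrow> g' \<in> hom B (fobj K x') z \<longrightarrow>
      u \<cdot>\<^bsub>V\<^esub> (lam x g \<otimes>\<^bsub>V\<^esub> lam x' g') = lam (x \<odot>\<^bsub>A\<^esub> x') (g \<otimes>\<^bsub>B\<^esub> g') \<cdot>\<^bsub>V\<^esub> \<mu>H x x')"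
proof -
  let ?d = "fobj L (y \<odot>\<^bsub>B\<^esub> z)"
  have d: "?d \<in> Obj V" using y z by simp
  \<comment> \<open>The colimit at \<open>z\<close> is treated with an index (x, g) of the colimit
    at \<open>y\<close> held fixed. This gives the family \<kappa>, to which the colimit at
    \<open>y\<close> is applied afterwards.\<close>
  have "\<exists>u. u \<in> hom V (fobj H x \<odot>\<^bsub>V\<^esub> fobj L z) ?d \<and> (\<forall>x' g'. x' \<in> Obj A \<longrightarrow> g' \<in> hom B (fobj K x') z \<longrightarrow>
      u \<cdot>\<^bsub>V\<^esub> (Idt V (fobj H x) \<otimes>\<^bsub>V\<^esub> lam x' g') = lam (x \<odot>\<^bsub>A\<^esub> x') (g \<otimes>\<^bsub>B\<^esub> g') \<cdot>\<^bsub>V\<^esub> \<mu>H x x')"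
    if x: "x \<in> Obj A" and g: "g \<in> hom B (fobj K x) y" for x g
  proof (rule lam_tensor_univ_left[OF z _ d, of "fobj H x" "\<lambda>x' g'. lam (x \<odot>\<^bsub>A\<^esub> x') (g \<otimes>\<^bsub>B\<^esub> g') \<cdot>\<^bsub>V\<^esub> \<mu>H x x'"])
    have g': "g \<in> Arr B" "Dom B g = fobj K x" "Cod B g = y" using g by (auto simp: hom_def)
    show "fobj H x \<in> Obj V" using x by simp
    show "lam (x \<odot>\<^bsub>A\<^esub> x') (g \<otimes>\<^bsub>B\<^esub> k) \<cdot>\<^bsub>V\<^esub> \<mu>H x x' \<in> hom V (fobj H x \<odot>\<^bsub>V\<^esub> fobj H x') ?d"
      if "x' \<in> Obj A" "k \<in> hom B (fobj K x') z" for x' k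
      using that x g' by (auto simp: hom_def)
    fix t a a' k assume t: "t \<in> hom A a a'" and k: "k \<in> hom B (fobj K a') z"
    have t': "t \<in> Arr A" "Dom A t = a" "Cod A t = a'" "a \<in> Obj A" "a' \<in> Obj A" using t by (auto simp: hom_def)
    have k': "k \<in> Arr B" "Dom B k = fobj K a'" "Cod B k = z" using k by (auto simp: hom_def)
    have 1: "\<mu>H x a' \<cdot>\<^bsub>V\<^esub> (Idt V (fobj H x) \<otimes>\<^bsub>V\<^esub> farr H t) = farr H (Idt A x \<otimes>\<^bsub>A\<^esub> t) \<cdot>\<^bsub>V\<^esub> \<mu>H x a"
      using \<mu>H_natural[of "Idt A x" t] t' x by simp
    have 2: "lam (x \<odot>\<^bsub>A\<^esub> a') (g \<otimes>\<^bsub>B\<^esub> k) \<cdot>\<^bsub>V\<^esub> farr H (Idt A x \<otimes>\<^bsub>A\<^esub> t) = lam (x \<odot>\<^bsub>A\<^esub> a) (g \<otimes>\<^bsub>B\<^esub> (k \<cdot>\<^bsub>B\<^esub> farr K t))"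
      using lam_pre[of "Idt A x \<otimes>\<^bsub>A\<^esub> t" "g \<otimes>\<^bsub>B\<^esub> k"] t' k' g' x by (simp add: B.interchange)
    have "(lam (x \<odot>\<^bsub>A\<^esub> a') (g \<otimes>\<^bsub>B\<^esub> k) \<cdot>\<^bsub>V\<^esub> \<mu>H x a') \<cdot>\<^bsub>V\<^esub> (Idt V (fobj H x) \<otimes>\<^bsub>V\<^esub> farr H t) =
       (lam (x \<odot>\<^bsub>A\<^esub> a') (g \<otimes>\<^bsub>B\<^esub> k) \<cdot>\<^bsub>V\<^esub> farr H (Idt A x \<otimes>\<^bsub>A\<^esub> t)) \<cdot>\<^bsub>V\<^esub> \<mu>H x a"
      using t' k' g' x 1 by (simp del: functor_simps(6))
    then show "(lam (x \<odot>\<^bsub>A\<^esub> a') (g \<otimes>\<^bsub>B\<^esub> k) \<cdot>\<^bsub>V\<^esub> \<mu>H x a') \<cdot>\<^bsub>V\<^esub> (Idt V (fobj H x) \<otimes>\<^bsub>V\<^esub> farr H t) =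
       lam (x \<odot>\<^bsub>A\<^esub> a) (g \<otimes>\<^bsub>B\<^esub> (k \<cdot>\<^bsub>B\<^esub> farr K t)) \<cdot>\<^bsub>V\<^esub> \<mu>H x a"
      by (simp only: 2)
  qed blast
  then obtain \<kappa> where \<kappa>: "\<And>x g. x \<in> Obj A \<Longrightarrow> g \<in> hom B (fobj K x) y \<Longrightarrow> \<kappa> x g \<in> hom V (fobj H x \<odot>\<^bsub>V\<^esub> fobj L z) ?d"
    "\<And>x g x' g'. x \<in> Obj A \<Longrightarrow> g \<in> hom B (fobj K x) y \<Longrightarrow> x' \<in> Obj A \<Longrightarrow> g' \<in> hom B (fobj K x') z \<Longrightarrow>
      \<kappa> x g \<cdot>\<^bsub>V\<^esub> (Idt V (fobj H x) \<otimes>\<^bsub>V\<^esub> lam x' g') = lam (x \<odot>\<^bsub>A\<^esub> x') (g \<otimes>\<^bsub>B\<^esub> g') \<cdot>\<^bsub>V\<^esub> \<mu>H x x'"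
    by metis
  have \<kappa>': "\<kappa> x g \<in> Arr V" "Dom V (\<kappa> x g) = fobj H x \<odot>\<^bsub>V\<^esub> fobj L z" "Cod V (\<kappa> x g) = ?d"
    if "x \<in> Obj A" "g \<in> hom B (fobj K x) y" for x g
    using \<kappa>(1)[OF that] by (auto simp: hom_def)
  obtain u where u: "u \<in> hom V (fobj L y \<odot>\<^bsub>V\<^esub> fobj L z) ?d"
    "\<And>a m. a \<in> Obj A \<Longrightarrow> m \<in> hom B (fobj K a) y \<Longrightarrow> u \<cdot>\<^bsub>V\<^esub> (lam a m \<otimes>\<^bsub>V\<^esub> Idt V (fobj L z)) = \<kappa> a m"
  proof (rule lam_tensor_univ_right[OF y _ d \<kappa>(1)])
    show "fobj L z \<in> Obj V" using z by simp
    fix t a a' m assume t: "t \<in> hom A a a'" and m: "m \<in> hom B (fobj K a') y"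
    have t': "t \<in> Arr A" "Dom A t = a" "Cod A t = a'" "a \<in> Obj A" "a' \<in> Obj A" using t by (auto simp: hom_def)
    have m': "m \<in> Arr B" "Dom B m = fobj K a'" "Cod B m = y" using m by (auto simp: hom_def)
    have mt: "m \<cdot>\<^bsub>B\<^esub> farr K t \<in> hom B (fobj K a) y" using m' t' by (auto simp: hom_def)
    have Ha: "fobj H a \<in> Obj V" using t' by simp
    \<comment> \<open>Naturality of \<kappa> in the index of the colimit at \<open>y\<close> is an
      equation between arrows out of \<open>fobj H a \<odot> fobj L z\<close>, tested on the
      coprojections at \<open>z\<close>.\<close>
    show "\<kappa> a' m \<cdot>\<^bsub>V\<^esub> (farr H t \<otimes>\<^bsub>V\<^esub> Idt V (fobj L z)) = \<kappa> a (m \<cdot>\<^bsub>B\<^esub> farr K t)"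
    proof (rule jointly_epiD[OF V.jointly_epi_tensor_left[OF jointly_epi_lam[OF z] Ha]])
      show "\<kappa> a' m \<cdot>\<^bsub>V\<^esub> (farr H t \<otimes>\<^bsub>V\<^esub> Idt V (fobj L z)) \<in> hom V (fobj H a \<odot>\<^bsub>V\<^esub> fobj L z) ?d"
        using \<kappa>'[OF t'(5) m] t' z by (simp add: hom_def)
      show "\<kappa> a (m \<cdot>\<^bsub>B\<^esub> farr K t) \<in> hom V (fobj H a \<odot>\<^bsub>V\<^esub> fobj L z) ?d" by (rule \<kappa>(1)[OF t'(4) mt])
      fix k assume "k \<in> (\<lambda>f. Idt V (fobj H a) \<otimes>\<^bsub>V\<^esub> f) ` {lam a m | a m. a \<in> Obj A \<and> m \<in> hom B (fobj K a) z}"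
      then obtain x' g' where k: "k = Idt V (fobj H a) \<otimes>\<^bsub>V\<^esub> lam x' g'" and x': "x' \<in> Obj A" and g: "g' \<in> hom B (fobj K x') z"
        by auto
      have g': "g' \<in> Arr B" "Dom B g' = fobj K x'" "Cod B g' = z" using g by (auto simp: hom_def)
      have 1: "\<mu>H a' x' \<cdot>\<^bsub>V\<^esub> (farr H t \<otimes>\<^bsub>V\<^esub> Idt V (fobj H x')) = farr H (t \<otimes>\<^bsub>A\<^esub> Idt A x') \<cdot>\<^bsub>V\<^esub> \<mu>H a x'"
        using \<mu>H_natural[of t "Idt A x'"] t' x' by simp
      have 2: "lam (a' \<odot>\<^bsub>A\<^esub> x') (m \<otimes>\<^bsub>B\<^esub> g') \<cdot>\<^bsub>V\<^esub> farr H (t \<otimes>\<^bsub>A\<^esub> Idt A x') = lam (a \<odot>\<^bsub>A\<^esub> x') ((m \<cdot>\<^bsub>B\<^esub> farr K t) \<otimes>\<^bsub>B\<^esub> g')"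
        using lam_pre[of "t \<otimes>\<^bsub>A\<^esub> Idt A x'" "m \<otimes>\<^bsub>B\<^esub> g'"] t' m' g' x' by (simp add: B.interchange)
      have "(\<kappa> a' m \<cdot>\<^bsub>V\<^esub> (farr H t \<otimes>\<^bsub>V\<^esub> Idt V (fobj L z))) \<cdot>\<^bsub>V\<^esub> k =
          (\<kappa> a' m \<cdot>\<^bsub>V\<^esub> (Idt V (fobj H a') \<otimes>\<^bsub>V\<^esub> lam x' g')) \<cdot>\<^bsub>V\<^esub> (farr H t \<otimes>\<^bsub>V\<^esub> Idt V (fobj H x'))"
        using \<kappa>'[OF t'(5) m] t' z x' g' by (simp add: k V.interchange)
      also have "\<dots> = lam (a' \<odot>\<^bsub>A\<^esub> x') (m \<otimes>\<^bsub>B\<^esub> g') \<cdot>\<^bsub>V\<^esub> (\<mu>H a' x' \<cdot>\<^bsub>V\<^esub> (farr H t \<otimes>\<^bsub>V\<^esub> Idt V (fobj H x')))"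
        unfolding \<kappa>(2)[OF t'(5) m x' g] using t' m' g' x' by simp
      also have "\<dots> = (lam (a' \<odot>\<^bsub>A\<^esub> x') (m \<otimes>\<^bsub>B\<^esub> g') \<cdot>\<^bsub>V\<^esub> farr H (t \<otimes>\<^bsub>A\<^esub> Idt A x')) \<cdot>\<^bsub>V\<^esub> \<mu>H a x'"
        unfolding 1 using t' m' g' x' by simp
      finally show "(\<kappa> a' m \<cdot>\<^bsub>V\<^esub> (farr H t \<otimes>\<^bsub>V\<^esub> Idt V (fobj L z))) \<cdot>\<^bsub>V\<^esub> k = \<kappa> a (m \<cdot>\<^bsub>B\<^esub> farr K t) \<cdot>\<^bsub>V\<^esub> k"
        unfolding 2 k \<kappa>(2)[OF t'(4) mt x' g] .
    qed
  qed (assumption+, (rule that; blast))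
  have u': "u \<in> Arr V" "Dom V u = fobj L y \<odot>\<^bsub>V\<^esub> fobj L z" "Cod V u = ?d" using u(1) by (auto simp: hom_def)
  show ?thesis
  proof (intro exI[of _ u] conjI u(1) allI impI)
    fix x x' g g' assume x: "x \<in> Obj A" "x' \<in> Obj A" and g: "g \<in> hom B (fobj K x) y" "g' \<in> hom B (fobj K x') z"
    have g': "g \<in> Arr B" "Dom B g = fobj K x" "Cod B g = y" "g' \<in> Arr B" "Dom B g' = fobj K x'" "Cod B g' = z"
      using g by (auto simp: hom_def)
    have "u \<cdot>\<^bsub>V\<^esub> (lam x g \<otimes>\<^bsub>V\<^esub> lam x' g') = (u \<cdot>\<^bsub>V\<^esub> (lam x g \<otimes>\<^bsub>V\<^esub> Idt V (fobj L z))) \<cdot>\<^bsub>V\<^esub> (Idt V (fobj H x) \<otimes>\<^bsub>V\<^esub> lam x' g')"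
      using x g' u' z y by (simp add: V.interchange)
    then show "u \<cdot>\<^bsub>V\<^esub> (lam x g \<otimes>\<^bsub>V\<^esub> lam x' g') = lam (x \<odot>\<^bsub>A\<^esub> x') (g \<otimes>\<^bsub>B\<^esub> g') \<cdot>\<^bsub>V\<^esub> \<mu>H x x'"
      unfolding u(2)[OF x(1) g(1)] \<kappa>(2)[OF x(1) g(1) x(2) g(2)] .
  qed
qed

definition mu :: "'p \<Rightarrow> 'p \<Rightarrow> 'y" where
  "mu y z = (SOME u. u \<in> hom V (fobj L y \<odot>\<^bsub>V\<^esub> fobj L z) (fobj L (y \<odot>\<^bsub>B\<^esub> z)) \<and>
    (\<forall>x x' g g'. x \<in> Obj A \<longrightarrow> x' \<in> Obj A \<longrightarrow> g \<in> hom B (fobj K x) y \<longrightarrow> g' \<in> hom B (fobj K x') z \<longrightarrow>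
      u \<cdot>\<^bsub>V\<^esub> (lam x g \<otimes>\<^bsub>V\<^esub> lam x' g') = lam (x \<odot>\<^bsub>A\<^esub> x') (g \<otimes>\<^bsub>B\<^esub> g') \<cdot>\<^bsub>V\<^esub> \<mu>H x x'))"

lemma mu_simps [simp]:
  assumes "y \<in> Obj B" "z \<in> Obj B"
  shows "mu y z \<in> Arr V" "Dom V (mu y z) = fobj L y \<odot>\<^bsub>V\<^esub> fobj L z" "Cod V (mu y z) = fobj L (y \<odot>\<^bsub>B\<^esub> z)"
  using someI_ex[OF mu_exists[OF assms], folded mu_def] by (auto simp: hom_def)

lemma mu_lam:
  assumes "x \<in> Obj A" "x' \<in> Obj A" "g \<in> Arr B" "Dom B g = fobj K x" "g' \<in> Arr B" "Dom B g' = fobj K x'"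
  shows "mu (Cod B g) (Cod B g') \<cdot>\<^bsub>V\<^esub> (lam x g \<otimes>\<^bsub>V\<^esub> lam x' g') = lam (x \<odot>\<^bsub>A\<^esub> x') (g \<otimes>\<^bsub>B\<^esub> g') \<cdot>\<^bsub>V\<^esub> \<mu>H x x'"
  using someI_ex[OF mu_exists[of "Cod B g" "Cod B g'"], folded mu_def] assms by (auto simp: hom_def)

text \<open>With it, equations between arrows out of a binary tensor product of values of
  \<open>L\<close>, such as naturality of \<open>mu\<close>, are checked on tensor products of
  coprojections, where \<open>mu_lam\<close> computes.\<close>

lemma jointly_epi_lam_tensor:
  assumes "y \<in> Obj B" "z \<in> Obj B" "u \<in> hom V (fobj L y \<odot>\<^bsub>V\<^esub> fobj L z) d" "v \<in> hom V (fobj L y \<odot>\<^bsub>V\<^esub> fobj L z) d"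
    "\<And>x x' g g'. x \<in> Obj A \<Longrightarrow> x' \<in> Obj A \<Longrightarrow> g \<in> Arr B \<Longrightarrow> Dom B g = fobj K x \<Longrightarrow> Cod B g = y \<Longrightarrow>
       g' \<in> Arr B \<Longrightarrow> Dom B g' = fobj K x' \<Longrightarrow> Cod B g' = z \<Longrightarrow>
       u \<cdot>\<^bsub>V\<^esub> (lam x g \<otimes>\<^bsub>V\<^esub> lam x' g') = v \<cdot>\<^bsub>V\<^esub> (lam x g \<otimes>\<^bsub>V\<^esub> lam x' g')"
  shows "u = v"
proof (rule jointly_epiD[OF V.jointly_epi_tensor[OF jointly_epi_lam[OF assms(1)] jointly_epi_lam[OF assms(2)]] assms(3,4)])
  fix k assume "k \<in> {f \<otimes>\<^bsub>V\<^esub> f' | f f'. f \<in> {lam a m | a m. a \<in> Obj A \<and> m \<in> hom B (fobj K a) y} \<and>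
      f' \<in> {lam a m | a m. a \<in> Obj A \<and> m \<in> hom B (fobj K a) z}}"
  then obtain x g x' g' where "k = lam x g \<otimes>\<^bsub>V\<^esub> lam x' g'" "x \<in> Obj A" "g \<in> hom B (fobj K x) y" "x' \<in> Obj A" "g' \<in> hom B (fobj K x') z"
    by auto
  then show "u \<cdot>\<^bsub>V\<^esub> k = v \<cdot>\<^bsub>V\<^esub> k" using assms(5)[of x x' g g'] by (auto simp: hom_def)
qed

text \<open>The inverse \<open>v\<close> is defined on the colimit at \<open>y \<otimes> z\<close>.
  At (a, m), a factorisation of m as \<open>g \<otimes> g'\<close> after the image of t is used: the
  value is \<open>H\<close> applied to t, followed by the inverse of \<mu>H and the tensor product
  of the coprojections at g and g'. By \<open>split_tensor\<close> one factorisation maps to all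
  others, so the value does not depend on the choice.\<close>

lemma mu_iso:
  assumes y: "y \<in> Obj B" and z: "z \<in> Obj B"
  shows "is_iso V (mu y z)"
proof -
  let ?c = "y \<odot>\<^bsub>B\<^esub> z" and ?d = "fobj L y \<odot>\<^bsub>V\<^esub> fobj L z"
  have c: "?c \<in> Obj B" and d: "?d \<in> Obj V" using y z by simp_all
  \<comment> \<open>p is the value of the cocone at (a, m) obtained from some factorisation of
    m.\<close>
  define P where "P a m p \<longleftrightarrow> (\<exists>x x' g g' t. x \<in> Obj A \<and> x' \<in> Obj A \<and> g \<in> hom B (fobj K x) y \<and> g' \<in> hom B (fobj K x') z \<and>
     t \<in> hom A a (x \<odot>\<^bsub>A\<^esub> x') \<and> (g \<otimes>\<^bsub>B\<^esub> g') \<cdot>\<^bsub>B\<^esub> farr K t = m \<and> p = (lam x g \<otimes>\<^bsub>V\<^esub> lam x' g') \<cdot>\<^bsub>V\<^esub> \<nu>H x x' \<cdot>\<^bsub>V\<^esub> farr H t)" for a m p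
  have ex: "\<exists>!p. P a m p" if a: "a \<in> Obj A" and m: "m \<in> hom B (fobj K a) ?c" for a m
  proof -
    obtain x x' s g g' where x: "x \<in> Obj A" "x' \<in> Obj A" and s: "s \<in> hom A a (x \<odot>\<^bsub>A\<^esub> x')"
      and g: "g \<in> hom B (fobj K x) y" "g' \<in> hom B (fobj K x') z" "(g \<otimes>\<^bsub>B\<^esub> g') \<cdot>\<^bsub>B\<^esub> farr K s = m"
      and univ: "\<forall>x1 \<in> Obj A. \<forall>x1' \<in> Obj A. \<forall>t \<in> hom A a (x1 \<odot>\<^bsub>A\<^esub> x1').
          \<forall>h \<in> hom B (fobj K x1) y. \<forall>h' \<in> hom B (fobj K x1') z. (h \<otimes>\<^bsub>B\<^esub> h') \<cdot>\<^bsub>B\<^esub> farr K t = m \<longrightarrow>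
            (\<exists>t1 \<in> hom A x x1. \<exists>t2 \<in> hom A x' x1'. t = (t1 \<otimes>\<^bsub>A\<^esub> t2) \<cdot>\<^bsub>A\<^esub> s \<and>
              h \<cdot>\<^bsub>B\<^esub> farr K t1 = g \<and> h' \<cdot>\<^bsub>B\<^esub> farr K t2 = g')"
      using split_tensor[OF a y z m] by blast
    have s': "s \<in> Arr A" "Dom A s = a" "Cod A s = x \<odot>\<^bsub>A\<^esub> x'" using s by (auto simp: hom_def)
    show ?thesis
    proof (rule ex1I)
      show "P a m ((lam x g \<otimes>\<^bsub>V\<^esub> lam x' g') \<cdot>\<^bsub>V\<^esub> \<nu>H x x' \<cdot>\<^bsub>V\<^esub> farr H s)"
        unfolding P_def using x s g by blast
      fix p assume "P a m p"
      then obtain x1 x1' h h' t where q: "x1 \<in> Obj A" "x1' \<in> Obj A" "h \<in> hom B (fobj K x1) y" "h' \<in> hom B (fobj K x1') z"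
        "t \<in> hom A a (x1 \<odot>\<^bsub>A\<^esub> x1')" "(h \<otimes>\<^bsub>B\<^esub> h') \<cdot>\<^bsub>B\<^esub> farr K t = m" and p: "p = (lam x1 h \<otimes>\<^bsub>V\<^esub> lam x1' h') \<cdot>\<^bsub>V\<^esub> \<nu>H x1 x1' \<cdot>\<^bsub>V\<^esub> farr H t"
        unfolding P_def by blast
      obtain t1 t2 where t: "t1 \<in> hom A x x1" "t2 \<in> hom A x' x1'" "t = (t1 \<otimes>\<^bsub>A\<^esub> t2) \<cdot>\<^bsub>A\<^esub> s"
        "h \<cdot>\<^bsub>B\<^esub> farr K t1 = g" "h' \<cdot>\<^bsub>B\<^esub> farr K t2 = g'"
        using univ q by blast
      have t': "t1 \<in> Arr A" "Dom A t1 = x" "Cod A t1 = x1" "t2 \<in> Arr A" "Dom A t2 = x'" "Cod A t2 = x1'"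
        "h \<in> Arr B" "Dom B h = fobj K x1" "h' \<in> Arr B" "Dom B h' = fobj K x1'"
        using t q by (auto simp: hom_def)
      have n: "\<nu>H x1 x1' \<cdot>\<^bsub>V\<^esub> farr H (t1 \<otimes>\<^bsub>A\<^esub> t2) = (farr H t1 \<otimes>\<^bsub>V\<^esub> farr H t2) \<cdot>\<^bsub>V\<^esub> \<nu>H x x'"
        using \<nu>H_natural[of t1 t2] t' by simp
      have e: "lam x1 h \<cdot>\<^bsub>V\<^esub> farr H t1 = lam x g" "lam x1' h' \<cdot>\<^bsub>V\<^esub> farr H t2 = lam x' g'"
        using lam_pre[of t1 h] lam_pre[of t2 h'] t' t(4,5) by simp_all
      have "p = (lam x1 h \<otimes>\<^bsub>V\<^esub> lam x1' h') \<cdot>\<^bsub>V\<^esub> (\<nu>H x1 x1' \<cdot>\<^bsub>V\<^esub> farr H (t1 \<otimes>\<^bsub>A\<^esub> t2)) \<cdot>\<^bsub>V\<^esub> farr H s"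
        using t' s' q(1,2) x by (simp add: p t(3))
      also have "\<dots> = ((lam x1 h \<otimes>\<^bsub>V\<^esub> lam x1' h') \<cdot>\<^bsub>V\<^esub> (farr H t1 \<otimes>\<^bsub>V\<^esub> farr H t2)) \<cdot>\<^bsub>V\<^esub> \<nu>H x x' \<cdot>\<^bsub>V\<^esub> farr H s"
        unfolding n using t' s' q(1,2) x by simp
      also have "\<dots> = (lam x g \<otimes>\<^bsub>V\<^esub> lam x' g') \<cdot>\<^bsub>V\<^esub> \<nu>H x x' \<cdot>\<^bsub>V\<^esub> farr H s"
        using t' q(1,2) e by (simp add: V.interchange)
      finally show "p = (lam x g \<otimes>\<^bsub>V\<^esub> lam x' g') \<cdot>\<^bsub>V\<^esub> \<nu>H x x' \<cdot>\<^bsub>V\<^esub> farr H s" .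
    qed
  qed
  define \<kappa> where "\<kappa> a m = (THE p. P a m p)" for a m
  have \<kappa>: "P a m (\<kappa> a m)" if "a \<in> Obj A" "m \<in> hom B (fobj K a) ?c" for a m
    unfolding \<kappa>_def by (rule theI'[OF ex[OF that]])
  have \<kappa>_eq: "\<kappa> a m = p" if "a \<in> Obj A" "m \<in> hom B (fobj K a) ?c" "P a m p" for a m p
    using ex[OF that(1,2)] \<kappa>[OF that(1,2)] that(3) by blast
  obtain v where v: "v \<in> hom V (fobj L ?c) ?d" "\<And>a m. a \<in> Obj A \<Longrightarrow> m \<in> hom B (fobj K a) ?c \<Longrightarrow> v \<cdot>\<^bsub>V\<^esub> lam a m = \<kappa> a m"
  proof (rule lam_univ[OF c d])
    fix a m assume am: "a \<in> Obj A" "m \<in> hom B (fobj K a) ?c"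
    from \<kappa>[OF am] show "\<kappa> a m \<in> hom V (fobj H a) ?d"
      unfolding P_def by (elim exE conjE) (simp add: hom_def)
  next
    fix t a a' m assume t: "t \<in> hom A a a'" and m: "m \<in> hom B (fobj K a') ?c"
    have t': "t \<in> Arr A" "Dom A t = a" "Cod A t = a'" "a \<in> Obj A" "a' \<in> Obj A" using t by (auto simp: hom_def)
    have mt: "m \<cdot>\<^bsub>B\<^esub> farr K t \<in> hom B (fobj K a) ?c" using m t' by (auto simp: hom_def)
    from \<kappa>[OF t'(5) m] obtain x x' g g' s where q: "x \<in> Obj A" "x' \<in> Obj A" "g \<in> hom B (fobj K x) y" "g' \<in> hom B (fobj K x') z"
      "s \<in> hom A a' (x \<odot>\<^bsub>A\<^esub> x')" "(g \<otimes>\<^bsub>B\<^esub> g') \<cdot>\<^bsub>B\<^esub> farr K s = m" and p: "\<kappa> a' m = (lam x g \<otimes>\<^bsub>V\<^esub> lam x' g') \<cdot>\<^bsub>V\<^esub> \<nu>H x x' \<cdot>\<^bsub>V\<^esub> farr H s"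
      unfolding P_def by blast
    have q': "s \<in> Arr A" "Dom A s = a'" "Cod A s = x \<odot>\<^bsub>A\<^esub> x'" "g \<in> Arr B" "Dom B g = fobj K x" "g' \<in> Arr B" "Dom B g' = fobj K x'"
      using q by (auto simp: hom_def)
    have st: "s \<cdot>\<^bsub>A\<^esub> t \<in> hom A a (x \<odot>\<^bsub>A\<^esub> x')" using q' t' by (simp add: hom_def)
    have mst: "(g \<otimes>\<^bsub>B\<^esub> g') \<cdot>\<^bsub>B\<^esub> farr K (s \<cdot>\<^bsub>A\<^esub> t) = m \<cdot>\<^bsub>B\<^esub> farr K t" using q' t' q(1,2) by (simp flip: q(6))
    have "P a (m \<cdot>\<^bsub>B\<^esub> farr K t) ((lam x g \<otimes>\<^bsub>V\<^esub> lam x' g') \<cdot>\<^bsub>V\<^esub> \<nu>H x x' \<cdot>\<^bsub>V\<^esub> farr H (s \<cdot>\<^bsub>A\<^esub> t))"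
      unfolding P_def using q(1-4) st mst by blast
    from \<kappa>_eq[OF t'(4) mt this] show "\<kappa> a' m \<cdot>\<^bsub>V\<^esub> farr H t = \<kappa> a (m \<cdot>\<^bsub>B\<^esub> farr K t)"
      using q' t' q(1,2) by (simp add: p)
  qed (rule that; blast)
  have v': "v \<in> Arr V" "Dom V v = fobj L ?c" "Cod V v = ?d" using v(1) by (auto simp: hom_def)
  have mv: "mu y z \<cdot>\<^bsub>V\<^esub> v = Idt V (fobj L ?c)"
  proof (rule lam_epi[OF c])
    show "mu y z \<cdot>\<^bsub>V\<^esub> v \<in> hom V (fobj L ?c) (fobj L ?c)" "Idt V (fobj L ?c) \<in> hom V (fobj L ?c) (fobj L ?c)"
      using v' y z by (simp_all add: hom_def)
    fix a m assume a: "a \<in> Obj A" and m: "m \<in> hom B (fobj K a) ?c"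
    from \<kappa>[OF a m] obtain x x' g g' s where q: "x \<in> Obj A" "x' \<in> Obj A" "g \<in> hom B (fobj K x) y" "g' \<in> hom B (fobj K x') z"
      "s \<in> hom A a (x \<odot>\<^bsub>A\<^esub> x')" "(g \<otimes>\<^bsub>B\<^esub> g') \<cdot>\<^bsub>B\<^esub> farr K s = m" and p: "\<kappa> a m = (lam x g \<otimes>\<^bsub>V\<^esub> lam x' g') \<cdot>\<^bsub>V\<^esub> \<nu>H x x' \<cdot>\<^bsub>V\<^esub> farr H s"
      unfolding P_def by blast
    have q': "s \<in> Arr A" "Dom A s = a" "Cod A s = x \<odot>\<^bsub>A\<^esub> x'" "g \<in> Arr B" "Dom B g = fobj K x" "Cod B g = y" "g' \<in> Arr B" "Dom B g' = fobj K x'" "Cod B g' = z"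
      "m \<in> Arr B" "Dom B m = fobj K a" "Cod B m = ?c"
      using q m by (auto simp: hom_def)
    have "(mu y z \<cdot>\<^bsub>V\<^esub> v) \<cdot>\<^bsub>V\<^esub> lam a m = (mu y z \<cdot>\<^bsub>V\<^esub> (lam x g \<otimes>\<^bsub>V\<^esub> lam x' g')) \<cdot>\<^bsub>V\<^esub> \<nu>H x x' \<cdot>\<^bsub>V\<^esub> farr H s"
      using v(2)[OF a m] v' y z q' a q(1,2) by (simp add: p)
    also have "\<dots> = lam (x \<odot>\<^bsub>A\<^esub> x') (g \<otimes>\<^bsub>B\<^esub> g') \<cdot>\<^bsub>V\<^esub> (\<mu>H x x' \<cdot>\<^bsub>V\<^esub> \<nu>H x x') \<cdot>\<^bsub>V\<^esub> farr H s"
      using mu_lam[of x x' g g'] q' q(1,2) by (simp del: \<nu>H_simps(5))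
    also have "\<dots> = lam a m" using lam_pre[of s "g \<otimes>\<^bsub>B\<^esub> g'"] q' q(1,2,6) by simp
    finally show "(mu y z \<cdot>\<^bsub>V\<^esub> v) \<cdot>\<^bsub>V\<^esub> lam a m = Idt V (fobj L ?c) \<cdot>\<^bsub>V\<^esub> lam a m" using a q' by simp
  qed
  have vm: "v \<cdot>\<^bsub>V\<^esub> mu y z = Idt V ?d"
  proof (rule jointly_epi_lam_tensor[OF y z])
    show "v \<cdot>\<^bsub>V\<^esub> mu y z \<in> hom V ?d ?d" "Idt V ?d \<in> hom V ?d ?d" using v' y z by (simp_all add: hom_def)
    fix x x' g g' assume q: "x \<in> Obj A" "x' \<in> Obj A" "g \<in> Arr B" "Dom B g = fobj K x" "Cod B g = y"
       "g' \<in> Arr B" "Dom B g' = fobj K x'" "Cod B g' = z"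
    let ?x = "x \<odot>\<^bsub>A\<^esub> x'"
    have x: "?x \<in> Obj A" and gg: "g \<otimes>\<^bsub>B\<^esub> g' \<in> hom B (fobj K ?x) ?c" using q by (simp_all add: hom_def)
    \<comment> \<open>At a tensor product of arrows the factorisation with an identity in front may
      be used.\<close>
    have "P ?x (g \<otimes>\<^bsub>B\<^esub> g') ((lam x g \<otimes>\<^bsub>V\<^esub> lam x' g') \<cdot>\<^bsub>V\<^esub> \<nu>H x x' \<cdot>\<^bsub>V\<^esub> farr H (Idt A ?x))"
      unfolding P_def
      by (rule exI[of _ x], rule exI[of _ x'], rule exI[of _ g], rule exI[of _ g'], rule exI[of _ "Idt A ?x"]) (use q in \<open>simp add: hom_def\<close>)
    from \<kappa>_eq[OF x gg this] have k: "\<kappa> ?x (g \<otimes>\<^bsub>B\<^esub> g') = (lam x g \<otimes>\<^bsub>V\<^esub> lam x' g') \<cdot>\<^bsub>V\<^esub> \<nu>H x x'" using q by simp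
    have "(v \<cdot>\<^bsub>V\<^esub> mu y z) \<cdot>\<^bsub>V\<^esub> (lam x g \<otimes>\<^bsub>V\<^esub> lam x' g') = v \<cdot>\<^bsub>V\<^esub> lam ?x (g \<otimes>\<^bsub>B\<^esub> g') \<cdot>\<^bsub>V\<^esub> \<mu>H x x'"
      using v' y z q mu_lam[of x x' g g'] by simp
    also have "\<dots> = (v \<cdot>\<^bsub>V\<^esub> lam ?x (g \<otimes>\<^bsub>B\<^esub> g')) \<cdot>\<^bsub>V\<^esub> \<mu>H x x'" using v' q by simp
    also have "\<dots> = lam x g \<otimes>\<^bsub>V\<^esub> lam x' g'" unfolding v(2)[OF x gg] k using q by simp
    finally show "(v \<cdot>\<^bsub>V\<^esub> mu y z) \<cdot>\<^bsub>V\<^esub> (lam x g \<otimes>\<^bsub>V\<^esub> lam x' g') = Idt V ?d \<cdot>\<^bsub>V\<^esub> (lam x g \<otimes>\<^bsub>V\<^esub> lam x' g')" using q by simp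
  qed
  show ?thesis
    unfolding is_iso_def using mv vm v(1) y z by (auto intro!: bexI[of _ v])
qed

definition iota :: 'y where
  "iota = \<psi> (Unt A) \<cdot>\<^bsub>V\<^esub> \<iota>H"

lemma iota_simps [simp]: "iota \<in> Arr V" "Dom V iota = Unt V" "Cod V iota = fobj L (Unt B)"
  by (simp_all add: iota_def)

text \<open>By \<open>split_unit\<close> and \<open>arr_unit\<close> the comma category over the
  unit has a single object and only its identity arrow. Hence the value of \<open>L\<close> at the
  unit is that of \<open>H\<close>, and \<psi> is invertible there.\<close>

lemma iota_iso: "is_iso V iota"
proof -
  let ?I = "fobj H (Unt A)"
  have "\<exists>r. r \<in> hom V (fobj L (Unt B)) ?I \<and> (\<forall>a m. a \<in> Obj A \<longrightarrow> m \<in> hom B (fobj K a) (Unt B) \<longrightarrow> r \<cdot>\<^bsub>V\<^esub> lam a m = Idt V ?I)"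
  proof (rule lam_univ[of "Unt B" ?I "\<lambda>a m. Idt V ?I"])
    show "Idt V ?I \<in> hom V (fobj H a) ?I" if "a \<in> Obj A" "m \<in> hom B (fobj K a) (Unt B)" for a m
      using split_unit[OF that] by (simp add: hom_def)
    fix t a a' m assume t: "t \<in> hom A a a'" and m: "m \<in> hom B (fobj K a') (Unt B)"
    have t': "t \<in> Arr A" "Dom A t = a" "Cod A t = a'" "a \<in> Obj A" "a' \<in> Obj A" using t by (auto simp: hom_def)
    have "m \<cdot>\<^bsub>B\<^esub> farr K t \<in> hom B (fobj K a) (Unt B)" using m t' by (auto simp: hom_def)
    then have "a = Unt A" "a' = Unt A" using split_unit t' m by blast+
    then have "t = Idt A (Unt A)" using arr_unit t by simp
    then show "Idt V ?I \<cdot>\<^bsub>V\<^esub> farr H t = Idt V ?I" by simp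
  qed (simp_all, blast)
  then obtain r where r: "r \<in> Arr V" "Dom V r = fobj L (Unt B)" "Cod V r = ?I"
    "\<And>a m. a \<in> Obj A \<Longrightarrow> m \<in> hom B (fobj K a) (Unt B) \<Longrightarrow> r \<cdot>\<^bsub>V\<^esub> lam a m = Idt V ?I"
    by (auto simp: hom_def[of V])
  have r\<psi>: "r \<cdot>\<^bsub>V\<^esub> \<psi> (Unt A) = Idt V ?I"
    using r(4)[of "Unt A" "Idt B (Unt B)"] lam_id[of "Unt A"] by (simp add: hom_def)
  have \<psi>r: "\<psi> (Unt A) \<cdot>\<^bsub>V\<^esub> r = Idt V (fobj L (Unt B))"
  proof (rule lam_epi[of "Unt B"])
    show "\<psi> (Unt A) \<cdot>\<^bsub>V\<^esub> r \<in> hom V (fobj L (Unt B)) (fobj L (Unt B))" "Idt V (fobj L (Unt B)) \<in> hom V (fobj L (Unt B)) (fobj L (Unt B))"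
      using r by (simp_all add: hom_def)
    fix a m assume a: "a \<in> Obj A" and m: "m \<in> hom B (fobj K a) (Unt B)"
    have "a = Unt A" "m = Idt B (Unt B)" using split_unit[OF a m] by auto
    then have "lam a m = \<psi> (Unt A)" using lam_id[of "Unt A"] by simp
    then show "(\<psi> (Unt A) \<cdot>\<^bsub>V\<^esub> r) \<cdot>\<^bsub>V\<^esub> lam a m = Idt V (fobj L (Unt B)) \<cdot>\<^bsub>V\<^esub> lam a m"
      using r(1-3) r\<psi> by simp
  qed simp
  obtain i where i: "i \<in> hom V (Cod V \<iota>H) (Dom V \<iota>H)" "i \<cdot>\<^bsub>V\<^esub> \<iota>H = Idt V (Dom V \<iota>H)" "\<iota>H \<cdot>\<^bsub>V\<^esub> i = Idt V (Cod V \<iota>H)"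
    using V.is_isoE[OF \<iota>H_simps(4)] .
  have i': "i \<in> Arr V" "Dom V i = ?I" "Cod V i = Unt V" using i(1) by (auto simp: hom_def)
  have "(i \<cdot>\<^bsub>V\<^esub> r) \<cdot>\<^bsub>V\<^esub> iota = i \<cdot>\<^bsub>V\<^esub> (r \<cdot>\<^bsub>V\<^esub> \<psi> (Unt A)) \<cdot>\<^bsub>V\<^esub> \<iota>H"
    using r i' by (simp add: iota_def)
  then have 1: "(i \<cdot>\<^bsub>V\<^esub> r) \<cdot>\<^bsub>V\<^esub> iota = Idt V (Unt V)" using r\<psi> i(2) by simp
  have "iota \<cdot>\<^bsub>V\<^esub> (i \<cdot>\<^bsub>V\<^esub> r) = \<psi> (Unt A) \<cdot>\<^bsub>V\<^esub> (\<iota>H \<cdot>\<^bsub>V\<^esub> i) \<cdot>\<^bsub>V\<^esub> r"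
    using r i' by (simp add: iota_def)
  then have 2: "iota \<cdot>\<^bsub>V\<^esub> (i \<cdot>\<^bsub>V\<^esub> r) = Idt V (fobj L (Unt B))" using \<psi>r i(3) r by simp
  show ?thesis
    unfolding is_iso_def
  proof (intro conjI bexI[of _ "i \<cdot>\<^bsub>V\<^esub> r"])
    show "i \<cdot>\<^bsub>V\<^esub> r \<in> hom V (Cod V iota) (Dom V iota)" using r(1-3) i' by (simp add: hom_def)
  qed (use 1 2 in \<open>simp_all del: V.comp_assoc_arr\<close>)
qed

lemma V_structure_simps [simp]:
  "x \<in> Obj V \<Longrightarrow> y \<in> Obj V \<Longrightarrow> z \<in> Obj V \<Longrightarrow> Asc V x y z \<in> Arr V"
  "x \<in> Obj V \<Longrightarrow> y \<in> Obj V \<Longrightarrow> z \<in> Obj V \<Longrightarrow> Dom V (Asc V x y z) = (x \<odot>\<^bsub>V\<^esub> y) \<odot>\<^bsub>V\<^esub> z"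
  "x \<in> Obj V \<Longrightarrow> y \<in> Obj V \<Longrightarrow> z \<in> Obj V \<Longrightarrow> Cod V (Asc V x y z) = x \<odot>\<^bsub>V\<^esub> (y \<odot>\<^bsub>V\<^esub> z)"
  "x \<in> Obj V \<Longrightarrow> Lun V x \<in> Arr V" "x \<in> Obj V \<Longrightarrow> Dom V (Lun V x) = Unt V \<odot>\<^bsub>V\<^esub> x" "x \<in> Obj V \<Longrightarrow> Cod V (Lun V x) = x"
  "x \<in> Obj V \<Longrightarrow> Run V x \<in> Arr V" "x \<in> Obj V \<Longrightarrow> Dom V (Run V x) = x \<odot>\<^bsub>V\<^esub> Unt V" "x \<in> Obj V \<Longrightarrow> Cod V (Run V x) = x"
  using V.asc_hom V.lun_hom V.run_hom by (auto simp: hom_def)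

lemma mu_natural:
  assumes n: "n \<in> Arr B" "n' \<in> Arr B"
  shows "mu (Cod B n) (Cod B n') \<cdot>\<^bsub>V\<^esub> (farr L n \<otimes>\<^bsub>V\<^esub> farr L n') = farr L (n \<otimes>\<^bsub>B\<^esub> n') \<cdot>\<^bsub>V\<^esub> mu (Dom B n) (Dom B n')"
proof (rule jointly_epi_lam_tensor[of "Dom B n" "Dom B n'"])
  show "mu (Cod B n) (Cod B n') \<cdot>\<^bsub>V\<^esub> (farr L n \<otimes>\<^bsub>V\<^esub> farr L n') \<in> hom V (fobj L (Dom B n) \<odot>\<^bsub>V\<^esub> fobj L (Dom B n')) (fobj L (Cod B n \<odot>\<^bsub>B\<^esub> Cod B n'))"
    "farr L (n \<otimes>\<^bsub>B\<^esub> n') \<cdot>\<^bsub>V\<^esub> mu (Dom B n) (Dom B n') \<in> hom V (fobj L (Dom B n) \<odot>\<^bsub>V\<^esub> fobj L (Dom B n')) (fobj L (Cod B n \<odot>\<^bsub>B\<^esub> Cod B n'))"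
    using n by (simp_all add: hom_def)
  fix x x' g g' assume q: "x \<in> Obj A" "x' \<in> Obj A" "g \<in> Arr B" "Dom B g = fobj K x" "Cod B g = Dom B n"
    "g' \<in> Arr B" "Dom B g' = fobj K x'" "Cod B g' = Dom B n'"
  have "(mu (Cod B n) (Cod B n') \<cdot>\<^bsub>V\<^esub> (farr L n \<otimes>\<^bsub>V\<^esub> farr L n')) \<cdot>\<^bsub>V\<^esub> (lam x g \<otimes>\<^bsub>V\<^esub> lam x' g') =
      mu (Cod B n) (Cod B n') \<cdot>\<^bsub>V\<^esub> (lam x (n \<cdot>\<^bsub>B\<^esub> g) \<otimes>\<^bsub>V\<^esub> lam x' (n' \<cdot>\<^bsub>B\<^esub> g'))"
    using n q by (simp add: V.interchange lam_post)
  also have "\<dots> = lam (x \<odot>\<^bsub>A\<^esub> x') ((n \<otimes>\<^bsub>B\<^esub> n') \<cdot>\<^bsub>B\<^esub> (g \<otimes>\<^bsub>B\<^esub> g')) \<cdot>\<^bsub>V\<^esub> \<mu>H x x'"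
    using mu_lam[of x x' "n \<cdot>\<^bsub>B\<^esub> g" "n' \<cdot>\<^bsub>B\<^esub> g'"] n q by (simp add: B.interchange)
  also have "\<dots> = (farr L (n \<otimes>\<^bsub>B\<^esub> n') \<cdot>\<^bsub>V\<^esub> lam (x \<odot>\<^bsub>A\<^esub> x') (g \<otimes>\<^bsub>B\<^esub> g')) \<cdot>\<^bsub>V\<^esub> \<mu>H x x'"
    using lam_post[of "x \<odot>\<^bsub>A\<^esub> x'" "g \<otimes>\<^bsub>B\<^esub> g'" "n \<otimes>\<^bsub>B\<^esub> n'"] n q by simp
  also have "\<dots> = (farr L (n \<otimes>\<^bsub>B\<^esub> n') \<cdot>\<^bsub>V\<^esub> mu (Dom B n) (Dom B n')) \<cdot>\<^bsub>V\<^esub> (lam x g \<otimes>\<^bsub>V\<^esub> lam x' g')"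
    using mu_lam[of x x' g g'] n q by simp
  finally show "(mu (Cod B n) (Cod B n') \<cdot>\<^bsub>V\<^esub> (farr L n \<otimes>\<^bsub>V\<^esub> farr L n')) \<cdot>\<^bsub>V\<^esub> (lam x g \<otimes>\<^bsub>V\<^esub> lam x' g') =
      (farr L (n \<otimes>\<^bsub>B\<^esub> n') \<cdot>\<^bsub>V\<^esub> mu (Dom B n) (Dom B n')) \<cdot>\<^bsub>V\<^esub> (lam x g \<otimes>\<^bsub>V\<^esub> lam x' g')" .
qed (use n in simp_all)

text \<open>Tested on triple tensor products of coprojections, where \<open>mu_lam\<close> reduces
  both sides to one coprojection precomposed with the two sides of the associativity axiom for
  \<mu>H.\<close>

lemma mu_assoc:
  assumes o: "x \<in> Obj B" "y \<in> Obj B" "z \<in> Obj B"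
  shows "mu (x \<odot>\<^bsub>B\<^esub> y) z \<cdot>\<^bsub>V\<^esub> (mu x y \<otimes>\<^bsub>V\<^esub> Idt V (fobj L z)) =
    mu x (y \<odot>\<^bsub>B\<^esub> z) \<cdot>\<^bsub>V\<^esub> (Idt V (fobj L x) \<otimes>\<^bsub>V\<^esub> mu y z) \<cdot>\<^bsub>V\<^esub> Asc V (fobj L x) (fobj L y) (fobj L z)"
proof (rule jointly_epiD[OF V.jointly_epi_tensor[OF V.jointly_epi_tensor[OF jointly_epi_lam[OF o(1)] jointly_epi_lam[OF o(2)]] jointly_epi_lam[OF o(3)]]])
  let ?d = "fobj L (x \<odot>\<^bsub>B\<^esub> y \<odot>\<^bsub>B\<^esub> z)"
  show "mu (x \<odot>\<^bsub>B\<^esub> y) z \<cdot>\<^bsub>V\<^esub> (mu x y \<otimes>\<^bsub>V\<^esub> Idt V (fobj L z)) \<in> hom V ((fobj L x \<odot>\<^bsub>V\<^esub> fobj L y) \<odot>\<^bsub>V\<^esub> fobj L z) ?d"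
    "mu x (y \<odot>\<^bsub>B\<^esub> z) \<cdot>\<^bsub>V\<^esub> (Idt V (fobj L x) \<otimes>\<^bsub>V\<^esub> mu y z) \<cdot>\<^bsub>V\<^esub> Asc V (fobj L x) (fobj L y) (fobj L z)
      \<in> hom V ((fobj L x \<odot>\<^bsub>V\<^esub> fobj L y) \<odot>\<^bsub>V\<^esub> fobj L z) ?d"
    using o by (simp_all add: hom_def)
  fix k assume "k \<in> {f \<otimes>\<^bsub>V\<^esub> f' | f f'. f \<in> {f \<otimes>\<^bsub>V\<^esub> f' | f f'. f \<in> {lam a m | a m. a \<in> Obj A \<and> m \<in> hom B (fobj K a) x} \<and>
       f' \<in> {lam a m | a m. a \<in> Obj A \<and> m \<in> hom B (fobj K a) y}} \<and> f' \<in> {lam a m | a m. a \<in> Obj A \<and> m \<in> hom B (fobj K a) z}}"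
  then obtain a m a' m' a'' m'' where k: "k = (lam a m \<otimes>\<^bsub>V\<^esub> lam a' m') \<otimes>\<^bsub>V\<^esub> lam a'' m''" and a: "a \<in> Obj A" "a' \<in> Obj A" "a'' \<in> Obj A"
    and m: "m \<in> hom B (fobj K a) x" "m' \<in> hom B (fobj K a') y" "m'' \<in> hom B (fobj K a'') z"
    by auto
  have m': "m \<in> Arr B" "Dom B m = fobj K a" "Cod B m = x" "m' \<in> Arr B" "Dom B m' = fobj K a'" "Cod B m' = y"
    "m'' \<in> Arr B" "Dom B m'' = fobj K a''" "Cod B m'' = z"
    using m by (auto simp: hom_def)
  have mm: "mu x y \<cdot>\<^bsub>V\<^esub> (lam a m \<otimes>\<^bsub>V\<^esub> lam a' m') = lam (a \<odot>\<^bsub>A\<^esub> a') (m \<otimes>\<^bsub>B\<^esub> m') \<cdot>\<^bsub>V\<^esub> \<mu>H a a'"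
    "mu y z \<cdot>\<^bsub>V\<^esub> (lam a' m' \<otimes>\<^bsub>V\<^esub> lam a'' m'') = lam (a' \<odot>\<^bsub>A\<^esub> a'') (m' \<otimes>\<^bsub>B\<^esub> m'') \<cdot>\<^bsub>V\<^esub> \<mu>H a' a''"
    "mu (x \<odot>\<^bsub>B\<^esub> y) z \<cdot>\<^bsub>V\<^esub> (lam (a \<odot>\<^bsub>A\<^esub> a') (m \<otimes>\<^bsub>B\<^esub> m') \<otimes>\<^bsub>V\<^esub> lam a'' m'') =
       lam (a \<odot>\<^bsub>A\<^esub> a' \<odot>\<^bsub>A\<^esub> a'') (m \<otimes>\<^bsub>B\<^esub> m' \<otimes>\<^bsub>B\<^esub> m'') \<cdot>\<^bsub>V\<^esub> \<mu>H (a \<odot>\<^bsub>A\<^esub> a') a''"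
    "mu x (y \<odot>\<^bsub>B\<^esub> z) \<cdot>\<^bsub>V\<^esub> (lam a m \<otimes>\<^bsub>V\<^esub> lam (a' \<odot>\<^bsub>A\<^esub> a'') (m' \<otimes>\<^bsub>B\<^esub> m'')) =
       lam (a \<odot>\<^bsub>A\<^esub> a' \<odot>\<^bsub>A\<^esub> a'') (m \<otimes>\<^bsub>B\<^esub> m' \<otimes>\<^bsub>B\<^esub> m'') \<cdot>\<^bsub>V\<^esub> \<mu>H a (a' \<odot>\<^bsub>A\<^esub> a'')"
    using mu_lam[of a a' m m'] mu_lam[of a' a'' m' m''] mu_lam[of "a \<odot>\<^bsub>A\<^esub> a'" a'' "m \<otimes>\<^bsub>B\<^esub> m'" m'']
      mu_lam[of a "a' \<odot>\<^bsub>A\<^esub> a''" m "m' \<otimes>\<^bsub>B\<^esub> m''"] a m' by simp_all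
  let ?l = "lam (a \<odot>\<^bsub>A\<^esub> a' \<odot>\<^bsub>A\<^esub> a'') (m \<otimes>\<^bsub>B\<^esub> m' \<otimes>\<^bsub>B\<^esub> m'')"
  have "(mu (x \<odot>\<^bsub>B\<^esub> y) z \<cdot>\<^bsub>V\<^esub> (mu x y \<otimes>\<^bsub>V\<^esub> Idt V (fobj L z))) \<cdot>\<^bsub>V\<^esub> k =
      mu (x \<odot>\<^bsub>B\<^esub> y) z \<cdot>\<^bsub>V\<^esub> ((mu x y \<cdot>\<^bsub>V\<^esub> (lam a m \<otimes>\<^bsub>V\<^esub> lam a' m')) \<otimes>\<^bsub>V\<^esub> lam a'' m'')"
    using o a m' by (simp add: k V.interchange)
  also have "\<dots> = (mu (x \<odot>\<^bsub>B\<^esub> y) z \<cdot>\<^bsub>V\<^esub> (lam (a \<odot>\<^bsub>A\<^esub> a') (m \<otimes>\<^bsub>B\<^esub> m') \<otimes>\<^bsub>V\<^esub> lam a'' m'')) \<cdot>\<^bsub>V\<^esub> (\<mu>H a a' \<otimes>\<^bsub>V\<^esub> Idt V (fobj H a''))"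
    unfolding mm(1) using o a m' by (simp add: V.interchange)
  also have "\<dots> = ?l \<cdot>\<^bsub>V\<^esub> (\<mu>H (a \<odot>\<^bsub>A\<^esub> a') a'' \<cdot>\<^bsub>V\<^esub> (\<mu>H a a' \<otimes>\<^bsub>V\<^esub> Idt V (fobj H a'')))"
    unfolding mm(3) using a m' by simp
  also have "\<dots> = (?l \<cdot>\<^bsub>V\<^esub> \<mu>H a (a' \<odot>\<^bsub>A\<^esub> a'')) \<cdot>\<^bsub>V\<^esub> (Idt V (fobj H a) \<otimes>\<^bsub>V\<^esub> \<mu>H a' a'') \<cdot>\<^bsub>V\<^esub> Asc V (fobj H a) (fobj H a') (fobj H a'')"
    unfolding \<mu>H_coherence(1)[OF a] using a m' by simp
  also have "\<dots> = mu x (y \<odot>\<^bsub>B\<^esub> z) \<cdot>\<^bsub>V\<^esub> (lam a m \<otimes>\<^bsub>V\<^esub> (mu y z \<cdot>\<^bsub>V\<^esub> (lam a' m' \<otimes>\<^bsub>V\<^esub> lam a'' m''))) \<cdot>\<^bsub>V\<^esub> Asc V (fobj H a) (fobj H a') (fobj H a'')"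
    unfolding mm(2) mm(4)[symmetric] using o a m' by (simp add: V.interchange_assoc)
  also have "\<dots> = mu x (y \<odot>\<^bsub>B\<^esub> z) \<cdot>\<^bsub>V\<^esub> (Idt V (fobj L x) \<otimes>\<^bsub>V\<^esub> mu y z) \<cdot>\<^bsub>V\<^esub> ((lam a m \<otimes>\<^bsub>V\<^esub> (lam a' m' \<otimes>\<^bsub>V\<^esub> lam a'' m'')) \<cdot>\<^bsub>V\<^esub> Asc V (fobj H a) (fobj H a') (fobj H a''))"
    using o a m' by (simp add: V.interchange_assoc)
  also have "(lam a m \<otimes>\<^bsub>V\<^esub> (lam a' m' \<otimes>\<^bsub>V\<^esub> lam a'' m'')) \<cdot>\<^bsub>V\<^esub> Asc V (fobj H a) (fobj H a') (fobj H a'') = Asc V (fobj L x) (fobj L y) (fobj L z) \<cdot>\<^bsub>V\<^esub> k"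
    using V.asc_natural[of "lam a m" "fobj H a" "fobj L x" "lam a' m'" "fobj H a'" "fobj L y" "lam a'' m''" "fobj H a''" "fobj L z"] a m'
    by (simp add: hom_def k)
  finally show "(mu (x \<odot>\<^bsub>B\<^esub> y) z \<cdot>\<^bsub>V\<^esub> (mu x y \<otimes>\<^bsub>V\<^esub> Idt V (fobj L z))) \<cdot>\<^bsub>V\<^esub> k =
      (mu x (y \<odot>\<^bsub>B\<^esub> z) \<cdot>\<^bsub>V\<^esub> (Idt V (fobj L x) \<otimes>\<^bsub>V\<^esub> mu y z) \<cdot>\<^bsub>V\<^esub> Asc V (fobj L x) (fobj L y) (fobj L z)) \<cdot>\<^bsub>V\<^esub> k"
    using o a m' by (simp add: k)
qed

text \<open>Tested on coprojections, where the unit axioms of \<open>H\<close> apply because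
  \<open>iota\<close> is \<psi> at the unit precomposed with \<iota>H.\<close>

lemma mu_units:
  assumes y: "y \<in> Obj B"
  shows "mu (Unt B) y \<cdot>\<^bsub>V\<^esub> (iota \<otimes>\<^bsub>V\<^esub> Idt V (fobj L y)) = Lun V (fobj L y)"
    "mu y (Unt B) \<cdot>\<^bsub>V\<^esub> (Idt V (fobj L y) \<otimes>\<^bsub>V\<^esub> iota) = Run V (fobj L y)"
proof -
  have i: "lam (Unt A) (Idt B (Unt B)) = \<psi> (Unt A)" using lam_id[of "Unt A"] by simp
  show "mu (Unt B) y \<cdot>\<^bsub>V\<^esub> (iota \<otimes>\<^bsub>V\<^esub> Idt V (fobj L y)) = Lun V (fobj L y)"
  proof (rule jointly_epiD[OF V.jointly_epi_tensor_left[OF jointly_epi_lam[OF y] V.unt_obj]])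
    show "mu (Unt B) y \<cdot>\<^bsub>V\<^esub> (iota \<otimes>\<^bsub>V\<^esub> Idt V (fobj L y)) \<in> hom V (Unt V \<odot>\<^bsub>V\<^esub> fobj L y) (fobj L y)"
      "Lun V (fobj L y) \<in> hom V (Unt V \<odot>\<^bsub>V\<^esub> fobj L y) (fobj L y)"
      using y by (simp_all add: hom_def)
    fix k assume "k \<in> (\<lambda>f. Idt V (Unt V) \<otimes>\<^bsub>V\<^esub> f) ` {lam a m | a m. a \<in> Obj A \<and> m \<in> hom B (fobj K a) y}"
    then obtain a m where k: "k = Idt V (Unt V) \<otimes>\<^bsub>V\<^esub> lam a m" and a: "a \<in> Obj A" and "m \<in> hom B (fobj K a) y" by auto
    then have m: "m \<in> Arr B" "Dom B m = fobj K a" "Cod B m = y" by (auto simp: hom_def)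
    have e: "mu (Unt B) y \<cdot>\<^bsub>V\<^esub> (\<psi> (Unt A) \<otimes>\<^bsub>V\<^esub> lam a m) = lam a m \<cdot>\<^bsub>V\<^esub> \<mu>H (Unt A) a"
      using mu_lam[of "Unt A" a "Idt B (Unt B)" m] a m i by simp
    have "(mu (Unt B) y \<cdot>\<^bsub>V\<^esub> (iota \<otimes>\<^bsub>V\<^esub> Idt V (fobj L y))) \<cdot>\<^bsub>V\<^esub> k =
       (mu (Unt B) y \<cdot>\<^bsub>V\<^esub> (\<psi> (Unt A) \<otimes>\<^bsub>V\<^esub> lam a m)) \<cdot>\<^bsub>V\<^esub> (\<iota>H \<otimes>\<^bsub>V\<^esub> Idt V (fobj H a))"
      using y a m by (simp add: k V.interchange iota_def)
    also have "\<dots> = lam a m \<cdot>\<^bsub>V\<^esub> Lun V (fobj H a)"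
      unfolding e using a m \<mu>H_coherence(2)[OF a] by simp
    also have "\<dots> = Lun V (fobj L y) \<cdot>\<^bsub>V\<^esub> k"
      using V.lun_natural[of "lam a m" "fobj H a" "fobj L y"] a m by (simp add: hom_def k)
    finally show "(mu (Unt B) y \<cdot>\<^bsub>V\<^esub> (iota \<otimes>\<^bsub>V\<^esub> Idt V (fobj L y))) \<cdot>\<^bsub>V\<^esub> k = Lun V (fobj L y) \<cdot>\<^bsub>V\<^esub> k" .
  qed
  show "mu y (Unt B) \<cdot>\<^bsub>V\<^esub> (Idt V (fobj L y) \<otimes>\<^bsub>V\<^esub> iota) = Run V (fobj L y)"
  proof (rule jointly_epiD[OF V.jointly_epi_tensor_right[OF jointly_epi_lam[OF y] V.unt_obj]])
    show "mu y (Unt B) \<cdot>\<^bsub>V\<^esub> (Idt V (fobj L y) \<otimes>\<^bsub>V\<^esub> iota) \<in> hom V (fobj L y \<odot>\<^bsub>V\<^esub> Unt V) (fobj L y)"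
      "Run V (fobj L y) \<in> hom V (fobj L y \<odot>\<^bsub>V\<^esub> Unt V) (fobj L y)"
      using y by (simp_all add: hom_def)
    fix k assume "k \<in> (\<lambda>f. f \<otimes>\<^bsub>V\<^esub> Idt V (Unt V)) ` {lam a m | a m. a \<in> Obj A \<and> m \<in> hom B (fobj K a) y}"
    then obtain a m where k: "k = lam a m \<otimes>\<^bsub>V\<^esub> Idt V (Unt V)" and a: "a \<in> Obj A" and "m \<in> hom B (fobj K a) y" by auto
    then have m: "m \<in> Arr B" "Dom B m = fobj K a" "Cod B m = y" by (auto simp: hom_def)
    have e: "mu y (Unt B) \<cdot>\<^bsub>V\<^esub> (lam a m \<otimes>\<^bsub>V\<^esub> \<psi> (Unt A)) = lam a m \<cdot>\<^bsub>V\<^esub> \<mu>H a (Unt A)"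
      using mu_lam[of a "Unt A" m "Idt B (Unt B)"] a m i by simp
    have "(mu y (Unt B) \<cdot>\<^bsub>V\<^esub> (Idt V (fobj L y) \<otimes>\<^bsub>V\<^esub> iota)) \<cdot>\<^bsub>V\<^esub> k =
       (mu y (Unt B) \<cdot>\<^bsub>V\<^esub> (lam a m \<otimes>\<^bsub>V\<^esub> \<psi> (Unt A))) \<cdot>\<^bsub>V\<^esub> (Idt V (fobj H a) \<otimes>\<^bsub>V\<^esub> \<iota>H)"
      using y a m by (simp add: k V.interchange iota_def)
    also have "\<dots> = lam a m \<cdot>\<^bsub>V\<^esub> Run V (fobj H a)"
      unfolding e using a m \<mu>H_coherence(3)[OF a] by simp
    also have "\<dots> = Run V (fobj L y) \<cdot>\<^bsub>V\<^esub> k"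
      using V.run_natural[of "lam a m" "fobj H a" "fobj L y"] a m by (simp add: hom_def k)
    finally show "(mu y (Unt B) \<cdot>\<^bsub>V\<^esub> (Idt V (fobj L y) \<otimes>\<^bsub>V\<^esub> iota)) \<cdot>\<^bsub>V\<^esub> k = Run V (fobj L y) \<cdot>\<^bsub>V\<^esub> k" .
  qed
qed

text \<open>On coprojections, naturality moves the braiding of \<open>B\<close> through
  \<open>g \<otimes> g'\<close> and turns it into the image under \<open>H\<close> of the braiding
  of \<open>A\<close>, so the symmetry axiom of \<open>H\<close> applies.\<close>

lemma mu_brd:
  assumes o: "y \<in> Obj B" "z \<in> Obj B"
  shows "farr L (Brd B y z) \<cdot>\<^bsub>V\<^esub> mu y z = mu z y \<cdot>\<^bsub>V\<^esub> Brd V (fobj L y) (fobj L z)"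
proof (rule jointly_epi_lam_tensor[OF o])
  show "farr L (Brd B y z) \<cdot>\<^bsub>V\<^esub> mu y z \<in> hom V (fobj L y \<odot>\<^bsub>V\<^esub> fobj L z) (fobj L (z \<odot>\<^bsub>B\<^esub> y))"
    "mu z y \<cdot>\<^bsub>V\<^esub> Brd V (fobj L y) (fobj L z) \<in> hom V (fobj L y \<odot>\<^bsub>V\<^esub> fobj L z) (fobj L (z \<odot>\<^bsub>B\<^esub> y))"
    using o by (simp_all add: hom_def)
  fix x x' g g' assume q: "x \<in> Obj A" "x' \<in> Obj A" "g \<in> Arr B" "Dom B g = fobj K x" "Cod B g = y"
    "g' \<in> Arr B" "Dom B g' = fobj K x'" "Cod B g' = z"
  have "(farr L (Brd B y z) \<cdot>\<^bsub>V\<^esub> mu y z) \<cdot>\<^bsub>V\<^esub> (lam x g \<otimes>\<^bsub>V\<^esub> lam x' g') =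
      (farr L (Brd B y z) \<cdot>\<^bsub>V\<^esub> lam (x \<odot>\<^bsub>A\<^esub> x') (g \<otimes>\<^bsub>B\<^esub> g')) \<cdot>\<^bsub>V\<^esub> \<mu>H x x'"
    using o q mu_lam[of x x' g g'] by simp
  also have "farr L (Brd B y z) \<cdot>\<^bsub>V\<^esub> lam (x \<odot>\<^bsub>A\<^esub> x') (g \<otimes>\<^bsub>B\<^esub> g') = lam (x' \<odot>\<^bsub>A\<^esub> x) (g' \<otimes>\<^bsub>B\<^esub> g) \<cdot>\<^bsub>V\<^esub> farr H (Brd A x x')"
    using lam_post[of "x \<odot>\<^bsub>A\<^esub> x'" "g \<otimes>\<^bsub>B\<^esub> g'" "Brd B y z"] lam_pre[of "Brd A x x'" "g' \<otimes>\<^bsub>B\<^esub> g"]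
      B.brd_natural_arr[of g g'] o q by simp
  also have "(lam (x' \<odot>\<^bsub>A\<^esub> x) (g' \<otimes>\<^bsub>B\<^esub> g) \<cdot>\<^bsub>V\<^esub> farr H (Brd A x x')) \<cdot>\<^bsub>V\<^esub> \<mu>H x x' =
      (lam (x' \<odot>\<^bsub>A\<^esub> x) (g' \<otimes>\<^bsub>B\<^esub> g) \<cdot>\<^bsub>V\<^esub> \<mu>H x' x) \<cdot>\<^bsub>V\<^esub> Brd V (fobj H x) (fobj H x')"
    using q \<mu>H_coherence(4)[OF q(1,2)] by simp
  also have "\<dots> = (mu z y \<cdot>\<^bsub>V\<^esub> (lam x' g' \<otimes>\<^bsub>V\<^esub> lam x g)) \<cdot>\<^bsub>V\<^esub> Brd V (fobj H x) (fobj H x')"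
    using mu_lam[of x' x g' g] q by simp
  also have "\<dots> = mu z y \<cdot>\<^bsub>V\<^esub> ((lam x' g' \<otimes>\<^bsub>V\<^esub> lam x g) \<cdot>\<^bsub>V\<^esub> Brd V (fobj H x) (fobj H x'))"
    using o q by simp
  also have "(lam x' g' \<otimes>\<^bsub>V\<^esub> lam x g) \<cdot>\<^bsub>V\<^esub> Brd V (fobj H x) (fobj H x') = Brd V (fobj L y) (fobj L z) \<cdot>\<^bsub>V\<^esub> (lam x g \<otimes>\<^bsub>V\<^esub> lam x' g')"
    using V.brd_natural_arr[of "lam x g" "lam x' g'"] q by simp
  finally show "(farr L (Brd B y z) \<cdot>\<^bsub>V\<^esub> mu y z) \<cdot>\<^bsub>V\<^esub> (lam x g \<otimes>\<^bsub>V\<^esub> lam x' g') =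
      (mu z y \<cdot>\<^bsub>V\<^esub> Brd V (fobj L y) (fobj L z)) \<cdot>\<^bsub>V\<^esub> (lam x g \<otimes>\<^bsub>V\<^esub> lam x' g')"
    using o q by simp
qed

lemma strong_monoidal: "strong_monoidal_functor B V L mu iota"
  unfolding strong_monoidal_functor_def
proof (intro conjI ballI l_functor iota_iso mu_iso mu_natural mu_brd)
  show "iota \<in> hom V (Unt V) (fobj L (Unt B))" by (simp add: hom_def)
  fix x assume x: "x \<in> Obj B"
  show "farr L (Lun B x) \<cdot>\<^bsub>V\<^esub> mu (Unt B) x \<cdot>\<^bsub>V\<^esub> (iota \<otimes>\<^bsub>V\<^esub> Idt V (fobj L x)) = Lun V (fobj L x)"
    "farr L (Run B x) \<cdot>\<^bsub>V\<^esub> mu x (Unt B) \<cdot>\<^bsub>V\<^esub> (Idt V (fobj L x) \<otimes>\<^bsub>V\<^esub> iota) = Run V (fobj L x)"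
    using x mu_units[OF x] by (simp_all add: B.strict_lun B.strict_run)
  fix y assume y: "y \<in> Obj B"
  show "mu x y \<in> hom V (fobj L x \<odot>\<^bsub>V\<^esub> fobj L y) (fobj L (x \<odot>\<^bsub>B\<^esub> y))" using x y by (simp add: hom_def)
  fix z assume z: "z \<in> Obj B"
  show "farr L (Asc B x y z) \<cdot>\<^bsub>V\<^esub> mu (x \<odot>\<^bsub>B\<^esub> y) z \<cdot>\<^bsub>V\<^esub> (mu x y \<otimes>\<^bsub>V\<^esub> Idt V (fobj L z)) =
    mu x (y \<odot>\<^bsub>B\<^esub> z) \<cdot>\<^bsub>V\<^esub> (Idt V (fobj L x) \<otimes>\<^bsub>V\<^esub> mu y z) \<cdot>\<^bsub>V\<^esub> Asc V (fobj L x) (fobj L y) (fobj L z)"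
    using mu_assoc[OF x y z] x y z by (simp add: B.strict_asc)
qed

text \<open>\<psi> consists of the coprojections at identities, so compatibility with tensor
  products is \<open>mu_lam\<close> at two identities; compatibility with units is the definition of
  \<open>iota\<close>.\<close>

lemma monoidal_unit:
  "monoidal_nat_trans A V H \<mu>H \<iota>H (L \<circ>\<^sub>F K) (\<lambda>x y. mu (fobj K x) (fobj K y)) iota \<psi>"
  unfolding monoidal_nat_trans_def
proof (intro conjI ballI \<psi>_nat)
  fix x y assume xy: "x \<in> Obj A" "y \<in> Obj A"
  show "\<psi> (x \<odot>\<^bsub>A\<^esub> y) \<cdot>\<^bsub>V\<^esub> \<mu>H x y = mu (fobj K x) (fobj K y) \<cdot>\<^bsub>V\<^esub> (\<psi> x \<otimes>\<^bsub>V\<^esub> \<psi> y)"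
    using mu_lam[of x y "Idt B (fobj K x)" "Idt B (fobj K y)"] lam_id[of "x \<odot>\<^bsub>A\<^esub> y"] xy by (simp add: lam_id)
qed (simp add: iota_def)

end

text \<open>The monoidal structure is asserted for every left Kan extension and not just for a
  constructed one; this is possible because cocompleteness gives a pointwise extension and all
  extensions are isomorphic to it. The last clause ties the structure on L to that on H: the unit
  \<psi> is monoidal.\<close>

theorem corollary3p4p1:
  fixes R T :: "('u :: infinite, 'u) oprd"
    and G :: "('u, 'u, 'u, 'u) opmor"
    and FR FT :: "('u, 'u) smcat"
    and \<eta>R \<eta>T :: "('u, 'u, 'u, 'u list \<times> 'u) opmor"
    and FG :: "('u, 'u, 'u, 'u) fctr"
    and V :: "('v, 'w) smcat"
  assumes "operad R" and "operad T" and "operad_morphism R T G"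
    and "free_sym_monoidal R FR \<eta>R" and "free_sym_monoidal T FT \<eta>T"
    and "free_sym_monoidal_map R FR \<eta>R FT \<eta>T G FG"
  shows "exact_monoidal_functor TYPE('x \<times> 'y) FR FT FG \<and>
    (symmetric_monoidal V \<and> monoidal_closed V \<and> cocomplete TYPE('u) V \<longrightarrow>
      (\<forall>H \<mu>H \<iota>H. strong_monoidal_functor FR V H \<mu>H \<iota>H \<longrightarrow>
        (\<exists>L \<psi>. left_kan FR FT V FG H L \<psi> \<and> pointwise_left_kan FR FT V FG H L \<psi>) \<and>
        (\<forall>L \<psi>. left_kan FR FT V FG H L \<psi> \<longrightarrow>
          (\<exists>\<mu> \<iota>. strong_monoidal_functor FT V L \<mu> \<iota> \<and>
            monoidal_nat_trans FR V H \<mu>H \<iota>H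
              (L \<circ>\<^sub>F FG) (\<lambda>x y. \<mu> (fobj FG x) (fobj FG y)) \<iota> \<psi>))))"
proof -
  interpret R: free_monoidal R FR \<eta>R by (rule free_monoidal.intro[OF assms(1,4)])
  interpret T: free_monoidal T FT \<eta>T by (rule free_monoidal.intro[OF assms(2,5)])
  have strict: "strict_monoidal_functor FR FT FG" and unit: "opmor_eq R (opmor_of FG \<circ>\<^sub>O \<eta>R) (\<eta>T \<circ>\<^sub>O G)"
    using assms(6) by (simp_all add: free_sym_monoidal_map_def)
  \<comment> \<open>Naturality of the units on colours: a generator of \<open>FR\<close> goes to the
    generator of \<open>FT\<close> given by its image under \<open>G\<close>. This is the property
    of \<open>FG\<close> besides strict monoidality on which the splitting rests.\<close>
  have "fobj FG c \<in> T.gens" if c: "c \<in> R.gens" for c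
  proof -
    obtain d where d: "c = ocol \<eta>R d" "d \<in> Col R" using c by (auto simp: R.gens_def)
    have "fobj FG c = ocol \<eta>T (ocol G d)"
      using unit d by (simp add: opmor_eq_def opmor_comp_def opmor_of_def)
    moreover have "ocol G d \<in> Col T" using assms(3) d(2) by (simp add: operad_morphism_def)
    ultimately show ?thesis by (simp add: T.gens_def)
  qed
  then have splitting: "splitting_functor FR FT FG"
    by (intro splitting_functor_free[OF R.free_monoidal_axioms T.free_monoidal_axioms strict])
  then interpret splitting_functor FR FT FG .
  show ?thesis
  proof (intro conjI impI allI)
    show "exact_monoidal_functor TYPE('x \<times> 'y) FR FT FG" by (rule exact_monoidal)
    fix H \<mu>H \<iota>H
    assume V: "symmetric_monoidal V \<and> monoidal_closed V \<and> cocomplete TYPE('u) V"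
      and H: "strong_monoidal_functor FR V H \<mu>H \<iota>H"
    have closed: "closed_monoidal V" using V by (simp add: closed_monoidal_def closed_monoidal_axioms_def)
    interpret V: closed_monoidal V by (rule closed)
    have Hf: "cat_functor FR V H" using H by (simp add: strong_monoidal_functor_def)
    have kan_setting: "kan_setting FR FT V FG H"
      using R.category_axioms T.category_axioms V.category_axioms is_functor Hf
      by (simp add: kan_setting_def kan_setting_axioms_def)
    then interpret kan_setting FR FT V FG H .
    \<comment> \<open>Objects and arrows of the comma categories are pairs of elements of the
      universe; the pairing \<open>p\<close> codes them back into it, so cocompleteness supplies
      their colimits.\<close>
    obtain p :: "'u \<times> 'u \<Rightarrow> 'u" where p: "inj p" using inj_prod_infinite by blast
    have "\<exists>d \<iota>. is_colimit (comma FR FT FG c) V (H \<circ>\<^sub>F comma_proj) d \<iota>" for c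
      using V inj_on_subset[OF p subset_UNIV]
      by (intro cocomplete_colimit[OF _ category_comma' _ _ cat_functor_comma]) auto
    then obtain L0 \<psi>0 where L0: "pointwise_left_kan FR FT V FG H L0 \<psi>0"
      using pointwise_left_kan_exists by blast
    then have kan0: "pointwise_kan FR FT V FG H L0 \<psi>0"
      using kan_setting by (simp add: pointwise_kan_def pointwise_kan_axioms_def)
    show "\<exists>L \<psi>. left_kan FR FT V FG H L \<psi> \<and> pointwise_left_kan FR FT V FG H L \<psi>"
      using pointwise_kan.left_kan[OF kan0] L0 by blast
    fix L \<psi> assume "left_kan FR FT V FG H L \<psi>"
    \<comment> \<open>An arbitrary Kan extension is pointwise as soon as one is, and
      \<open>mu\<close> is built from the colimits of a pointwise one.\<close>
    then have "pointwise_left_kan FR FT V FG H L \<psi>" by (rule pointwise_kan.left_kan_pointwise[OF kan0])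
    then have km: "kan_monoidal FR FT FG V H L \<psi> \<mu>H \<iota>H"
      using splitting closed kan_setting H
      by (simp add: kan_monoidal_def kan_monoidal_axioms_def closed_kan_def pointwise_kan_def pointwise_kan_axioms_def)
    show "\<exists>\<mu> \<iota>. strong_monoidal_functor FT V L \<mu> \<iota> \<and>
        monoidal_nat_trans FR V H \<mu>H \<iota>H (L \<circ>\<^sub>F FG) (\<lambda>x y. \<mu> (fobj FG x) (fobj FG y)) \<iota> \<psi>"
      by (intro exI conjI) (rule kan_monoidal.strong_monoidal[OF km], rule kan_monoidal.monoidal_unit[OF km])
  qed
qed

end
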